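(* Let $N$ be a positive integer, let $\mathcal{F}=(F_1,F_2,F_3,F_4)$ be a quartet of finite sets of positive integers (the empty set is allowed, in which case $\max F=-1$), and let $\mathfrak{h}=(h_1,h_2,h_3)$ with integers $h_i\ge1$. Let $\mathcal{U}=(U_1,U_2,U_3,U_4)$ with $U_j=J_{h_j}(F_j)$, $j=1,2,3$, and $U_4=I(F_4)$. Let $m_i$ be the cardinality of $U_i$, $m=m_1+m_2+m_3+m_4$, $f_{i,M}=\max F_i$, and $n_{F_i}$ the cardinality of $F_i$. Let $a,b$ be real numbers satisfying $$a\notin\mathbb{Z}_{f_{2,M}+f_{4,M}+h_2},\quad b\notin\mathbb{Z}_{f_{1,M}+f_{3,M}+h_1+h_3-1},\quad a+b\notin\mathbb{Z}_{\sum_{i=1}^4f_{i,M}+\sum_{i=1}^3h_i},$$ where $\mathbb{Z}_i=\{j\in\mathbb{Z}:j\le i\}$. In addition assume that $a\ne1,2,\ldots$ if $F_2\neq\emptyset$ or $F_4\ne\emptyset$, and that $b\neq1,2,\ldots$ if $F_1\ne\emptyset$ or $F_3\neq\emptyset$. Put $\theta_x=x(x+a+b+1)$ and assume that $\Omega_{a,b,N}^{\mathcal{U},\mathfrak{h}}(n)\ne0$ for $0\le n\le N+m_3+m_4+1$, where $\Omega_{a,b,N}^{\mathcal{U},\mathfrak{h}}(x)$ is the $m\times m$ determinant whose $j$-th column, $j=1,\ldots,m$, consists of the entries $$\begin{aligned}&\xi^1_{x-j,m-j}R_u^{-b,-a,a+b+N}(\theta_{x-j}+a+b)\ (u\in U_1),\qquad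 \xi^2_{x-j,m-j}R_u^{-a,-b,a+b+N}(\theta_{x-j}+a+b)\ (u\in U_2),\\ &\xi^3_{x-j,m-j}R_u^{-b,-a,-2-N}(\theta_{x-j}+a+b)\ (u\in U_3),\qquad \xi^4_{x-j,m-j}R_u^{-a,-b,-2-N}(\theta_{x-j}+a+b)\ (u\in U_4),\end{aligned}$$ the rows being ordered first through $U_1$, then $U_2$, $U_3$, $U_4$ (each in increasing order). Define $q_n$, $n\ge0$, as the $(m+1)\times(m+1)$ determinant whose $j$-th column, $j=1,\ldots,m+1$, has first entry $(-1)^{j-1}h_{n+1-j}^{a,b,N}(x)$ followed by the entries $$\begin{aligned}&\xi^1_{n+1-j,m+1-j}R_u^{-b,-a,a+b+N}(\theta_{n+1-j}+a+b)\ (u\in U_1),\qquad \xi^2_{n+1-j,m+1-j}R_u^{-a,-b,a+b+N}(\theta_{n+1-j}+a+b)\ (u\in U_2),\\ &\xi^3_{n+1-j,m+1-j}R_u^{-b,-a,-2-N}(\theta_{n+1-j}+a+b)\ (u\in U_3),\qquad \xi^4_{n+1-j,m+1-j}R_u^{-a,-b,-2-N}(\theta_{n+1-j}+a+b)\ (u\in U_4),\end{aligned}$$ in the same row order. Then: (1) The polynomials $q_n$, $0\le n\le N+m_3+m_4$, are orthogonal and have non-null norms with respect to the measure $$\tilde\rho^{\mathcal{F},\mathfrak{h}}_{a,b,N}=\prod_{f\in F_1}(b+N+1-f-x)\prod_{f\in F_2}(x+a+1-f)\prod_{f\in F_3}(N+f-x)\prod_{f\in F_4}(x+f_{4,M}+1-f)\;\rho_{\tilde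 a,\tilde b,\tilde N}(x+f_{4,M}+1),$$ where $$\tilde a=a-f_{2,M}-f_{4,M}-h_2-1,\quad \tilde b=b-f_{1,M}-f_{3,M}-h_1-h_3,\quad \tilde N=N+f_{3,M}+f_{4,M}+h_3+1,$$ and $\rho_{a,b,N}$ is the Hahn weight. (2) The polynomials $q_n$, $0\le n\le N+m_3+m_4$, are eigenfunctions of a higher-order difference operator of the form $D=\sum_{l=-r}^{r}g_l\,\mathfrak{s}_l$, with $g_l$ polynomials and $g_{-r},g_r\ne0$, where $$r=\sum_{f\in F_4}f-\sum_{f\in F_1,F_2,F_3}f-\sum_{i=1}^4\binom{n_{F_i}}2+\sum_{i=1}^3n_{F_i}(f_{i,M}+h_i)+1$$ (and this operator can be taken to be one produced by the $\mathcal{D}$-operator construction described in the context, for a suitable rational function $S$).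
   Context: **Transforms of finite sets.** For a finite set $F$ of positive integers with maximum $f_k=\max F$ (and $\max\emptyset=-1$), $$I(F)=\{1,2,\ldots,f_k\}\setminus\{f_k-f: f\in F\},\qquad J_h(F)=\{0,1,\ldots,f_k+h-1\}\setminus\{f-1:f\in F\}\quad(h\ge1).$$ So $I(\emptyset)=\emptyset$ and $J_h(\emptyset)=\{0,\ldots,h-2\}$. A sum $\sum_{f\in F_1,F_2,F_3}f$ means $\sum_{i=1}^3\sum_{f\in F_i}f$. **Polynomials.** $(z)_j=z(z+1)\cdots(z+j-1)$, $(z)_0=1$. Hahn polynomials: $$h_n^{a,b,N}(x)=\sum_{j=0}^n\frac{(-x)_j(N-n+1)_{n-j}(a+b+1)_{j+n}}{(2+a+b+N)_n(a+1)_j(n-j)!\,j!},\ n\ge0,\qquad h_n^{a,b,N}=0,\ n<0.$$ Dual Hahn polynomials ($n\ge0$): $$R_n^{a,b,N}(x)=\sum_{j=0}^n\frac{(-1)^j(-n)_j(-N+j)_{n-j}}{(a+1)_j\,j!}\prod_{i=0}^{j-1}[x-i(i+a+b+1)].$$ **Hahn weight.** For a positive integer $N$, $$\rho_{a,b,N}=N!\sum_{x=0}^N\frac{\Gamma(a+x+1)\Gamma(N-x+b+1)}{x!(N-x)!}\,\delta_x;$$ $\rho_{a,b,N}(x+c)$ denotes the measure translated so that the mass of $\rho_{a,b,N}$ at $y$ is placed at $x=y-c$. Multiplying a measure by a polynomial means multiplying masses. Polynomials are orthogonal with respect to a (possibly signed) measure $\mu$ with non-null norms if $\int q_nq_k\,d\mu=0$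 for $n\ne k$ and $\int q_n^2\,d\mu\ne0$, where $\deg q_n=n$. **Functions $\xi$.** For $j\ge0$ (with parameters $a,b,N$): $$\xi^1_{x,j}=(-1)^j\frac{(x-j-N)_j}{(x-j+a+b+N+2)_j},\quad \xi^2_{x,j}=\frac{(x-j+b+1)_j(x-j-N)_j}{(x-j+a+1)_j(x-j+a+b+N+2)_j},\quad \xi^3_{x,j}=1,\quad \xi^4_{x,j}=(-1)^j\frac{(x-j+b+1)_j}{(x-j+a+1)_j}.$$ The assumption $\Omega_{a,b,N}^{\mathcal{U},\mathfrak{h}}(n)\neq0$ includes that the determinant is defined at $n$. A $0\times0$ determinant equals $1$. **Operators.** $\mathfrak{s}_l$ is the shift $\mathfrak{s}_l(p)(x)=p(x+l)$, $\Delta f=f(x+1)-f(x)$, $\nabla f=f(x)-f(x-1)$, and $$D_{a,b,N}=x(x-b-N-1)\mathfrak{s}_{-1}-[(x+a+1)(x-N)+x(x-b-N-1)]\mathfrak{s}_0+(x+a+1)(x-N)\mathfrak{s}_1,$$ for which $D_{a,b,N}(h_n^{a,b,N})=\theta_nh_n^{a,b,N}$. **The construction in (2).** Put $\sigma_x=-(2x+a+b-1)$ and $$\mathcal{D}_1=\tfrac{a+b+1}2\mathrm{Id}+x\nabla,\quad \mathcal{D}_2=\tfrac{a+b+1}2\mathrm{Id}+(x-N)\Delta,\quad \mathcal{D}_3=\tfrac{a+b+1}2\mathrm{Id}+(x+a+1)\Delta,\quad \mathcal{D}_4=\tfrac{a+b+1}2\mathrm{Id}+(x-b-N-1)\nabla.$$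 Number the rows of $\Omega=\Omega_{a,b,N}^{\mathcal{U},\mathfrak{h}}$ by $l=1,\ldots,m$; if row $l$ corresponds to $u\in U_t$ put $t(l)=t$ and let $Y_l(x)$ be the polynomial $R_u^{\cdots}(x+a+b)$ occurring in that row, so that the $(l,j)$ entry of $\Omega(x)$ is $\xi^{t(l)}_{x-j,m-j}Y_l(\theta_{x-j})$. For a rational function $S$ such that $S\Omega$ is a polynomial, let $\lambda_x$ be a polynomial with $\lambda_x-\lambda_{x-1}=S(x)\Omega(x)$ and $$M_h(x)=\sum_{j=1}^m(-1)^{h+j}\xi^{t(h)}_{x,m-j}S(x+j)\det\left(\xi^{t(l)}_{x+j-r,m-r}Y_l(\theta_{x+j-r})\right)_{l\ne h;\,r\ne j}.$$ If there are polynomials $\tilde M_h$ with $M_h(x)=\sigma_{x+1}\tilde M_h(\theta_x)$ and a polynomial $P_S$ with $P_S(\theta_x)=2\lambda_x+\sum_{h=1}^mY_h(\theta_x)M_h(x)$, the operator produced by the construction is $$D_{q,S}=\tfrac12P_S(D_{a,b,N})+\sum_{h=1}^m\tilde M_h(D_{a,b,N})\,\mathcal{D}_{t(h)}\,Y_h(D_{a,b,N}),$$ with eigenvalues $\lambda_n$: $D_{q,S}(q_n)=\lambda_nq_n$. *)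

theory Defs
  imports
    "HOL-Analysis.Gamma_Function"
    "Jordan_Normal_Form.Determinant"
begin

text \<open>Quartets and triples are functions on \<^typ>\<open>nat\<close>, used only at the indices \<open>1,\<dots>,4\<close>
  and \<open>1,\<dots>,3\<close>.  Sets of positive integers are sets of natural numbers not containing 0.\<close>

definition fmax :: "nat set \<Rightarrow> int" where
  "fmax F = (if F = {} then - 1 else int (Max F))"

definition I_set :: "nat set \<Rightarrow> nat set" where
  "I_set F = {u. int u \<in> {1..fmax F} - {fmax F - int f | f. f \<in> F}}"

definition J_set :: "nat \<Rightarrow> nat set \<Rightarrow> nat set" where
  "J_set h F = {u. int u \<in> {0..fmax F + int h - 1} - {int f - 1 | f. f \<in> F}}"

definition U_sets :: "(nat \<Rightarrow> nat set) \<Rightarrow> (nat \<Rightarrow> nat) \<Rightarrow> nat \<Rightarrow> nat set" where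
  "U_sets F h i = (if i = 4 then I_set (F 4) else J_set (h i) (F i))"

text \<open>The sets written with a blackboard Z and index \<open>k\<close>: all integers \<open>\<le> k\<close>.\<close>

definition ints_upto :: "int \<Rightarrow> real set" where
  "ints_upto k = {of_int j | j. j \<le> k}"

definition hahn :: "real \<Rightarrow> real \<Rightarrow> real \<Rightarrow> int \<Rightarrow> real poly" where
  "hahn a b N k = (if k < 0 then 0 else let n = nat k in
     \<Sum>j = 0..n. smult
       (pochhammer (N - real n + 1) (n - j) * pochhammer (a + b + 1) (j + n) /
         (pochhammer (2 + a + b + N) n * pochhammer (a + 1) j * fact (n - j) * fact j))
       (pochhammer [:0, - 1:] j))"

definition dual_hahn :: "real \<Rightarrow> real \<Rightarrow> real \<Rightarrow> nat \<Rightarrow> real poly" where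
  "dual_hahn a b N n =
     (\<Sum>j = 0..n. smult
       ((- 1) ^ j * pochhammer (- real n) j * pochhammer (- N + real j) (n - j) /
         (pochhammer (a + 1) j * fact j))
       (\<Prod>i<j. [:- (real i * (real i + a + b + 1)), 1:]))"

text \<open>A finite discrete (possibly signed) measure on the reals is given by its mass function,
  which has finite support.\<close>

definition mass_integral :: "(real \<Rightarrow> real) \<Rightarrow> (real \<Rightarrow> real) \<Rightarrow> real" where
  "mass_integral \<mu> f = (\<Sum>x | \<mu> x \<noteq> 0. f x * \<mu> x)"

definition orthogonal_polys :: "(real \<Rightarrow> real) \<Rightarrow> (nat \<Rightarrow> real poly) \<Rightarrow> nat set \<Rightarrow> bool" where
  "orthogonal_polys \<mu> q A \<longleftrightarrow>
     (\<forall>n\<in>A. degree (q n) = n) \<and>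
     (\<forall>n\<in>A. \<forall>k\<in>A. n \<noteq> k \<longrightarrow> mass_integral \<mu> (\<lambda>x. poly (q n) x * poly (q k) x) = 0) \<and>
     (\<forall>n\<in>A. mass_integral \<mu> (\<lambda>x. (poly (q n) x)\<^sup>2) \<noteq> 0)"

definition hahn_weight :: "real \<Rightarrow> real \<Rightarrow> nat \<Rightarrow> real \<Rightarrow> real" where
  "hahn_weight a b N y = fact N *
     (\<Sum>x = 0..N. Gamma (a + real x + 1) * Gamma (real N - real x + b + 1) /
        (fact x * fact (N - x)) * of_bool (y = real x))"

text \<open>The argument of \<^const>\<open>nat\<close> below is at least \<open>N\<close>, since \<open>fmax\<close> is at least \<open>-1\<close>
  and \<open>h 3 \<ge> 1\<close>.  The mass of the Hahn weight at \<open>y\<close> is moved to \<open>y - (fmax (F 4) + 1)\<close>.\<close>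

definition transformed_weight ::
    "real \<Rightarrow> real \<Rightarrow> nat \<Rightarrow> (nat \<Rightarrow> nat set) \<Rightarrow> (nat \<Rightarrow> nat) \<Rightarrow> real \<Rightarrow> real" where
  "transformed_weight a b N F h x =
     (let a' = a - of_int (fmax (F 2)) - of_int (fmax (F 4)) - real (h 2) - 1;
          b' = b - of_int (fmax (F 1)) - of_int (fmax (F 3)) - real (h 1) - real (h 3);
          N' = nat (int N + fmax (F 3) + fmax (F 4) + int (h 3) + 1)
      in (\<Prod>f\<in>F 1. b + real N + 1 - real f - x) * (\<Prod>f\<in>F 2. x + a + 1 - real f) *
         (\<Prod>f\<in>F 3. real N + real f - x) * (\<Prod>f\<in>F 4. x + of_int (fmax (F 4)) + 1 - real f) *
         hahn_weight a' b' N' (x + of_int (fmax (F 4)) + 1))"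

definition \<theta> :: "real \<Rightarrow> real \<Rightarrow> real \<Rightarrow> real" where
  "\<theta> a b x = x * (x + a + b + 1)"

definition \<sigma> :: "real \<Rightarrow> real \<Rightarrow> real \<Rightarrow> real" where
  "\<sigma> a b x = - (2 * x + a + b - 1)"

definition \<xi>_num :: "real \<Rightarrow> real \<Rightarrow> real \<Rightarrow> nat \<Rightarrow> real \<Rightarrow> nat \<Rightarrow> real" where
  "\<xi>_num a b N t x j =
     (if t = 1 then (- 1) ^ j * pochhammer (x - real j - N) j
      else if t = 2 then pochhammer (x - real j + b + 1) j * pochhammer (x - real j - N) j
      else if t = 3 then 1
      else (- 1) ^ j * pochhammer (x - real j + b + 1) j)"

definition \<xi>_den :: "real \<Rightarrow> real \<Rightarrow> real \<Rightarrow> nat \<Rightarrow> real \<Rightarrow> nat \<Rightarrow> real" where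
  "\<xi>_den a b N t x j =
     (if t = 1 then pochhammer (x - real j + a + b + N + 2) j
      else if t = 2 then pochhammer (x - real j + a + 1) j *
                         pochhammer (x - real j + a + b + N + 2) j
      else if t = 3 then 1
      else pochhammer (x - real j + a + 1) j)"

definition \<xi> :: "real \<Rightarrow> real \<Rightarrow> real \<Rightarrow> nat \<Rightarrow> real \<Rightarrow> nat \<Rightarrow> real" where
  "\<xi> a b N t x j = \<xi>_num a b N t x j / \<xi>_den a b N t x j"

text \<open>A row is a pair \<open>(t, u)\<close> with \<open>u \<in> U t\<close>; rows and columns are numbered from 1.\<close>

definition rows :: "(nat \<Rightarrow> nat set) \<Rightarrow> (nat \<times> nat) list" where
  "rows U = concat (map (\<lambda>t. map (Pair t) (sorted_list_of_set (U t))) [1, 2, 3, 4])"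

definition size_U :: "(nat \<Rightarrow> nat set) \<Rightarrow> nat" where
  "size_U U = (\<Sum>t = 1..4. card (U t))"

definition row_t :: "(nat \<Rightarrow> nat set) \<Rightarrow> nat \<Rightarrow> nat" where
  "row_t U l = fst (rows U ! (l - 1))"

definition row_u :: "(nat \<Rightarrow> nat set) \<Rightarrow> nat \<Rightarrow> nat" where
  "row_u U l = snd (rows U ! (l - 1))"

text \<open>\<open>Y_row a b N U l\<close> is the polynomial \<open>R_u(x + a + b)\<close> of row \<open>l\<close>.\<close>

definition Y_row :: "real \<Rightarrow> real \<Rightarrow> real \<Rightarrow> (nat \<Rightarrow> nat set) \<Rightarrow> nat \<Rightarrow> real poly" where
  "Y_row a b N U l =
     (let t = row_t U l; u = row_u U l
      in pcompose
        (if t = 1 then dual_hahn (- b) (- a) (a + b + N) u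
         else if t = 2 then dual_hahn (- a) (- b) (a + b + N) u
         else if t = 3 then dual_hahn (- b) (- a) (- 2 - N) u
         else dual_hahn (- a) (- b) (- 2 - N) u)
        [:a + b, 1:])"

definition mat1 :: "nat \<Rightarrow> (nat \<Rightarrow> nat \<Rightarrow> 'a) \<Rightarrow> 'a mat" where
  "mat1 n f = mat n n (\<lambda>(i, j). f (Suc i) (Suc j))"

definition \<Omega> :: "real \<Rightarrow> real \<Rightarrow> real \<Rightarrow> (nat \<Rightarrow> nat set) \<Rightarrow> real \<Rightarrow> real" where
  "\<Omega> a b N U x =
     (let m = size_U U
      in Determinant.det (mat1 m (\<lambda>l j.
           \<xi> a b N (row_t U l) (x - real j) (m - j) *
           poly (Y_row a b N U l) (\<theta> a b (x - real j)))))"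

text \<open>Division by zero is total in HOL, so that every entry of \<open>\<Omega>\<close> is defined at \<open>x\<close>
  has to be said separately.  The denominators \<open>(1 - b)\<^sub>j\<close>, \<open>(1 - a)\<^sub>j\<close> in the dual Hahn
  polynomials do not depend on \<open>x\<close>; they are nonzero under the assumptions on \<open>a\<close> and \<open>b\<close>.\<close>

definition \<Omega>_defined :: "real \<Rightarrow> real \<Rightarrow> real \<Rightarrow> (nat \<Rightarrow> nat set) \<Rightarrow> real \<Rightarrow> bool" where
  "\<Omega>_defined a b N U x \<longleftrightarrow>
     (\<forall>l\<in>{1..size_U U}. \<forall>j\<in>{1..size_U U}.
        \<xi>_den a b N (row_t U l) (x - real j) (size_U U - j) \<noteq> 0)"

definition q_poly :: "real \<Rightarrow> real \<Rightarrow> real \<Rightarrow> (nat \<Rightarrow> nat set) \<Rightarrow> nat \<Rightarrow> real poly" where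
  "q_poly a b N U n =
     (let m = size_U U
      in Determinant.det (mat1 (m + 1) (\<lambda>i j.
           if i = 1 then smult ((- 1) ^ (j - 1)) (hahn a b N (int n + 1 - int j))
           else [: \<xi> a b N (row_t U (i - 1)) (real n + 1 - real j) (m + 1 - j) *
                   poly (Y_row a b N U (i - 1)) (\<theta> a b (real n + 1 - real j)) :])))"

definition shift :: "real \<Rightarrow> real poly \<Rightarrow> real poly" where
  "shift l p = pcompose p [:l, 1:]"

definition fwd_diff :: "real poly \<Rightarrow> real poly" where
  "fwd_diff p = shift 1 p - p"

definition bwd_diff :: "real poly \<Rightarrow> real poly" where
  "bwd_diff p = p - shift (- 1) p"

definition hahn_op :: "real \<Rightarrow> real \<Rightarrow> real \<Rightarrow> real poly \<Rightarrow> real poly" where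
  "hahn_op a b N p =
     [:0, 1:] * [:- b - N - 1, 1:] * shift (- 1) p
     - ([:a + 1, 1:] * [:- N, 1:] + [:0, 1:] * [:- b - N - 1, 1:]) * p
     + [:a + 1, 1:] * [:- N, 1:] * shift 1 p"

definition cal_D :: "real \<Rightarrow> real \<Rightarrow> real \<Rightarrow> nat \<Rightarrow> real poly \<Rightarrow> real poly" where
  "cal_D a b N t p = smult ((a + b + 1) / 2) p +
     (if t = 1 then [:0, 1:] * bwd_diff p
      else if t = 2 then [:- N, 1:] * fwd_diff p
      else if t = 3 then [:a + 1, 1:] * fwd_diff p
      else [:- b - N - 1, 1:] * bwd_diff p)"

definition poly_op :: "real poly \<Rightarrow> (real poly \<Rightarrow> real poly) \<Rightarrow> real poly \<Rightarrow> real poly" where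
  "poly_op P T p = (\<Sum>i\<le>degree P. smult (coeff P i) ((T ^^ i) p))"

definition is_rational :: "(real \<Rightarrow> real) \<Rightarrow> bool" where
  "is_rational S \<longleftrightarrow> (\<exists>p q. q \<noteq> 0 \<and> S = (\<lambda>x. poly p x / poly q x))"

text \<open>In \<open>M_fun\<close> the determinant is the minor without row \<open>h\<close> and column \<open>j\<close>; \<^const>\<open>mat_delete\<close>
  counts from 0.\<close>

definition M_fun ::
    "real \<Rightarrow> real \<Rightarrow> real \<Rightarrow> (nat \<Rightarrow> nat set) \<Rightarrow> (real \<Rightarrow> real) \<Rightarrow> nat \<Rightarrow> real \<Rightarrow> real" where
  "M_fun a b N U S h x =
     (let m = size_U U
      in \<Sum>j = 1..m. (- 1) ^ (h + j) * \<xi> a b N (row_t U h) x (m - j) * S (x + real j) *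
           Determinant.det (mat_delete
             (mat1 m (\<lambda>l r. \<xi> a b N (row_t U l) (x + real j - real r) (m - r) *
                           poly (Y_row a b N U l) (\<theta> a b (x + real j - real r))))
             (h - 1) (j - 1)))"

text \<open>\<open>constructed_op a b N U S lam D\<close>: the operator \<open>D\<close>, with eigenvalues \<open>poly lam n\<close>, is
  produced by the \<open>\<D>\<close>-operator construction from the rational function \<open>S\<close>.
  Equalities of rational functions are stated for all but finitely many arguments.\<close>

definition constructed_op ::
    "real \<Rightarrow> real \<Rightarrow> real \<Rightarrow> (nat \<Rightarrow> nat set) \<Rightarrow> (real \<Rightarrow> real) \<Rightarrow> real poly \<Rightarrow>
     (real poly \<Rightarrow> real poly) \<Rightarrow> bool" where
  "constructed_op a b N U S lam D \<longleftrightarrow>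
     is_rational S \<and>
     (\<forall>\<^sub>\<infinity>x. poly lam x - poly lam (x - 1) = S x * \<Omega> a b N U x) \<and>
     (\<exists>Mt P.
        (\<forall>h\<in>{1..size_U U}. \<forall>\<^sub>\<infinity>x.
           M_fun a b N U S h x = \<sigma> a b (x + 1) * poly (Mt h) (\<theta> a b x)) \<and>
        (\<forall>\<^sub>\<infinity>x. poly P (\<theta> a b x) = 2 * poly lam x +
           (\<Sum>h = 1..size_U U. poly (Y_row a b N U h) (\<theta> a b x) * M_fun a b N U S h x)) \<and>
        D = (\<lambda>p. smult (1 / 2) (poly_op P (hahn_op a b N) p) +
           (\<Sum>h = 1..size_U U.
              poly_op (Mt h) (hahn_op a b N)
                (cal_D a b N (row_t U h) (poly_op (Y_row a b N U h) (hahn_op a b N) p)))))"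

text \<open>\<open>D = \<Sum>\<^bsub>l = -r\<^esub>\<^bsup>r\<^esup> g\<^sub>l \<s>\<^sub>l\<close> with polynomial coefficients and \<open>g\<^sub>-\<^sub>r\<close>, \<open>g\<^sub>r\<close> nonzero.\<close>

definition is_difference_op :: "int \<Rightarrow> (real poly \<Rightarrow> real poly) \<Rightarrow> bool" where
  "is_difference_op r D \<longleftrightarrow>
     (\<exists>g :: int \<Rightarrow> real poly. g (- r) \<noteq> 0 \<and> g r \<noteq> 0 \<and>
        (\<forall>p. D p = (\<Sum>l = - r..r. g l * shift (of_int l) p)))"

definition order_r :: "(nat \<Rightarrow> nat set) \<Rightarrow> (nat \<Rightarrow> nat) \<Rightarrow> int" where
  "order_r F h =
     (\<Sum>f\<in>F 4. int f) - (\<Sum>i = 1..3. \<Sum>f\<in>F i. int f)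
     - (\<Sum>i = 1..4. int (card (F i) choose 2))
     + (\<Sum>i = 1..3. int (card (F i)) * (fmax (F i) + int (h i))) + 1"

end

theory Submission
  imports Defs "HOL-Number_Theory.Cong" "HOL-Computational_Algebra.Field_as_Ring" "HOL-Library.Landau_Symbols"
begin

text \<open>The difference operator. Clearing the denominators of \<open>\<xi>\<close> and a factor common to all columns turns \<open>\<Omega>\<close> into a polynomial
  determinant that is divisible by the product of \<open>2y + c - s\<close>, \<open>c = a + b + 1\<close>, over all pairs of columns \<open>i, j\<close>, \<open>s = i + j\<close>, because
  columns at points exchanged by the reflection \<open>z \<mapsto> - z - c\<close> of \<open>\<theta>\<close> agree. This defines \<open>S\<close>. The divisibility persists when one row is
  replaced by any polynomial in \<open>\<theta>\<close>, hence \<open>M\<^sub>h\<close> has no poles, and the reflection makes it a multiple of \<open>\<sigma>\<^sub>x\<^sub>+\<^sub>1\<close> by a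
  polynomial in \<open>\<theta>\<close>. The linear relation between \<open>m + 1\<close> consecutive columns, truncated, gives the eigenvalue equation, and
  the leading terms of the determinants at infinity give the order.

  Orthogonality. The transformed weight times all nodes, one for each row, is the Hahn weight. Times all nodes but one,
  its integral against \<open>h\<^sub>n\<close> is a function of the second kind and equals, up to \<open>\<xi>\<close>, the entry of that row. By the relation between
  the columns, \<open>q\<^sub>n\<close> with \<open>n \<ge> m\<close> is therefore orthogonal to all polynomials of degree less than \<open>m\<close>, and division by the product of
  the nodes settles the others. For \<open>n < m\<close> the columns to the right of column \<open>n\<close> are values at negative indices, which are polynomials in
  the node, and Lagrange interpolation applies.\<close>

section \<open>Hahn polynomials\<close>

text \<open>The identities behind the operator hold between rational functions of \<open>x\<close>.
  They are proved off a finite set and carried to \<open>x = n\<close> by continuity, for which all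
  entries must be defined there. The reflection is useful because the denominators of
  \<open>\<xi>\<close> are, up to sign, its numerators at mirror images. For special parameters the
  weights common to all columns vanish at zeros of the mirror factors and cannot be cancelled
  afterwards; so they are removed from each Leibniz term, and the divisibility is reached by
  perturbing the weights. The summands of \<open>M_fun\<close> belong to different points
  \<open>x + j\<close> and have poles of their own. Only the sum is a polynomial, which requires a
  local study of poles at every real point. Nodes of types 1 and 2 avoid the support of the weight,
  those of types 3 and 4 lie in its range. Only for the former can the weight be divided by a node;
  for the latter the quotient is a sum of weights on longer ranges. The minor that multiplies the
  last Hahn polynomial in q_n is \<open>\<Omega>\<close> at \<open>n + 1\<close> up to factors; it
  governs the norm for n > 0, hence the hypothesis reaches one index beyond the last
  polynomial.\<close>

lemma pochhammer_reflect: "pochhammer (1 - z - of_nat k) k = (-1) ^ k * pochhammer (z::real) k"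
  using pochhammer_minus[of "z + of_nat k - 1" k] by (simp add: algebra_simps)

lemma pochhammer_split: "pochhammer (z::real) (i + j) = pochhammer z i * pochhammer (z + real i) j"
  using pochhammer_product[of i "i + j" z] by simp

lemma minus_one_power_diff: "j \<le> n \<Longrightarrow> (-1::real) ^ (n - j) = (-1) ^ n * (-1) ^ j"
  by (metis (no_types, lifting) le_add_diff_inverse2 left_minus_one_mult_self mult.commute power_add)

text \<open>Chu-Vandermonde: reflecting the factor with \<open>d\<close> turns the sum into that of
  \<open>pochhammer_binomial_sum\<close>. Since \<open>d\<close> is never inverted, it is free of
  conditions.\<close>

lemma vandermonde_alternating:
  "(\<Sum>j\<le>n. (-1) ^ j * real (n choose j) * pochhammer s j * pochhammer (d + real j) (n - j)) = pochhammer (d - s) n"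
proof -
  have "(\<Sum>j\<le>n. (-1) ^ j * real (n choose j) * pochhammer s j * pochhammer (d + real j) (n - j))
      = (\<Sum>j\<le>n. (-1) ^ n * (real (n choose j) * pochhammer s j * pochhammer (1 - d - real n) (n - j)))"
  proof (rule sum.cong[OF refl], goal_cases)
    case (1 j)
    hence j: "j \<le> n" by simp
    have "pochhammer (1 - d - real n) (n - j) = (-1) ^ (n - j) * pochhammer (d + real j) (n - j)"
      using pochhammer_reflect[of "d + real j" "n - j"] j by (simp add: of_nat_diff algebra_simps)
    moreover have "(-1::real) ^ j = (-1) ^ n * (-1) ^ (n - j)"
      using minus_one_power_diff[OF j] by simp
    ultimately show ?case by simp
  qed
  also have "\<dots> = (-1) ^ n * pochhammer (s + (1 - d - real n)) n"
    by (simp add: sum_distrib_left pochhammer_binomial_sum)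
  also have "\<dots> = pochhammer (d - s) n"
    using pochhammer_reflect[of "d - s" n] by (simp add: algebra_simps)
  finally show ?thesis .
qed

text \<open>\<open>hsum\<close> is a terminating hypergeometric \<open>\<^sub>3F\<^sub>2\<close> at 1, multiplied by \<open>(c)\<^sub>n (d)\<^sub>n\<close> so that no parameter has to be
  excluded; \<open>hsum_transform\<close> is Sheppard's transformation, which gives the four expansions of the Hahn polynomials.\<close>

definition hsum :: "nat \<Rightarrow> real \<Rightarrow> real \<Rightarrow> real \<Rightarrow> real \<Rightarrow> real" where
  "hsum n s x c d = (\<Sum>j\<le>n. (-1) ^ j * real (n choose j) * pochhammer s j * pochhammer x j *
     pochhammer (c + real j) (n - j) * pochhammer (d + real j) (n - j))"

lemma hsum_commute: "hsum n s x c d = hsum n s x d c"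
  unfolding hsum_def by (intro sum.cong) auto

lemma hsum_transform: "hsum n s (c - w) c d = (-1) ^ n * hsum n s w c (1 + s - d - real n)"
proof -
  \<comment> \<open>Vandermonde expands (c - w)_j, the order of summation is exchanged, and the
    inner sum over \<open>j\<close> is again of Vandermonde type.\<close>
  let ?A = "\<lambda>j k. (-1) ^ j * real (n choose j) * pochhammer s j * pochhammer (d + real j) (n - j) *
      ((-1) ^ k * real (j choose k) * pochhammer w k * pochhammer (c + real k) (n - k))"
  have "hsum n s (c - w) c d = (\<Sum>j\<le>n. \<Sum>k\<le>j. ?A j k)"
    unfolding hsum_def
  proof (rule sum.cong[OF refl], goal_cases)
    case (1 j)
    hence j: "j \<le> n" by simp
    have sp: "pochhammer (c + real k) (n - k) = pochhammer (c + real k) (j - k) * pochhammer (c + real j) (n - j)"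
      if "k \<le> j" for k
      using pochhammer_split[of "c + real k" "j - k" "n - j"] that j by (simp add: of_nat_diff)
    have "(-1) ^ j * real (n choose j) * pochhammer s j * pochhammer (c - w) j *
      pochhammer (c + real j) (n - j) * pochhammer (d + real j) (n - j) =
      (-1) ^ j * real (n choose j) * pochhammer s j * pochhammer (d + real j) (n - j) * pochhammer (c + real j) (n - j) *
        (\<Sum>k\<le>j. (-1) ^ k * real (j choose k) * pochhammer w k * pochhammer (c + real k) (j - k))"
      by (simp add: vandermonde_alternating)
    also have "\<dots> = (\<Sum>k\<le>j. ?A j k)"
      unfolding sum_distrib_left
    proof (rule sum.cong[OF refl], goal_cases)
      case (1 k)
      hence "k \<le> j" by simp
      from sp[OF this] show ?case by (simp only: mult_ac)
    qed
    finally show ?case .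
  qed
  also have "\<dots> = (\<Sum>k\<le>n. \<Sum>j=k..n. ?A j k)"
  proof -
    have "(\<Sum>j\<le>n. \<Sum>k\<le>j. ?A j k) = (\<Sum>j\<le>n. \<Sum>k\<in>{k\<in>{..n}. k \<le> j}. ?A j k)"
      by (intro sum.cong) auto
    also have "\<dots> = (\<Sum>k\<le>n. \<Sum>j\<in>{j\<in>{..n}. k \<le> j}. ?A j k)"
      by (rule sum.swap_restrict) auto
    also have "\<dots> = (\<Sum>k\<le>n. \<Sum>j=k..n. ?A j k)"
      by (intro sum.cong) auto
    finally show ?thesis .
  qed
  also have "\<dots> = (-1) ^ n * hsum n s w c (1 + s - d - real n)"
    unfolding hsum_def sum_distrib_left
  proof (rule sum.cong[OF refl], goal_cases)
    case (1 k)
    hence k: "k \<le> n" by simp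
    have "(\<Sum>j=k..n. ?A j k) = (\<Sum>i\<le>n-k. ?A (k + i) k)"
      using k by (intro sum.reindex_bij_witness[of _ "\<lambda>i. k + i" "\<lambda>j. j - k"]) auto
    also have "\<dots> = (\<Sum>i\<le>n-k. (real (n choose k) * pochhammer s k * pochhammer w k * pochhammer (c + real k) (n - k)) *
        ((-1) ^ i * real ((n - k) choose i) * pochhammer (s + real k) i * pochhammer ((d + real k) + real i) (n - k - i)))"
    proof (rule sum.cong[OF refl], goal_cases)
      case (1 i)
      hence i: "i \<le> n - k" by simp
      have "(n choose (k + i)) * ((k + i) choose k) = (n choose k) * ((n - k) choose i)"
        using choose_mult[of k "k + i" n] i k by simp
      hence ch: "real (n choose (k + i)) * real ((k + i) choose k) = real (n choose k) * real ((n - k) choose i)"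
        by (metis of_nat_mult)
      show ?case
        using ch by (simp add: pochhammer_split power_add add.assoc mult_ac)
    qed
    also have "\<dots> = (real (n choose k) * pochhammer s k * pochhammer w k * pochhammer (c + real k) (n - k)) *
       pochhammer (d - s) (n - k)"
      using vandermonde_alternating[where n="n-k" and s="s + real k" and d="d + real k"]
      by (simp add: sum_distrib_left[symmetric] add.assoc)
    also have "pochhammer (d - s) (n - k) = (-1) ^ (n - k) * pochhammer (1 + s - d - real n + real k) (n - k)"
      using pochhammer_reflect[of "d - s" "n - k"] k by (simp add: of_nat_diff algebra_simps)
    also have "(-1::real) ^ (n - k) = (-1) ^ n * (-1) ^ k"
      by (rule minus_one_power_diff[OF k])
    finally show ?case
      by (simp add: mult_ac)
  qed
  finally show ?thesis .
qed

text \<open>Saalschuetz's sum. After one transformation the upper parameter \<open>b + 1\<close>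
  meets an equal lower one; they cancel and Vandermonde sums the rest.\<close>

lemma hsum_saalschuetz:
  "hsum n (real n + a + b + 1) X (a + 1) (X + b + 1) = pochhammer (b + 1) n * pochhammer (a + 1 - X) n"
proof -
  let ?s = "real n + a + b + 1"
  have "hsum n ?s X (a + 1) (X + b + 1) = hsum n ?s ((X + b + 1) - (b + 1)) (X + b + 1) (a + 1)"
    by (simp add: hsum_commute)
  also have "\<dots> = (-1) ^ n * hsum n ?s (b + 1) (X + b + 1) (1 + ?s - (a + 1) - real n)"
    by (rule hsum_transform)
  also have "1 + ?s - (a + 1) - real n = b + 1" by simp
  also have "hsum n ?s (b + 1) (X + b + 1) (b + 1) = pochhammer (b + 1) n *
     (\<Sum>j\<le>n. (-1) ^ j * real (n choose j) * pochhammer ?s j * pochhammer (X + b + 1 + real j) (n - j))"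
    unfolding hsum_def sum_distrib_left
  proof (rule sum.cong[OF refl], goal_cases)
    case (1 j)
    hence "pochhammer (b + 1) n = pochhammer (b + 1) j * pochhammer (b + 1 + real j) (n - j)"
      using pochhammer_split[of "b + 1" j "n - j"] by simp
    thus ?case by simp
  qed
  also have "\<dots> = pochhammer (b + 1) n * pochhammer (X + b + 1 - ?s) n"
    by (simp only: vandermonde_alternating)
  also have "pochhammer (X + b + 1 - ?s) n = (-1) ^ n * pochhammer (a + 1 - X) n"
    using pochhammer_reflect[of "a + 1 - X" n] by (simp add: algebra_simps)
  finally show ?thesis by simp
qed

text \<open>Rising factorials are to \<open>y * (E - 1)\<close>, with \<open>E\<close> the unit
  shift, what powers are to the Euler operator: eigenfunctions with eigenvalue
  \<open>j\<close>.\<close>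

lemma pochhammer_euler: "y * (pochhammer (y + 1) j - pochhammer y j) = real j * pochhammer (y::real) j"
proof -
  have "y * pochhammer (y + 1) j = pochhammer y j * (y + real j)"
    using pochhammer_rec[of y j] pochhammer_rec'[of y j] by (simp add: mult.commute)
  thus ?thesis by (simp add: algebra_simps)
qed

lemma hsum_euler:
  "y * (hsum n s (y + 1) c d - hsum n s y c d) =
   (\<Sum>j\<le>n. real j * ((-1) ^ j * real (n choose j) * pochhammer s j * pochhammer y j *
     pochhammer (c + real j) (n - j) * pochhammer (d + real j) (n - j)))"
  unfolding hsum_def sum_subtractf[symmetric] sum_distrib_left
proof (rule sum.cong[OF refl], goal_cases)
  case (1 j)
  show ?case using arg_cong[OF pochhammer_euler[of y j], of "\<lambda>t. (-1) ^ j * real (n choose j) * pochhammer s j * 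
     pochhammer (c + real j) (n - j) * pochhammer (d + real j) (n - j) * t"]
    by (simp add: algebra_simps)
qed

text \<open>In the basis of rising factorials of \<open>y\<close> the brackets multiply the
  \<open>j\<close>-th coefficient by \<open>j - Suc n\<close> and by
  \<open>j + n + \<sigma>'\<close>. These are the factors by which the coefficients for
  \<open>Suc n\<close> and \<open>n\<close> differ, so the two sides agree term by term.\<close>

lemma hsum_structure:
  fixes \<sigma>' c d :: real
  defines "H \<equiv> \<lambda>n y. hsum n (real n + \<sigma>') y c d"
  shows "(real n + \<sigma>') * (y * (H (Suc n) (y + 1) - H (Suc n) y) - real (Suc n) * H (Suc n) y) =
    - real (Suc n) * (c + real n) * (d + real n) * (y * (H n (y + 1) - H n y) + (real n + \<sigma>') * H n y)"
proof -
  let ?e = "\<lambda>n j. (-1) ^ j * real (n choose j) * pochhammer (real n + \<sigma>') j * pochhammer y j *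
     pochhammer (c + real j) (n - j) * pochhammer (d + real j) (n - j)"
  have 1: "y * (H (Suc n) (y + 1) - H (Suc n) y) - real (Suc n) * H (Suc n) y = (\<Sum>j\<le>Suc n. (real j - real (Suc n)) * ?e (Suc n) j)"
    unfolding H_def hsum_euler unfolding hsum_def sum_distrib_left sum_subtractf[symmetric]
    by (intro sum.cong refl) (simp add: algebra_simps)
  have 2: "y * (H n (y + 1) - H n y) + (real n + \<sigma>') * H n y = (\<Sum>j\<le>n. (real j + (real n + \<sigma>')) * ?e n j)"
    unfolding H_def hsum_euler unfolding hsum_def sum_distrib_left sum.distrib[symmetric]
    by (intro sum.cong refl) (simp add: algebra_simps)
  have 3: "(real n + \<sigma>') * ((real j - real (Suc n)) * ?e (Suc n) j) =
     - real (Suc n) * (c + real n) * (d + real n) * ((real j + (real n + \<sigma>')) * ?e n j)" if j: "j \<le> n" for j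
  proof -
    have ch: "(real (Suc n) - real j) * real (Suc n choose j) = real (Suc n) * real (n choose j)"
    proof -
      have "(Suc n - j) * (Suc n choose j) = Suc n * (n choose j)"
        using j binomial_absorb_comp[of "Suc n" j] by simp
      hence "real (Suc n - j) * real (Suc n choose j) = real (Suc n) * real (n choose j)" by (metis of_nat_mult)
      moreover have "real (Suc n - j) = real (Suc n) - real j" using j by (simp add: of_nat_diff)
      ultimately show ?thesis by simp
    qed
    have p: "(real n + \<sigma>') * pochhammer (real (Suc n) + \<sigma>') j = (real n + \<sigma>' + real j) * pochhammer (real n + \<sigma>') j"
      using pochhammer_rec[of "real n + \<sigma>'" j] pochhammer_rec'[of "real n + \<sigma>'" j] by (simp add: algebra_simps)
    have q: "pochhammer (z + real j) (Suc n - j) = pochhammer (z + real j) (n - j) * (z + real n)" for z :: real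
      using pochhammer_Suc[of "z + real j" "n - j"] j by (simp add: Suc_diff_le of_nat_diff)
    have "(real n + \<sigma>') * ((real j - real (Suc n)) * ?e (Suc n) j) =
      - (((real (Suc n) - real j) * real (Suc n choose j)) * ((real n + \<sigma>') * pochhammer (real (Suc n) + \<sigma>') j)) *
       ((-1) ^ j * pochhammer y j * pochhammer (c + real j) (Suc n - j) * pochhammer (d + real j) (Suc n - j))"
      by (simp only: mult_ac) (simp add: algebra_simps)
    also have "\<dots> = - real (Suc n) * (c + real n) * (d + real n) * ((real j + (real n + \<sigma>')) * ?e n j)"
      unfolding ch p q by (simp add: mult_ac add_ac del: of_nat_Suc)
    finally show ?thesis .
  qed
  \<comment> \<open>The term \<open>j = Suc n\<close>, present only on the left, carries the factor
    0.\<close>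
  show ?thesis
    unfolding 1 2 sum_distrib_left
    using 3 by (subst sum.atMost_Suc) (simp, intro sum.cong, auto)
qed

section \<open>Structure relations and difference equation of the Hahn polynomials\<close>

lemma poly_pochhammer: "poly (pochhammer p n) x = pochhammer (poly p x) n"
  by (induction n) (auto simp: pochhammer_Suc)

lemma degree_pochhammer_minus_X:
  "degree (pochhammer [:0, -1 :: real:] j) = j" "coeff (pochhammer [:0, -1 :: real:] j) j = (-1) ^ j"
proof -
  have "degree (pochhammer [:0, -1 :: real:] j) = j \<and> lead_coeff (pochhammer [:0, -1 :: real:] j) = (-1) ^ j"
  proof (induction j)
    case (Suc j)
    have e: "[:0, -1 :: real:] + of_nat j = [:real j, -1:]" by (simp add: of_nat_poly)
    have nz: "pochhammer [:0, -1 :: real:] j \<noteq> 0" using Suc by (metis leading_coeff_0_iff power_eq_0_iff zero_neq_neg_one)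
    have "lead_coeff (pochhammer [:0, -1 :: real:] j) = (-1) ^ j" using Suc by blast
    hence "lead_coeff (pochhammer [:0, -1 :: real:] j * [:real j, -1:]) = (-1) ^ Suc j"
      unfolding lead_coeff_mult by simp
    moreover have "degree (pochhammer [:0, -1 :: real:] j * [:real j, -1:]) = Suc j"
      using Suc nz by (subst degree_mult_eq) auto
    ultimately show ?case unfolding pochhammer_Suc e by simp
  qed auto
  thus "degree (pochhammer [:0, -1 :: real:] j) = j" "coeff (pochhammer [:0, -1 :: real:] j) j = (-1) ^ j" by auto
qed

text \<open>The nonscalar part of the four D-operators. Each is \<open>y * (E - 1)\<close> in one of
  the variables \<open>y = - x\<close>, \<open>x - N\<close>, \<open>x + a + 1\<close>,
  \<open>b + N + 1 - x\<close>, and each of these is the variable of one hypergeometric expansion of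
  the Hahn polynomials.\<close>

definition euler_op :: "real \<Rightarrow> real \<Rightarrow> real \<Rightarrow> nat \<Rightarrow> (real \<Rightarrow> real) \<Rightarrow> real \<Rightarrow> real" where
  "euler_op a b N t f x =
     (if t = 1 then x * (f x - f (x - 1)) else if t = 2 then (x - N) * (f (x + 1) - f x)
      else if t = 3 then (x + a + 1) * (f (x + 1) - f x) else (x - b - N - 1) * (f x - f (x - 1)))"

locale hahn_params =
  fixes a b N :: real
  assumes pos_a: "pochhammer (a + 1) n \<noteq> 0"
    and pos_b: "pochhammer (b + 1) n \<noteq> 0"
    and pos_ab: "pochhammer (a + b + 1) n \<noteq> 0"
    and pos_abN: "pochhammer (a + b + N + 2) n \<noteq> 0"
begin

lemma nz_a: "a + 1 + real n \<noteq> 0" using pos_a[of "Suc n"] by (simp add: pochhammer_Suc)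
lemma nz_b: "b + 1 + real n \<noteq> 0" using pos_b[of "Suc n"] by (simp add: pochhammer_Suc)
lemma nz_ab: "a + b + 1 + real n \<noteq> 0" using pos_ab[of "Suc n"] by (simp add: pochhammer_Suc)
lemma nz_abN: "a + b + N + 2 + real n \<noteq> 0" using pos_abN[of "Suc n"] by (simp add: pochhammer_Suc)

abbreviation "hp n \<equiv> hahn a b N (int n)"
abbreviation "H n \<equiv> poly (hp n)"

definition hconst :: "nat \<Rightarrow> real" where
  "hconst n = (-1) ^ n * pochhammer (a + b + 1) n /
     (pochhammer (a + b + N + 2) n * pochhammer (a + 1) n * fact n)"

lemma hconst_nonzero: "hconst n \<noteq> 0"
  using pos_a pos_ab pos_abN by (simp add: hconst_def)

lemma hconst_Suc: "hconst (Suc n) * (real (Suc n) * (a + 1 + real n) * (a + b + N + 2 + real n)) =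
    - hconst n * (a + b + 1 + real n)"
proof -
  have aux: "(-1) ^ Suc n * (P * u) / (Q * q * (R * p) * (r * f)) * (r * p * q) = - ((-1) ^ n * P / (Q * R * f)) * u"
    if "p \<noteq> 0" "q \<noteq> 0" "r \<noteq> 0" "Q \<noteq> 0" "R \<noteq> 0" "f \<noteq> 0" for P Q R p q r f u :: real
    using that by (simp add: field_simps)
  have "fact (Suc n) = real (Suc n) * fact n" by simp
  thus ?thesis
    unfolding hconst_def pochhammer_Suc
    using aux[of "a + 1 + real n" "a + b + N + 2 + real n" "real (Suc n)" "pochhammer (a + b + N + 2) n" "pochhammer (a + 1) n" "fact n"
        "pochhammer (a + b + 1) n" "a + b + 1 + real n"] nz_a[of n] nz_abN[of n] pos_a pos_abN
    by (simp only:) simp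
qed

lemma hahn_hsum1: "H n x = hconst n * hsum n (real n + (a + b + 1)) (- x) (a + 1) (- N)"
proof -
  have "H n x = (\<Sum>j\<le>n. pochhammer (N - real n + 1) (n - j) * pochhammer (a + b + 1) (j + n) /
         (pochhammer (2 + a + b + N) n * pochhammer (a + 1) j * fact (n - j) * fact j) * pochhammer (- x) j)"
    by (simp add: hahn_def poly_sum poly_pochhammer atLeast0AtMost)
  also have "\<dots> = hconst n * hsum n (real n + (a + b + 1)) (- x) (a + 1) (- N)"
    unfolding hsum_def sum_distrib_left
  proof (rule sum.cong[OF refl], goal_cases)
    case (1 j)
    hence j: "j \<le> n" by simp
    have 1: "pochhammer (N - real n + 1) (n - j) = (-1) ^ n * (-1) ^ j * pochhammer (- N + real j) (n - j)"
      using minus_one_power_diff[OF j] pochhammer_reflect[of "- N + real j" "n - j"] j by (simp add: of_nat_diff algebra_simps)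
    have 2: "pochhammer (a + b + 1) (j + n) = pochhammer (a + b + 1) n * pochhammer (real n + (a + b + 1)) j"
      using pochhammer_split[of "a + b + 1" n j] by (simp add: add_ac)
    have 3: "pochhammer (a + 1) n = pochhammer (a + 1) j * pochhammer (a + 1 + real j) (n - j)"
      using pochhammer_split[of "a + 1" j "n - j"] j by simp
    have 4: "real (n choose j) = fact n / (fact j * fact (n - j))"
      using j by (simp add: binomial_fact)
    have 5: "2 + a + b + N = a + b + N + 2" by simp
    have nz: "pochhammer (a + 1) j \<noteq> 0" "pochhammer (a + 1 + real j) (n - j) \<noteq> 0"
      using pos_a[of n] unfolding 3 by auto
    show ?case
      unfolding hconst_def 1 2 3 4 5 using nz by (simp add: field_simps)
  qed
  finally show ?thesis .
qed

lemma hahn_hsum3: "H n x = (-1) ^ n * hconst n * hsum n (real n + (a + b + 1)) (x + a + 1) (a + 1) (a + b + N + 2)"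
  using hsum_transform[of n "real n + (a + b + 1)" "a + 1" "x + a + 1" "- N"]
  unfolding hahn_hsum1 by (simp add: algebra_simps)

lemma hahn_hsum2: "H n x = (-1) ^ n * hconst n * hsum n (real n + (a + b + 1)) (x - N) (b + 1) (- N)"
  using hsum_transform[of n "real n + (a + b + 1)" "- N" "x - N" "a + 1"]
  unfolding hahn_hsum1 by (subst (1 2) hsum_commute) (simp add: algebra_simps)

lemma hahn_hsum4: "H n x = hconst n * hsum n (real n + (a + b + 1)) (b + N + 1 - x) (b + 1) (a + b + N + 2)"
  using hsum_transform[of n "real n + (a + b + 1)" "b + 1" "b + N + 1 - x" "- N"]
  unfolding hahn_hsum2 by (simp add: algebra_simps)

lemma eq_times_divide: "q * X = - k * Z \<Longrightarrow> q \<noteq> 0 \<Longrightarrow> X = - (k / q) * (Z :: real)"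
  by (simp add: field_simps)

text \<open>Common form of the four cases: \<open>y\<close> is the expansion variable,
  \<open>K\<close> the normalisation and \<open>\<kappa>\<close> the sign in its recursion.
  Multiplying \<open>hsum_structure\<close> by \<open>K (Suc n)\<close> and cancelling
  \<open>a + b + 1 + n\<close> gives the relation.\<close>

lemma hahn_structure_aux:
  assumes H: "\<And>n x. H n x = K n * hsum n (real n + (a + b + 1)) (y x) c d"
    and K: "\<And>n. K (Suc n) * (real (Suc n) * (a + 1 + real n) * (a + b + N + 2 + real n)) = \<kappa> * K n * (a + b + 1 + real n)"
    and x': "y x' = y x + 1"
  shows "y x * (H (Suc n) x' - H (Suc n) x) - real (Suc n) * H (Suc n) x =
    - (\<kappa> * (c + real n) * (d + real n) / ((a + 1 + real n) * (a + b + N + 2 + real n))) *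
     (y x * (H n x' - H n x) + (real n + (a + b + 1)) * H n x)"
proof -
  let ?G = "\<lambda>n y. hsum n (real n + (a + b + 1)) y c d"
  let ?s = "a + b + 1 + real n" and ?q = "(a + 1 + real n) * (a + b + N + 2 + real n)"
  have st: "?s * (y x * (?G (Suc n) (y x + 1) - ?G (Suc n) (y x)) - real (Suc n) * ?G (Suc n) (y x)) =
     - real (Suc n) * (c + real n) * (d + real n) * (y x * (?G n (y x + 1) - ?G n (y x)) + (real n + (a + b + 1)) * ?G n (y x))"
    using hsum_structure[of n "a + b + 1" "y x" c d] by (simp add: add_ac)
  have nz: "?s \<noteq> 0" "?q \<noteq> 0" using nz_ab[of n] nz_a[of n] nz_abN[of n] by auto
  let ?L = "y x * (?G (Suc n) (y x + 1) - ?G (Suc n) (y x)) - real (Suc n) * ?G (Suc n) (y x)"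
  let ?R = "y x * (?G n (y x + 1) - ?G n (y x)) + (real n + (a + b + 1)) * ?G n (y x)"
  have "?s * ?q * (K (Suc n) * ?L) = K (Suc n) * ?q * (?s * ?L)" by (simp only: mult_ac)
  also have "\<dots> = (K (Suc n) * (real (Suc n) * (a + 1 + real n) * (a + b + N + 2 + real n))) * (- (c + real n) * (d + real n) * ?R)"
    unfolding st by (simp only: mult_ac mult_minus_left mult_minus_right)
  also have "\<dots> = ?s * (- (\<kappa> * (c + real n) * (d + real n)) * (K n * ?R))"
    unfolding K by (simp only: mult_ac mult_minus_left mult_minus_right)
  finally have "?q * (K (Suc n) * ?L) = - (\<kappa> * (c + real n) * (d + real n)) * (K n * ?R)"
    using nz by (simp only: mult.assoc mult_cancel_left) simp
  hence "K (Suc n) * ?L = - (\<kappa> * (c + real n) * (d + real n) / ?q) * (K n * ?R)"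
    using nz(2) by (rule eq_times_divide)
  moreover have "K (Suc n) * ?L = y x * (H (Suc n) x' - H (Suc n) x) - real (Suc n) * H (Suc n) x"
    unfolding H x' by (simp only: algebra_simps)
  moreover have "K n * ?R = y x * (H n x' - H n x) + (real n + (a + b + 1)) * H n x"
    unfolding H x' by (simp only: algebra_simps)
  ultimately show ?thesis by simp
qed

text \<open>This first-order recursion in \<open>n\<close> is the source of the functions
  \<open>\<xi>\<close>: iterated in \<open>cal_D_hahn\<close>, its ratios multiply up to
  \<open>\<xi>\<close> of higher order.\<close>

lemma hahn_structure:
  assumes "t \<in> {1, 2, 3, 4}"
  shows "euler_op a b N t (H (Suc n)) x - real (Suc n) * H (Suc n) x =
     - \<xi> a b N t (real (Suc n)) 1 * (euler_op a b N t (H n) x + (real n + (a + b + 1)) * H n x)"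
proof -
  have nz: "a + 1 + real n \<noteq> 0" "a + b + N + 2 + real n \<noteq> 0" using nz_a nz_abN by auto
  have K1: "hconst (Suc n) * (real (Suc n) * (a + 1 + real n) * (a + b + N + 2 + real n)) = (-1) * hconst n * (a + b + 1 + real n)" for n
    using hconst_Suc[of n] by simp
  have K2: "((-1) ^ Suc n * hconst (Suc n)) * (real (Suc n) * (a + 1 + real n) * (a + b + N + 2 + real n)) = 1 * ((-1) ^ n * hconst n) * (a + b + 1 + real n)" for n
    using arg_cong[OF hconst_Suc[of n], of "\<lambda>t. (-1) ^ Suc n * t"] by (simp add: mult_ac)
  consider "t = 1" | "t = 2" | "t = 3" | "t = 4" using assms by auto
  thus ?thesis
  proof cases
    case 1
    have "- ((-1) * (a + 1 + real n) * (- N + real n) / ((a + 1 + real n) * (a + b + N + 2 + real n))) = - \<xi> a b N t (real (Suc n)) 1"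
      using 1 nz by (simp add: \<xi>_def \<xi>_num_def \<xi>_den_def add_ac divide_simps) (simp add: algebra_simps)?
    thus ?thesis using hahn_structure_aux[of hconst uminus "a + 1" "- N", OF hahn_hsum1 K1, of "x - 1" x n] 1
      by (simp add: euler_op_def algebra_simps)
  next
    case 2
    have "- (1 * (b + 1 + real n) * (- N + real n) / ((a + 1 + real n) * (a + b + N + 2 + real n))) = - \<xi> a b N t (real (Suc n)) 1"
      using 2 nz by (simp add: \<xi>_def \<xi>_num_def \<xi>_den_def add_ac divide_simps) (simp add: algebra_simps)?
    thus ?thesis using hahn_structure_aux[of "\<lambda>n. (-1) ^ n * hconst n" "\<lambda>x. x - N" "b + 1" "- N", OF hahn_hsum2 K2, of "x + 1" x n] 2
      by (simp add: euler_op_def)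
  next
    case 3
    have "- (1 * (a + 1 + real n) * (a + b + N + 2 + real n) / ((a + 1 + real n) * (a + b + N + 2 + real n))) = - \<xi> a b N t (real (Suc n)) 1"
      using 3 nz by (simp add: \<xi>_def \<xi>_num_def \<xi>_den_def)
    thus ?thesis using hahn_structure_aux[of "\<lambda>n. (-1) ^ n * hconst n" "\<lambda>x. x + a + 1" "a + 1" "a + b + N + 2", OF hahn_hsum3 K2, of "x + 1" x n] 3
      by (simp add: euler_op_def)
  next
    case 4
    have "- ((-1) * (b + 1 + real n) * (a + b + N + 2 + real n) / ((a + 1 + real n) * (a + b + N + 2 + real n))) = - \<xi> a b N t (real (Suc n)) 1"
      using 4 nz by (simp add: \<xi>_def \<xi>_num_def \<xi>_den_def add_ac divide_simps) (simp add: algebra_simps)?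
    thus ?thesis using hahn_structure_aux[of hconst "\<lambda>x. b + N + 1 - x" "b + 1" "a + b + N + 2", OF hahn_hsum4 K1, of "x - 1" x n] 4
      by (simp add: euler_op_def algebra_simps)
  qed
qed

text \<open>On the basis (-x)_j the operator is bidiagonal, so the eigenvalue equation reduces to a
  two-term recursion for the coefficients \<open>w\<close>.\<close>

lemma hahn_difference_equation:
  "x * (x - b - N - 1) * H n (x - 1) - ((x + a + 1) * (x - N) + x * (x - b - N - 1)) * H n x
     + (x + a + 1) * (x - N) * H n (x + 1) = \<theta> a b (real n) * H n x"
proof -
  define p where "p = (\<lambda>j x. pochhammer (- x) j :: real)"
  define w where "w = (\<lambda>j. (-1) ^ j * real (n choose j) * pochhammer (real n + (a + b + 1)) j *
     pochhammer (a + 1 + real j) (n - j) * pochhammer (- N + real j) (n - j))"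
  define DD where "DD = (\<lambda>f :: real \<Rightarrow> real. x * (x - b - N - 1) * f (x - 1) - ((x + a + 1) * (x - N) + x * (x - b - N - 1)) * f x
     + (x + a + 1) * (x - N) * f (x + 1))"
  have Hw: "H n y = hconst n * (\<Sum>j\<le>n. w j * p j y)" for y
    unfolding hahn_hsum1 hsum_def w_def p_def by (simp add: mult_ac)
  have D0: "DD (p 0) = 0" by (simp add: DD_def p_def algebra_simps)
  have D1: "DD (p (Suc i)) = real (Suc i) * (real (Suc i) + a + b + 1) * p (Suc i) x - real (Suc i) * (a + real (Suc i)) * (real i - N) * p i x" for i
  proof -
    have e1: "p (Suc i) (x + 1) = (- x - 1) * p i x"
      using pochhammer_rec[of "- x - 1" i] by (simp add: p_def)
    have e2: "p (Suc i) x = (- x + real i) * p i x"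
      using pochhammer_rec'[of "- x" i] by (simp add: p_def)
    have e3: "x * p (Suc i) (x - 1) = (x - real i) * (- x + real i + 1) * p i x"
    proof -
      have "(- x) * pochhammer (- x + 1) (Suc i) = (- x + real (Suc i)) * ((- x + real i) * pochhammer (- x) i)"
        using pochhammer_rec[of "- x" "Suc i"] pochhammer_rec'[of "- x" "Suc i"] pochhammer_rec'[of "- x" i] by simp
      hence "x * p (Suc i) (x - 1) = - ((- x + real (Suc i)) * ((- x + real i) * pochhammer (- x) i))"
        unfolding p_def by (simp add: algebra_simps)
      thus ?thesis by (simp add: p_def algebra_simps)
    qed
    have "DD (p (Suc i)) = (x - b - N - 1) * (x * p (Suc i) (x - 1)) - ((x + a + 1) * (x - N) + x * (x - b - N - 1)) * p (Suc i) x
     + (x + a + 1) * (x - N) * p (Suc i) (x + 1)" by (simp add: DD_def)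
    also have "\<dots> = real (Suc i) * (real (Suc i) + a + b + 1) * p (Suc i) x - real (Suc i) * (a + real (Suc i)) * (real i - N) * p i x"
      unfolding e1 e2 e3 of_nat_Suc by (simp add: algebra_simps)
    finally show ?thesis .
  qed
  have D: "DD (p j) = real j * (real j + a + b + 1) * p j x - real j * (a + real j) * (real j - 1 - N) * p (j - 1) x" for j
    by (cases j) (simp_all add: D0 D1)
  have "DD (H n) = hconst n * (\<Sum>j\<le>n. w j * DD (p j))"
    unfolding DD_def Hw by (simp add: sum_distrib_left sum_subtractf sum.distrib algebra_simps)
  also have "(\<Sum>j\<le>n. w j * DD (p j)) = (\<Sum>j\<le>n. w j * (real j * (real j + a + b + 1)) * p j x) -
       (\<Sum>j\<le>n. w j * (real j * (a + real j) * (real j - 1 - N)) * p (j - 1) x)"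
    unfolding D sum_subtractf[symmetric] by (intro sum.cong refl) (simp add: algebra_simps)
  also have "(\<Sum>j\<le>n. w j * (real j * (a + real j) * (real j - 1 - N)) * p (j - 1) x) =
       (\<Sum>j<n. w (Suc j) * (real (Suc j) * (a + real (Suc j)) * (real j - N)) * p j x)"
    by (subst sum.atMost_shift) simp
  \<comment> \<open>The recursion of \<open>w\<close> rewrites each term; the new term
    \<open>j = n\<close> contains \<open>n - j\<close> and may be added.\<close>
  also have "\<dots> = (\<Sum>j\<le>n. - (real n - real j) * (real n + a + b + 1 + real j) * w j * p j x)"
  proof -
    have "w (Suc j) * (real (Suc j) * (a + real (Suc j)) * (real j - N)) = - (real n - real j) * (real n + a + b + 1 + real j) * w j"
      if "j < n" for j
    proof -
      have ch: "real (Suc j) * real (n choose Suc j) = (real n - real j) * real (n choose j)"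
      proof -
        have "Suc j * (n choose Suc j) = (n - j) * (n choose j)"
          by (metis binomial_absorption binomial_absorb_comp)
        hence "real (Suc j) * real (n choose Suc j) = real (n - j) * real (n choose j)" by (metis of_nat_mult)
        moreover have "real (n - j) = real n - real j" using that by (simp add: of_nat_diff)
        ultimately show ?thesis by simp
      qed
      have q: "pochhammer (z + real j) (n - j) = (z + real j) * pochhammer (z + real (Suc j)) (n - Suc j)" for z :: real
        using pochhammer_rec[of "z + real j" "n - Suc j"] that by (simp add: Suc_diff_Suc add_ac)
      have "w (Suc j) * (real (Suc j) * (a + real (Suc j)) * (real j - N)) =
         - ((-1) ^ j) * (real (Suc j) * real (n choose Suc j)) * (pochhammer (real n + (a + b + 1)) j * (real n + (a + b + 1) + real j)) *
         ((a + 1 + real j) * pochhammer (a + 1 + real (Suc j)) (n - Suc j)) * ((- N + real j) * pochhammer (- N + real (Suc j)) (n - Suc j))"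
        by (simp add: w_def pochhammer_Suc algebra_simps)
      also have "\<dots> = - (real n - real j) * (real n + a + b + 1 + real j) * w j"
        unfolding ch q[symmetric] by (simp add: w_def algebra_simps)
      finally show ?thesis .
    qed
    thus ?thesis by (simp add: lessThan_Suc_atMost[symmetric])
  qed
  also have "(\<Sum>j\<le>n. w j * (real j * (real j + a + b + 1)) * p j x) - \<dots> = (\<Sum>j\<le>n. \<theta> a b (real n) * (w j * p j x))"
    unfolding sum_subtractf[symmetric] by (intro sum.cong refl) (simp add: \<theta>_def algebra_simps)
  finally have "DD (H n) = \<theta> a b (real n) * H n x"
    unfolding Hw sum_distrib_left[symmetric] by (simp only: mult_ac)
  thus ?thesis unfolding DD_def .
qed

lemma coeff_hahn: "degree (hp n) \<le> n"
  "coeff (hp n) n = (-1) ^ n * pochhammer (a + b + 1) (2 * n) / (pochhammer (2 + a + b + N) n * pochhammer (a + 1) n * fact n)" (is "_ = ?r")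
proof -
  let ?c = "\<lambda>j. pochhammer (N - real n + 1) (n - j) * pochhammer (a + b + 1) (j + n) /
         (pochhammer (2 + a + b + N) n * pochhammer (a + 1) j * fact (n - j) * fact j)"
  have h: "hp n = (\<Sum>j\<le>n. smult (?c j) (pochhammer [:0, - 1:] j))"
    by (simp add: hahn_def atLeast0AtMost)
  show "degree (hp n) \<le> n" unfolding h
    by (rule degree_sum_le) (auto intro!: order.trans[OF degree_smult_le] simp: degree_pochhammer_minus_X)
  have "coeff (hp n) n = (\<Sum>j\<le>n. ?c j * coeff (pochhammer [:0, - 1:] j) n)"
    unfolding h by (simp add: coeff_sum)
  also have "\<dots> = (\<Sum>j\<in>{n}. ?c j * coeff (pochhammer [:0, - 1:] j) n)"
    by (rule sum.mono_neutral_right) (auto simp: coeff_eq_0 degree_pochhammer_minus_X)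
  finally show "coeff (hp n) n = ?r" by (simp add: degree_pochhammer_minus_X mult_2)
qed

lemma degree_hahn: "degree (hp n) = n"
proof -
  have "coeff (hp n) n \<noteq> 0"
    using pos_ab pos_a pos_abN[of n] by (simp add: coeff_hahn add_ac)
  thus ?thesis using coeff_hahn(1)[of n] le_degree by (metis le_antisym)
qed

end

section \<open>The difference operator and its eigenfunctions\<close>

lemma pochhammer_shifted_add:
  "pochhammer (x - real i - real j + c) (i + j) = pochhammer (x - real i + c) i * pochhammer (x - real i - real j + c) j"
  using pochhammer_split[of "x - real i - real j + c" j i] by (simp add: algebra_simps)

lemma \<xi>_num_add: "\<xi>_num a b N t x (i + j) = \<xi>_num a b N t x i * \<xi>_num a b N t (x - real i) j"
  using pochhammer_shifted_add[of x i j "- N"] pochhammer_shifted_add[of x i j "b + 1"]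
  by (simp add: \<xi>_num_def power_add algebra_simps)

lemma \<xi>_den_add: "\<xi>_den a b N t x (i + j) = \<xi>_den a b N t x i * \<xi>_den a b N t (x - real i) j"
  using pochhammer_shifted_add[of x i j "a + b + N + 2"] pochhammer_shifted_add[of x i j "a + 1"]
  by (simp add: \<xi>_den_def algebra_simps)

text \<open>The cocycle rule behind all rearrangements of Casorati columns: when all windows are
  extended beyond a common end point, a row gains a factor that is the same in every column. With x
  / 0 = 0 it holds at poles too, since numerator and denominator are separately
  multiplicative.\<close>

lemma \<xi>_add: "\<xi> a b N t x (i + j) = \<xi> a b N t x i * \<xi> a b N t (x - real i) j"
  by (simp add: \<xi>_def \<xi>_num_add \<xi>_den_add)

lemma \<xi>_0 [simp]: "\<xi> a b N t x 0 = 1"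
  by (simp add: \<xi>_def \<xi>_num_def \<xi>_den_def)

lemma isCont_pochhammer: "isCont f x \<Longrightarrow> isCont (\<lambda>x. pochhammer (f x) n) (x :: real)" for f :: "real \<Rightarrow> real"
  by (induction n) (auto simp: pochhammer_Suc intro!: continuous_intros)

lemma isCont_\<xi>:
  assumes "\<xi>_den a b N t (x - c) j \<noteq> 0"
  shows "isCont (\<lambda>x. \<xi> a b N t (x - c) j) x"
proof -
  have "isCont (\<lambda>x. \<xi>_num a b N t (x - c) j) x" "isCont (\<lambda>x. \<xi>_den a b N t (x - c) j) x"
    unfolding \<xi>_num_def \<xi>_den_def
    by (cases "t = 1"; cases "t = 2"; cases "t = 3"; simp; intro continuous_intros isCont_pochhammer)+
  thus ?thesis unfolding \<xi>_def using assms by (intro continuous_intros) auto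
qed

lemma isCont_det:
  assumes "\<And>i j. i < n \<Longrightarrow> j < n \<Longrightarrow> isCont (\<lambda>x. f x i j) (x :: real)"
  shows "isCont (\<lambda>x. Determinant.det (mat n n (\<lambda>(i, j). f x i j :: real))) x"
proof -
  have "isCont (\<lambda>x. \<Sum>p | p permutes {0..<n}. of_int (sign p) * (\<Prod>i = 0..<n. f x i (p i))) x"
    using assms by (intro continuous_intros) (auto dest: permutes_in_image)
  also have "(\<lambda>x. \<Sum>p | p permutes {0..<n}. of_int (sign p) * (\<Prod>i = 0..<n. f x i (p i))) =
     (\<lambda>x. Determinant.det (mat n n (\<lambda>(i, j). f x i j :: real)))"
    by (auto simp: Determinant.det_def dest: permutes_in_image intro!: ext sum.cong prod.cong)
  finally show ?thesis .
qed

lemma cofinite_shift: "(MOST x. P x) \<Longrightarrow> (MOST x. P (x + c :: real))"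
  by (rule MOST_inj) (auto simp: inj_def)

lemma cofinite_reflect: "(MOST x. P x) \<Longrightarrow> (MOST x. P (c - x :: real))"
  by (rule MOST_inj) (auto simp: inj_def)

lemma cofinite_imp_at: "(MOST x. P x) \<Longrightarrow> eventually P (at (x :: real))"
proof -
  assume "MOST x. P x"
  hence f: "finite ({y. \<not> P y} - {x})" by (simp add: eventually_cofinite)
  hence "open (- ({y. \<not> P y} - {x}))" by (intro open_Compl finite_imp_closed f)
  moreover have "x \<in> - ({y. \<not> P y} - {x})" by simp
  ultimately show ?thesis unfolding eventually_at_topological by blast
qed

text \<open>The device that brings identities of rational functions, known off a finite set, to
  prescribed arguments such as integers.\<close>

lemma isCont_cofinite_eq:
  assumes "isCont f x" "isCont g x" "MOST y. f y = g y"
  shows "f (x::real) = (g x :: real)"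
proof -
  have "(f \<longlongrightarrow> f x) (at x)" "(g \<longlongrightarrow> g x) (at x)" using assms by (auto simp: isCont_def)
  moreover have "eventually (\<lambda>y. f y = g y) (at x)" using assms(3) by (rule cofinite_imp_at)
  ultimately have "(f \<longlongrightarrow> g x) (at x)" by (simp add: filterlim_cong)
  thus ?thesis using \<open>(f \<longlongrightarrow> f x) (at x)\<close> tendsto_unique trivial_limit_at by blast
qed

lemma poly_det: "A \<in> carrier_mat n n \<Longrightarrow> poly (Determinant.det A) x = Determinant.det (map_mat (\<lambda>p. poly p x) A)"
  for x :: real
proof -
  interpret comm_ring_hom "\<lambda>p. poly p x" by unfold_locales auto
  show ?thesis by simp
qed

lemma mat1_carrier [simp]: "mat1 n f \<in> carrier_mat n n" by (simp add: mat1_def)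

lemma mat1_index: "i < n \<Longrightarrow> j < n \<Longrightarrow> mat1 n f $$ (i, j) = f (Suc i) (Suc j)"
  by (simp add: mat1_def)

definition entry :: "real \<Rightarrow> real \<Rightarrow> real \<Rightarrow> (nat \<Rightarrow> nat set) \<Rightarrow> nat \<Rightarrow> real \<Rightarrow> nat \<Rightarrow> real" where
  "entry a b N U l x k = \<xi> a b N (row_t U l) x k * poly (Y_row a b N U l) (\<theta> a b x)"

lemma entry_add: "entry a b N U l x (i + k) = entry a b N U l x i * \<xi> a b N (row_t U l) (x - real i) k"
  by (simp add: entry_def \<xi>_add)

lemma entry_add_diff: "j \<le> s \<Longrightarrow> entry a b N U l (x - real j) ((s - j) + k) =
    entry a b N U l (x - real j) (s - j) * \<xi> a b N (row_t U l) (x - real s) k"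
  unfolding entry_add by (simp add: of_nat_diff)

definition casorati :: "real \<Rightarrow> real \<Rightarrow> real \<Rightarrow> (nat \<Rightarrow> nat set) \<Rightarrow> real \<Rightarrow> real mat" where
  "casorati a b N U x = mat1 (size_U U) (\<lambda>l j. entry a b N U l (x - real j) (size_U U - j))"

lemma casorati_carrier [simp]: "casorati a b N U x \<in> carrier_mat (size_U U) (size_U U)"
  by (simp add: casorati_def)

lemma casorati_index: "i < size_U U \<Longrightarrow> j < size_U U \<Longrightarrow>
   casorati a b N U x $$ (i, j) = entry a b N U (Suc i) (x - real (Suc j)) (size_U U - Suc j)"
  by (simp add: casorati_def mat1_index)

lemma \<Omega>_casorati: "\<Omega> a b N U x = Determinant.det (casorati a b N U x)"
  by (simp add: \<Omega>_def casorati_def entry_def Let_def)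

text \<open>Columns are counted from 0 and column \<open>j\<close> belongs to the point
  \<open>x - j\<close>. The matrix \<open>casorati\<close> has no column for \<open>x\<close>
  itself; its first column belongs to \<open>x - 1\<close>.\<close>

definition bordered :: "real \<Rightarrow> real \<Rightarrow> real \<Rightarrow> (nat \<Rightarrow> nat set) \<Rightarrow> (nat \<Rightarrow> real) \<Rightarrow> real \<Rightarrow> real mat" where
  "bordered a b N U f x = mat (Suc (size_U U)) (Suc (size_U U)) (\<lambda>(i, j).
     if i = 0 then f j else entry a b N U i (x - real j) (size_U U - j))"

definition bminor :: "real \<Rightarrow> real \<Rightarrow> real \<Rightarrow> (nat \<Rightarrow> nat set) \<Rightarrow> real \<Rightarrow> nat \<Rightarrow> real" where
  "bminor a b N U x j = Determinant.det (mat_delete (bordered a b N U (\<lambda>_. 0) x) 0 j)"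

lemma bordered_carrier [simp]: "bordered a b N U f x \<in> carrier_mat (Suc (size_U U)) (Suc (size_U U))"
  by (simp add: bordered_def)

lemma bminor_mat:
  "bminor a b N U x j = Determinant.det (mat (size_U U) (size_U U)
     (\<lambda>(i, k). let r = (if k < j then k else Suc k) in entry a b N U (Suc i) (x - real r) (size_U U - r)))"
  unfolding bminor_def by (rule arg_cong[where f = Determinant.det], rule eq_matI)
    (auto simp: mat_delete_def bordered_def)

lemma det_bordered: "Determinant.det (bordered a b N U f x) = (\<Sum>j\<le>size_U U. (-1) ^ j * f j * bminor a b N U x j)"
proof -
  have d: "mat_delete (bordered a b N U f x) 0 j = mat_delete (bordered a b N U (\<lambda>_. 0) x) 0 j" for j
    by (rule eq_matI) (auto simp: mat_delete_def bordered_def)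
  have "Determinant.det (bordered a b N U f x) =
     (\<Sum>j<Suc (size_U U). bordered a b N U f x $$ (0, j) * cofactor (bordered a b N U f x) 0 j)"
    by (rule laplace_expansion_row) auto
  also have "\<dots> = (\<Sum>j<Suc (size_U U). (-1) ^ j * f j * bminor a b N U x j)"
    by (intro sum.cong refl) (simp add: cofactor_def bminor_def d, simp add: bordered_def)
  finally show ?thesis by (simp add: lessThan_Suc_atMost)
qed

text \<open>Bordering with a copy of row \<open>l\<close> gives two equal rows; the relation is the
  expansion of this zero determinant along the border.\<close>

lemma bminor_relation:
  assumes "l \<in> {1..size_U U}"
  shows "(\<Sum>j\<le>size_U U. (-1) ^ j * bminor a b N U x j * entry a b N U l (x - real j) (size_U U - j)) = 0"
proof -
  let ?f = "\<lambda>j. entry a b N U l (x - real j) (size_U U - j)"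
  have "Determinant.det (bordered a b N U ?f x) = 0"
  proof (rule det_identical_rows[of _ "Suc (size_U U)" 0 l])
    show "row (bordered a b N U ?f x) 0 = row (bordered a b N U ?f x) l"
      using assms by (intro eq_vecI) (auto simp: bordered_def)
  qed (use assms in auto)
  thus ?thesis unfolding det_bordered by (simp add: mult_ac)
qed

lemma bminor_0: "bminor a b N U x 0 = \<Omega> a b N U x"
  unfolding bminor_mat \<Omega>_casorati casorati_def mat1_def
  by (rule arg_cong[where f = Determinant.det], rule eq_matI) auto

lemma isCont_bminor:
  assumes "\<And>l j. l \<in> {1..size_U U} \<Longrightarrow> j \<le> size_U U \<Longrightarrow> \<xi>_den a b N (row_t U l) (x - real j) (size_U U - j) \<noteq> 0"
  shows "isCont (\<lambda>x. bminor a b N U x j) x"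
  unfolding bminor_mat Let_def
proof (rule isCont_det)
  fix i k assume "i < size_U U" "k < size_U U"
  thus "isCont (\<lambda>x. entry a b N U (Suc i) (x - real (if k < j then k else Suc k)) (size_U U - (if k < j then k else Suc k))) x"
    unfolding entry_def \<theta>_def by (intro continuous_intros isCont_\<xi> assms) auto
qed

lemma poly_q_poly:
  "poly (q_poly a b N U n) x = (\<Sum>j\<le>size_U U. bminor a b N U (real n) j * poly (hahn a b N (int n - int j)) x)"
proof -
  let ?f = "\<lambda>j. (-1) ^ j * poly (hahn a b N (int n - int j)) x"
  have "poly (q_poly a b N U n) x = Determinant.det (bordered a b N U ?f (real n))"
    unfolding q_poly_def Let_def poly_det[OF mat1_carrier]
    by (rule arg_cong[where f = Determinant.det], rule eq_matI)
       (auto simp: mat1_def bordered_def entry_def poly_power)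
  also have "\<dots> = (\<Sum>j\<le>size_U U. bminor a b N U (real n) j * poly (hahn a b N (int n - int j)) x)"
    unfolding det_bordered
  proof (rule sum.cong[OF refl])
    fix j
    have "(-1) ^ j * ((-1) ^ j * p) * q = ((-1) ^ j * (-1) ^ j) * (q * p)" for p q :: real by (simp only: mult_ac)
    moreover have "(-1::real) ^ j * (-1) ^ j = 1" by (simp flip: power_mult_distrib)
    ultimately show "(-1) ^ j * ((-1) ^ j * poly (hahn a b N (int n - int j)) x) * bminor a b N U (real n) j =
      bminor a b N U (real n) j * poly (hahn a b N (int n - int j)) x" by simp
  qed
  finally show ?thesis .
qed

lemma q_poly_sum:
  "q_poly a b N U n = (\<Sum>j\<le>size_U U. smult (bminor a b N U (real n) j) (hahn a b N (int n - int j)))"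
  by (rule poly_eq_poly_eq_iff[THEN iffD1], rule ext) (simp add: poly_q_poly poly_sum)

text \<open>Column \<open>i\<close> of the Casorati matrix at \<open>y = x - s + i\<close> is replaced by a truncation of the linear
  relation between the columns at \<open>x, x - 1, \<dots>, x - m\<close>; by that relation the replacement is a
  combination of the columns at \<open>y\<close>, in which column \<open>i\<close> occurs only if \<open>i \<le> s\<close>.\<close>

lemma M_fun_truncated_relation:
  fixes a b N :: real and U :: "nat \<Rightarrow> nat set" and S :: "real \<Rightarrow> real" and x :: real
  defines "E \<equiv> \<lambda>l s x. (\<Sum>j<s. (-1) ^ j * bminor a b N U x j * entry a b N U l (x - real j) (s - j))"
  assumes s: "s \<in> {1..size_U U}"
  shows "(\<Sum>h=1..size_U U. M_fun a b N U S h (x - real s) * E h s x) =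
     - ((-1) ^ s) * bminor a b N U x s * (\<Sum>i=1..s. S (x - real s + real i) * \<Omega> a b N U (x - real s + real i))"
proof -
  define m where "m = size_U U"
  define B where "B = (\<lambda>j. (-1) ^ j * bminor a b N U x j)"
  define y where "y = (\<lambda>i. x - real s + real i)"
  define w where "w = (\<lambda>i l. \<xi> a b N (row_t U l) (x - real s) (m - i) * E l s x)"
  define C where "C = (\<lambda>i. casorati a b N U (y i))"
  let ?R = "\<lambda>i. replace_col (C i) (vec m (\<lambda>l. w i (Suc l))) (i - 1)"
  have C: "C i \<in> carrier_mat m m" for i by (simp add: C_def m_def)
  have Crep: "Determinant.det (?R i) =
      (if i \<le> s then - B s * \<Omega> a b N U (y i) else 0)" if i: "i \<in> {1..m}" for i
  proof -
    \<comment> \<open>Column \<open>r\<close> at \<open>y i\<close> is the point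
      \<open>x - j\<close> with \<open>j = r + 1 + s - i\<close>. For \<open>i > s\<close> the head
      \<open>j < s\<close> of the relation consists of such points. For \<open>i \<le> s\<close> it
      need not, and it is replaced by minus the tail \<open>j \<ge> s\<close>.\<close>
    define c where "c = vec m (\<lambda>r. if i \<le> s then (if r + 1 + s - i \<ge> s \<and> r + 1 + s - i \<le> m then - B (r + 1 + s - i) else 0)
        else (if r + 1 + s \<ge> i \<and> r + 1 < i then B (r + 1 + s - i) else 0))"
    have "C i *\<^sub>v c = vec m (\<lambda>l. w i (Suc l))"
    proof (rule eq_vecI)
      fix l assume "l < dim_vec (vec m (\<lambda>l. w i (Suc l)))"
      hence l: "l < m" by simp
      let ?e = "\<lambda>j. entry a b N U (Suc l) (x - real j)"
      have Ci: "C i $$ (l, r) = entry a b N U (Suc l) (y i - real (Suc r)) (m - Suc r)" if "r < m" for r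
        using l that by (simp add: C_def casorati_index m_def)
      have "(C i *\<^sub>v c) $ l = (\<Sum>r<m. C i $$ (l, r) * c $ r)"
        using l C[of i] by (auto simp: scalar_prod_def c_def lessThan_atLeast0 intro!: sum.cong)
      also have "\<dots> = w i (Suc l)"
      proof (cases "i \<le> s")
        case True
        have "(\<Sum>r<m. C i $$ (l, r) * c $ r) = (\<Sum>j=s..m. - B j * ?e j (m - j + (s - i)))"
        proof -
          have "(\<Sum>r<m. C i $$ (l, r) * c $ r) = (\<Sum>r\<in>{r. r < m \<and> r + 1 + s - i \<ge> s \<and> r + 1 + s - i \<le> m}. C i $$ (l, r) * c $ r)"
            using True by (intro sum.mono_neutral_right) (auto simp: c_def)
          also have "\<dots> = (\<Sum>j=s..m. - B j * ?e j (m - j + (s - i)))"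
          proof (rule sum.reindex_bij_witness[of _ "\<lambda>j. j + i - s - 1" "\<lambda>r. r + 1 + s - i"])
            fix r assume r: "r \<in> {r. r < m \<and> r + 1 + s - i \<ge> s \<and> r + 1 + s - i \<le> m}"
            have e1: "y i - real (Suc r) = x - real (r + 1 + s - i)" using True by (simp add: y_def of_nat_diff)
            have e2: "m - Suc r = m - (r + 1 + s - i) + (s - i)" using True r by auto
            have c: "c $ r = - B (r + 1 + s - i)" using r True by (auto simp: c_def)
            have "C i $$ (l, r) = ?e (r + 1 + s - i) (m - (r + 1 + s - i) + (s - i))"
              using Ci[of r] r unfolding e1 e2[symmetric] by simp
            thus "- B (r + 1 + s - i) * ?e (r + 1 + s - i) (m - (r + 1 + s - i) + (s - i)) = C i $$ (l, r) * c $ r"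
              unfolding c by (simp only: mult.commute)
          qed (use True i s in \<open>auto simp: m_def\<close>)
          finally show ?thesis .
        qed
        also have "\<dots> = - (\<Sum>j=s..m. B j * ?e j (m - j + (s - i)))"
          by (simp add: sum_negf)
        also have "\<dots> = (\<Sum>j<s. B j * ?e j (m - j + (s - i)))"
        proof -
          have "(\<Sum>j\<le>m. B j * ?e j (m - j + (s - i))) =
             (\<Sum>j\<le>m. B j * ?e j (m - j)) * \<xi> a b N (row_t U (Suc l)) (x - real m) (s - i)"
            unfolding sum_distrib_right
          proof (rule sum.cong[OF refl], goal_cases)
            case (1 j)
            hence "x - real j - real (m - j) = x - real m" by (simp add: of_nat_diff)
            thus ?case
              using entry_add[of a b N U "Suc l" "x - real j" "m - j" "s - i"] by simp
          qed
          also have "\<dots> = 0" using bminor_relation[of "Suc l" U a b N x] l by (simp add: B_def m_def)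
          finally have "(\<Sum>j\<le>m. B j * ?e j (m - j + (s - i))) = 0" .
          moreover have "{..m} = {..<s} \<union> {s..m}" using s by (auto simp: m_def)
          ultimately show ?thesis by (subst (asm) \<open>{..m} = _\<close>, subst (asm) sum.union_disjoint) auto
        qed
        also have "\<dots> = w i (Suc l)"
          unfolding w_def E_def sum_distrib_left
        proof (rule sum.cong[OF refl])
          fix j assume j: "j \<in> {..<s}"
          hence e1: "m - j + (s - i) = (s - j) + (m - i)" using True s i by (auto simp: m_def)
          have "x - real j - real (s - j) = x - real s" using j by (simp add: of_nat_diff)
          hence "?e j (m - j + (s - i)) = ?e j (s - j) * \<xi> a b N (row_t U (Suc l)) (x - real s) (m - i)"
            unfolding e1 entry_add by simp
          thus "B j * ?e j (m - j + (s - i)) =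
            \<xi> a b N (row_t U (Suc l)) (x - real s) (m - i) * ((-1) ^ j * bminor a b N U x j * ?e j (s - j))"
            by (simp add: B_def)
        qed
        finally show ?thesis .
      next
        case False
        have "(\<Sum>r<m. C i $$ (l, r) * c $ r) = (\<Sum>r\<in>{r. r + 1 + s \<ge> i \<and> r + 1 < i}. C i $$ (l, r) * c $ r)"
          using False i by (intro sum.mono_neutral_right) (auto simp: c_def)
        also have "\<dots> = (\<Sum>j<s. B j * ?e j ((s - j) + (m - i)))"
        proof (rule sum.reindex_bij_witness[of _ "\<lambda>j. j + i - s - 1" "\<lambda>r. r + 1 + s - i"])
          fix r assume r: "r \<in> {r. r + 1 + s \<ge> i \<and> r + 1 < i}"
          have e1: "y i - real (Suc r) = x - real (r + 1 + s - i)" using r by (simp add: y_def of_nat_diff)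
          have e2: "m - Suc r = (s - (r + 1 + s - i)) + (m - i)" using False r i by auto
          have "r < m" using r i by auto
          hence c: "c $ r = B (r + 1 + s - i)" using r False by (simp add: c_def)
          have "C i $$ (l, r) = ?e (r + 1 + s - i) ((s - (r + 1 + s - i)) + (m - i))"
            using Ci[of r] \<open>r < m\<close> unfolding e1 e2[symmetric] by simp
          thus "B (r + 1 + s - i) * ?e (r + 1 + s - i) ((s - (r + 1 + s - i)) + (m - i)) = C i $$ (l, r) * c $ r"
            unfolding c by (simp only: mult.commute)
        qed (use False i in auto)
        also have "\<dots> = w i (Suc l)"
          unfolding w_def E_def sum_distrib_left
          by (intro sum.cong refl) (subst entry_add_diff, auto simp: B_def)
        finally show ?thesis .
      qed
      finally show "(C i *\<^sub>v c) $ l = vec m (\<lambda>l. w i (Suc l)) $ l" using l by simp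
    qed (use C in auto)
    moreover have "c \<in> carrier_vec m" "i - 1 < m" using i by (auto simp: c_def)
    \<comment> \<open>Cramer's rule. The entry \<open>i - 1\<close> of \<open>c\<close> corresponds
      to \<open>j = s\<close>, which is the first index of the tail and just outside the
      head.\<close>
    ultimately have "Determinant.det (?R i) = c $ (i - 1) * Determinant.det (C i)"
      using cramer_lemma_mat[OF C[of i]] by metis
    thus ?thesis using i s by (auto simp: c_def C_def \<Omega>_casorati m_def)
  qed
  have expand: "Determinant.det (?R i) =
     (\<Sum>h=1..m. (-1) ^ (h + i) * w i h * Determinant.det (mat_delete (C i) (h - 1) (i - 1)))" if i: "i \<in> {1..m}" for i
  proof -
    have R: "?R i \<in> carrier_mat m m" using C[of i] by (simp add: replace_col_def)
    have "Determinant.det (?R i) = (\<Sum>l<m. ?R i $$ (l, i - 1) * cofactor (?R i) l (i - 1))"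
      by (rule laplace_expansion_column[OF R]) (use i in auto)
    also have "\<dots> = (\<Sum>l<m. (-1) ^ (Suc l + i) * w i (Suc l) * Determinant.det (mat_delete (C i) l (i - 1)))"
    proof (rule sum.cong[OF refl], goal_cases)
      case (1 l)
      hence l: "l < m" by simp
      have "mat_delete (?R i) l (i - 1) = mat_delete (C i) l (i - 1)"
        using l i C[of i] by (intro eq_matI) (auto simp: mat_delete_def replace_col_def)
      moreover have "?R i $$ (l, i - 1) = w i (Suc l)" using l i C[of i] by (auto simp: replace_col_def)
      moreover have "(-1::real) ^ (l + (i - 1)) = (-1) ^ (Suc l + i)" using i by (cases i) auto
      ultimately show ?case
        by (simp add: cofactor_def)
    qed
    also have "\<dots> = (\<Sum>h=1..m. (-1) ^ (h + i) * w i h * Determinant.det (mat_delete (C i) (h - 1) (i - 1)))"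
      by (rule sum.reindex_bij_witness[of _ "\<lambda>h. h - 1" Suc]) auto
    finally show ?thesis .
  qed
  have "(\<Sum>h=1..m. M_fun a b N U S h (x - real s) * E h s x) =
     (\<Sum>h=1..m. \<Sum>i=1..m. S (y i) * ((-1) ^ (h + i) * w i h * Determinant.det (mat_delete (C i) (h - 1) (i - 1))))"
    unfolding M_fun_def Let_def m_def[symmetric] sum_distrib_right
    by (intro sum.cong refl) (simp add: w_def y_def C_def casorati_def entry_def m_def mult_ac)
  also have "\<dots> = (\<Sum>i=1..m. S (y i) * Determinant.det (?R i))"
    by (subst sum.swap, intro sum.cong refl) (simp only: expand sum_distrib_left)
  also have "\<dots> = (\<Sum>i=1..m. if i \<le> s then - B s * (S (y i) * \<Omega> a b N U (y i)) else 0)"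
    by (intro sum.cong refl) (subst Crep, auto)
  also have "\<dots> = (\<Sum>i=1..s. - B s * (S (y i) * \<Omega> a b N U (y i)))"
  proof -
    have "{i \<in> {1..m}. i \<le> s} = {1..s}" using s by (auto simp: m_def)
    thus ?thesis by (simp add: sum.If_cases Int_def)
  qed
  finally show ?thesis by (simp add: sum_distrib_left B_def y_def m_def)
qed

section \<open>Action of the operator on the determinants \<open>q_poly\<close>\<close>

definition poly_linear :: "(real poly \<Rightarrow> real poly) \<Rightarrow> bool" where
  "poly_linear T \<longleftrightarrow> (\<forall>p q. T (p + q) = T p + T q) \<and> (\<forall>c p. T (smult c p) = smult c (T p))"

lemma poly_linear_0: "poly_linear T \<Longrightarrow> T 0 = 0"
  by (metis poly_linear_def smult_0_left)

lemma poly_linear_sum: "poly_linear T \<Longrightarrow> T (\<Sum>i\<in>A. f i) = (\<Sum>i\<in>A. T (f i))"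
  by (induction A rule: infinite_finite_induct) (auto simp: poly_linear_0 poly_linear_def)

lemma smult_sum_right: "smult c (\<Sum>i\<in>A. f i) = (\<Sum>i\<in>A. smult c (f i))"
  by (induction A rule: infinite_finite_induct) (auto simp: smult_add_right)

lemma poly_linear_funpow: "poly_linear T \<Longrightarrow> poly_linear (T ^^ i)"
  by (induction i) (auto simp: poly_linear_def)

lemma poly_linear_poly_op:
  assumes "poly_linear T"
  shows "poly_linear (poly_op Q T)"
proof -
  have "(T ^^ i) (p + q) = (T ^^ i) p + (T ^^ i) q" "(T ^^ i) (smult c p) = smult c ((T ^^ i) p)" for i p q c
    using poly_linear_funpow[OF assms] by (auto simp: poly_linear_def)
  thus ?thesis
    by (simp add: poly_linear_def poly_op_def smult_add_right sum.distrib smult_sum_right mult.commute)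
qed

lemma poly_op_eigen:
  assumes "poly_linear T" "T p = smult c p"
  shows "poly_op Q T p = smult (poly Q c) p"
proof -
  have "(T ^^ i) p = smult (c ^ i) p" for i
    using assms by (induction i) (auto simp: poly_linear_def mult.commute)
  thus ?thesis by (simp add: poly_op_def poly_altdef smult_sum)
qed

lemma poly_shift: "poly (shift l p) x = poly p (x + l)"
  by (simp add: shift_def poly_pcompose add.commute)

lemma poly_linear_shift: "poly_linear (shift l)"
  by (simp add: poly_linear_def shift_def pcompose_add pcompose_smult)

lemma poly_linear_hahn_op: "poly_linear (hahn_op a b N)"
  using poly_linear_shift by (simp add: poly_linear_def hahn_op_def algebra_simps smult_diff_right smult_add_right)

lemma poly_linear_cal_D: "poly_linear (cal_D a b N t)"
  using poly_linear_shift
  by (simp add: poly_linear_def cal_D_def bwd_diff_def fwd_diff_def algebra_simps smult_diff_right smult_add_right)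

lemma poly_cal_D:
  "poly (cal_D a b N t p) x = (a + b + 1) / 2 * poly p x + euler_op a b N t (poly p) x"
  by (simp add: cal_D_def euler_op_def bwd_diff_def fwd_diff_def poly_shift algebra_simps)

context hahn_params
begin

lemma hahn_op_hahn: "hahn_op a b N (hp n) = smult (\<theta> a b (real n)) (hp n)"
proof (rule poly_eq_poly_eq_iff[THEN iffD1], rule ext)
  fix x
  show "poly (hahn_op a b N (hp n)) x = poly (smult (\<theta> a b (real n)) (hp n)) x"
    using hahn_difference_equation[of x n] by (simp add: hahn_op_def poly_shift algebra_simps)
qed

text \<open>Unrolls \<open>hahn_structure\<close> down to index 0. Each step multiplies what was
  found before by minus one value of \<open>\<xi>\<close>, and the cocycle rule gathers these
  values.\<close>

lemma cal_D_hahn: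
  assumes t: "t \<in> {1, 2, 3, 4}"
  shows "cal_D a b N t (hp n) = smult (- \<sigma> a b (real n + 1) / 2) (hp n) +
     (\<Sum>i=1..n. smult ((-1) ^ (i + 1) * \<sigma> a b (real n - real i + 1) * \<xi> a b N t (real n) i) (hp (n - i)))"
proof (induction n)
  case 0
  have "hp 0 = 1" by (simp add: hahn_def)
  thus ?case
    by (intro poly_eq_poly_eq_iff[THEN iffD1] ext) (simp add: poly_cal_D euler_op_def \<sigma>_def)
next
  case (Suc n)
  let ?e = "\<xi> a b N t (real (Suc n)) 1"
  let ?g = "\<lambda>n i. (-1) ^ (i + 1) * \<sigma> a b (real n - real i + 1) * \<xi> a b N t (real n) i"
  have "cal_D a b N t (hp (Suc n)) = smult (- \<sigma> a b (real (Suc n) + 1) / 2) (hp (Suc n))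
     + smult (- ?e) (cal_D a b N t (hp n) - smult (\<sigma> a b (real n + 1) / 2) (hp n))"
  proof (rule poly_eq_poly_eq_iff[THEN iffD1], rule ext)
    fix x
    define d where "d = (a + b + 1) / 2"
    have d: "(a + b + 1) / 2 = d" "a + b + 1 = 2 * d" by (simp_all add: d_def)
    have "\<sigma> a b (real k + 1) = - (2 * real k + (a + b + 1))" for k by (simp add: \<sigma>_def)
    hence "\<sigma> a b (real k + 1) = 2 * - (real k + d)" for k unfolding d(2) by (simp only: distrib_left mult_minus_right)
    hence \<sigma>: "\<sigma> a b (real k + 1) / 2 = - (real k + d)" for k by (simp only: nonzero_mult_div_cancel_left)
    have \<sigma>': "- \<sigma> a b (real k + 1) / 2 = real k + d" for k unfolding minus_divide_left[symmetric] \<sigma> by simp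
    have "d * y' + e' = (k' + d) * y' + - \<xi> * (d * y + e - - (k + d) * y)" if "e' - k' * y' = - \<xi> * (e + (k + 2 * d) * y)" for y y' e e' k k' \<xi>
    proof -
      have "d * y + e - - (k + d) * y = e + (k + 2 * d) * y" by (simp add: algebra_simps)
      moreover have "d * y' + e' = (k' + d) * y' + (e' - k' * y')" by (simp add: algebra_simps)
      ultimately show ?thesis using that by simp
    qed
    from this[OF hahn_structure[OF t, of n x, unfolded d]]
    show "poly (cal_D a b N t (hp (Suc n))) x = poly (smult (- \<sigma> a b (real (Suc n) + 1) / 2) (hp (Suc n))
     + smult (- ?e) (cal_D a b N t (hp n) - smult (\<sigma> a b (real n + 1) / 2) (hp n))) x"
      unfolding poly_add poly_smult poly_diff poly_cal_D d(1) \<sigma> \<sigma>' .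
  qed
  \<comment> \<open>Subtracting another half turns the diagonal term into the term
    \<open>i = 0\<close> of the same sum, so that one more step is a mere shift of the
    index.\<close>
  also have "cal_D a b N t (hp n) - smult (\<sigma> a b (real n + 1) / 2) (hp n) = (\<Sum>i\<le>n. smult (?g n i) (hp (n - i)))"
  proof -
    have "(\<Sum>i\<le>n. smult (?g n i) (hp (n - i))) = smult (?g n 0) (hp n) + (\<Sum>i=1..n. smult (?g n i) (hp (n - i)))"
      by (simp add: sum.atMost_shift sum.shift_bounds_cl_Suc_ivl flip: atLeast0AtMost)
         (simp add: sum.atLeast_Suc_atMost)
    also have "smult (?g n 0) (hp n) = smult (- \<sigma> a b (real n + 1) / 2) (hp n) - smult (\<sigma> a b (real n + 1) / 2) (hp n)"
      by (simp only: smult_diff_left[symmetric]) simp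
    finally show ?thesis unfolding Suc.IH by simp
  qed
  also have "smult (- ?e) (\<Sum>i\<le>n. smult (?g n i) (hp (n - i))) = (\<Sum>i=1..Suc n. smult (?g (Suc n) i) (hp (Suc n - i)))"
    unfolding smult_sum_right
  proof (rule sum.reindex_bij_witness[of _ "\<lambda>i. i - 1" Suc])
    fix i assume "i \<in> {..n}"
    have "\<xi> a b N t (real (Suc n)) (Suc i) = ?e * \<xi> a b N t (real n) i"
      using \<xi>_add[of a b N t "real (Suc n)" 1 i] by simp
    thus "smult (?g (Suc n) (Suc i)) (hp (Suc n - Suc i)) = smult (- ?e) (smult (?g n i) (hp (n - i)))"
      by (simp add: mult_ac)
  qed auto
  finally show ?case .
qed

text \<open>On h_k the operator is \<open>lam k\<close> plus lower terms with coefficients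
  \<open>G\<close>. In the image of q_n the coefficient of h_(n-s) collects the truncated relation,
  which \<open>M_fun_truncated_relation\<close> evaluates by values of \<open>S * \<Omega>\<close>.
  They telescope to \<open>lam n - lam (n - s)\<close>, exactly what turns the diagonal value
  \<open>lam (n - s)\<close> into \<open>lam n\<close>.\<close>

lemma constructed_op_eigen:
  fixes U :: "nat \<Rightarrow> nat set" and S :: "real \<Rightarrow> real" and lam P :: "real poly" and Mt :: "nat \<Rightarrow> real poly" and n :: nat
  defines "m \<equiv> size_U U"
  assumes lam: "MOST x. poly lam x - poly lam (x - 1) = S x * \<Omega> a b N U x"
    and M: "\<forall>h\<in>{1..m}. MOST x. M_fun a b N U S h x = \<sigma> a b (x + 1) * poly (Mt h) (\<theta> a b x)"
    and P: "MOST x. poly P (\<theta> a b x) = 2 * poly lam x +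
           (\<Sum>h = 1..m. poly (Y_row a b N U h) (\<theta> a b x) * M_fun a b N U S h x)"
    and D: "D = (\<lambda>p. smult (1 / 2) (poly_op P (hahn_op a b N) p) +
           (\<Sum>h = 1..m. poly_op (Mt h) (hahn_op a b N)
                (cal_D a b N (row_t U h) (poly_op (Y_row a b N U h) (hahn_op a b N) p))))"
    and den: "\<And>l j. l \<in> {1..m} \<Longrightarrow> j \<le> m \<Longrightarrow> \<xi>_den a b N (row_t U l) (real n - real j) (m - j) \<noteq> 0"
    and rt: "\<And>l. l \<in> {1..m} \<Longrightarrow> row_t U l \<in> {1, 2, 3, 4}"
  shows "D (q_poly a b N U n) = smult (poly lam (real n)) (q_poly a b N U n)"
proof -
  let ?T = "hahn_op a b N" and ?E = "\<lambda>h s x. \<Sum>j<s. (-1) ^ j * bminor a b N U x j * entry a b N U h (x - real j) (s - j)"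
  define Mp where "Mp = (\<lambda>h x. \<sigma> a b (x + 1) * poly (Mt h) (\<theta> a b x))"
  define B where "B = (\<lambda>j. bminor a b N U (real n) j)"
  define Y where "Y = (\<lambda>h x. poly (Y_row a b N U h) (\<theta> a b x))"
  define X where "X = (\<lambda>h x k. \<xi> a b N (row_t U h) x k)"
  have contMp: "isCont (Mp h) x" for h x
    unfolding Mp_def \<sigma>_def \<theta>_def by (intro continuous_intros)
  have contY: "isCont (Y h) x" for h x
    unfolding Y_def \<theta>_def by (intro continuous_intros)
  have Mfin: "MOST x. \<forall>h\<in>{1..m}. M_fun a b N U S h x = Mp h x"
    using M by (simp add: eventually_ball_finite_distrib Mp_def)
  \<comment> \<open>Together with the diagonal terms \<open>- Y * Mp / 2\<close> of the summands,
    half of this leaves exactly \<open>lam\<close> on the diagonal.\<close>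
  have Pall: "poly P (\<theta> a b x) = 2 * poly lam x + (\<Sum>h = 1..m. Y h x * Mp h x)" for x
  proof (rule isCont_cofinite_eq[where f = "\<lambda>x. poly P (\<theta> a b x)" and x = x and g = "\<lambda>x. 2 * poly lam x + (\<Sum>h = 1..m. Y h x * Mp h x)"])
    show "isCont (\<lambda>x. poly P (\<theta> a b x)) x" unfolding \<theta>_def by (intro continuous_intros)
    show "isCont (\<lambda>x. 2 * poly lam x + (\<Sum>h = 1..m. Y h x * Mp h x)) x"
      by (intro continuous_intros contMp contY)
    show "MOST x. poly P (\<theta> a b x) = 2 * poly lam x + (\<Sum>h = 1..m. Y h x * Mp h x)"
      using P Mfin by eventually_elim (simp add: Y_def)
  qed
  \<comment> \<open>Proved for all but finitely many \<open>x\<close> and transferred to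
    \<open>n\<close>: the minors and entries are continuous there because the denominators do not
    vanish.\<close>
  have key: "(\<Sum>h=1..m. Mp h (real n - real s) * (\<Sum>j<s. (-1) ^ j * B j * entry a b N U h (real n - real j) (s - j))) =
     - ((-1) ^ s) * B s * (poly lam (real n) - poly lam (real n - real s))" if s: "s \<in> {1..m}" for s
    unfolding B_def
  proof (rule isCont_cofinite_eq[where f = "\<lambda>x. \<Sum>h=1..m. Mp h (x - real s) * ?E h s x" and x = "real n"
     and g = "\<lambda>x. - ((-1) ^ s) * bminor a b N U x s * (poly lam x - poly lam (x - real s))"])
    have dens: "\<xi>_den a b N (row_t U l) (real n - real j) (s - j) \<noteq> 0" if "l \<in> {1..m}" "j < s" for l j
    proof -
      have e: "m - j = (s - j) + (m - s)" using that s by auto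
      have "\<xi>_den a b N (row_t U l) (real n - real j) (m - j) \<noteq> 0" using that s by (intro den) auto
      thus ?thesis unfolding e \<xi>_den_add by simp
    qed
    have contB: "isCont (\<lambda>x. bminor a b N U x j) (real n)" for j
      by (rule isCont_bminor) (use den in \<open>simp add: m_def\<close>)
    show "isCont (\<lambda>x. \<Sum>h=1..m. Mp h (x - real s) * ?E h s x) (real n)"
      unfolding entry_def \<theta>_def
      by (intro continuous_intros contB isCont_\<xi> isCont_o2[OF _ contMp]) (use dens in auto)
    show "isCont (\<lambda>x. - ((-1) ^ s) * bminor a b N U x s * (poly lam x - poly lam (x - real s))) (real n)"
      by (intro continuous_intros contB)
    have tl: "(\<Sum>i=1..k. f i - f (i - 1)) = f k - f (0::nat)" for f :: "nat \<Rightarrow> real" and k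
      by (induction k) auto
    have 1: "MOST x. \<forall>h\<in>{1..m}. M_fun a b N U S h (x - real s) = Mp h (x - real s)"
      using cofinite_shift[OF Mfin, of "- real s"] by simp
    have 2: "MOST x. \<forall>i\<in>{1..s}. S (x - real s + real i) * \<Omega> a b N U (x - real s + real i) =
        poly lam (x - real s + real i) - poly lam (x - real s + real i - 1)"
    proof -
      have "MOST x. S (x - real s + real i) * \<Omega> a b N U (x - real s + real i) =
        poly lam (x - real s + real i) - poly lam (x - real s + real i - 1)" for i
        by (rule eventually_mono[OF cofinite_shift[OF lam, of "- real s + real i"]]) (simp add: algebra_simps)
      thus ?thesis by (simp add: eventually_ball_finite_distrib)
    qed
    show "MOST x. (\<Sum>h=1..m. Mp h (x - real s) * ?E h s x) =
      - ((-1) ^ s) * bminor a b N U x s * (poly lam x - poly lam (x - real s))"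
      using 1 2
    proof eventually_elim
      case (elim x)
      have "(\<Sum>i=1..s. S (x - real s + real i) * \<Omega> a b N U (x - real s + real i)) =
         (\<Sum>i=1..s. poly lam (x - real s + real i) - poly lam (x - real s + real (i - 1)))"
        using elim(2) by (intro sum.cong refl) (auto simp: of_nat_diff algebra_simps)
      also have "\<dots> = poly lam (x - real s + real s) - poly lam (x - real s + real 0)"
        using tl[of "\<lambda>i. poly lam (x - real s + real i)" s] by simp
      finally have tel: "(\<Sum>i=1..s. S (x - real s + real i) * \<Omega> a b N U (x - real s + real i)) = poly lam x - poly lam (x - real s)" by simp
      have "(\<Sum>h=1..m. Mp h (x - real s) * ?E h s x) =
        (\<Sum>h=1..m. M_fun a b N U S h (x - real s) * ?E h s x)"
        using elim(1) by (intro sum.cong refl) simp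
      also have "\<dots> = - ((-1) ^ s) * bminor a b N U x s * (poly lam x - poly lam (x - real s))"
        using M_fun_truncated_relation[of s U a b N S x] s unfolding m_def tel by simp
      finally show ?case .
    qed
  qed
  \<comment> \<open>For \<open>s > m\<close> nothing is truncated: the full relation appears, times
    a factor common to its terms.\<close>
  have high: "(\<Sum>j\<le>m. (-1) ^ j * B j * entry a b N U h (real n - real j) (s - j)) = 0" if "s > m" "h \<in> {1..m}" for s h
  proof -
    have "(\<Sum>j\<le>m. (-1) ^ j * B j * entry a b N U h (real n - real j) (s - j)) =
      (\<Sum>j\<le>m. (-1) ^ j * B j * entry a b N U h (real n - real j) (m - j)) * X h (real n - real m) (s - m)"
      unfolding sum_distrib_right
    proof (rule sum.cong[OF refl], goal_cases)
      case (1 j)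
      hence j: "j \<le> m" by simp
      hence e: "s - j = (m - j) + (s - m)" using that by auto
      show ?case
        unfolding e entry_add_diff[OF j] X_def by (simp only: mult.assoc)
    qed
    also have "\<dots> = 0" using bminor_relation[of h U a b N "real n"] that by (simp add: B_def m_def)
    finally show ?thesis .
  qed
  define G where "G = (\<lambda>k i. (-1) ^ (i + 1) * (\<Sum>h=1..m. Mp h (real k - real i) * X h (real k) i * Y h (real k)))"
  let ?r = "\<lambda>k h i. smult ((-1) ^ (i + 1) * (Mp h (real k - real i) * X h (real k) i * Y h (real k))) (hp (k - i))"
  have linD: "poly_linear D"
    unfolding D
    using poly_linear_poly_op[OF poly_linear_hahn_op] poly_linear_cal_D[of a b N]
    by (simp add: poly_linear_def smult_add_right sum.distrib smult_sum_right mult.commute)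
  have Dh: "D (hp k) = smult (poly lam (real k)) (hp k) + (\<Sum>i=1..k. smult (G k i) (hp (k - i)))" for k
  proof -
    have pe: "poly_op Q ?T (hp j) = smult (poly Q (\<theta> a b (real j))) (hp j)" for Q j
      by (rule poly_op_eigen[OF poly_linear_hahn_op hahn_op_hahn])
    have lin: "poly_linear (poly_op Q ?T)" for Q by (rule poly_linear_poly_op[OF poly_linear_hahn_op])
    have one: "poly_op (Mt h) ?T (cal_D a b N (row_t U h) (smult (Y h (real k)) (hp k))) =
       smult (- (Y h (real k) * Mp h (real k)) / 2) (hp k) +
       (\<Sum>i=1..k. ?r k h i)"
      if h: "h \<in> {1..m}" for h
    proof -
      have "cal_D a b N (row_t U h) (smult (Y h (real k)) (hp k)) = smult (Y h (real k)) (smult (- \<sigma> a b (real k + 1) / 2) (hp k) +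
     (\<Sum>i=1..k. smult ((-1) ^ (i + 1) * \<sigma> a b (real k - real i + 1) * X h (real k) i) (hp (k - i))))"
        using poly_linear_cal_D[of a b N "row_t U h"] unfolding X_def cal_D_hahn[OF rt[OF h], symmetric] by (simp add: poly_linear_def)
      note cD = this
      have la: "poly_op (Mt h) ?T (p + q) = poly_op (Mt h) ?T p + poly_op (Mt h) ?T q"
        and ls: "poly_op (Mt h) ?T (smult c p) = smult c (poly_op (Mt h) ?T p)" for p q c
        using lin[of "Mt h"] by (auto simp: poly_linear_def)
      have "poly_op (Mt h) ?T (cal_D a b N (row_t U h) (smult (Y h (real k)) (hp k))) =
        smult (Y h (real k)) (smult (- \<sigma> a b (real k + 1) / 2) (smult (poly (Mt h) (\<theta> a b (real k))) (hp k)) +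
     (\<Sum>i=1..k. smult ((-1) ^ (i + 1) * \<sigma> a b (real k - real i + 1) * X h (real k) i) (smult (poly (Mt h) (\<theta> a b (real (k - i)))) (hp (k - i)))))"
        unfolding cD la ls poly_linear_sum[OF lin] pe ..
      also have "\<dots> = smult (- (Y h (real k) * Mp h (real k)) / 2) (hp k) +
       (\<Sum>i=1..k. ?r k h i)"
        unfolding smult_add_right smult_sum_right smult_smult
        by (intro arg_cong2[where f = "(+)"] sum.cong refl arg_cong2[where f = smult])
           (auto simp: Mp_def of_nat_diff)
      finally show ?thesis .
    qed
    have "D (hp k) = smult (poly P (\<theta> a b (real k)) / 2) (hp k) + (\<Sum>h = 1..m. poly_op (Mt h) ?T
                (cal_D a b N (row_t U h) (smult (Y h (real k)) (hp k))))"
      unfolding D by (simp add: pe Y_def)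
    also have "\<dots> = smult (poly P (\<theta> a b (real k)) / 2) (hp k) + (\<Sum>h = 1..m. smult (- (Y h (real k) * Mp h (real k)) / 2) (hp k)) +
       (\<Sum>h = 1..m. \<Sum>i=1..k. ?r k h i)"
      unfolding add.assoc sum.distrib[symmetric]
      by (rule arg_cong2[where f = "(+)", OF refl sum.cong[OF refl one]])
    also have "(\<Sum>h = 1..m. \<Sum>i=1..k. ?r k h i)
       = (\<Sum>i=1..k. smult (G k i) (hp (k - i)))"
      by (subst sum.swap) (simp add: G_def smult_sum sum_distrib_left)
    also have "smult (poly P (\<theta> a b (real k)) / 2) (hp k) + (\<Sum>h = 1..m. smult (- (Y h (real k) * Mp h (real k)) / 2) (hp k)) =
       smult (poly lam (real k)) (hp k)"
      unfolding smult_sum[symmetric] smult_add_left[symmetric] Pall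
      by (simp add: sum_negf sum_divide_distrib[symmetric] add_divide_distrib)
    finally show ?thesis .
  qed
  let ?v = "\<lambda>s. if s \<le> m then B s * (poly lam (real n) - poly lam (real n - real s)) else 0"
  define J where "J = {j. j \<le> m \<and> j \<le> n}"
  have fJ: "finite J" by (simp add: J_def)
  \<comment> \<open>\<open>J\<close> drops the columns with negative index, where
    \<open>hahn\<close> is 0.\<close>
  have q: "q_poly a b N U n = (\<Sum>j\<in>J. smult (B j) (hp (n - j)))"
  proof -
    have "q_poly a b N U n = (\<Sum>j\<in>J. smult (B j) (hahn a b N (int n - int j)))"
      unfolding q_poly_sum m_def[symmetric] B_def J_def
      by (rule sum.mono_neutral_right) (auto simp: hahn_def)
    thus ?thesis by (auto simp: J_def of_nat_diff intro!: sum.cong)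
  qed
  have "D (q_poly a b N U n) = (\<Sum>j\<in>J. smult (B j * poly lam (real (n - j))) (hp (n - j))) +
     (\<Sum>j\<in>J. \<Sum>i=1..n-j. smult (B j * G (n - j) i) (hp (n - j - i)))"
  proof -
    have "D (q_poly a b N U n) = (\<Sum>j\<in>J. smult (B j) (D (hp (n - j))))"
      using linD unfolding q by (simp add: poly_linear_sum) (simp add: poly_linear_def)
    thus ?thesis unfolding Dh smult_add_right smult_sum_right smult_smult sum.distrib .
  qed
  also have "(\<Sum>j\<in>J. \<Sum>i=1..n-j. smult (B j * G (n - j) i) (hp (n - j - i))) =
      (\<Sum>j\<in>J. \<Sum>s\<in>{s\<in>{1..n}. j < s}. smult (B j * G (n - j) (s - j)) (hp (n - s)))"
  proof (rule sum.cong[OF refl], goal_cases)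
    case j: (1 j)
    show ?case
      by (rule sum.reindex_bij_witness[of _ "\<lambda>s. s - j" "\<lambda>i. i + j"]) (use j in \<open>auto simp: J_def add.commute\<close>)
  qed
  also have "\<dots> = (\<Sum>s\<in>{1..n}. \<Sum>j\<in>{j\<in>J. j < s}. smult (B j * G (n - j) (s - j)) (hp (n - s)))"
    by (rule sum.swap_restrict) (auto simp: fJ)
  also have "\<dots> = (\<Sum>s\<in>{1..n}. smult (?v s) (hp (n - s)))"
  proof (rule sum.cong[OF refl], goal_cases)
    case s: (1 s)
    have "(\<Sum>j\<in>{j\<in>J. j < s}. B j * G (n - j) (s - j)) =
      (-1) ^ (s + 1) * (\<Sum>h=1..m. Mp h (real n - real s) * (\<Sum>j\<in>{j\<in>J. j < s}. (-1) ^ j * B j * entry a b N U h (real n - real j) (s - j)))"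
    proof -
      have "(\<Sum>j\<in>{j\<in>J. j < s}. B j * G (n - j) (s - j)) = (\<Sum>j\<in>{j\<in>J. j < s}. \<Sum>h=1..m.
         (-1) ^ (s + 1) * (Mp h (real n - real s) * ((-1) ^ j * B j * entry a b N U h (real n - real j) (s - j))))"
        unfolding G_def sum_distrib_left
      proof (intro sum.cong refl, goal_cases)
        case (1 j h)
        hence j: "j < s" "j \<le> n" by (auto simp: J_def)
        have "(-1::real) ^ (s - j + 1) = (-1) ^ (s + 1) * (-1) ^ j"
          using j minus_one_power_diff[of j s] by simp
        moreover have "real (n - j) - real (s - j) = real n - real s" "real (n - j) = real n - real j" using j by (auto simp: of_nat_diff)
        ultimately show ?case by (simp add: entry_def X_def Y_def)
      qed
      thus ?thesis by (subst (asm) sum.swap) (simp add: sum_distrib_left)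
    qed
    also have "\<dots> = ?v s"
    proof (cases "s \<le> m")
      case True
      have "{j \<in> J. j < s} = {..<s}" using True s by (auto simp: J_def)
      moreover have "(-1) ^ (s + 1) * (- ((-1) ^ s) * B s * v) = B s * v" for v
        by (simp add: mult.assoc[symmetric] flip: power_mult_distrib)
      ultimately show ?thesis using True s key[of s] by simp
    next
      case False
      have "{j \<in> J. j < s} = {..m}" using False s by (auto simp: J_def)
      thus ?thesis using False high[of s] by simp
    qed
    finally show ?case
      by (simp only: smult_sum[symmetric])
  qed
  also have "\<dots> = (\<Sum>s\<in>J. smult (B s * (poly lam (real n) - poly lam (real n - real s))) (hp (n - s)))"
  proof -
    have "(\<Sum>s\<in>{1..n}. smult (?v s) (hp (n - s))) =
       (\<Sum>s\<le>n. smult (?v s) (hp (n - s)))"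
      by (rule sum.mono_neutral_left) (auto simp: Suc_le_eq)
    also have "\<dots> = (\<Sum>s\<in>J. smult (?v s) (hp (n - s)))"
      by (rule sum.mono_neutral_right) (auto simp: J_def)
    finally show ?thesis by (auto simp: J_def intro!: sum.cong)
  qed
  also have "(\<Sum>j\<in>J. smult (B j * poly lam (real (n - j))) (hp (n - j))) + \<dots> = (\<Sum>j\<in>J. smult (poly lam (real n)) (smult (B j) (hp (n - j))))"
    unfolding sum.distrib[symmetric] smult_add_left[symmetric] smult_smult
    by (intro sum.cong refl) (auto simp: J_def of_nat_diff algebra_simps)
  also have "\<dots> = smult (poly lam (real n)) (q_poly a b N U n)" unfolding q smult_sum_right ..
  finally show ?thesis .
qed

end

section \<open>The order of the difference operator\<close>

lemma coeff_mult_top: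
  assumes "degree p \<le> d" "degree q \<le> e"
  shows "coeff (p * q) (d + e) = coeff p d * coeff q e"
proof -
  have "coeff (p * q) (d + e) = (\<Sum>i\<le>d + e. coeff p i * coeff q (d + e - i))" by (simp add: coeff_mult)
  also have "\<dots> = (\<Sum>i\<in>{d}. coeff p i * coeff q (d + e - i))"
  proof (rule sum.mono_neutral_right, simp, simp, rule ballI)
    fix i assume "i \<in> {..d + e} - {d}"
    hence "i > d \<or> d + e - i > e" by auto
    thus "coeff p i * coeff q (d + e - i) = 0" using assms by (auto simp: coeff_eq_0)
  qed
  finally show ?thesis by simp
qed

lemma degree_shift [simp]: "degree (shift l p) = degree p"
  by (simp add: shift_def degree_pcompose)

lemma coeff_shift_top:
  assumes "degree p \<le> d"
  shows "coeff (shift l p) d = coeff p d"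
proof (cases "degree p = d")
  case True
  thus ?thesis using lead_coeff_comp[of "[:l, 1:]" p] by (simp add: shift_def degree_pcompose)
next
  case False
  thus ?thesis using assms by (simp add: coeff_eq_0)
qed

lemma shift_0 [simp]: "shift 0 p = p"
  by (simp add: shift_def)

lemma shift_shift: "shift l (shift k p) = shift (l + k) p"
  by (rule poly_eq_poly_eq_iff[THEN iffD1]) (simp add: fun_eq_iff poly_shift add.assoc)

lemma shift_mult: "shift l (p * q) = shift l p * shift l q"
  by (simp add: shift_def pcompose_mult)

text \<open>Only the two extreme coefficients are recorded: a bound \<open>d\<close> for their
  degrees and their coefficients at x^d. These may be 0, so an operator of smaller order or degree
  also belongs to a larger class, with \<open>c = e = 0\<close>.\<close>

definition dop_coeffs :: "nat \<Rightarrow> nat \<Rightarrow> real \<Rightarrow> real \<Rightarrow> (real poly \<Rightarrow> real poly) \<Rightarrow> (int \<Rightarrow> real poly) \<Rightarrow> bool" where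
  "dop_coeffs k d c e T g \<longleftrightarrow> T = (\<lambda>p. \<Sum>l=-int k..int k. g l * shift (of_int l) p) \<and>
     degree (g (int k)) \<le> d \<and> degree (g (- int k)) \<le> d \<and> coeff (g (int k)) d = c \<and> coeff (g (- int k)) d = e"

definition dop :: "nat \<Rightarrow> nat \<Rightarrow> real \<Rightarrow> real \<Rightarrow> (real poly \<Rightarrow> real poly) \<Rightarrow> bool" where
  "dop k d c e T \<longleftrightarrow> (\<exists>g. dop_coeffs k d c e T g)"

lemma dop_coeffsD:
  assumes "dop_coeffs k d c e T g"
  shows "T = (\<lambda>p. \<Sum>l=-int k..int k. g l * shift (of_int l) p)" "degree (g (int k)) \<le> d"
    "degree (g (- int k)) \<le> d" "coeff (g (int k)) d = c" "coeff (g (- int k)) d = e"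
  using assms by (auto simp: dop_coeffs_def)

lemma dop_id: "dop 0 0 1 1 (\<lambda>p. p)"
  unfolding dop_def dop_coeffs_def by (rule exI[of _ "\<lambda>_. 1"]) simp

lemma dop_zero: "dop k d 0 0 (\<lambda>p. 0)"
  unfolding dop_def dop_coeffs_def by (rule exI[of _ "\<lambda>_. 0"]) simp

lemma dop_add:
  assumes "dop k d c e T" "dop k d c' e' T'"
  shows "dop k d (c + c') (e + e') (\<lambda>p. T p + T' p)"
proof -
  obtain g where "dop_coeffs k d c e T g" using assms(1) unfolding dop_def by blast
  note g = dop_coeffsD[OF this]
  obtain g' where "dop_coeffs k d c' e' T' g'" using assms(2) unfolding dop_def by blast
  note g' = dop_coeffsD[OF this]
  show ?thesis unfolding dop_def dop_coeffs_def
    using g g' by (intro exI[of _ "\<lambda>l. g l + g' l"]) (auto simp: sum.distrib algebra_simps intro!: degree_add_le)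
qed

lemma dop_smult:
  assumes "dop k d c e T"
  shows "dop k d (s * c) (s * e) (\<lambda>p. smult s (T p))"
proof -
  obtain g where "dop_coeffs k d c e T g" using assms unfolding dop_def by blast
  note g = dop_coeffsD[OF this]
  show ?thesis unfolding dop_def dop_coeffs_def
    using g by (intro exI[of _ "\<lambda>l. smult s (g l)"])
      (auto simp: smult_sum_right intro!: order.trans[OF degree_smult_le])
qed

lemma dop_sum:
  assumes "\<And>h. h \<in> A \<Longrightarrow> dop k d (c h) (e h) (T h)"
  shows "dop k d (\<Sum>h\<in>A. c h) (\<Sum>h\<in>A. e h) (\<lambda>p. \<Sum>h\<in>A. T h p)"
  using assms by (induction A rule: infinite_finite_induct) (auto intro!: dop_add dop_zero)

lemma dop_less_order:
  assumes "dop k d c e T" "k < k'"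
  shows "dop k' d' 0 0 T"
proof -
  obtain g where "dop_coeffs k d c e T g" using assms(1) unfolding dop_def by blast
  note g = dop_coeffsD(1)[OF this]
  show ?thesis unfolding dop_def dop_coeffs_def
  proof (intro exI[of _ "\<lambda>l. if l \<in> {-int k..int k} then g l else 0"] conjI ext)
    fix p show "T p = (\<Sum>l=-int k'..int k'. (if l \<in> {-int k..int k} then g l else 0) * shift (of_int l) p)"
      unfolding g using assms(2) by (intro sum.mono_neutral_cong_left) auto
  qed (use assms(2) in auto)
qed

lemma dop_less_degree: "dop k d c e T \<Longrightarrow> d < d' \<Longrightarrow> dop k d' 0 0 T"
  unfolding dop_def dop_coeffs_def by (elim exE) (rule_tac x=g in exI, auto simp: coeff_eq_0)

lemma dop_comp:
  assumes "dop k d c e T" "dop k' d' c' e' T'"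
  shows "dop (k + k') (d + d') (c * c') (e * e') (\<lambda>p. T (T' p))"
proof -
  obtain g where "dop_coeffs k d c e T g" using assms(1) unfolding dop_def by blast
  note g = dop_coeffsD[OF this]
  obtain g' where "dop_coeffs k' d' c' e' T' g'" using assms(2) unfolding dop_def by blast
  note g' = dop_coeffsD[OF this]
  define A where "A = {-int k..int k} \<times> {-int k'..int k'}"
  define G where "G = (\<lambda>n. \<Sum>(l, j)\<in>{x \<in> A. fst x + snd x = n}. g l * shift (of_int l) (g' j))"
  have lin: "poly_linear (shift l)" for l by (rule poly_linear_shift)
  have T: "T (T' p) = (\<Sum>n=-int (k + k')..int (k + k'). G n * shift (of_int n) p)" for p
  proof -
    have "T (T' p) = (\<Sum>(l, j)\<in>A. g l * shift (of_int l) (g' j) * shift (of_int (l + j)) p)"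
      unfolding g g' poly_linear_sum[OF lin] A_def
      by (simp add: sum_distrib_left shift_mult shift_shift mult.assoc sum.cartesian_product)
    also have "\<dots> = (\<Sum>n=-int (k + k')..int (k + k'). \<Sum>x\<in>{x \<in> A. fst x + snd x = n}.
        case x of (l, j) \<Rightarrow> g l * shift (of_int l) (g' j) * shift (of_int (l + j)) p)"
      by (rule sum.group[symmetric]) (auto simp: A_def)
    also have "\<dots> = (\<Sum>n=-int (k + k')..int (k + k'). G n * shift (of_int n) p)"
      unfolding G_def sum_distrib_right by (intro sum.cong refl) (auto simp: case_prod_beta)
    finally show ?thesis .
  qed
  have "{x \<in> A. fst x + snd x = int (k + k')} = {(int k, int k')}" by (auto simp: A_def)
  hence G1: "G (int (k + k')) = g (int k) * shift (of_int (int k)) (g' (int k'))" by (simp add: G_def)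
  have "{x \<in> A. fst x + snd x = - int (k + k')} = {(- int k, - int k')}" by (auto simp: A_def)
  hence G2: "G (- int (k + k')) = g (- int k) * shift (of_int (- int k)) (g' (- int k'))" by (simp add: G_def)
  show ?thesis unfolding dop_def dop_coeffs_def
  proof (intro exI[of _ G] conjI T ext)
    show "degree (G (int (k + k'))) \<le> d + d'" "degree (G (- int (k + k'))) \<le> d + d'"
      unfolding G1 G2 using g g' by (auto intro!: order.trans[OF degree_mult_le] add_mono)
    show "coeff (G (int (k + k'))) (d + d') = c * c'"
      unfolding G1 using g g' by (subst coeff_mult_top) (auto simp: coeff_shift_top)
    show "coeff (G (- int (k + k'))) (d + d') = e * e'"
      unfolding G2 using g g' by (subst coeff_mult_top) (auto simp: coeff_shift_top)
  qed
qed

lemma atLeastAtMost_minus1_1: "{-1..1::int} = {-1, 0, 1}" by auto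

lemma dop_hahn_op: "dop 1 2 1 1 (hahn_op a b N)"
  unfolding dop_def dop_coeffs_def
proof (intro exI[of _ "\<lambda>l. if l = - 1 then [:0, 1:] * [:- b - N - 1, 1:] else if l = 0 then
    - ([:a + 1, 1:] * [:- N, 1:] + [:0, 1:] * [:- b - N - 1, 1:]) else [:a + 1, 1:] * [:- N, 1:]"] conjI ext)
  fix p
  show "hahn_op a b N p = (\<Sum>l=-int 1..int 1. (if l = - 1 then [:0, 1:] * [:- b - N - 1, 1:] else if l = 0 then
    - ([:a + 1, 1:] * [:- N, 1:] + [:0, 1:] * [:- b - N - 1, 1:]) else [:a + 1, 1:] * [:- N, 1:]) * shift (of_int l) p)"
    by (simp add: atLeastAtMost_minus1_1 hahn_op_def ring_distribs del: mult_pCons_left mult_pCons_right)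
qed (auto simp: numeral_2_eq_2)

lemma dop_cal_D: "\<exists>c e. dop 1 1 c e (cal_D a b N t)"
proof -
  define q where "q = (if t = 1 then [:0, 1:] else if t = 2 then [:- N, 1:] else if t = 3 then [:a + 1, 1:] else [:- b - N - 1, 1 :: real:])"
  define g where "g = (\<lambda>l :: int. if l = - 1 then (if t = 2 \<or> t = 3 then 0 else - q) else if l = 0 then
    [:(a + b + 1) / 2:] + (if t = 2 \<or> t = 3 then - q else q) else (if t = 2 \<or> t = 3 then q else 0))"
  have "dop 1 1 (coeff (g (int 1)) 1) (coeff (g (- int 1)) 1) (cal_D a b N t)"
    unfolding dop_def dop_coeffs_def
  proof (intro exI[of _ g] conjI refl ext)
    fix p
    have "cal_D a b N t p = [:(a + b + 1) / 2:] * p + q * (if t = 2 \<or> t = 3 then shift 1 p - p else p - shift (- 1) p)"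
      by (simp add: cal_D_def fwd_diff_def bwd_diff_def q_def)
    also have "\<dots> = (\<Sum>l=-int 1..int 1. g l * shift (of_int l) p)"
      by (cases "t = 2 \<or> t = 3")
        (simp_all add: atLeastAtMost_minus1_1 g_def ring_distribs del: mult_pCons_left mult_pCons_right)
    finally show "cal_D a b N t p = (\<Sum>l=-int 1..int 1. g l * shift (of_int l) p)" .
  qed (auto simp: g_def q_def)
  thus ?thesis by blast
qed

lemma dop_funpow: "dop k d 1 1 T \<Longrightarrow> dop (i * k) (i * d) 1 1 (T ^^ i)"
proof (induction i)
  case (Suc i)
  show ?case using dop_comp[OF Suc.prems Suc.IH[OF Suc.prems]] by (simp add: comp_def)
qed (simp add: dop_id id_def)

lemma dop_poly_op:
  "dop (degree Q) (2 * degree Q) (lead_coeff Q) (lead_coeff Q) (poly_op Q (hahn_op a b N))"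
proof -
  let ?T = "hahn_op a b N" and ?c = "\<lambda>i. if i = degree Q then lead_coeff Q else 0"
  have "dop (degree Q) (2 * degree Q) (\<Sum>i\<le>degree Q. ?c i) (\<Sum>i\<le>degree Q. ?c i)
     (\<lambda>p. \<Sum>i\<le>degree Q. smult (coeff Q i) ((?T ^^ i) p))"
  proof (rule dop_sum)
    fix i assume i: "i \<in> {..degree Q}"
    have T: "dop i (2 * i) 1 1 (?T ^^ i)" using dop_funpow[OF dop_hahn_op, of i] by (simp add: mult.commute)
    show "dop (degree Q) (2 * degree Q) (?c i) (?c i) (\<lambda>p. smult (coeff Q i) ((?T ^^ i) p))"
    proof (cases "i = degree Q")
      case True
      thus ?thesis using dop_smult[OF T, where s = "coeff Q i"] by simp
    next
      case False
      thus ?thesis using dop_smult[OF dop_less_order[OF T, of "degree Q"], where s = "coeff Q i"] i by simp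
    qed
  qed
  thus ?thesis unfolding poly_op_def[abs_def] by simp
qed

text \<open>The extreme coefficients of \<open>poly_op P (hahn_op a b N)\<close> have degree twice
  the order. The operator \<open>cal_D\<close> has order 1 but coefficients of degree at most 1, so
  a summand of full order stays below that degree. Nothing can cancel the leading coefficient of
  \<open>P\<close>.\<close>

lemma constructed_is_difference_op:
  assumes D: "D = (\<lambda>p. smult (1 / 2) (poly_op P (hahn_op a b N) p) +
           (\<Sum>h = 1..m. poly_op (Mt h) (hahn_op a b N) (cal_D a b N (t h) (poly_op (Y h) (hahn_op a b N) p))))"
    and P: "P \<noteq> 0"
    and deg: "\<And>h. h \<in> {1..m} \<Longrightarrow> Mt h \<noteq> 0 \<Longrightarrow> degree (Mt h) + degree (Y h) + 1 \<le> degree P"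
  shows "is_difference_op (int (degree P)) D"
proof -
  let ?r = "degree P" and ?D = "\<lambda>h p. poly_op (Mt h) (hahn_op a b N) (cal_D a b N (t h) (poly_op (Y h) (hahn_op a b N) p))"
  have terms: "dop ?r (2 * ?r) 0 0 (?D h)"
    if h: "h \<in> {1..m}" for h
  proof (cases "Mt h = 0")
    case True
    thus ?thesis by (simp add: poly_op_def dop_zero)
  next
    case False
    obtain c e where c: "dop 1 1 c e (cal_D a b N (t h))" using dop_cal_D by blast
    let ?k = "degree (Mt h) + (1 + degree (Y h))" and ?d = "2 * degree (Mt h) + (1 + 2 * degree (Y h))"
    have "\<exists>c e. dop ?k ?d c e (?D h)"
      using dop_comp[OF dop_poly_op[of "Mt h" a b N] dop_comp[OF c dop_poly_op[of "Y h" a b N]]] by blast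
    then obtain c e where T: "dop ?k ?d c e (?D h)" by blast
    show ?thesis
    proof (cases "?k = ?r")
      case True
      hence "?d < 2 * ?r" by simp
      from dop_less_degree[OF T this] show ?thesis unfolding True .
    next
      case False
      hence "?k < ?r" using deg[OF h \<open>Mt h \<noteq> 0\<close>] by simp
      from dop_less_order[OF T this] show ?thesis .
    qed
  qed
  have "dop ?r (2 * ?r) (1 / 2 * lead_coeff P + (\<Sum>h=1..m. 0)) (1 / 2 * lead_coeff P + (\<Sum>h=1..m. 0)) D"
    unfolding D by (intro dop_add dop_smult dop_poly_op dop_sum terms)
  then obtain g where g: "D = (\<lambda>p. \<Sum>l=-int ?r..int ?r. g l * shift (of_int l) p)"
     "coeff (g (int ?r)) (2 * ?r) = 1 / 2 * lead_coeff P" "coeff (g (- int ?r)) (2 * ?r) = 1 / 2 * lead_coeff P"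
    by (auto simp: dop_def dop_coeffs_def)
  have "g (int ?r) \<noteq> 0" "g (- int ?r) \<noteq> 0" using g(2,3) P by auto
  thus ?thesis unfolding is_difference_op_def by (intro exI[of _ g]) (simp add: g(1))
qed

section \<open>Mirror divisibility of weighted determinants\<close>

definition continuous_family :: "(real \<Rightarrow> real poly) \<Rightarrow> bool" where
  "continuous_family f \<longleftrightarrow> (\<exists>d. \<forall>s. degree (f s) \<le> d) \<and> (\<forall>e. isCont (\<lambda>s. coeff (f s) e) 0)"

lemma continuous_family_const: "continuous_family (\<lambda>s. p)"
  by (auto simp: continuous_family_def)

lemma continuous_family_param: "continuous_family (\<lambda>s. [:s:])"
proof -
  have "isCont (\<lambda>s. coeff [:s:] e) 0" for e :: nat by (cases e) (auto simp: coeff_pCons)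
  thus ?thesis by (auto simp: continuous_family_def)
qed

lemma continuous_family_add:
  assumes "continuous_family f" "continuous_family g"
  shows "continuous_family (\<lambda>s. f s + g s)"
proof -
  obtain d e where "\<And>s. degree (f s) \<le> d" "\<And>s. degree (g s) \<le> e" using assms by (auto simp: continuous_family_def)
  hence "\<And>s. degree (f s + g s) \<le> max d e" by (meson degree_add_le le_max_iff_disj)
  thus ?thesis using assms by (auto simp: continuous_family_def)
qed

lemma continuous_family_mult:
  assumes "continuous_family f" "continuous_family g"
  shows "continuous_family (\<lambda>s. f s * g s)"
proof -
  obtain d e where "\<And>s. degree (f s) \<le> d" "\<And>s. degree (g s) \<le> e" using assms by (auto simp: continuous_family_def)
  hence "\<And>s. degree (f s * g s) \<le> d + e" by (meson add_mono degree_mult_le order.trans)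
  thus ?thesis using assms by (auto simp: continuous_family_def coeff_mult intro!: continuous_intros)
qed

lemma continuous_family_sum: "(\<And>i. i \<in> A \<Longrightarrow> continuous_family (f i)) \<Longrightarrow> continuous_family (\<lambda>s. \<Sum>i\<in>A. f i s)"
  by (induction A rule: infinite_finite_induct) (auto intro: continuous_family_const continuous_family_add)

lemma continuous_family_prod: "(\<And>i. i \<in> A \<Longrightarrow> continuous_family (f i)) \<Longrightarrow> continuous_family (\<lambda>s. \<Prod>i\<in>A. f i s)"
  by (induction A rule: infinite_finite_induct) (auto intro: continuous_family_const continuous_family_mult)

lemma continuous_family_power: "continuous_family f \<Longrightarrow> continuous_family (\<lambda>s. f s ^ n)"
  by (induction n) (auto intro: continuous_family_const continuous_family_mult)

text \<open>The remainder modulo the fixed \<open>V\<close> is linear in the coefficients of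
  \<open>K s\<close>, hence continuous at 0; it vanishes for all but finitely many \<open>s\<close>,
  so also in the limit.\<close>

lemma dvd_limit:
  assumes K: "continuous_family K" and dvd: "MOST s. V dvd K s"
  shows "V dvd K 0"
proof -
  obtain d where d: "\<And>s. degree (K s) \<le> d" using K by (auto simp: continuous_family_def)
  define r where "r = (\<lambda>s j. \<Sum>e\<le>d. coeff (K s) e * coeff (monom 1 e mod V) j)"
  have mod_sum: "(\<Sum>e\<le>n. smult (f e) (g e)) mod V = (\<Sum>e\<le>n. smult (f e) (g e mod V))" for f g and n :: nat
    by (induction n) (auto simp: poly_mod_add_left mod_smult_left)
  have r: "coeff (K s mod V) j = r s j" for s j
  proof -
    have "K s = (\<Sum>e\<le>d. smult (coeff (K s) e) (monom 1 e))"
      using poly_as_sum_of_monoms'[OF d[of s]] by (simp add: smult_monom)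
    hence "K s mod V = (\<Sum>e\<le>d. smult (coeff (K s) e) (monom 1 e mod V))" using mod_sum by metis
    thus ?thesis by (simp add: r_def coeff_sum)
  qed
  have "r 0 j = 0" for j
  proof (rule isCont_cofinite_eq[where f = "\<lambda>s. r s j" and g = "\<lambda>s. 0" and x = 0])
    show "isCont (\<lambda>s. r s j) 0" using K unfolding r_def continuous_family_def by (intro continuous_intros) auto
    show "MOST s. r s j = 0" using dvd
    proof eventually_elim
      case (elim s)
      hence "K s mod V = 0" by simp
      thus ?case using r[of s j] by simp
    qed
  qed simp
  hence "K 0 mod V = 0" using r[of 0] by (intro poly_eqI) simp
  thus ?thesis by (simp add: dvd_eq_mod_eq_0)
qed

lemma cong_pcompose: "[p = q] (mod w) \<Longrightarrow> [pcompose f p = pcompose f q] (mod (w :: real poly))"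
proof (induction f)
  case (pCons a f)
  thus ?case by (auto simp: pcompose_pCons intro!: cong_add cong_mult)
qed auto

text \<open>Columns are numbered from 0, column \<open>r\<close> belongs to the point \<open>z\<^sub>r = y - (r + 1)\<close>; \<open>col_pt\<close> is
  \<open>z\<^sub>r\<close> and \<open>ref_pt\<close> its mirror image \<open>- z\<^sub>r - c\<close>, as polynomials in \<open>y\<close>.\<close>

definition col_pt :: "nat \<Rightarrow> real poly" where "col_pt r = [:- real (Suc r), 1:]"
definition ref_pt :: "real \<Rightarrow> nat \<Rightarrow> real poly" where "ref_pt c r = [:real (Suc r) - c, -1:]"
text \<open>For \<open>s = i + j + 2\<close> this is z_i + z_j + c, which vanishes exactly where
  columns \<open>i\<close> and \<open>j\<close> are mirror images.\<close>

definition mirror_lin :: "real \<Rightarrow> nat \<Rightarrow> real poly" where "mirror_lin c s = [:c - real s, 2:]"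

text \<open>What \<open>\<xi>\<close> leaves in column \<open>r\<close> after clearing denominators:
  its numerator is a product of \<open>al\<close> over the points right of \<open>r\<close>, and the
  part of the common denominator that column \<open>r\<close> does not use is, up to sign, a product
  of \<open>al\<close> over the mirror images of the points left of it.\<close>

definition col_weight :: "real \<Rightarrow> nat \<Rightarrow> real poly \<Rightarrow> nat \<Rightarrow> real poly" where
  "col_weight c m al r = (\<Prod>i\<in>{r<..<m}. pcompose al (col_pt i)) * (\<Prod>i<r. pcompose al (ref_pt c i))"

text \<open>Pigeonhole: of \<open>k\<close> rows placed in distinct columns at least
  \<open>k - (m - i)\<close> lie left of column \<open>i\<close> and at least
  \<open>k - Suc i\<close> right of it. So many factors occur in every Leibniz term; the truncated
  subtraction is intended.\<close>

definition common_weight :: "real \<Rightarrow> nat \<Rightarrow> real poly \<Rightarrow> nat \<Rightarrow> real poly" where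
  "common_weight c m al k = (\<Prod>i<m. pcompose al (col_pt i) ^ (k - (m - i)) * pcompose al (ref_pt c i) ^ (k - Suc i))"

definition left_weight :: "real \<Rightarrow> nat \<Rightarrow> real poly \<Rightarrow> (nat \<Rightarrow> bool) \<Rightarrow> (nat \<Rightarrow> nat) \<Rightarrow> real poly" where
  "left_weight c m al f \<pi> = (\<Prod>i<m. 
      pcompose al (col_pt i) ^ (card {l. l < m \<and> f l \<and> \<pi> l < i} - (card {l. l < m \<and> f l} - (m - i))) *
      pcompose al (ref_pt c i) ^ (card {l. l < m \<and> f l \<and> i < \<pi> l} - (card {l. l < m \<and> f l} - Suc i)))"

definition theta_pt :: "real \<Rightarrow> nat \<Rightarrow> real poly" where
  "theta_pt c r = col_pt r * (col_pt r + [:c:])"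

lemma mirror_cong: "i + j + 2 = s \<Longrightarrow> [col_pt i = ref_pt c j] (mod mirror_lin c s)"
proof -
  assume "i + j + 2 = s"
  hence "real i + real j + 2 = real s" by linarith
  hence "col_pt i - ref_pt c j = mirror_lin c s" by (simp add: col_pt_def ref_pt_def mirror_lin_def)
  thus ?thesis by (simp add: cong_iff_dvd_diff)
qed

lemma theta_pt_cong: "i + j + 2 = s \<Longrightarrow> [theta_pt c i = theta_pt c j] (mod mirror_lin c s)"
proof -
  assume s: "i + j + 2 = s"
  have "[theta_pt c i = ref_pt c j * (ref_pt c j + [:c:])] (mod mirror_lin c s)"
    unfolding theta_pt_def by (intro cong_mult cong_add mirror_cong s cong_refl)
  also have "ref_pt c j * (ref_pt c j + [:c:]) = theta_pt c j"
    by (simp add: theta_pt_def ref_pt_def col_pt_def algebra_simps)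
  finally show ?thesis .
qed

text \<open>Modulo the mirror factor, \<open>r\<close> and \<open>i + j - r\<close> are mirror
  images. The factors that column \<open>i\<close> has at the points after \<open>i\<close> up to
  \<open>j\<close> become those that column \<open>j\<close> has at the mirror images from
  \<open>i\<close> up to before \<open>j\<close>; the others are shared.\<close>

lemma col_weight_cong:
  assumes s: "i + j + 2 = s" and ij: "i < j" "j < m"
  shows "[col_weight c m al i = col_weight c m al j] (mod mirror_lin c s)"
proof -
  let ?a = "\<lambda>i. pcompose al (col_pt i)" and ?b = "\<lambda>i. pcompose al (ref_pt c i)"
  have 1: "col_weight c m al i = (\<Prod>r\<in>{i<..<j}. ?a r) * ?a j * (\<Prod>r\<in>{j<..<m}. ?a r) * (\<Prod>r<i. ?b r)"
  proof -
    have e: "{i<..<m} = {i<..<j} \<union> {j} \<union> {j<..<m}" using ij by auto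
    show ?thesis unfolding col_weight_def e by (subst prod.union_disjoint; (auto simp: prod.union_disjoint)?)
  qed
  have 2: "col_weight c m al j = (\<Prod>r\<in>{i<..<j}. ?b r) * ?b i * (\<Prod>r\<in>{j<..<m}. ?a r) * (\<Prod>r<i. ?b r)"
  proof -
    have e: "{..<j} = {i<..<j} \<union> {i} \<union> {..<i}" using ij by auto
    have "(\<Prod>r<j. ?b r) = (\<Prod>r\<in>{i<..<j}. ?b r) * ?b i * (\<Prod>r<i. ?b r)"
      unfolding e by (subst prod.union_disjoint; (auto simp: prod.union_disjoint)?)
    thus ?thesis unfolding col_weight_def by (simp add: mult_ac)
  qed
  have 3: "(\<Prod>r\<in>{i<..<j}. ?b r) = (\<Prod>r\<in>{i<..<j}. ?b (i + j - r))"
    by (rule prod.reindex_bij_witness[of _ "\<lambda>r. i + j - r" "\<lambda>r. i + j - r"]) auto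
  show ?thesis unfolding 1 2 3
    by (intro cong_mult cong_prod cong_refl cong_pcompose mirror_cong) (use s in auto)
qed

lemma power_dvd_det:
  fixes A :: "real poly mat"
  assumes A: "A \<in> carrier_mat n n" and C: "C \<subseteq> {..<n}" and dvd: "\<And>l j. l < n \<Longrightarrow> j \<in> C \<Longrightarrow> w dvd A $$ (l, j)"
  shows "w ^ card C dvd Determinant.det A"
  unfolding det_col[OF A]
proof (intro dvd_sum dvd_mult)
  fix p assume "p \<in> {p. p permutes {0..<n}}"
  hence p: "p permutes {0..<n}" by simp
  have "w ^ card C = (\<Prod>j\<in>C. w)" by simp
  also have "\<dots> dvd (\<Prod>j\<in>C. A $$ (p j, j))"
  proof (rule prod_dvd_prod)
    fix j assume j: "j \<in> C"
    hence "p j < n" using permutes_in_image[OF p, of j] C by auto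
    thus "w dvd A $$ (p j, j)" using dvd j by blast
  qed
  also have "\<dots> dvd (\<Prod>j<n. A $$ (p j, j))"
    by (rule prod_dvd_prod_subset) (use C in auto)
  finally show "w ^ card C dvd (\<Prod>j<n. A $$ (p j, j))" .
qed

text \<open>Subtracting column \<open>r j\<close> from column \<open>j\<close> for all
  \<open>j\<close> in \<open>C\<close> at once is multiplication by the unitriangular
  \<open>E\<close>, because \<open>r j < j\<close>. The determinant is unchanged and the columns in
  \<open>C\<close> become divisible by \<open>w\<close>.\<close>

lemma power_dvd_det_mirror:
  fixes A :: "real poly mat"
  assumes A: "A \<in> carrier_mat n n"
    and C: "\<And>j. j \<in> C \<Longrightarrow> j < n \<and> r j < j"
    and cong: "\<And>l j. l < n \<Longrightarrow> j \<in> C \<Longrightarrow> [A $$ (l, j) = A $$ (l, r j)] (mod w)"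
  shows "w ^ card C dvd Determinant.det A"
proof -
  define E :: "real poly mat" where "E = mat n n (\<lambda>(i, j). if i = j then 1 else if j \<in> C \<and> i = r j then -1 else 0)"
  have E: "E \<in> carrier_mat n n" by (simp add: E_def)
  have "upper_triangular E"
  proof (rule upper_triangularI)
    fix i j assume ij: "j < i" "i < dim_row E"
    hence "\<not> (j \<in> C \<and> i = r j)" using C[of j] by auto
    thus "E $$ (i, j) = 0" using ij by (simp add: E_def)
  qed
  hence "Determinant.det E = prod_list (diag_mat E)" using E by (rule det_upper_triangular)
  also have "diag_mat E = replicate n 1" by (intro nth_equalityI) (auto simp: diag_mat_def E_def)
  finally have dE: "Determinant.det E = 1" by simp
  have entries: "(A * E) $$ (l, j) = A $$ (l, j) - A $$ (l, r j)" if "l < n" "j \<in> C" for l j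
  proof -
    have j: "j < n" "r j < j" using C that by auto
    have "(A * E) $$ (l, j) = (\<Sum>i\<in>{0..<n}. A $$ (l, i) * E $$ (i, j))"
      using A E that j by (simp add: scalar_prod_def)
    also have "\<dots> = (\<Sum>i\<in>{j, r j}. A $$ (l, i) * E $$ (i, j))"
      using j by (intro sum.mono_neutral_right) (auto simp: E_def)
    also have "\<dots> = A $$ (l, j) - A $$ (l, r j)" using j that by (simp add: E_def)
    finally show ?thesis .
  qed
  have "w ^ card C dvd Determinant.det (A * E)"
  proof (rule power_dvd_det[of _ n])
    show "A * E \<in> carrier_mat n n" using A E by simp
    show "C \<subseteq> {..<n}" using C by auto
    show "w dvd (A * E) $$ (l, j)" if "l < n" "j \<in> C" for l j
      using cong[OF that] by (simp add: entries[OF that] cong_iff_dvd_diff)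
  qed
  thus ?thesis using det_mult[OF A E] dE by simp
qed

lemma prod_dvd_coprime:
  assumes "finite I" "\<And>i j. i \<in> I \<Longrightarrow> j \<in> I \<Longrightarrow> i \<noteq> j \<Longrightarrow> coprime (f i) (f j)" "\<And>i. i \<in> I \<Longrightarrow> f i dvd x"
  shows "(\<Prod>i\<in>I. f i) dvd (x :: real poly)"
  using assms
proof (induction I rule: finite_induct)
  case (insert i I)
  have "coprime (f i) (\<Prod>i\<in>I. f i)" by (rule prod_coprime_right) (use insert in auto)
  thus ?case using insert by (auto intro!: divides_mult)
qed auto

lemma coprime_mirror_lin: "s \<noteq> s' \<Longrightarrow> coprime (mirror_lin c s) (mirror_lin c s')"
proof (rule coprimeI)
  fix d assume s: "s \<noteq> s'" and "d dvd mirror_lin c s" "d dvd mirror_lin c s'"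
  hence "d dvd mirror_lin c s - mirror_lin c s'" by (rule_tac dvd_diff)
  also have "mirror_lin c s - mirror_lin c s' = [:real s' - real s:]" by (simp add: mirror_lin_def)
  finally have "d dvd [:real s' - real s:]" .
  moreover have "is_unit [:real s' - real s:]" using s by (subst is_unit_iff_degree) auto
  ultimately show "is_unit d" using dvd_trans by blast
qed

lemma coprime_mirror_lin_root:
  assumes "poly p ((real s - c) / 2) \<noteq> 0"
  shows "coprime (mirror_lin c s) p"
proof -
  have "prime_elem (mirror_lin c s)"
    unfolding mirror_lin_def by (rule prime_elem_linear_field_poly) simp
  moreover have "\<not> mirror_lin c s dvd p"
  proof
    assume "mirror_lin c s dvd p"
    then obtain q where "p = mirror_lin c s * q" by (elim dvdE)
    moreover have "poly (mirror_lin c s) ((real s - c) / 2) = 0" by (simp add: mirror_lin_def)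
    ultimately show False using assms by simp
  qed
  ultimately show ?thesis by (rule prime_elem_imp_coprime)
qed

definition mirror_prod :: "real \<Rightarrow> nat \<Rightarrow> real poly" where
  "mirror_prod c m = (\<Prod>(i, j)\<in>{(i, j). i < j \<and> j < m}. mirror_lin c (i + j + 2))"

lemma finite_pairs: "finite {(i, j). i < j \<and> j < (m :: nat)}"
  by (rule finite_subset[of _ "{..<m} \<times> {..<m}"]) auto

lemma mirror_prod_nonzero: "mirror_prod c m \<noteq> 0"
  unfolding mirror_prod_def using finite_pairs by (auto simp: prod_zero_iff mirror_lin_def)

text \<open>Factors for different \<open>s\<close> are coprime, so the pairs are sorted by their
  sum. The larger member \<open>j\<close> determines the pair as \<open>s - 2 - j\<close> and
  \<open>j\<close>.\<close>

lemma mirror_prod_grouped: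
  "mirror_prod c m = (\<Prod>s<2*m. mirror_lin c s ^ card {j. j < m \<and> j + 2 \<le> s \<and> s - 2 - j < j})"
proof -
  let ?P = "{(i, j). i < j \<and> j < m}"
  have "mirror_prod c m = (\<Prod>s\<in>{..<2*m}. \<Prod>x\<in>{x\<in>?P. fst x + snd x + 2 = s}. case x of (i, j) \<Rightarrow> mirror_lin c (i + j + 2))"
    unfolding mirror_prod_def by (rule prod.group[symmetric]) (use finite_pairs in auto)
  also have "\<dots> = (\<Prod>s<2*m. mirror_lin c s ^ card {j. j < m \<and> j + 2 \<le> s \<and> s - 2 - j < j})"
  proof (rule prod.cong[OF refl], goal_cases)
    case (1 s)
    have "(\<Prod>x\<in>{x\<in>?P. fst x + snd x + 2 = s}. case x of (i, j) \<Rightarrow> mirror_lin c (i + j + 2)) = (\<Prod>x\<in>{x\<in>?P. fst x + snd x + 2 = s}. mirror_lin c s)"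
      by (intro prod.cong refl) auto
    moreover have "card {x\<in>?P. fst x + snd x + 2 = s} = card {j. j < m \<and> j + 2 \<le> s \<and> s - 2 - j < j}"
      by (rule bij_betw_same_card[of snd], rule bij_betw_byWitness[of _ "\<lambda>j. (s - 2 - j, j)"]) auto
    ultimately show ?case by simp
  qed
  finally show ?thesis .
qed

definition weighted_det :: "real \<Rightarrow> nat \<Rightarrow> real poly \<Rightarrow> real poly \<Rightarrow> (nat \<Rightarrow> bool) \<Rightarrow> (nat \<Rightarrow> bool) \<Rightarrow>
    (nat \<Rightarrow> nat \<Rightarrow> real poly) \<Rightarrow> real poly" where
  "weighted_det c m al be f g Q = Determinant.det (mat m m (\<lambda>(l, r).
     (if f l then col_weight c m al r else 1) * (if g l then col_weight c m be r else 1) * Q l r))"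

text \<open>The weighted determinant without its common weights. They are removed term by term in
  the Leibniz expansion, so no division occurs and the result depends continuously on
  \<open>al\<close> and \<open>be\<close>.\<close>

definition reduced_det :: "real \<Rightarrow> nat \<Rightarrow> real poly \<Rightarrow> real poly \<Rightarrow> (nat \<Rightarrow> bool) \<Rightarrow> (nat \<Rightarrow> bool) \<Rightarrow>
    (nat \<Rightarrow> nat \<Rightarrow> real poly) \<Rightarrow> real poly" where
  "reduced_det c m al be f g Q = (\<Sum>\<pi> | \<pi> permutes {0..<m}. of_int (sign \<pi>) *
     (left_weight c m al f \<pi> * left_weight c m be g \<pi> * (\<Prod>l<m. Q l (\<pi> l))))"

lemma prod_col_weight:
  assumes p: "\<pi> permutes {0..<m}"
  shows "(\<Prod>l<m. if f l then col_weight c m al (\<pi> l) else 1) =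
     common_weight c m al (card {l. l < m \<and> f l}) * left_weight c m al f \<pi>"
proof -
  let ?a = "\<lambda>i. pcompose al (col_pt i)" and ?b = "\<lambda>i. pcompose al (ref_pt c i)"
  let ?L = "{l. l < m \<and> f l}"
  let ?k = "card ?L"
  have im: "\<pi> l < m" if "l < m" for l using permutes_in_image[OF p, of l] that by simp
  have inj: "inj_on \<pi> A" for A using permutes_inj[OF p] by (rule inj_on_subset) simp
  have "(\<Prod>l<m. if f l then col_weight c m al (\<pi> l) else 1) = (\<Prod>l\<in>?L. col_weight c m al (\<pi> l))"
    by (rule prod.mono_neutral_cong_right) auto
  also have "\<dots> = (\<Prod>l\<in>?L. \<Prod>i<m. (if \<pi> l < i then ?a i else 1) * (if i < \<pi> l then ?b i else 1))"
  proof (rule prod.cong[OF refl], goal_cases)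
    case (1 l)
    hence "\<pi> l < m" using im by simp
    have "(\<Prod>i\<in>{\<pi> l<..<m}. ?a i) = (\<Prod>i<m. if \<pi> l < i then ?a i else 1)"
      by (rule prod.mono_neutral_cong_left) auto
    moreover have "(\<Prod>i<\<pi> l. ?b i) = (\<Prod>i<m. if i < \<pi> l then ?b i else 1)"
      using \<open>\<pi> l < m\<close> by (intro prod.mono_neutral_cong_left) auto
    ultimately show ?case
      by (simp add: col_weight_def prod.distrib)
  qed
  also have "\<dots> = (\<Prod>i<m. \<Prod>l\<in>?L. (if \<pi> l < i then ?a i else 1) * (if i < \<pi> l then ?b i else 1))"
    by (rule prod.swap)
  also have "\<dots> = (\<Prod>i<m. ?a i ^ card {l. l < m \<and> f l \<and> \<pi> l < i} * ?b i ^ card {l. l < m \<and> f l \<and> i < \<pi> l})"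
  proof (rule prod.cong[OF refl], goal_cases)
    case (1 i)
    have "(\<Prod>l\<in>?L. if \<pi> l < i then ?a i else 1) = (\<Prod>l\<in>{l. l < m \<and> f l \<and> \<pi> l < i}. ?a i)"
      by (rule prod.mono_neutral_cong_right) auto
    moreover have "(\<Prod>l\<in>?L. if i < \<pi> l then ?b i else 1) = (\<Prod>l\<in>{l. l < m \<and> f l \<and> i < \<pi> l}. ?b i)"
      by (rule prod.mono_neutral_cong_right) auto
    ultimately show ?case by (simp add: prod.distrib)
  qed
  also have "\<dots> = common_weight c m al ?k * left_weight c m al f \<pi>"
    unfolding common_weight_def left_weight_def prod.distrib[symmetric]
  proof (rule prod.cong[OF refl], goal_cases)
    case (1 i)
    hence i: "i < m" by simp
    have u: "?k = card {l. l < m \<and> f l \<and> \<pi> l < i} + card {l. l < m \<and> f l \<and> \<pi> l \<ge> i}"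
      by (subst card_Un_disjoint[symmetric]) (auto intro!: arg_cong[where f = card])
    have "card {l. l < m \<and> f l \<and> \<pi> l \<ge> i} = card (\<pi> ` {l. l < m \<and> f l \<and> \<pi> l \<ge> i})" by (simp add: card_image inj)
    also have "\<dots> \<le> card {i..<m}" by (rule card_mono) (auto simp: im)
    finally have 1: "?k - (m - i) \<le> card {l. l < m \<and> f l \<and> \<pi> l < i}" using u by simp
    have u': "?k = card {l. l < m \<and> f l \<and> i < \<pi> l} + card {l. l < m \<and> f l \<and> \<pi> l \<le> i}"
      by (subst card_Un_disjoint[symmetric]) (auto intro!: arg_cong[where f = card])
    have "card {l. l < m \<and> f l \<and> \<pi> l \<le> i} = card (\<pi> ` {l. l < m \<and> f l \<and> \<pi> l \<le> i})" by (simp add: card_image inj)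
    also have "\<dots> \<le> card {..i}" by (rule card_mono) auto
    finally have 2: "?k - Suc i \<le> card {l. l < m \<and> f l \<and> i < \<pi> l}" using u' by simp
    have pw: "x ^ n = x ^ k * x ^ (n - k)" if "k \<le> n" for x :: "real poly" and n k
      using that by (simp flip: power_add)
    show ?case
      unfolding pw[OF 1] pw[OF 2] by (simp only: mult_ac)
  qed
  finally show ?thesis .
qed

lemma weighted_det_reduced:
  "weighted_det c m al be f g Q = common_weight c m al (card {l. l < m \<and> f l}) *
     common_weight c m be (card {l. l < m \<and> g l}) * reduced_det c m al be f g Q"
proof -
  have "weighted_det c m al be f g Q = (\<Sum>\<pi> | \<pi> permutes {0..<m}. of_int (sign \<pi>) *
     ((\<Prod>l<m. if f l then col_weight c m al (\<pi> l) else 1) * (\<Prod>l<m. if g l then col_weight c m be (\<pi> l) else 1) * (\<Prod>l<m. Q l (\<pi> l))))"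
    unfolding weighted_det_def Determinant.det_def
    by (auto simp: prod.distrib[symmetric] lessThan_atLeast0 dest: permutes_in_image intro!: sum.cong prod.cong)
  also have "\<dots> = (\<Sum>\<pi> | \<pi> permutes {0..<m}. common_weight c m al (card {l. l < m \<and> f l}) *
     common_weight c m be (card {l. l < m \<and> g l}) * (of_int (sign \<pi>) * (left_weight c m al f \<pi> * left_weight c m be g \<pi> * (\<Prod>l<m. Q l (\<pi> l)))))"
    by (intro sum.cong refl) (simp add: prod_col_weight mult_ac)
  finally show ?thesis by (simp add: reduced_det_def sum_distrib_left)
qed

text \<open>At the zero of every mirror factor \<open>p\<close> is nonzero at all column points and
  their mirror images; then the common weights are prime to the mirror factors.\<close>

definition mirror_generic :: "real \<Rightarrow> nat \<Rightarrow> real poly \<Rightarrow> bool" where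
  "mirror_generic c m p \<longleftrightarrow> (\<forall>i<m. \<forall>s<2*m. poly p ((real s - c) / 2 - real (Suc i)) \<noteq> 0 \<and>
     poly p (real (Suc i) - c - (real s - c) / 2) \<noteq> 0)"

lemma mirror_generic_perturb: "finite {t. \<not> mirror_generic c m (p + [:t:])}"
proof -
  let ?Z = "\<Union>i<m. \<Union>s<2*m. {- poly p ((real s - c) / 2 - real (Suc i)), - poly p (real (Suc i) - c - (real s - c) / 2)}"
  have "{t. \<not> mirror_generic c m (p + [:t:])} \<subseteq> ?Z" by (force simp: mirror_generic_def add_eq_0_iff)
  thus ?thesis by (rule finite_subset) simp
qed

lemma mirror_prod_dvd_reduced:
  assumes "mirror_generic c m al" "mirror_generic c m be"
  shows "mirror_prod c m dvd reduced_det c m al be f g (\<lambda>l r. pcompose (R l) (theta_pt c r))"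
proof -
  let ?Q = "\<lambda>l r. pcompose (R l) (theta_pt c r)"
  show ?thesis unfolding mirror_prod_grouped
  proof (rule prod_dvd_coprime)
    fix s assume "s \<in> {..<2*m}"
    hence s: "s < 2 * m" by simp
    let ?C = "{j. j < m \<and> j + 2 \<le> s \<and> s - 2 - j < j}"
    let ?w = "mirror_lin c s ^ card ?C" and ?c = "common_weight c m al (card {l. l < m \<and> f l}) * common_weight c m be (card {l. l < m \<and> g l})"
    let ?M = "mat m m (\<lambda>(l, r). (if f l then col_weight c m al r else 1) * (if g l then col_weight c m be r else 1) * ?Q l r)"
    have "?w dvd weighted_det c m al be f g ?Q" unfolding weighted_det_def
    proof (rule power_dvd_det_mirror[where r = "\<lambda>j. s - 2 - j"])
      fix l j assume l: "l < m" and j: "j \<in> ?C"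
      let ?i = "s - 2 - j"
      have ij: "?i + j + 2 = s" "?i < j" "j < m" "?i < m" using j by auto
      show "[?M $$ (l, j) = ?M $$ (l, ?i)] (mod mirror_lin c s)"
        using l ij(3,4) theta_pt_cong[OF ij(1), of c] col_weight_cong[OF ij(1,2,3), of c]
        by (auto intro!: cong_mult cong_pcompose simp: cong_sym_eq)
    qed auto
    hence "?w dvd ?c * reduced_det c m al be f g ?Q"
      by (simp add: weighted_det_reduced)
    moreover have "coprime ?w ?c"
    proof -
      have pt: "poly (col_pt i) y = y - real (Suc i)" "poly (ref_pt c i) y = real (Suc i) - c - y" for i y
        by (simp_all add: col_pt_def ref_pt_def)
      have "poly (common_weight c m al k) ((real s - c) / 2) \<noteq> 0" "poly (common_weight c m be k) ((real s - c) / 2) \<noteq> 0" for k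
        using assms s by (auto simp: mirror_generic_def common_weight_def poly_prod prod_zero_iff poly_pcompose pt simp del: of_nat_Suc)
      hence "coprime (mirror_lin c s) ?c"
        by (intro coprime_mirror_lin_root) simp
      thus ?thesis by simp
    qed
    ultimately show "?w dvd reduced_det c m al be f g ?Q" by (simp add: coprime_dvd_mult_right_iff)
  qed (auto intro: coprime_mirror_lin)
qed

text \<open>For generic \<open>al\<close> and \<open>be\<close> the weights shared by all columns are prime to the mirror factors, and these divide
  the full determinant because columns at mirror images agree. The general case is a limit of generic ones.\<close>

theorem mirror_prod_dvd:
  "mirror_prod c m dvd reduced_det c m al be f g (\<lambda>l r. pcompose (R l) (theta_pt c r))"
proof -
  let ?Q = "\<lambda>l r. pcompose (R l) (theta_pt c r)"
  define K where "K = (\<lambda>s. reduced_det c m (al + [:s:]) (be + [:s:]) f g ?Q)"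
  have fam: "continuous_family (\<lambda>s. pcompose (q + [:s:]) p)" for q p
    by (simp add: pcompose_add continuous_family_add continuous_family_const continuous_family_param)
  have "continuous_family K"
    unfolding K_def reduced_det_def left_weight_def
    by (intro continuous_family_sum continuous_family_mult continuous_family_const continuous_family_prod continuous_family_power fam)
  moreover have "MOST s. mirror_generic c m (p + [:s:])" for p
    using mirror_generic_perturb by (simp add: eventually_cofinite)
  from this[of al] this[of be] have "MOST s. mirror_prod c m dvd K s"
    by eventually_elim (simp only: K_def mirror_prod_dvd_reduced)
  ultimately have "mirror_prod c m dvd K 0" by (rule dvd_limit)
  thus ?thesis by (simp add: K_def)
qed

section \<open>Polynomial window sums\<close>

text \<open>Only real zeros: for such a denominator divisibility can be decided by boundedness of
  the quotient at real points.\<close>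

definition real_split :: "real poly \<Rightarrow> bool" where
  "real_split p \<longleftrightarrow> (\<exists>k xs. k \<noteq> 0 \<and> p = smult k (\<Prod>x\<leftarrow>xs. [:- x, 1:]))"

lemma real_split_mult: "real_split p \<Longrightarrow> real_split q \<Longrightarrow> real_split (p * q)"
proof -
  assume "real_split p" "real_split q"
  then obtain k xs l ys where "k \<noteq> 0" "p = smult k (\<Prod>x\<leftarrow>xs. [:- x, 1:])" "l \<noteq> 0" "q = smult l (\<Prod>x\<leftarrow>ys. [:- x, 1:])"
    by (auto simp: real_split_def)
  thus ?thesis unfolding real_split_def
    by (intro exI[of _ "k * l"] exI[of _ "xs @ ys"]) (simp add: mult.commute)
qed

lemma real_split_1: "real_split 1"
  unfolding real_split_def by (intro exI[of _ 1] exI[of _ "[]"]) simp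

lemma real_split_prod: "(\<And>i. i \<in> A \<Longrightarrow> real_split (f i)) \<Longrightarrow> real_split (\<Prod>i\<in>A. f i)"
  by (induction A rule: infinite_finite_induct) (auto intro: real_split_mult real_split_1)

lemma real_split_linear: "q \<noteq> 0 \<Longrightarrow> real_split [:p, q:]"
  unfolding real_split_def by (intro exI[of _ q] exI[of _ "[- p / q]"]) simp

lemma real_split_nonzero: "real_split p \<Longrightarrow> p \<noteq> 0"
  by (auto simp: real_split_def prod_list_zero_iff)

abbreviation (input) bounded_at_0 :: "(real \<Rightarrow> real) \<Rightarrow> bool" where
  "bounded_at_0 f \<equiv> f \<in> O[at 0](\<lambda>_. 1)"

lemma bounded_at_0_isCont: "isCont f 0 \<Longrightarrow> bounded_at_0 f"
  by (rule bigoI_tendsto[of _ _ "f 0"]) (auto simp: isCont_def)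

lemma bounded_at_0_poly: "bounded_at_0 (\<lambda>d. poly p d)"
  by (rule bounded_at_0_isCont) simp

lemma bounded_at_0_mult: "bounded_at_0 f \<Longrightarrow> bounded_at_0 g \<Longrightarrow> bounded_at_0 (\<lambda>d. f d * g d)"
  using landau_o.big.mult[of f "at 0" "\<lambda>_. 1" g "\<lambda>_. 1"] by simp

lemma bounded_at_0_tendsto_0:
  assumes "bounded_at_0 f" "(g \<longlongrightarrow> 0) (at 0)"
  shows "((\<lambda>d. f d * g d) \<longlongrightarrow> 0) (at (0::real))"
proof -
  have "g \<in> o[at 0](\<lambda>_. 1)" using assms(2) by (intro smalloI_tendsto) auto
  hence "(\<lambda>d. f d * g d) \<in> o[at 0](\<lambda>_. 1 * 1)" using assms(1) by (intro landau_o.big_small_mult)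
  thus ?thesis by (auto dest: smalloD_tendsto)
qed

lemma filterlim_minus_at_0: "filterlim (\<lambda>d::real. - d) (at 0) (at 0)"
  by (auto intro!: filterlim_atI tendsto_eq_intros simp: eventually_at_filter)

lemma bounded_at_0_reflect: "bounded_at_0 f \<Longrightarrow> bounded_at_0 (\<lambda>d. f (- d))"
  using landau_o.big.compose filterlim_minus_at_0 by blast

lemma bounded_at_0_cong: "\<forall>\<^sub>F d in at 0. f d = g d \<Longrightarrow> bounded_at_0 f \<Longrightarrow> bounded_at_0 g"
  using landau_o.big.in_cong by blast

text \<open>One linear factor is removed at a time: boundedness of the quotient at a zero
  \<open>r\<close> of the denominator forces \<open>poly A r = 0\<close>.\<close>

lemma split_dvd_if_bounded:
  fixes A B :: "real poly"
  assumes "real_split B" and "\<And>x0. bounded_at_0 (\<lambda>d. poly A (x0 + d) / poly B (x0 + d))"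
  shows "B dvd A"
proof -
  obtain k xs where k: "k \<noteq> 0" "B = smult k (\<Prod>x\<leftarrow>xs. [:- x, 1:])" using assms(1) by (auto simp: real_split_def)
  have "\<lbrakk>\<And>x0. bounded_at_0 (\<lambda>d. poly A (x0 + d) / poly (\<Prod>x\<leftarrow>xs. [:- x, 1:]) (x0 + d))\<rbrakk> \<Longrightarrow> (\<Prod>x\<leftarrow>xs. [:- x, 1:]) dvd A" for A
  proof (induction xs arbitrary: A)
    case (Cons r xs)
    let ?P = "\<Prod>x\<leftarrow>xs. [:- x, 1 :: real:]"
    have Pnz: "?P \<noteq> 0" by (auto simp: prod_list_zero_iff)
    have nz: "\<forall>\<^sub>F d in at 0. poly ([:- r, 1:] * ?P) (x0 + d) \<noteq> 0" for x0
    proof -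
      have "finite {x. poly ([:- r, 1:] * ?P) x = 0}" using Pnz by (intro poly_roots_finite) (simp del: mult_pCons_left)
      hence "MOST x. poly ([:- r, 1:] * ?P) x \<noteq> 0" by (simp add: eventually_cofinite)
      from cofinite_imp_at[OF cofinite_shift[OF this, of x0], of 0] show ?thesis by (simp add: add.commute)
    qed
    have "((\<lambda>d. poly A (r + d) / poly ([:- r, 1:] * ?P) (r + d) * poly ([:- r, 1:] * ?P) (r + d)) \<longlongrightarrow> 0) (at 0)"
    proof (rule bounded_at_0_tendsto_0)
      show "bounded_at_0 (\<lambda>d. poly A (r + d) / poly ([:- r, 1:] * ?P) (r + d))" using Cons.prems[of r] by simp
      have "isCont (\<lambda>d. poly ([:- r, 1:] * ?P) (r + d)) 0" by (intro continuous_intros)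
      thus "((\<lambda>d. poly ([:- r, 1:] * ?P) (r + d)) \<longlongrightarrow> 0) (at 0)" by (simp add: isCont_def)
    qed
    moreover have "\<forall>\<^sub>F d in at 0. poly A (r + d) / poly ([:- r, 1:] * ?P) (r + d) * poly ([:- r, 1:] * ?P) (r + d) = poly A (r + d)"
      using nz[of r] by eventually_elim simp
    ultimately have "((\<lambda>d. poly A (r + d)) \<longlongrightarrow> 0) (at 0)" by (simp add: filterlim_cong)
    moreover have "((\<lambda>d. poly A (r + d)) \<longlongrightarrow> poly A (r + 0)) (at 0)"
      by (intro tendsto_intros)
    ultimately have "poly A r = 0" using tendsto_unique[of "at (0::real)"] by force
    then obtain A2 where A2: "A = [:- r, 1:] * A2" by (auto simp: poly_eq_0_iff_dvd)
    have "?P dvd A2"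
    proof (rule Cons.IH)
      fix x0
      show "bounded_at_0 (\<lambda>d. poly A2 (x0 + d) / poly ?P (x0 + d))"
      proof (rule bounded_at_0_cong[OF _ Cons.prems[of x0]])
        show "\<forall>\<^sub>F d in at 0. poly A (x0 + d) / poly (\<Prod>x\<leftarrow>r # xs. [:- x, 1:]) (x0 + d) = poly A2 (x0 + d) / poly ?P (x0 + d)"
          using nz[of x0] by eventually_elim (simp add: A2 del: mult_pCons_left)
      qed
    qed
    thus ?case unfolding A2 by (simp del: mult_pCons_left)
  qed simp
  moreover have "bounded_at_0 (\<lambda>d. poly A (x0 + d) / poly (\<Prod>x\<leftarrow>xs. [:- x, 1:]) (x0 + d))" for x0
  proof -
    have "bounded_at_0 (\<lambda>d. k * (poly A (x0 + d) / poly B (x0 + d)))"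
      using assms(2)[of x0] by (intro bounded_at_0_mult[OF bounded_at_0_isCont]) auto
    thus ?thesis using k by simp
  qed
  ultimately have "(\<Prod>x\<leftarrow>xs. [:- x, 1:]) dvd A" by blast
  thus ?thesis using k by (simp add: smult_dvd_iff)
qed

lemma rational_pole_order:
  fixes A B :: "real poly" and x0 :: real
  assumes "B \<noteq> 0"
  shows "\<exists>k g. isCont g 0 \<and> (\<forall>\<^sub>F d in at 0. poly A (x0 + d) / poly B (x0 + d) = g d / d ^ k) \<and> (k > 0 \<longrightarrow> g 0 \<noteq> 0)"
proof -
  define A' where "A' = pcompose A [:x0, 1:]"
  define B' where "B' = pcompose B [:x0, 1:]"
  have AB: "poly A (x0 + d) = poly A' d" "poly B (x0 + d) = poly B' d" for d by (simp_all add: A'_def B'_def poly_pcompose algebra_simps)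
  show ?thesis
  proof (cases "A' = 0")
    case True
    thus ?thesis unfolding AB by (intro exI[of _ 0] exI[of _ "\<lambda>_. 0"]) simp
  next
    case False
    have B': "B' \<noteq> 0" using assms unfolding B'_def by (simp add: pcompose_eq_0_iff)
    obtain A1 where A1: "A' = [:- 0, 1:] ^ order 0 A' * A1" "\<not> [:- 0, 1:] dvd A1" using order_decomp[OF False, of 0] by blast
    obtain B1 where B1: "B' = [:- 0, 1:] ^ order 0 B' * B1" "\<not> [:- 0, 1:] dvd B1" using order_decomp[OF B', of 0] by blast
    define p q where "p = order 0 A'" and "q = order 0 B'"
    have A1': "poly A' d = d ^ p * poly A1 d" for d using arg_cong[OF A1(1), of "\<lambda>P. poly P d"] by (simp add: p_def)
    have B1': "poly B' d = d ^ q * poly B1 d" for d using arg_cong[OF B1(1), of "\<lambda>P. poly P d"] by (simp add: q_def)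
    have A10: "poly A1 0 \<noteq> 0" and B10: "poly B1 0 \<noteq> 0" using A1(2) B1(2) by (auto simp: poly_eq_0_iff_dvd)
    define g where "g = (\<lambda>d. d ^ (p - q) * poly A1 d / poly B1 d)"
    have "isCont g 0" unfolding g_def using B10 by (intro continuous_intros) auto
    moreover have "\<forall>\<^sub>F d in at 0. poly A' d / poly B' d = g d / d ^ (q - p)"
    proof -
      have "\<forall>\<^sub>F d in at (0::real). d \<noteq> 0" by (simp add: eventually_at_filter)
      thus ?thesis
      proof eventually_elim
        case (elim d)
        have "d ^ p = d ^ (p - q) * d ^ min p q" "d ^ q = d ^ (q - p) * d ^ min p q"
          by (auto simp: min_def simp flip: power_add)
        thus ?case unfolding A1' B1' g_def using elim by (simp add: field_simps)
      qed
    qed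
    moreover have "q - p > 0 \<longrightarrow> g 0 \<noteq> 0" using A10 B10 by (simp add: g_def)
    ultimately show ?thesis unfolding AB by (intro exI[of _ "q - p"] exI[of _ g] conjI)
  qed
qed

text \<open>The pole is at most simple, and the principal part k / d is odd: it would survive,
  doubled, in \<open>f d - f (- d)\<close>.\<close>

lemma rational_bounded_if_even_part:
  assumes B: "B \<noteq> 0" and f: "f = (\<lambda>d. poly A (x0 + d) / poly B (x0 + d))"
    and simple: "bounded_at_0 (\<lambda>d. d * f d)" and odd: "bounded_at_0 (\<lambda>d. f d - f (- d))"
  shows "bounded_at_0 f"
proof -
  obtain k g where g: "isCont g 0" "\<forall>\<^sub>F d in at 0. f d = g d / d ^ k" "k > 0 \<longrightarrow> g 0 \<noteq> 0"
    using rational_pole_order[OF B, of A x0] unfolding f by blast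
  have nz: "\<forall>\<^sub>F d in at (0::real). d \<noteq> 0" by (simp add: eventually_at_filter)
  have lim0: "((\<lambda>d::real. d) \<longlongrightarrow> 0) (at 0)" by (rule tendsto_ident_at)
  consider "k = 0" | "k = 1" | "k \<ge> 2" by linarith
  thus ?thesis
  proof cases
    case 1
    have "bounded_at_0 g" using g(1) by (rule bounded_at_0_isCont)
    moreover have "\<forall>\<^sub>F d in at 0. g d = f d" using g(2) by eventually_elim (simp add: 1)
    ultimately show ?thesis using bounded_at_0_cong by blast
  next
    case 2
    have gm: "\<forall>\<^sub>F d in at 0. f (- d) = g (- d) / (- d) ^ k"
      using g(2) filterlim_minus_at_0 unfolding filterlim_iff by blast
    have "((\<lambda>d. (f d - f (- d)) * d) \<longlongrightarrow> 0) (at 0)" using odd lim0 by (rule bounded_at_0_tendsto_0)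
    moreover have "\<forall>\<^sub>F d in at 0. (f d - f (- d)) * d = g d + g (- d)"
      using g(2) gm nz by eventually_elim (simp add: 2 field_simps)
    ultimately have "((\<lambda>d. g d + g (- d)) \<longlongrightarrow> 0) (at 0)" by (simp add: filterlim_cong)
    moreover have "((\<lambda>d. g d + g (- d)) \<longlongrightarrow> g 0 + g 0) (at 0)"
    proof -
      have "(g \<longlongrightarrow> g 0) (at 0)" using g(1) by (simp add: isCont_def)
      moreover from filterlim_compose[OF this filterlim_minus_at_0] have "((\<lambda>d. g (- d)) \<longlongrightarrow> g 0) (at 0)" .
      ultimately show ?thesis by (rule tendsto_add)
    qed
    ultimately have "g 0 + g 0 = 0" using tendsto_unique[of "at (0::real)"] by force
    thus ?thesis using g(3) 2 by simp
  next
    case 3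
    have "((\<lambda>d. d * f d * d ^ (k - 1)) \<longlongrightarrow> 0) (at 0)"
    proof (rule bounded_at_0_tendsto_0[OF simple])
      have "((\<lambda>d::real. d ^ (k - 1)) \<longlongrightarrow> 0 ^ (k - 1)) (at 0)" by (intro tendsto_intros)
      thus "((\<lambda>d::real. d ^ (k - 1)) \<longlongrightarrow> 0) (at 0)" using 3 by (simp add: power_0_left)
    qed
    moreover have "\<forall>\<^sub>F d in at 0. d * f d * d ^ (k - 1) = g d"
      using g(2) nz
    proof eventually_elim
      case (elim d)
      have "d * d ^ (k - 1) = d ^ k" using 3 by (cases k) auto
      moreover have "d * f d * d ^ (k - 1) = (d * d ^ (k - 1)) * f d" by (simp only: mult_ac)
      ultimately show ?case using elim by simp
    qed
    ultimately have "(g \<longlongrightarrow> 0) (at 0)" by (simp add: filterlim_cong)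
    moreover have "(g \<longlongrightarrow> g 0) (at 0)" using g(1) by (simp add: isCont_def)
    ultimately have "g 0 = 0" using tendsto_unique[of "at (0::real)"] by force
    thus ?thesis using g(3) 3 by simp
  qed
qed

text \<open>An explicit Chinese remainder solution. \<open>R\<close> is 1 at \<open>v\<close> and 0
  on the rest of \<open>W\<close>; the expression \<open>1 - (1 - R ^ k) ^ k\<close> raises both
  congruences to order \<open>k\<close>.\<close>

lemma localising_poly:
  fixes W :: "real set"
  assumes "finite W"
  obtains Q where "[:- v, 1:] ^ k dvd Q - 1" "\<And>w. w \<in> W \<Longrightarrow> w \<noteq> v \<Longrightarrow> [:- w, 1:] ^ k dvd Q"
proof -
  define R where "R = (\<Prod>w\<in>W - {v}. smult (1 / (v - w)) [:- w, 1:])"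
  have Rv: "poly R v = 1" unfolding R_def poly_prod by (rule prod.neutral) (auto simp flip: diff_divide_distrib)
  define Q where "Q = 1 - (1 - R ^ k) ^ k"
  have geo: "x dvd 1 - (1 - x) ^ n" for x :: "real poly" and n
  proof -
    have "[(1 - x) ^ n = 1 ^ n] (mod x)" by (intro cong_pow) (simp add: cong_iff_dvd_diff)
    thus ?thesis by (simp add: cong_iff_dvd_diff dvd_diff_commute)
  qed
  have 1: "[:- v, 1:] ^ k dvd Q - 1"
  proof -
    have "poly (1 - R ^ k) v = 0" by (simp add: Rv)
    hence "[:- v, 1:] dvd 1 - R ^ k" by (simp only: poly_eq_0_iff_dvd)
    hence "[:- v, 1:] ^ k dvd (1 - R ^ k) ^ k" by (rule dvd_power_same)
    thus ?thesis by (simp add: Q_def)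
  qed
  have 2: "[:- w, 1:] ^ k dvd Q" if w: "w \<in> W" "w \<noteq> v" for w
  proof -
    have "poly R w = 0" unfolding R_def poly_prod using assms w by (intro prod_zero) auto
    hence "[:- w, 1:] dvd R" by (simp only: poly_eq_0_iff_dvd)
    hence "[:- w, 1:] ^ k dvd R ^ k" by (rule dvd_power_same)
    also have "R ^ k dvd Q" unfolding Q_def by (rule geo)
    finally show ?thesis .
  qed
  show ?thesis using that 1 2 by blast
qed

text \<open>The hypothesis \<open>poly_windows\<close> allows to separate the points \<open>y - j\<close> by their values \<open>z (z + c)\<close>, so a pole of \<open>T\<^sub>j\<close>
  can only be compensated at a mirror image. Hence all poles of \<open>T\<^sub>j\<close> are simple, and \<open>T_reflect\<close> cancels them in pairs
  in \<open>\<Sum>\<^sub>j T\<^sub>j\<close>.\<close>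

locale windows =
  fixes c :: real and m :: nat and T :: "nat \<Rightarrow> real \<Rightarrow> real" and A B :: "nat \<Rightarrow> real poly"
  assumes T: "\<And>j x. j \<in> {1..m} \<Longrightarrow> T j x = poly (A j) x / poly (B j) x"
    and B: "\<And>j. j \<in> {1..m} \<Longrightarrow> real_split (B j)"
    and poly_windows: "\<And>Q. \<exists>u. MOST y. poly u y = (\<Sum>j=1..m. poly Q ((y - real j) * (y - real j + c)) * T j (y - real j))"
    and T_reflect: "\<And>j. j \<in> {1..m} \<Longrightarrow> MOST x. T j (- x - c) = - T (m + 1 - j) x"
begin

abbreviation th :: "real \<Rightarrow> real" where "th z \<equiv> z * (z + c)"

lemma T_pole: "\<exists>k. \<forall>j\<in>{1..m}. bounded_at_0 (\<lambda>d. d ^ k * T j (z j + d))"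
proof -
  have "\<exists>k. bounded_at_0 (\<lambda>d. d ^ k * T j (z j + d))" if j: "j \<in> {1..m}" for j
  proof -
    obtain k g where g: "isCont g 0" "\<forall>\<^sub>F d in at 0. poly (A j) (z j + d) / poly (B j) (z j + d) = g d / d ^ k"
      using rational_pole_order[OF real_split_nonzero[OF B[OF j]], of "A j" "z j"] by blast
    have nz: "\<forall>\<^sub>F d in at (0::real). d \<noteq> 0" by (simp add: eventually_at_filter)
    have "\<forall>\<^sub>F d in at 0. g d = d ^ k * T j (z j + d)"
      using g(2) nz by eventually_elim (simp add: T[OF j])
    from bounded_at_0_cong[OF this bounded_at_0_isCont[OF g(1)]] show ?thesis by blast
  qed
  then obtain k where k: "\<And>j. j \<in> {1..m} \<Longrightarrow> bounded_at_0 (\<lambda>d. d ^ k j * T j (z j + d))" by metis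
  define K where "K = Max (insert 0 (k ` {1..m}))"
  have "bounded_at_0 (\<lambda>d. d ^ K * T j (z j + d))" if j: "j \<in> {1..m}" for j
  proof -
    have "k j \<le> K" unfolding K_def using j by (intro Max_ge) auto
    hence "(\<lambda>d. d ^ K * T j (z j + d)) = (\<lambda>d. d ^ (K - k j) * (d ^ k j * T j (z j + d)))"
      by (auto simp: mult.assoc[symmetric] simp flip: power_add)
    moreover have "bounded_at_0 (\<lambda>d. d ^ (K - k j))" by (rule bounded_at_0_isCont) simp
    ultimately show ?thesis using bounded_at_0_mult[OF _ k[OF j]] by simp
  qed
  thus ?thesis by blast
qed

text \<open>In \<open>poly_windows\<close> take \<open>Q * G\<close> with \<open>Q\<close>
  localising at \<open>v\<close> to an order beyond all poles. Windows with another value of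
  \<open>th\<close> then become bounded, and on those with value \<open>v\<close> replacing
  \<open>Q\<close> by 1 changes the sum by bounded terms only.\<close>

lemma localised:
  "bounded_at_0 (\<lambda>d. \<Sum>i | i \<in> {1..m} \<and> th (y - real i) = v. poly G (th (y - real i + d)) * T i (y - real i + d))"
proof -
  obtain k where k: "\<And>i. i \<in> {1..m} \<Longrightarrow> bounded_at_0 (\<lambda>d. d ^ k * T i (y - real i + d))"
    using T_pole[of "\<lambda>i. y - real i"] by blast
  obtain Q where Q: "[:- v, 1:] ^ k dvd Q - 1" "\<And>w. w \<in> (\<lambda>i. th (y - real i)) ` {1..m} \<Longrightarrow> w \<noteq> v \<Longrightarrow> [:- w, 1:] ^ k dvd Q"
    using localising_poly[of "(\<lambda>i. th (y - real i)) ` {1..m}" v k] by auto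
  have small: "bounded_at_0 (\<lambda>d. poly P (th (y - real i + d)) * T i (y - real i + d))"
    if i: "i \<in> {1..m}" and P: "[:- th (y - real i), 1:] ^ k dvd P" for P i
  proof -
    let ?z = "y - real i"
    obtain P' where P': "P = [:- th ?z, 1:] ^ k * P'" using P by (elim dvdE)
    have "(\<lambda>d. poly P (th (?z + d)) * T i (?z + d)) = (\<lambda>d. ((2 * ?z + c + d) ^ k * poly P' (th (?z + d))) * (d ^ k * T i (?z + d)))"
    proof
      fix d
      have "th (?z + d) - th ?z = (2 * ?z + c + d) * d" by (simp add: algebra_simps)
      thus "poly P (th (?z + d)) * T i (?z + d) = ((2 * ?z + c + d) ^ k * poly P' (th (?z + d))) * (d ^ k * T i (?z + d))"
        by (simp add: P' power_mult_distrib add.commute)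
    qed
    moreover have "bounded_at_0 (\<lambda>d. (2 * ?z + c + d) ^ k * poly P' (th (?z + d)))"
      by (intro bounded_at_0_isCont continuous_intros)
    ultimately show ?thesis using bounded_at_0_mult[OF _ k[OF i]] by simp
  qed
  let ?F = "\<lambda>P i d. poly P (th (y - real i + d)) * T i (y - real i + d)"
  obtain u where u: "MOST w. poly u w = (\<Sum>j=1..m. poly (Q * G) (th (w - real j)) * T j (w - real j))"
    using poly_windows[of "Q * G"] by (auto simp: algebra_simps)
  have "\<forall>\<^sub>F d in at 0. poly u (d + y) = (\<Sum>j=1..m. poly (Q * G) (th (d + y - real j)) * T j (d + y - real j))"
    by (rule cofinite_imp_at[OF cofinite_shift[OF u, of y]])
  moreover have "bounded_at_0 (\<lambda>d. poly u (d + y))" by (intro bounded_at_0_isCont continuous_intros)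
  ultimately have "bounded_at_0 (\<lambda>d. \<Sum>j=1..m. poly (Q * G) (th (d + y - real j)) * T j (d + y - real j))"
    by (rule bounded_at_0_cong)
  hence tot: "bounded_at_0 (\<lambda>d. \<Sum>j=1..m. ?F (Q * G) j d)"
    by (simp add: algebra_simps)
  let ?I = "{i \<in> {1..m}. th (y - real i) = v}"
  have "bounded_at_0 (\<lambda>d. (\<Sum>j=1..m. ?F (Q * G) j d)
     - (\<Sum>i\<in>{1..m} - ?I. ?F (Q * G) i d)
     - (\<Sum>i\<in>?I. ?F ((Q - 1) * G) i d))" (is "bounded_at_0 ?l")
  proof (intro sum_in_bigo tot big_sum_in_bigo small)
    fix i assume "i \<in> {1..m} - ?I"
    thus "i \<in> {1..m}" "[:- th (y - real i), 1:] ^ k dvd Q * G" using Q(2) by auto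
  next
    fix i assume "i \<in> ?I"
    thus "i \<in> {1..m}" "[:- th (y - real i), 1:] ^ k dvd (Q - 1) * G" using Q(1) by auto
  qed
  also have "?l = (\<lambda>d. \<Sum>i\<in>?I. ?F G i d)"
  proof
    fix d
    have "(\<Sum>j=1..m. ?F (Q * G) j d) - (\<Sum>i\<in>{1..m} - ?I. ?F (Q * G) i d) = (\<Sum>i\<in>?I. ?F (Q * G) i d)"
      by (subst sum.subset_diff[of ?I "{1..m}"]) auto
    thus "?l d = (\<Sum>i\<in>?I. ?F G i d)"
      by (simp add: sum_subtractf[symmetric] algebra_simps)
  qed
  finally show ?thesis by (simp add: conj_commute)
qed

text \<open>A value of \<open>th\<close> is shared by at most two points, \<open>x0\<close> and its
  mirror image \<open>x0 - e\<close>. With \<open>G = 1\<close> the sum of the two terms is bounded.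
  With \<open>G = th - th x0\<close> a second bounded combination arises, and since \<open>e\<close>
  is not 0 the two can be solved for \<open>d * T j\<close>.\<close>

lemma T_local:
  fixes x0 :: real
  defines "e \<equiv> 2 * x0 + c"
  assumes j: "j \<in> {1..m}"
  shows "(\<nexists>i. i \<in> {1..m} \<and> i \<noteq> j \<and> real i = real j + e) \<Longrightarrow> bounded_at_0 (\<lambda>d. T j (x0 + d))"
    and "i \<in> {1..m} \<Longrightarrow> i \<noteq> j \<Longrightarrow> real i = real j + e \<Longrightarrow> bounded_at_0 (\<lambda>d. T j (x0 + d) + T i (x0 - e + d))"
    and "i \<in> {1..m} \<Longrightarrow> i \<noteq> j \<Longrightarrow> real i = real j + e \<Longrightarrow> bounded_at_0 (\<lambda>d. d * T j (x0 + d))"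
proof -
  have th: "th z = th x0 \<longleftrightarrow> z = x0 \<or> z = x0 - e" for z
  proof -
    have "th z - th x0 = (z - x0) * (z - (x0 - e))" by (simp add: e_def algebra_simps)
    thus ?thesis by (metis diff_eq_diff_eq eq_iff_diff_eq_0 mult_eq_0_iff)
  qed
  have I: "{i. i \<in> {1..m} \<and> th (x0 + real j - real i) = th x0} = {i \<in> {1..m}. i = j \<or> real i = real j + e}"
    unfolding th by (auto simp: algebra_simps)
  note loc = localised[where y = "x0 + real j" and v = "th x0", unfolded I]
  {
    assume "\<nexists>i. i \<in> {1..m} \<and> i \<noteq> j \<and> real i = real j + e"
    hence "{i \<in> {1..m}. i = j \<or> real i = real j + e} = {j}" using j by auto
    with loc[of 1] show "bounded_at_0 (\<lambda>d. T j (x0 + d))" by simp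
  }
  assume i: "i \<in> {1..m}" "i \<noteq> j" "real i = real j + e"
  have set: "{i \<in> {1..m}. i = j \<or> real i = real j + e} = {j, i}" using i j by auto
  have ei: "x0 + real j - real i = x0 - e" using i by simp
  have loc': "bounded_at_0 (\<lambda>d. poly G (th (x0 + d)) * T j (x0 + d) + poly G (th (x0 - e + d)) * T i (x0 - e + d))" for G
    using loc[of G] i(2) unfolding set by (simp add: ei)
  show s: "bounded_at_0 (\<lambda>d. T j (x0 + d) + T i (x0 - e + d))"
    using loc'[of 1] by simp
  have e0: "e \<noteq> 0" using i by auto
  have w: "bounded_at_0 (\<lambda>d. d * (e + d) * T j (x0 + d) + d * (d - e) * T i (x0 - e + d))"
  proof -
    have "th (x0 + d) - th x0 = d * (e + d)" "th (x0 - e + d) - th x0 = d * (d - e)" for d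
      by (simp_all add: e_def algebra_simps)
    thus ?thesis using loc'[of "[:- th x0, 1:]"] by simp
  qed
  have p: "bounded_at_0 (\<lambda>d. poly q d * (T j (x0 + d) + T i (x0 - e + d)))" for q
    by (intro bounded_at_0_mult bounded_at_0_poly s)
  have "bounded_at_0 (\<lambda>d. 1 / (2 * e) * ((d * (e + d) * T j (x0 + d) + d * (d - e) * T i (x0 - e + d))
     - poly [:0, 0, 1:] d * (T j (x0 + d) + T i (x0 - e + d)) + poly [:0, e:] d * (T j (x0 + d) + T i (x0 - e + d))))"
    (is "bounded_at_0 ?l")
    by (intro bounded_at_0_mult sum_in_bigo w p) (rule bounded_at_0_isCont, simp)
  also have "?l = (\<lambda>d. d * T j (x0 + d))"
    using e0 by (intro ext) (simp add: field_simps)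
  finally show "bounded_at_0 (\<lambda>d. d * T j (x0 + d))" .
qed

theorem sum_T_polynomial: "\<exists>M. MOST x. poly M x = (\<Sum>j=1..m. T j x)"
proof -
  define BB where "BB = (\<Prod>j=1..m. B j)"
  define AA where "AA = (\<Sum>j=1..m. A j * (\<Prod>i\<in>{1..m} - {j}. B i))"
  have BB: "real_split BB" unfolding BB_def by (intro real_split_prod B)
  hence BBnz: "BB \<noteq> 0" by (rule real_split_nonzero)
  define M where "M = (\<lambda>x. \<Sum>j=1..m. T j x)"
  have quot: "poly BB x \<noteq> 0 \<Longrightarrow> M x = poly AA x / poly BB x" for x
  proof -
    assume nz: "poly BB x \<noteq> 0"
    have "T j x = poly (A j * (\<Prod>i\<in>{1..m} - {j}. B i)) x / poly BB x" if j: "j \<in> {1..m}" for j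
    proof -
      have "BB = B j * (\<Prod>i\<in>{1..m} - {j}. B i)" unfolding BB_def using j by (subst prod.remove[of _ j]) auto
      thus ?thesis using nz by (simp add: T[OF j])
    qed
    thus ?thesis unfolding M_def AA_def poly_sum sum_divide_distrib by (intro sum.cong refl) auto
  qed
  have cof: "MOST x. poly BB x \<noteq> 0" using poly_roots_finite[OF BBnz] by (simp add: eventually_cofinite)
  have "BB dvd AA"
  proof (rule split_dvd_if_bounded[OF BB])
    fix x0 :: real
    let ?q = "\<lambda>d. poly AA (x0 + d) / poly BB (x0 + d)"
    define e where "e = 2 * x0 + c"
    have evq: "\<forall>\<^sub>F d in at 0. M (x0 + d) = ?q d"
      using cofinite_imp_at[OF cofinite_shift[OF cof, of x0], of 0] by eventually_elim (simp add: quot add.commute)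
    have evqm: "\<forall>\<^sub>F d in at 0. M (x0 + - d) = ?q (- d)"
      using evq filterlim_minus_at_0 unfolding filterlim_iff by blast
    define J where "J = {j \<in> {1..m}. \<exists>i. i \<in> {1..m} \<and> i \<noteq> j \<and> real i = real j + e}"
    have out: "bounded_at_0 (\<lambda>d. T j (x0 + d))" if "j \<in> {1..m} - J" for j
      using that T_local(1)[of j x0] by (auto simp: J_def e_def)
    have simple: "bounded_at_0 (\<lambda>d. d * T j (x0 + d))" if j: "j \<in> {1..m}" for j
    proof (cases "j \<in> J")
      case True
      thus ?thesis using T_local(3)[of j _ x0] j by (auto simp: J_def e_def)
    next
      case False
      hence "bounded_at_0 (\<lambda>d. T j (x0 + d))" using out j by auto
      thus ?thesis by (intro bounded_at_0_mult[OF bounded_at_0_isCont]) auto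
    qed
    \<comment> \<open>On \<open>J\<close> the number \<open>e\<close> is an integer and
      \<open>j + e\<close> is the column mirrored to \<open>j\<close>; \<open>\<phi> j\<close> is
      the index of that column counted from the other end.\<close>
    define \<phi> where "\<phi> = (\<lambda>j. nat (int m + 1 - int j - \<lfloor>e\<rfloor>))"
    have J: "\<phi> j \<in> J \<and> \<phi> (\<phi> j) = j \<and> real (m + 1 - \<phi> j) = real j + e \<and> m + 1 - \<phi> j \<in> {1..m} \<and> m + 1 - \<phi> j \<noteq> j" if jJ: "j \<in> J" for j
    proof -
      obtain i where i: "i \<in> {1..m}" "i \<noteq> j" "real i = real j + e" and j: "j \<in> {1..m}" using jJ by (auto simp: J_def)
      have e: "e = real_of_int (int i - int j)" using i by simp
      have fl: "\<lfloor>e\<rfloor> = int i - int j" unfolding e by (rule floor_of_int)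
      have ph: "\<phi> j = m + 1 - i" using i by (simp add: \<phi>_def fl)
      have "real (m + 1 - j) = real (m + 1 - i) + e" using i j by (simp add: of_nat_diff)
      moreover have "m + 1 - j \<in> {1..m}" "m + 1 - i \<in> {1..m}" "m + 1 - j \<noteq> m + 1 - i" using i j by auto
      ultimately have 1: "\<phi> j \<in> J" unfolding J_def ph by blast
      have "int (m + 1 - i) = int m + 1 - int i" using i by (simp add: of_nat_diff)
      hence 2: "\<phi> (\<phi> j) = j" unfolding ph by (simp only: \<phi>_def fl)
      have 3: "m + 1 - (m + 1 - i) = i" using i by simp
      show ?thesis using 1 2 i unfolding ph 3 by simp
    qed
    have pair: "bounded_at_0 (\<lambda>d. T j (x0 + d) - T (\<phi> j) (x0 - d))" if jJ: "j \<in> J" for j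
    proof -
      define i where "i = m + 1 - \<phi> j"
      have i: "i \<in> {1..m}" "i \<noteq> j" "real i = real j + (2 * x0 + c)" "m + 1 - i = \<phi> j"
        using J[OF jJ] by (auto simp: i_def e_def J_def)
      have j: "j \<in> {1..m}" using jJ by (simp add: J_def)
      note cofinite_reflect[OF T_reflect[OF i(1)], of x0]
      from cofinite_imp_at[OF this, of 0]
      have ev: "\<forall>\<^sub>F d in at 0. T j (x0 + d) + T i (x0 - (2 * x0 + c) + d) = T j (x0 + d) - T (\<phi> j) (x0 - d)"
        unfolding i(4) by eventually_elim (simp add: algebra_simps)
      show ?thesis
        by (rule bounded_at_0_cong[OF ev T_local(2)[OF j i(1,2,3)]])
    qed
    \<comment> \<open>A simple pole of \<open>M\<close> would double in this difference. Terms in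
      \<open>J\<close> cancel in pairs under \<open>\<phi>\<close>, the others are bounded on both
      sides.\<close>
    have "bounded_at_0 (\<lambda>d. M (x0 + d) - M (x0 - d))"
    proof -
      have split: "M x = (\<Sum>j\<in>J. T j x) + (\<Sum>j\<in>{1..m}-J. T j x)" for x
        unfolding M_def by (subst sum.subset_diff[of J]) (auto simp: J_def)
      have reidx: "(\<Sum>j\<in>J. T j x) = (\<Sum>j\<in>J. T (\<phi> j) x)" for x
        by (rule sum.reindex_bij_witness[of _ \<phi> \<phi>]) (use J in auto)
      have "bounded_at_0 (\<lambda>d. (\<Sum>j\<in>J. T j (x0 + d) - T (\<phi> j) (x0 - d)) + (\<Sum>j\<in>{1..m}-J. T j (x0 + d)) - (\<Sum>j\<in>{1..m}-J. T j (x0 + - d)))"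
        (is "bounded_at_0 ?l")
        by (intro sum_in_bigo big_sum_in_bigo pair out bounded_at_0_reflect[where f = "\<lambda>d. T _ (x0 + d)"])
      also have "?l = (\<lambda>d. M (x0 + d) - M (x0 - d))"
        by (intro ext) (simp add: split sum_subtractf reidx[symmetric])
      finally show ?thesis .
    qed
    moreover have "\<forall>\<^sub>F d in at 0. M (x0 + d) - M (x0 - d) = ?q d - ?q (- d)"
      using evq evqm by eventually_elim simp
    ultimately have odd: "bounded_at_0 (\<lambda>d. ?q d - ?q (- d))"
      by (rule bounded_at_0_cong[rotated])
    have "bounded_at_0 (\<lambda>d. d * M (x0 + d))"
      unfolding M_def sum_distrib_left by (intro big_sum_in_bigo simple)
    moreover have "\<forall>\<^sub>F d in at 0. d * M (x0 + d) = d * (?q d)"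
      using evq by eventually_elim simp
    ultimately have "bounded_at_0 (\<lambda>d. d * (?q d))"
      by (rule bounded_at_0_cong[rotated])
    thus "bounded_at_0 (\<lambda>d. ?q d)"
      using odd by (rule rational_bounded_if_even_part[OF BBnz refl])
  qed
  then obtain P where P: "AA = BB * P" by (elim dvdE)
  have "MOST x. poly P x = M x" using cof by eventually_elim (simp add: quot P)
  thus ?thesis unfolding M_def by blast
qed

end

section \<open>The rational function \<open>S\<close>\<close>

lemma real_split_pochhammer: "degree p = 1 \<Longrightarrow> p \<noteq> 0 \<Longrightarrow> (pochhammer p n :: real poly) \<noteq> 0"
proof (induction n)
  case (Suc n)
  have "p + of_nat n \<noteq> 0"
  proof
    assume "p + of_nat n = 0"
    hence "p = - of_nat n" by (simp add: eq_neg_iff_add_eq_0)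
    thus False using Suc.prems by (simp add: of_nat_poly)
  qed
  thus ?case using Suc by (simp add: pochhammer_Suc)
qed simp

lemma cofinite_nonzero: "p \<noteq> 0 \<Longrightarrow> MOST y. poly p y \<noteq> (0 :: real)"
  using poly_roots_finite[of p] by (simp add: eventually_cofinite)

lemma poly_col_pt: "poly (col_pt r) y = y - real (Suc r)"
  by (simp add: col_pt_def)

lemma poly_ref_pt: "poly (ref_pt c r) y = real (Suc r) - c - y"
  by (simp add: ref_pt_def)

lemma poly_theta_pt: "poly (theta_pt c r) y = (y - real (Suc r)) * (y - real (Suc r) + c)"
  by (simp add: theta_pt_def poly_col_pt)

lemma poly_mirror_lin: "poly (mirror_lin c s) y = 2 * y + c - real s"
  by (simp add: mirror_lin_def)

lemma poly_col_weight:
  assumes "r < m"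
  shows "pochhammer (y - real m + \<beta>) (m - Suc r) * pochhammer (y - real r + c - \<beta>) r = (-1) ^ r * poly (col_weight c m [:\<beta>, 1:] r) y"
proof -
  have "pochhammer (y - real m + \<beta>) (m - Suc r) = (\<Prod>i\<in>{r<..<m}. \<beta> + (y - real (Suc i)))"
    unfolding pochhammer_prod
    by (rule prod.reindex_bij_witness[of _ "\<lambda>i. m - Suc i" "\<lambda>i. m - Suc i"]) (use assms in \<open>auto simp: of_nat_diff algebra_simps\<close>)
  moreover have "pochhammer (y - real r + c - \<beta>) r = (-1) ^ r * (\<Prod>i<r. \<beta> + (real (Suc i) - c - y))"
  proof -
    have "pochhammer (y - real r + c - \<beta>) r = (\<Prod>i<r. (-1) * (\<beta> + (real (Suc i) - c - y)))"
      unfolding pochhammer_prod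
      by (rule prod.reindex_bij_witness[of _ "\<lambda>i. r - Suc i" "\<lambda>i. r - Suc i"]) (auto simp: of_nat_diff algebra_simps)
    thus ?thesis by (simp only: prod.distrib prod_constant card_lessThan)
  qed
  ultimately show ?thesis
    by (simp add: col_weight_def poly_prod poly_pcompose poly_col_pt poly_ref_pt mult_ac del: of_nat_Suc)
qed

locale casorati_rows =
  fixes a b N :: real and U :: "nat \<Rightarrow> nat set"
  assumes row_types: "\<And>l. l < size_U U \<Longrightarrow> row_t U (Suc l) \<in> {1, 2, 3, 4}"
begin

abbreviation "c \<equiv> a + b + 1"
abbreviation "m \<equiv> size_U U"
text \<open>These two factors account for numerators and denominators alike, since at the mirror
  image \<open>- z - c\<close> they take the values \<open>- (z + a + b + N + 1)\<close> and
  \<open>- (z + a)\<close>.\<close>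

abbreviation "al \<equiv> [:- N, 1:] :: real poly"
abbreviation "be \<equiv> [:b + 1, 1:] :: real poly"
definition "rtyp l = row_t U (Suc l)"
text \<open>The first quotient in \<open>\<xi>\<close>, with \<open>x - N\<close> on top, occurs in
  types 1 and 2, the second, with \<open>x + b + 1\<close> on top, in types 2 and 4.\<close>

definition "ty12 l \<longleftrightarrow> rtyp l \<in> {1, 2}"
definition "ty24 l \<longleftrightarrow> rtyp l \<in> {2, 4}"
abbreviation "k12 \<equiv> card {l. l < m \<and> ty12 l}"
abbreviation "k24 \<equiv> card {l. l < m \<and> ty24 l}"
definition "den12 = pochhammer [:a + b + N + 2 - real m, 1:] (m - 1)"
definition "den24 = pochhammer [:a + 1 - real m, 1:] (m - 1)"
definition sgn_row :: "nat \<Rightarrow> real" where "sgn_row l = (if rtyp l \<in> {1, 4} then (-1) ^ (m - 1) else 1)"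
definition den_row :: "nat \<Rightarrow> real poly" where "den_row l = (if ty12 l then den12 else 1) * (if ty24 l then den24 else 1)"
text \<open>This is \<open>\<sigma> a b (y - (m - 1) / 2)\<close>. It is odd under the reflection
  \<open>y \<mapsto> m + 1 - c - y\<close>, which is what makes the functions \<open>M_fun\<close>
  antisymmetric and the eigenvalue polynomial symmetric.\<close>

definition "mid = [:real m - a - b, - 2:]"
abbreviation "V \<equiv> mirror_prod c m"
abbreviation "red Q \<equiv> reduced_det c m al be ty12 ty24 Q"
abbreviation "com \<equiv> common_weight c m al k12 * common_weight c m be k24"

lemma rtyp_range: "l < m \<Longrightarrow> rtyp l \<in> {1, 2, 3, 4}"
  using row_types by (simp add: rtyp_def)

lemma \<xi>_col_weight:
  assumes l: "l < m" and r: "r < m" and nz: "poly den12 y \<noteq> 0" "poly den24 y \<noteq> 0"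
  shows "\<xi> a b N (rtyp l) (y - real (Suc r)) (m - Suc r) * poly (den_row l) y =
     sgn_row l * poly ((if ty12 l then col_weight c m al r else 1) * (if ty24 l then col_weight c m be r else 1)) y"
proof -
  let ?k = "m - Suc r"
  let ?n1 = "pochhammer (y - real m - N) ?k" and ?p1 = "pochhammer (y - real m + a + b + N + 2) ?k"
    and ?n2 = "pochhammer (y - real m + b + 1) ?k" and ?p2 = "pochhammer (y - real m + a + 1) ?k"
    and ?w1 = "poly (col_weight c m al r) y" and ?w2 = "poly (col_weight c m be r) y"
  have k: "y - real (Suc r) - real ?k = y - real m" using r by (simp add: of_nat_diff)
  have mk: "m - 1 = ?k + r" using r by simp
  \<comment> \<open>The sign in \<open>\<xi>\<close> for types 1 and 4 and the sign from reflecting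
    \<open>r\<close> factors combine to one that depends on the row only.\<close>
  have sg: "(-1::real) ^ (m - 1) = (-1) ^ ?k * (-1) ^ r" unfolding mk power_add ..
  have sq: "(-1::real) ^ r * (-1) ^ r = 1" by (simp flip: power_mult_distrib)
  have d12: "poly den12 y = ?p1 * pochhammer (y - real r + c - (- N)) r"
  proof -
    have "poly den12 y = pochhammer (y - real m + a + b + N + 2) (?k + r)"
      unfolding den12_def poly_pochhammer mk by (simp add: algebra_simps)
    moreover have "y - real m + a + b + N + 2 + real ?k = y - real r + c - (- N)" using r by (simp add: of_nat_diff)
    ultimately show ?thesis by (simp only: pochhammer_split)
  qed
  have d24: "poly den24 y = ?p2 * pochhammer (y - real r + c - (b + 1)) r"
  proof -
    have "poly den24 y = pochhammer (y - real m + a + 1) (?k + r)"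
      unfolding den24_def poly_pochhammer mk by (simp add: algebra_simps)
    moreover have "y - real m + a + 1 + real ?k = y - real r + c - (b + 1)" using r by (simp add: of_nat_diff)
    ultimately show ?thesis by (simp only: pochhammer_split)
  qed
  have nz': "?p1 \<noteq> 0" "?p2 \<noteq> 0"
    using nz unfolding d12 d24 by auto
  have w12: "?n1 * pochhammer (y - real r + c - (- N)) r = (-1) ^ r * ?w1"
    using poly_col_weight[OF r, of y "- N" c] by simp
  have w24: "?n2 * pochhammer (y - real r + c - (b + 1)) r = (-1) ^ r * ?w2"
    using poly_col_weight[OF r, of y "b + 1" c] by (simp add: add_ac)
  have q12: "?n1 / ?p1 * poly den12 y = (-1) ^ r * ?w1"
    unfolding d12 using nz'(1) w12 by simp
  have q24: "?n2 / ?p2 * poly den24 y = (-1) ^ r * ?w2"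
    unfolding d24 using nz'(2) w24 by simp
  consider "rtyp l = 1" | "rtyp l = 2" | "rtyp l = 3" | "rtyp l = 4" using rtyp_range[OF l] by auto
  thus ?thesis
  proof cases
    case 1
    have "\<xi> a b N (rtyp l) (y - real (Suc r)) ?k * poly (den_row l) y =
       (-1) ^ ?k * (?n1 / ?p1 * poly den12 y)"
      unfolding \<xi>_def \<xi>_num_def \<xi>_den_def k den_row_def ty12_def ty24_def 1 by simp
    thus ?thesis unfolding q12 by (simp add: 1 ty12_def ty24_def sgn_row_def sg[unfolded One_nat_def])
  next
    case 2
    have "\<xi> a b N (rtyp l) (y - real (Suc r)) ?k * poly (den_row l) y =
       (?n1 / ?p1 * poly den12 y) *
       (?n2 / ?p2 * poly den24 y)"
      unfolding \<xi>_def \<xi>_num_def \<xi>_den_def k den_row_def ty12_def ty24_def 2 by (simp add: mult_ac)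
    also have "\<dots> = ((-1) ^ r * (-1) ^ r) * (?w1 * ?w2)"
      unfolding q12 q24 by (simp only: mult_ac)
    finally show ?thesis by (simp add: 2 ty12_def ty24_def sgn_row_def sq)
  next
    case 3
    thus ?thesis by (simp add: \<xi>_def \<xi>_num_def \<xi>_den_def den_row_def ty12_def ty24_def sgn_row_def)
  next
    case 4
    have "\<xi> a b N (rtyp l) (y - real (Suc r)) ?k * poly (den_row l) y =
       (-1) ^ ?k * (?n2 / ?p2 * poly den24 y)"
      unfolding \<xi>_def \<xi>_num_def \<xi>_den_def k den_row_def ty12_def ty24_def 4 by simp
    thus ?thesis unfolding q24 by (simp add: 4 ty12_def ty24_def sgn_row_def sg[unfolded One_nat_def])
  qed
qed

text \<open>The weights \<open>\<xi>\<close> stay while the other factors are free. Later a row is a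
  polynomial in \<open>\<theta>\<close>, a power of the column point or a unit vector.\<close>

definition cdet :: "real \<Rightarrow> (nat \<Rightarrow> nat \<Rightarrow> real) \<Rightarrow> real" where
  "cdet y q = Determinant.det (mat m m (\<lambda>(l, r). \<xi> a b N (rtyp l) (y - real (Suc r)) (m - Suc r) * q l r))"

definition sgn_all :: real where "sgn_all = (\<Prod>l<m. sgn_row l)"

lemma sgn_all_sq: "sgn_all * sgn_all = 1"
proof -
  have "sgn_row l * sgn_row l = 1" for l by (simp add: sgn_row_def flip: power_mult_distrib)
  thus ?thesis by (simp add: sgn_all_def prod.distrib[symmetric])
qed

lemma den_row_prod: "(\<Prod>l<m. den_row l) = den12 ^ k12 * den24 ^ k24"
proof -
  have "(\<Prod>l<m. if P l then x else 1) = x ^ card {l. l < m \<and> P l}" for x :: "real poly" and P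
  proof -
    have "(\<Prod>l<m. if P l then x else 1) = (\<Prod>l\<in>{l. l < m \<and> P l}. x)"
      by (rule prod.mono_neutral_cong_right) auto
    thus ?thesis by simp
  qed
  thus ?thesis by (simp add: den_row_def prod.distrib)
qed

lemma cdet_reduced:
  assumes nz: "poly den12 y \<noteq> 0" "poly den24 y \<noteq> 0"
  shows "cdet y (\<lambda>l r. poly (Q l r) y) * poly (den12 ^ k12 * den24 ^ k24) y = sgn_all * poly (com * red Q) y"
proof -
  let ?P = "{\<pi>. \<pi> permutes {0..<m}}" and ?x = "\<lambda>l r. \<xi> a b N (rtyp l) (y - real (Suc r)) (m - Suc r)" and ?q = "\<lambda>l r. poly (Q l r) y"
  let ?w = "\<lambda>l r. (if ty12 l then col_weight c m al r else 1) * (if ty24 l then col_weight c m be r else 1)"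
  have "cdet y ?q * poly (\<Prod>l<m. den_row l) y =
     (\<Sum>\<pi>\<in>?P. of_int (sign \<pi>) * (\<Prod>l<m. ?x l (\<pi> l) * poly (den_row l) y * ?q l (\<pi> l)))"
  proof -
    have "cdet y ?q = (\<Sum>\<pi>\<in>?P. of_int (sign \<pi>) * (\<Prod>l<m. ?x l (\<pi> l) * ?q l (\<pi> l)))"
      unfolding cdet_def Determinant.det_def
      by (auto simp: lessThan_atLeast0 dest: permutes_in_image intro!: sum.cong prod.cong)
    thus ?thesis unfolding poly_prod
      by (simp only: sum_distrib_right) (intro sum.cong refl, simp only: prod.distrib mult_ac)
  qed
  also have "\<dots> = (\<Sum>\<pi>\<in>?P. of_int (sign \<pi>) * (\<Prod>l<m. sgn_row l * (poly (?w l (\<pi> l)) y * ?q l (\<pi> l))))"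
  proof (rule sum.cong[OF refl], goal_cases)
    case (1 \<pi>)
    hence \<pi>: "\<pi> permutes {0..<m}" by simp
    have "(\<Prod>l<m. ?x l (\<pi> l) * poly (den_row l) y * ?q l (\<pi> l)) =
        (\<Prod>l<m. sgn_row l * (poly (?w l (\<pi> l)) y * ?q l (\<pi> l)))"
    proof (rule prod.cong[OF refl], goal_cases)
      case (1 l)
      hence l: "l < m" and p: "\<pi> l < m" using permutes_in_image[OF \<pi>, of l] by auto
      show ?case
        unfolding \<xi>_col_weight[OF l p nz] by (simp only: mult.assoc)
    qed
    thus ?case by simp
  qed
  also have "\<dots> = sgn_all * (\<Sum>\<pi>\<in>?P. of_int (sign \<pi>) * (\<Prod>l<m. poly (?w l (\<pi> l) * Q l (\<pi> l)) y))"
    unfolding prod.distrib sgn_all_def sum_distrib_left poly_mult by (intro sum.cong refl) (simp only: mult_ac)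
  also have "(\<Sum>\<pi>\<in>?P. of_int (sign \<pi>) * (\<Prod>l<m. poly (?w l (\<pi> l) * Q l (\<pi> l)) y)) = poly (weighted_det c m al be ty12 ty24 Q) y"
    unfolding weighted_det_def Determinant.det_def
    by (auto simp: poly_sum poly_prod of_int_poly lessThan_atLeast0 dest: permutes_in_image intro!: sum.cong prod.cong)
  finally show ?thesis unfolding den_row_prod weighted_det_reduced .
qed

lemma den_nonzero: "den12 \<noteq> 0" "den24 \<noteq> 0"
  unfolding den12_def den24_def by (intro real_split_pochhammer; simp)+

lemma com_nonzero: "com \<noteq> 0"
proof -
  have "pcompose [:\<beta>, 1:] (col_pt i) \<noteq> 0" "pcompose [:\<beta>, 1:] (ref_pt c i) \<noteq> 0" for \<beta> i
    by (simp_all add: col_pt_def ref_pt_def pcompose_pCons)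
  thus ?thesis by (auto simp: common_weight_def prod_zero_iff)
qed

text \<open>\<open>S\<close> is designed so that \<open>S * cdet\<close> becomes
  \<open>mid * red / V\<close>: it cancels the common weights, restores the denominators and divides
  by all mirror factors.\<close>

definition S_num :: "real poly" where "S_num = smult sgn_all (mid * (den12 ^ k12 * den24 ^ k24))"
definition S_den :: "real poly" where "S_den = com * V"
definition S :: "real \<Rightarrow> real" where "S y = poly S_num y / poly S_den y"

lemma S_den_nonzero: "S_den \<noteq> 0"
  unfolding S_den_def using com_nonzero mirror_prod_nonzero by simp

text \<open>The exceptional points are the zeros of denominators, common weights and mirror factors;
  one finite set thus serves all \<open>Q\<close>.\<close>

lemma S_cdet:
  "MOST y. \<forall>Q. S y * cdet y (\<lambda>l r. poly (Q l r) y) = poly mid y * poly (red Q) y / poly V y"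
  using cofinite_nonzero[OF den_nonzero(1)] cofinite_nonzero[OF den_nonzero(2)] cofinite_nonzero[OF com_nonzero]
    cofinite_nonzero[OF mirror_prod_nonzero[of c m]]
proof eventually_elim
  case (elim y)
  show ?case
  proof
    fix Q
    note e = cdet_reduced[OF elim(1,2), of Q]
    have "S y * cdet y (\<lambda>l r. poly (Q l r) y) = sgn_all * poly mid y * (cdet y (\<lambda>l r. poly (Q l r) y) * poly (den12 ^ k12 * den24 ^ k24) y) / poly (com * V) y"
      unfolding S_def S_num_def S_den_def by simp
    also have "\<dots> = (sgn_all * sgn_all) * poly mid y * poly com y * poly (red Q) y / (poly com y * poly V y)"
      unfolding e by simp
    also have "\<dots> = poly mid y * poly (red Q) y / poly V y"
      unfolding sgn_all_sq using elim(3) by simp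
    finally show "S y * cdet y (\<lambda>l r. poly (Q l r) y) = poly mid y * poly (red Q) y / poly V y" .
  qed
qed

section \<open>Determinants whose rows are polynomials in \<open>\<theta>\<close>\<close>

definition theta_rows :: "(nat \<Rightarrow> real poly) \<Rightarrow> nat \<Rightarrow> nat \<Rightarrow> real poly" where
  "theta_rows R l r = pcompose (R l) (theta_pt c r)"

text \<open>The division is exact by \<open>mirror_prod_dvd\<close>. For \<open>R = Yl\<close> this
  is the polynomial to which \<open>S * \<Omega>\<close> reduces.\<close>

definition upoly :: "(nat \<Rightarrow> real poly) \<Rightarrow> real poly" where
  "upoly R = mid * (red (theta_rows R) div V)"

lemma poly_upoly: "poly V y \<noteq> 0 \<Longrightarrow> poly mid y * poly (red (theta_rows R)) y / poly V y = poly (upoly R) y"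
proof -
  assume nz: "poly V y \<noteq> 0"
  have "V dvd red (theta_rows R)" unfolding theta_rows_def[abs_def] by (rule mirror_prod_dvd)
  hence "red (theta_rows R) = V * (red (theta_rows R) div V)" by simp
  hence "poly (red (theta_rows R)) y = poly V y * poly (red (theta_rows R) div V) y" by (metis poly_mult)
  thus ?thesis using nz by (simp add: upoly_def)
qed

definition Yl :: "nat \<Rightarrow> real poly" where "Yl l = Y_row a b N U (Suc l)"

lemma \<Omega>_cdet: "\<Omega> a b N U y = cdet y (\<lambda>l r. poly (theta_rows Yl l r) y)"
  unfolding \<Omega>_casorati casorati_def mat1_def cdet_def
  by (rule arg_cong[where f = Determinant.det], rule eq_matI)
     (auto simp: entry_def rtyp_def Yl_def theta_rows_def poly_pcompose poly_theta_pt \<theta>_def algebra_simps)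

lemma S_\<Omega>: "MOST y. S y * \<Omega> a b N U y = poly (upoly Yl) y"
  using S_cdet cofinite_nonzero[OF mirror_prod_nonzero[of c m]]
  by eventually_elim (simp add: \<Omega>_cdet poly_upoly)

text \<open>A unit vector in row \<open>h\<close> turns cofactors into values of \<open>red\<close>,
  so the machinery of weighted determinants applies to the minors in \<open>M_fun\<close>.\<close>

definition unit_row :: "nat \<Rightarrow> nat \<Rightarrow> nat \<Rightarrow> nat \<Rightarrow> real poly" where
  "unit_row h j l r = (if l = h then if r = j then 1 else 0 else theta_rows Yl l r)"

lemma red_row_expand:
  assumes h: "h < m"
  shows "red (\<lambda>l r. if l = h then f r else theta_rows Yl l r) = (\<Sum>j<m. f j * red (unit_row h j))"
proof -
  have "(\<Sum>j<m. f j * (\<Prod>l<m. unit_row h j l (\<pi> l))) = (\<Prod>l<m. if l = h then f (\<pi> l) else theta_rows Yl l (\<pi> l))"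
    if p: "\<pi> permutes {0..<m}" for \<pi>
  proof -
    have ph: "\<pi> h < m" using permutes_in_image[OF p, of h] h by simp
    have 1: "(\<Prod>l<m. unit_row h j l (\<pi> l)) = (if \<pi> h = j then 1 else 0) * (\<Prod>l\<in>{..<m} - {h}. theta_rows Yl l (\<pi> l))" for j
      using h by (subst prod.remove[of _ h]) (auto simp: unit_row_def intro!: prod.cong)
    have 2: "(\<Prod>l<m. if l = h then f (\<pi> l) else theta_rows Yl l (\<pi> l)) = f (\<pi> h) * (\<Prod>l\<in>{..<m} - {h}. theta_rows Yl l (\<pi> l))"
      using h by (subst prod.remove[of _ h]) (auto intro!: prod.cong)
    have "(\<Sum>j<m. f j * (if \<pi> h = j then 1 else 0)) = f (\<pi> h)" using ph by (simp add: if_distrib sum.delta cong: if_cong)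
    thus ?thesis unfolding 1 2 by (simp add: sum_distrib_right[symmetric] mult.assoc[symmetric])
  qed
  hence "red (\<lambda>l r. if l = h then f r else theta_rows Yl l r) = (\<Sum>\<pi> | \<pi> permutes {0..<m}. of_int (sign \<pi>) *
     (left_weight c m al ty12 \<pi> * left_weight c m be ty24 \<pi> * (\<Sum>j<m. f j * (\<Prod>l<m. unit_row h j l (\<pi> l)))))"
    unfolding reduced_det_def by (intro sum.cong refl) simp
  also have "\<dots> = (\<Sum>j<m. f j * red (unit_row h j))"
    unfolding reduced_det_def sum_distrib_left by (subst sum.swap) (intro sum.cong refl, simp only: mult_ac)
  finally show ?thesis .
qed

definition Tj :: "nat \<Rightarrow> nat \<Rightarrow> real \<Rightarrow> real" where
  "Tj h j x = poly mid (x + real j) * poly (red (unit_row h (j - 1))) (x + real j) / poly V (x + real j)"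

text \<open>The sign, the value of \<open>\<xi>\<close> and the minor in one summand of
  \<open>M_fun\<close> are together the expansion of \<open>cdet\<close> along a row with a single
  nonzero entry.\<close>

lemma M_fun_windows:
  assumes h: "h < m"
  shows "MOST x. M_fun a b N U S (Suc h) x = (\<Sum>j=1..m. Tj h j x)"
proof -
  have "MOST x. \<forall>j\<in>{1..m}. \<forall>Q. S (x + real j) * cdet (x + real j) (\<lambda>l r. poly (Q l r) (x + real j)) = poly mid (x + real j) * poly (red Q) (x + real j) / poly V (x + real j)"
    using cofinite_shift[OF S_cdet] by (simp add: eventually_ball_finite_distrib)
  thus ?thesis
  proof eventually_elim
    case (elim x)
    show ?case unfolding M_fun_def Let_def
    proof (rule sum.cong[OF refl], goal_cases)
      case j: (1 j)
      let ?y = "x + real j"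
      let ?C = "mat m m (\<lambda>(l, r). \<xi> a b N (rtyp l) (?y - real (Suc r)) (m - Suc r) * poly (unit_row h (j - 1) l r) ?y)"
      let ?W = "mat1 m (\<lambda>l r. \<xi> a b N (row_t U l) (?y - real r) (m - r) * poly (Y_row a b N U l) (\<theta> a b (?y - real r)))"
      have C: "?C \<in> carrier_mat m m" by simp
      have del: "mat_delete ?C h (j - 1) = mat_delete ?W h (j - 1)"
        using h by (intro eq_matI)
          (auto simp: mat_delete_def mat1_def unit_row_def theta_rows_def poly_pcompose poly_theta_pt \<theta>_def Yl_def rtyp_def algebra_simps)
      let ?d = "cdet ?y (\<lambda>l r. poly (unit_row h (j - 1) l r) ?y)" and ?e = "\<xi> a b N (row_t U (Suc h)) x (m - j)"
      have "?d = (\<Sum>r<m. ?C $$ (h, r) * cofactor ?C h r)"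
        unfolding cdet_def by (rule laplace_expansion_row[OF C h])
      also have "\<dots> = (\<Sum>r\<in>{j - 1}. ?C $$ (h, r) * cofactor ?C h r)"
        using h j by (intro sum.mono_neutral_right) (auto simp: unit_row_def)
      also have "\<dots> = ?C $$ (h, j - 1) * cofactor ?C h (j - 1)" by simp
      also have "\<dots> = ?e * ((-1) ^ (Suc h + j) * Determinant.det (mat_delete ?W h (j - 1)))"
      proof -
        have e: "?y - real (Suc (j - 1)) = x" "m - Suc (j - 1) = m - j" using j by auto
        have "?C $$ (h, j - 1) = \<xi> a b N (rtyp h) (?y - real (Suc (j - 1))) (m - Suc (j - 1)) * poly (unit_row h (j - 1) h (j - 1)) ?y"
          using h j by (subst index_mat) auto
        hence e1: "?C $$ (h, j - 1) = ?e"
          unfolding e by (simp add: unit_row_def rtyp_def)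
        have e2: "(-1::real) ^ (h + (j - 1)) = (-1) ^ (Suc h + j)" using j by (cases j) auto
        show ?thesis unfolding e1 cofactor_def del e2 ..
      qed
      finally have "?d =
         ?e * ((-1) ^ (Suc h + j) * Determinant.det (mat_delete ?W h (j - 1)))" .
      moreover have "S ?y * ?d = Tj h j x"
        using elim j unfolding Tj_def by blast
      ultimately show ?case by (simp add: mult_ac)
    qed
  qed
qed

text \<open>The divisibility holds for arbitrary polynomials in \<open>\<theta>\<close> in every
  row, in particular for any \<open>Q\<close> in row \<open>h\<close>. This freedom is the
  hypothesis \<open>poly_windows\<close>.\<close>

lemma Tj_poly_windows:
  assumes h: "h < m"
  shows "MOST y. poly (upoly (Yl(h := Q))) y = (\<Sum>j=1..m. poly Q ((y - real j) * (y - real j + c)) * Tj h j (y - real j))"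
  using cofinite_nonzero[OF mirror_prod_nonzero[of c m]]
proof eventually_elim
  case (elim y)
  have "theta_rows (Yl(h := Q)) = (\<lambda>l r. if l = h then pcompose Q (theta_pt c r) else theta_rows Yl l r)"
    by (intro ext) (simp add: theta_rows_def)
  hence e: "red (theta_rows (Yl(h := Q))) = (\<Sum>j<m. pcompose Q (theta_pt c j) * red (unit_row h j))"
    by (simp add: red_row_expand[OF h])
  have "poly (upoly (Yl(h := Q))) y = poly mid y * poly (red (theta_rows (Yl(h := Q)))) y / poly V y"
    using poly_upoly[OF elim] by simp
  also have "\<dots> = (\<Sum>j<m. poly Q ((y - real (Suc j)) * (y - real (Suc j) + c)) * (poly mid y * poly (red (unit_row h j)) y / poly V y))"
    unfolding e poly_sum poly_mult poly_pcompose poly_theta_pt sum_distrib_left sum_divide_distrib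
    by (intro sum.cong refl) (simp del: of_nat_Suc)
  also have "\<dots> = (\<Sum>j=1..m. poly Q ((y - real j) * (y - real j + c)) * Tj h j (y - real j))"
    by (rule sum.reindex_bij_witness[of _ "\<lambda>j. j - 1" Suc]) (auto simp: Tj_def)
  finally show ?case .
qed

text \<open>The reflection \<open>y \<mapsto> m + 1 - c - y\<close> mirrors all points and reverses the order of the columns.\<close>

lemma left_weight_reflect:
  assumes "\<pi> permutes {0..<m}"
  shows "poly (left_weight c m al' f \<pi>) (real m + 1 - c - y) = poly (left_weight c m al' f (\<lambda>l. if l < m then m - 1 - \<pi> l else l)) y"
proof -
  let ?\<rho> = "\<lambda>l. if l < m then m - 1 - \<pi> l else l"
  have im: "\<pi> l < m" if "l < m" for l using permutes_in_image[OF assms, of l] that by simp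
  let ?k = "card {l. l < m \<and> f l}"
  let ?g = "\<lambda>\<pi> i y. poly al' (y - real (Suc i)) ^ (card {l. l < m \<and> f l \<and> \<pi> l < i} - (?k - (m - i))) *
      poly al' (real (Suc i) - c - y) ^ (card {l. l < m \<and> f l \<and> i < \<pi> l} - (?k - Suc i))"
  have lw: "poly (left_weight c m al' f \<pi>) y = (\<Prod>i<m. ?g \<pi> i y)" for \<pi> y
    by (simp add: left_weight_def poly_prod poly_pcompose poly_col_pt poly_ref_pt del: of_nat_Suc)
  show ?thesis unfolding lw
  proof (rule prod.reindex_bij_witness[of _ "\<lambda>i. m - 1 - i" "\<lambda>i. m - 1 - i"])
    fix i assume "i \<in> {..<m}"
    hence i: "i < m" by simp
    have s1: "{l. l < m \<and> f l \<and> ?\<rho> l < m - 1 - i} = {l. l < m \<and> f l \<and> i < \<pi> l}" using im i by force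
    have s2: "{l. l < m \<and> f l \<and> m - 1 - i < ?\<rho> l} = {l. l < m \<and> f l \<and> \<pi> l < i}" using im i by force
    have e: "m - (m - 1 - i) = Suc i" "Suc (m - 1 - i) = m - i" "real (Suc (m - 1 - i)) = real m - real i" using i by (auto simp: of_nat_diff)
    have p: "y - real (m - i) = real (Suc i) - c - (real m + 1 - c - y)" "real (m - i) - c - y = real m + 1 - c - y - real (Suc i)"
      using i by (simp_all add: of_nat_diff)
    show "?g ?\<rho> (m - 1 - i) y = ?g \<pi> i (real m + 1 - c - y)"
      unfolding s1 s2 e(1,2) p by (simp only: mult.commute)
  qed auto
qed

definition rev_sign :: int where "rev_sign = sign (\<lambda>l. if l < m then m - 1 - l else l)"

lemma red_reflect:
  assumes Q: "\<And>l r. l < m \<Longrightarrow> r < m \<Longrightarrow> poly (Q l r) (real m + 1 - c - y) = poly (Q' l (m - 1 - r)) y"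
  shows "poly (red Q) (real m + 1 - c - y) = of_int rev_sign * poly (red Q') y"
proof -
  let ?y = "real m + 1 - c - y" and ?P = "{\<pi>. \<pi> permutes {0..<m}}"
  let ?W = "\<lambda>\<pi> y. poly (left_weight c m al ty12 \<pi>) y * poly (left_weight c m be ty24 \<pi>) y"
  let ?r = "\<lambda>\<pi> l. if l < m then m - 1 - \<pi> l else l"
  define \<rho> where "\<rho> = (\<lambda>l. if l < m then m - 1 - l else l)"
  have \<rho>\<rho>: "\<rho> (\<rho> l) = l" for l by (auto simp: \<rho>_def)
  \<comment> \<open>Reversing the columns is a permutation; composing it with the summation index
    contributes its sign once.\<close>
  have \<rho>: "\<rho> permutes {0..<m}"
    by (rule bij_imp_permutes) (auto simp: \<rho>_def intro!: bij_betw_byWitness[of _ \<rho>])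
  have "poly (red Q) ?y = (\<Sum>\<pi>\<in>?P. of_int (sign \<pi>) *
      (?W (?r \<pi>) y
        * (\<Prod>l<m. poly (Q' l (m - 1 - \<pi> l)) y)))"
  proof -
    have "poly (red Q) ?y = (\<Sum>\<pi>\<in>?P. of_int (sign \<pi>) *
      (?W \<pi> ?y
        * (\<Prod>l<m. poly (Q l (\<pi> l)) ?y)))"
      by (simp add: reduced_det_def poly_sum poly_prod of_int_poly)
    also have "\<dots> = (\<Sum>\<pi>\<in>?P. of_int (sign \<pi>) *
      (?W (?r \<pi>) y
        * (\<Prod>l<m. poly (Q' l (m - 1 - \<pi> l)) y)))"
    proof (rule sum.cong[OF refl], goal_cases)
      case (1 \<pi>)
      hence p: "\<pi> permutes {0..<m}" by simp
      have "(\<Prod>l<m. poly (Q l (\<pi> l)) ?y) = (\<Prod>l<m. poly (Q' l (m - 1 - \<pi> l)) y)"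
        using permutes_in_image[OF p] by (intro prod.cong refl Q) auto
      thus ?case
        unfolding left_weight_reflect[OF p] by simp
    qed
    finally show ?thesis .
  qed
  also have "\<dots> = (\<Sum>\<pi>\<in>?P. of_int rev_sign * (of_int (sign (\<rho> \<circ> \<pi>)) *
     (?W (\<rho> \<circ> \<pi>) y * (\<Prod>l<m. poly (Q' l ((\<rho> \<circ> \<pi>) l)) y))))"
  proof (rule sum.cong[OF refl], goal_cases)
    case (1 \<pi>)
    hence p: "\<pi> permutes {0..<m}" by simp
    have e: "?r \<pi> = \<rho> \<circ> \<pi>"
      using permutes_in_image[OF p] permutes_not_in[OF p] by (auto simp: \<rho>_def fun_eq_iff)
    have e': "(\<Prod>l<m. poly (Q' l (m - 1 - \<pi> l)) y) = (\<Prod>l<m. poly (Q' l ((\<rho> \<circ> \<pi>) l)) y)"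
      unfolding e[symmetric] by (rule prod.cong) auto
    have "sign (\<rho> \<circ> \<pi>) = sign \<rho> * sign \<pi>"
      using \<rho> p by (intro sign_compose permutation_permutes[THEN iffD2]) auto
    moreover have "sign \<rho> * sign \<rho> = 1" by (simp add: sign_def)
    ultimately have "sign \<pi> = rev_sign * sign (\<rho> \<circ> \<pi>)" by (simp add: rev_sign_def \<rho>_def[symmetric] mult.assoc[symmetric])
    thus ?case
      unfolding e e' by simp
  qed
  also have "\<dots> = of_int rev_sign * (\<Sum>\<pi>\<in>?P. of_int (sign \<pi>) *
     (?W \<pi> y * (\<Prod>l<m. poly (Q' l (\<pi> l)) y)))"
  proof -
    have "(\<Sum>\<pi>\<in>?P. F (\<rho> \<circ> \<pi>)) = (\<Sum>\<pi>\<in>?P. F \<pi>)" for F :: "(nat \<Rightarrow> nat) \<Rightarrow> real"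
      by (rule sum.reindex_bij_witness[of _ "\<lambda>\<pi>. \<rho> \<circ> \<pi>" "\<lambda>\<pi>. \<rho> \<circ> \<pi>"]) (auto simp: \<rho>\<rho> fun_eq_iff intro: permutes_compose[OF _ \<rho>])
    from this[of "\<lambda>\<pi>. of_int (sign \<pi>) * (?W \<pi> y * (\<Prod>l<m. poly (Q' l (\<pi> l)) y))"]
    show ?thesis unfolding sum_distrib_left[symmetric] by simp
  qed
  also have "\<dots> = of_int rev_sign * poly (red Q') y"
    by (simp add: reduced_det_def poly_sum poly_prod of_int_poly)
  finally show ?thesis .
qed

text \<open>Both the reversal of \<open>m\<close> columns and the reflection of the pairs contribute
  the sign (-1)^(m choose 2). That the product is 1 is read off later, in
  \<open>mirror_sign_1\<close>, from the parity of a degree.\<close>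

definition mirror_sign :: real where
  "mirror_sign = of_int rev_sign * (-1) ^ card {(i, j). i < j \<and> j < m}"

lemma mirror_sign: "mirror_sign = 1 \<or> mirror_sign = -1"
proof -
  have "rev_sign = 1 \<or> rev_sign = -1" by (simp add: rev_sign_def sign_def)
  have "(-1::real) ^ k = 1 \<or> (-1::real) ^ k = -1" for k by (induction k) auto
  from \<open>rev_sign = 1 \<or> rev_sign = -1\<close> this[of "card {(i, j). i < j \<and> j < m}"]
  show ?thesis unfolding mirror_sign_def by (elim disjE) simp_all
qed

lemma poly_V_reflect: "poly V (real m + 1 - c - y) = (-1) ^ card {(i, j). i < j \<and> j < m} * poly V y"
proof -
  let ?P = "{(i, j). i < j \<and> j < m}" and ?r = "\<lambda>(i, j). (m - 1 - j, m - 1 - i)"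
  have V: "poly V y = (\<Prod>x\<in>?P. 2 * y + c - real (fst x + snd x + 2))" for y
    unfolding mirror_prod_def poly_prod by (intro prod.cong) (auto simp: poly_mirror_lin)
  have "poly V (real m + 1 - c - y) = (\<Prod>x\<in>?P. (-1) * (2 * y + c - real (fst x + snd x + 2)))"
    unfolding V
  proof (rule prod.reindex_bij_witness[of _ ?r ?r])
    fix x assume "x \<in> ?P"
    then obtain i j where x: "x = (i, j)" "i < j" "j < m" by auto
    have "real (m - 1 - j + (m - 1 - i) + 2) = 2 * real m - real i - real j" using x by (simp add: of_nat_diff)
    thus "(-1) * (2 * y + c - real (fst (?r x) + snd (?r x) + 2)) = 2 * (real m + 1 - c - y) + c - real (fst x + snd x + 2)"
      unfolding x(1) prod.case fst_conv snd_conv by simp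
  qed auto
  also have "\<dots> = (-1) ^ card ?P * poly V y"
    unfolding V by (simp only: prod.distrib prod_constant)
  finally show ?thesis .
qed

lemma poly_mid_reflect: "poly mid (real m + 1 - c - y) = - poly mid y"
  by (simp add: mid_def algebra_simps)

lemma theta_rows_reflect:
  "l < m \<Longrightarrow> r < m \<Longrightarrow> poly (theta_rows R l r) (real m + 1 - c - y) = poly (theta_rows R l (m - 1 - r)) y"
proof -
  assume "l < m" "r < m"
  hence e: "real (Suc (m - 1 - r)) = real m - real r" by (simp add: of_nat_diff)
  have "poly (theta_pt c r) (real m + 1 - c - y) = poly (theta_pt c (m - 1 - r)) y"
    unfolding poly_theta_pt e by (simp add: algebra_simps)
  thus ?thesis by (simp add: theta_rows_def poly_pcompose)
qed

lemma window_reflect: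
  assumes "\<And>l r. l < m \<Longrightarrow> r < m \<Longrightarrow> poly (Q l r) (real m + 1 - c - y) = poly (Q' l (m - 1 - r)) y"
  shows "poly mid (real m + 1 - c - y) * poly (red Q) (real m + 1 - c - y) / poly V (real m + 1 - c - y) =
     - mirror_sign * (poly mid y * poly (red Q') y / poly V y)"
proof -
  let ?s = "(-1::real) ^ card {(i, j). i < j \<and> j < m}"
  have pm: "(-1::real) ^ k = 1 \<or> (-1::real) ^ k = -1" for k by (induction k) auto
  have d: "x / (?s * v) = ?s * (x / v)" for x v :: real
    using pm[of "card {(i, j). i < j \<and> j < m}"] by (elim disjE) simp_all
  have e: "poly (red Q) (real m + 1 - c - y) = of_int rev_sign * poly (red Q') y"
    by (rule red_reflect) (rule assms)
  show ?thesis
    unfolding poly_mid_reflect e poly_V_reflect d mirror_sign_def by simp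
qed

lemma Tj_reflect:
  assumes h: "h < m" and j: "j \<in> {1..m}"
  shows "Tj h j (- x - c) = - mirror_sign * Tj h (m + 1 - j) x"
proof -
  define y where "y = x + real (m + 1 - j)"
  have e: "- x - c + real j = real m + 1 - c - y" using j by (simp add: y_def of_nat_diff)
  have "poly (unit_row h (j - 1) l r) (real m + 1 - c - y) = poly (unit_row h (m + 1 - j - 1) l (m - 1 - r)) y"
    if "l < m" "r < m" for l r
  proof (cases "l = h")
    case True
    have "r = j - 1 \<longleftrightarrow> m - 1 - r = m + 1 - j - 1" using that j by auto
    thus ?thesis using True by (simp add: unit_row_def)
  next
    case False
    thus ?thesis using theta_rows_reflect[OF that, of Yl y] by (simp add: unit_row_def)
  qed
  from window_reflect[of "unit_row h (j - 1)" y "unit_row h (m + 1 - j - 1)", OF this]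
  show ?thesis unfolding Tj_def e y_def[symmetric] .
qed

lemma upoly_reflect: "poly (upoly R) (real m + 1 - c - y) = - mirror_sign * poly (upoly R) y"
proof (rule isCont_cofinite_eq[where f = "\<lambda>y. poly (upoly R) (real m + 1 - c - y)" and g = "\<lambda>y. - mirror_sign * poly (upoly R) y" and x = y])
  show "MOST y. poly (upoly R) (real m + 1 - c - y) = - mirror_sign * poly (upoly R) y"
    using cofinite_nonzero[OF mirror_prod_nonzero[of c m]]
  proof eventually_elim
    case (elim y)
    have "poly V (real m + 1 - c - y) \<noteq> 0" unfolding poly_V_reflect using elim by simp
    from poly_upoly[OF elim, of R] poly_upoly[OF this, of R] window_reflect[of "theta_rows R" y "theta_rows R", OF theta_rows_reflect]
    show ?case by simp
  qed
qed (intro continuous_intros)+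

text \<open>The reflection maps the summand of column \<open>j\<close> to minus that of column
  \<open>m + 1 - j\<close>. This yields both the hypothesis \<open>T_reflect\<close> and the
  antisymmetry of the sum.\<close>

lemma M_fun_polynomial:
  assumes h: "h < m" and sign: "mirror_sign = 1"
  shows "\<exists>M. MOST x. M_fun a b N U S (Suc h) x = poly M x"
    and "MOST x. M_fun a b N U S (Suc h) x = poly M x \<Longrightarrow> poly M (- x - c) = - poly M x"
proof -
  define A where "A = (\<lambda>j. pcompose (mid * red (unit_row h (j - 1))) [:real j, 1:])"
  define B where "B = (\<lambda>j. pcompose V [:real j, 1:])"
  interpret W: windows c m "Tj h" A B
  proof
    fix j x assume j: "j \<in> {1..m}"
    show "Tj h j x = poly (A j) x / poly (B j) x"
      by (simp add: Tj_def A_def B_def poly_pcompose add.commute)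
    have "B j = (\<Prod>(i, k)\<in>{(i, k). i < k \<and> k < m}. [:c - real (i + k + 2) + 2 * real j, 2:])"
      unfolding B_def mirror_prod_def pcompose_prod
      by (intro prod.cong refl) (auto simp: mirror_lin_def pcompose_pCons algebra_simps)
    thus "real_split (B j)" by (auto simp: case_prod_beta intro!: real_split_prod real_split_linear)
    show "MOST x. Tj h j (- x - c) = - Tj h (m + 1 - j) x"
      using Tj_reflect[OF h j] sign by simp
  next
    fix Q
    show "\<exists>u. MOST y. poly u y = (\<Sum>j=1..m. poly Q ((y - real j) * (y - real j + c)) * Tj h j (y - real j))"
      using Tj_poly_windows[OF h, of Q] by blast
  qed
  show "\<exists>M. MOST x. M_fun a b N U S (Suc h) x = poly M x"
  proof -
    obtain M where M: "MOST x. poly M x = (\<Sum>j=1..m. Tj h j x)" using W.sum_T_polynomial by blast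
    have "MOST x. M_fun a b N U S (Suc h) x = poly M x"
      using M M_fun_windows[OF h] by eventually_elim simp
    thus ?thesis by blast
  qed
  assume "MOST x. M_fun a b N U S (Suc h) x = poly M x"
  hence M: "MOST x. poly M x = (\<Sum>j=1..m. Tj h j x)"
    using M_fun_windows[OF h] by eventually_elim simp
  let ?T = "\<lambda>x. \<Sum>j=1..m. Tj h j x"
  show "poly M (- x - c) = - poly M x"
  proof (rule isCont_cofinite_eq[where f = "\<lambda>x. poly M (- x - c)" and g = "\<lambda>x. - poly M x" and x = x])
    have "MOST x. poly M (- x - c) = ?T (- x - c)"
      using cofinite_reflect[OF M, of "- c"] unfolding diff_conv_add_uminus add.commute[of "- c"] .
    thus "MOST x. poly M (- x - c) = - poly M x"
      using M
    proof eventually_elim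
      case (elim x)
      have "?T (- x - c) = (\<Sum>j=1..m. - Tj h (m + 1 - j) x)"
        using Tj_reflect[OF h] sign by (intro sum.cong refl) simp
      also have "\<dots> = (\<Sum>j=1..m. - Tj h j x)"
        by (rule sum.reindex_bij_witness[of _ "\<lambda>j. m + 1 - j" "\<lambda>j. m + 1 - j"]) auto
      finally show ?case using elim by (simp add: sum_negf)
    qed
  qed (intro continuous_intros)+
qed

end

section \<open>Leading terms of Casorati determinants\<close>

text \<open>\<open>rdeg e L f\<close>: \<open>f\<close> is (off a finite set) a rational function with \<open>f(x) = L x\<^sup>e + O(x\<^sup>e\<^sup>-\<^sup>1)\<close>.\<close>

definition rfrac :: "int \<Rightarrow> real \<Rightarrow> (real \<Rightarrow> real) \<Rightarrow> real poly \<Rightarrow> real poly \<Rightarrow> nat \<Rightarrow> bool" where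
  "rfrac e L f P Q n \<longleftrightarrow> Q \<noteq> 0 \<and> (MOST x. f x = poly P x / poly Q x) \<and> degree P \<le> n \<and>
     int n = int (degree Q) + e \<and> coeff P n = L * lead_coeff Q"

definition rdeg :: "int \<Rightarrow> real \<Rightarrow> (real \<Rightarrow> real) \<Rightarrow> bool" where
  "rdeg e L f \<longleftrightarrow> (\<exists>P Q n. rfrac e L f P Q n)"

lemma rfracD:
  assumes "rfrac e L f P Q n"
  shows "Q \<noteq> 0" "MOST x. f x = poly P x / poly Q x" "degree P \<le> n" "int n = int (degree Q) + e" "coeff P n = L * lead_coeff Q"
  using assms by (auto simp: rfrac_def)

lemma rdegI: "Q \<noteq> 0 \<Longrightarrow> MOST x. f x = poly P x / poly Q x \<Longrightarrow> degree P \<le> n \<Longrightarrow>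
    int n = int (degree Q) + e \<Longrightarrow> coeff P n = L * lead_coeff Q \<Longrightarrow> rdeg e L f"
  unfolding rdeg_def rfrac_def by blast

text \<open>Numerator and denominator are multiplied by \<open>x\<close>, so that the degrees are
  successors, as \<open>coeff_shift_diff\<close> expects.\<close>

lemma rdegE:
  assumes "rdeg e L f"
  obtains P Q n where "Q \<noteq> 0" "MOST x. f x = poly P x / poly Q x" "degree P \<le> Suc n" "0 < degree Q"
    "int (Suc n) = int (degree Q) + e" "coeff P (Suc n) = L * lead_coeff Q"
proof -
  obtain P Q n where "rfrac e L f P Q n" using assms unfolding rdeg_def by blast
  note * = rfracD[OF this]
  have "MOST x. poly [:0, 1:] x \<noteq> (0 :: real)" by (rule cofinite_nonzero) simp
  hence "MOST x. f x = poly (pCons 0 P) x / poly (pCons 0 Q) x"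
    using *(2) by eventually_elim simp
  thus ?thesis using that[of "pCons 0 Q" "pCons 0 P" n] * by (auto intro: order.trans[OF degree_pCons_le])
qed

lemma rdeg_cong: "MOST x. f x = g x \<Longrightarrow> rdeg e L f \<Longrightarrow> rdeg e L g"
proof -
  assume fg: "MOST x. f x = g x" and "rdeg e L f"
  then obtain P Q n where "rfrac e L f P Q n" unfolding rdeg_def by blast
  note * = rfracD[OF this]
  have "MOST x. g x = poly P x / poly Q x" using *(2) fg by eventually_elim simp
  thus ?thesis using * by (intro rdegI)
qed

lemma rdeg_poly: "degree p \<le> n \<Longrightarrow> rdeg (int n) (coeff p n) (poly p)"
  by (rule rdegI[where P = p and Q = 1 and n = n]) auto

lemma rdeg_const: "rdeg 0 k (\<lambda>x. k)"
  by (rule rdegI[where P = "[:k:]" and Q = 1 and n = 0]) auto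

lemma rdeg_zero: "rdeg e 0 (\<lambda>x. 0)"
  by (rule rdegI[where P = 0 and Q = "monom 1 (nat (- e))" and n = "nat e"]) (auto simp: degree_monom_eq monom_eq_0_iff)

lemma rdeg_add:
  assumes "rdeg e L f" "rdeg e L' g"
  shows "rdeg e (L + L') (\<lambda>x. f x + g x)"
proof -
  obtain P Q n where "rfrac e L f P Q n" using assms(1) unfolding rdeg_def by blast
  note 1 = rfracD[OF this]
  obtain P' Q' n' where "rfrac e L' g P' Q' n'" using assms(2) unfolding rdeg_def by blast
  note 2 = rfracD[OF this]
  have n: "n + degree Q' = n' + degree Q" using 1(4) 2(4) by linarith
  have c1: "coeff (P * Q') (n + degree Q') = L * lead_coeff Q * lead_coeff Q'"
    using coeff_mult_top[OF 1(3) order_refl, of Q'] 1(5) by simp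
  have c2: "coeff (P' * Q) (n + degree Q') = L' * lead_coeff Q' * lead_coeff Q"
    unfolding n using coeff_mult_top[OF 2(3) order_refl, of Q] 2(5) by simp
  have d1: "degree (P * Q') \<le> n + degree Q'" using degree_mult_le[of P Q'] 1(3) by linarith
  have d2: "degree (P' * Q) \<le> n + degree Q'" unfolding n using degree_mult_le[of P' Q] 2(3) by linarith
  show ?thesis
  proof (rule rdegI[where P = "P * Q' + P' * Q" and Q = "Q * Q'" and n = "n + degree Q'"])
    show "MOST x. f x + g x = poly (P * Q' + P' * Q) x / poly (Q * Q') x"
      using 1(2) 2(2) cofinite_nonzero[OF 1(1)] cofinite_nonzero[OF 2(1)]
      by eventually_elim (simp add: field_simps)
    show "int (n + degree Q') = int (degree (Q * Q')) + e" using 1 2 by (simp add: degree_mult_eq)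
    show "coeff (P * Q' + P' * Q) (n + degree Q') = (L + L') * lead_coeff (Q * Q')"
      by (simp only: coeff_add c1 c2 lead_coeff_mult) (simp add: algebra_simps)
  qed (use 1 2 d1 d2 in \<open>auto intro: degree_add_le\<close>)
qed

lemma rdeg_mult:
  assumes "rdeg e L f" "rdeg e' L' g"
  shows "rdeg (e + e') (L * L') (\<lambda>x. f x * g x)"
proof -
  obtain P Q n where "rfrac e L f P Q n" using assms(1) unfolding rdeg_def by blast
  note 1 = rfracD[OF this]
  obtain P' Q' n' where "rfrac e' L' g P' Q' n'" using assms(2) unfolding rdeg_def by blast
  note 2 = rfracD[OF this]
  show ?thesis
  proof (rule rdegI[where P = "P * P'" and Q = "Q * Q'" and n = "n + n'"])
    show "MOST x. f x * g x = poly (P * P') x / poly (Q * Q') x"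
      using 1(2) 2(2) by eventually_elim simp
    show "int (n + n') = int (degree (Q * Q')) + (e + e')" using 1 2 by (simp add: degree_mult_eq)
    show "coeff (P * P') (n + n') = L * L' * lead_coeff (Q * Q')"
      by (simp only: coeff_mult_top[OF 1(3) 2(3)] 1(5) 2(5) lead_coeff_mult) simp
    show "degree (P * P') \<le> n + n'" using degree_mult_le[of P P'] 1(3) 2(3) by linarith
  qed (use 1 2 in auto)
qed

lemma rdeg_cmult: "rdeg e L f \<Longrightarrow> rdeg e (k * L) (\<lambda>x. k * f x)"
  using rdeg_mult[OF rdeg_const] by simp

lemma rdeg_sum: "(\<And>i. i \<in> A \<Longrightarrow> rdeg e (L i) (f i)) \<Longrightarrow> rdeg e (\<Sum>i\<in>A. L i) (\<lambda>x. \<Sum>i\<in>A. f i x)"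
  by (induction A rule: infinite_finite_induct) (auto intro: rdeg_add rdeg_zero)

lemma rdeg_prod: "finite A \<Longrightarrow> (\<And>i. i \<in> A \<Longrightarrow> rdeg (e i) (L i) (f i)) \<Longrightarrow> rdeg (\<Sum>i\<in>A. e i) (\<Prod>i\<in>A. L i) (\<lambda>x. \<Prod>i\<in>A. f i x)"
proof (induction A rule: finite_induct)
  case empty
  thus ?case using rdeg_const[of 1] by simp
next
  case (insert x A)
  thus ?case using rdeg_mult[of "e x" "L x" "f x"] by simp
qed

lemma rdeg_weaken:
  assumes "rdeg e L f" "e < e'"
  shows "rdeg e' 0 f"
proof -
  obtain P Q n where "rfrac e L f P Q n" using assms(1) unfolding rdeg_def by blast
  note 1 = rfracD[OF this]
  have n: "n < nat (int (degree Q) + e')" "int (nat (int (degree Q) + e')) = int (degree Q) + e'" using 1(4) assms(2) by auto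
  show ?thesis
    by (rule rdegI[where P = P and Q = Q and n = "nat (int (degree Q) + e')"]) (use 1 n in \<open>auto simp: coeff_eq_0\<close>)
qed

lemma rdeg_shift:
  assumes "rdeg e L f"
  shows "rdeg e L (\<lambda>x. f (x + s))"
proof -
  obtain P Q n where "rfrac e L f P Q n" using assms(1) unfolding rdeg_def by blast
  note 1 = rfracD[OF this]
  have lc: "coeff (shift s Q) (degree Q) = lead_coeff Q" by (rule coeff_shift_top) simp
  show ?thesis
  proof (rule rdegI[where P = "shift s P" and Q = "shift s Q" and n = "n"])
    show "MOST x. f (x + s) = poly (shift s P) x / poly (shift s Q) x"
      using cofinite_shift[OF 1(2), of s] by (simp add: poly_shift)
    show "shift s Q \<noteq> 0" using lc 1(1) by auto
  qed (use 1 lc in \<open>auto simp: coeff_shift_top\<close>)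
qed

lemma coeff_shift_diff:
  fixes P :: "real poly"
  assumes "degree P \<le> Suc n"
  shows "degree (shift s P - P) \<le> n \<and> coeff (shift s P - P) n = real (Suc n) * s * coeff P (Suc n)"
  using assms
proof (induction n arbitrary: P)
  case 0
  have P: "P = [:coeff P 0, coeff P 1:]"
    by (rule poly_eqI) (use 0 in \<open>auto simp: coeff_pCons coeff_eq_0 split: nat.splits\<close>)
  have "shift s P - P = [:s * coeff P 1:]" by (subst (1 2) P) (simp add: shift_def pcompose_pCons)
  thus ?case by simp
next
  case (Suc n)
  obtain a p where P: "P = pCons a p" by (cases P)
  have dp: "degree p \<le> Suc n" using Suc.prems unfolding P by (cases "p = 0") auto
  let ?d = "shift s p - p"
  have d: "degree ?d \<le> n" "coeff ?d n = real (Suc n) * s * coeff p (Suc n)" using Suc.IH[OF dp] by auto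
  have e: "shift s P - P = smult s (shift s p) + pCons 0 ?d"
    by (simp add: P shift_def pcompose_pCons)
  have "degree (smult s (shift s p)) \<le> Suc n" using dp by (intro order.trans[OF degree_smult_le]) simp
  moreover have "degree (pCons 0 ?d) \<le> Suc n" using d(1) by (intro order.trans[OF degree_pCons_le]) simp
  ultimately have "degree (shift s P - P) \<le> Suc n" unfolding e by (rule degree_add_le)
  moreover have "coeff (shift s P - P) (Suc n) = real (Suc (Suc n)) * s * coeff P (Suc (Suc n))"
    unfolding e using d(2) by (simp add: coeff_shift_top[OF dp] P algebra_simps)
  ultimately show ?case by simp
qed

lemma rdeg_difference:
  assumes "rdeg e L f"
  shows "rdeg (e - 1) (of_int e * s * L) (\<lambda>x. f (x + s) - f x)"
proof -
  obtain P Q n where 1: "Q \<noteq> 0" "MOST x. f x = poly P x / poly Q x" "degree P \<le> Suc n" "0 < degree Q"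
    "int (Suc n) = int (degree Q) + e" "coeff P (Suc n) = L * lead_coeff Q" using assms by (rule rdegE)
  obtain k where k: "degree Q = Suc k" using 1(4) by (cases "degree Q") auto
  note dP = coeff_shift_diff[OF 1(3), of s] and dQ = coeff_shift_diff[of Q k s]
  let ?A = "(shift s P - P) * Q" and ?B = "P * (shift s Q - Q)"
  have lcs: "coeff (shift s Q) (degree Q) = lead_coeff Q" by (rule coeff_shift_top) simp
  have sQ: "shift s Q \<noteq> 0" using lcs 1(1) by auto
  have nk: "n + Suc k = Suc n + k" by simp
  have cA: "coeff ?A (n + Suc k) = (real (Suc n) * s * (L * lead_coeff Q)) * lead_coeff Q"
    using coeff_mult_top[of "shift s P - P" n Q "Suc k"] dP k 1(6) by simp
  have cB: "coeff ?B (n + Suc k) = (L * lead_coeff Q) * (real (Suc k) * s * lead_coeff Q)"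
    unfolding nk using coeff_mult_top[of P "Suc n" "shift s Q - Q" k] dQ 1(3,6) k by simp
  have dA: "degree ?A \<le> n + Suc k" using degree_mult_le[of "shift s P - P" Q] dP k by linarith
  have dB: "degree ?B \<le> n + Suc k" using degree_mult_le[of P "shift s Q - Q"] dQ 1(3) k by linarith
  have "e = int (Suc n) - int (Suc k)" using 1(5) k by linarith
  hence e: "of_int e = real (Suc n) - real (Suc k)" by (simp only: of_int_diff of_int_of_nat_eq)
  show ?thesis
  proof (rule rdegI[where P = "?A - ?B" and Q = "Q * shift s Q" and n = "n + Suc k"])
    show "MOST x. f (x + s) - f x = poly (?A - ?B) x / poly (Q * shift s Q) x"
      using 1(2) cofinite_shift[OF 1(2), of s] cofinite_nonzero[OF 1(1)] cofinite_nonzero[OF sQ]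
      by eventually_elim (simp add: poly_shift field_simps)
    show "int (n + Suc k) = int (degree (Q * shift s Q)) + (e - 1)" using 1 sQ k by (simp add: degree_mult_eq)
    show "coeff (?A - ?B) (n + Suc k) = of_int e * s * L * lead_coeff (Q * shift s Q)"
      unfolding coeff_diff cA cB lead_coeff_mult e using lcs by (simp add: algebra_simps)
    show "degree (?A - ?B) \<le> n + Suc k" using dA dB by (rule degree_diff_le)
    show "Q * shift s Q \<noteq> 0" using 1(1) sQ by simp
  qed
qed

lemma poly_rdegD:
  assumes "rdeg e L (poly u)"
  shows "u \<noteq> 0 \<Longrightarrow> int (degree u) \<le> e" and "L \<noteq> 0 \<Longrightarrow> int (degree u) = e \<and> lead_coeff u = L"
proof -
  obtain P Q n where "rfrac e L (poly u) P Q n" using assms(1) unfolding rdeg_def by blast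
  note 1 = rfracD[OF this]
  have "MOST x. poly (u * Q) x = poly P x" using 1(2) cofinite_nonzero[OF 1(1)] by eventually_elim simp
  hence "poly (u * Q) x = poly P x" for x
    by (intro isCont_cofinite_eq[where f = "poly (u * Q)" and g = "poly P"]) auto
  hence uQ: "u * Q = P" by (intro poly_eq_poly_eq_iff[THEN iffD1] ext)
  show 2: "int (degree u) \<le> e" if "u \<noteq> 0"
    using 1(3,4) that 1(1) by (simp add: uQ[symmetric] degree_mult_eq)
  assume L: "L \<noteq> 0"
  hence "coeff P n \<noteq> 0" using 1 by simp
  hence nP: "n = degree P" and u0: "u \<noteq> 0" using 1(3) le_degree uQ by (auto intro: le_antisym)
  have "int (degree u) = e" using 1(4) 1(1) u0 unfolding nP uQ[symmetric] by (simp add: degree_mult_eq)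
  moreover have "lead_coeff u = L" using 1(5) 1(1) unfolding nP uQ[symmetric] lead_coeff_mult by simp
  ultimately show "int (degree u) = e \<and> lead_coeff u = L" by simp
qed

lemma det_mat_permutes:
  "Determinant.det (mat n n (\<lambda>(l, i). F l i)) = (\<Sum>p | p permutes {0..<n}. of_int (sign p) * (\<Prod>l<n. F l (p l) :: real))"
  unfolding Determinant.det_def by (auto simp: lessThan_atLeast0 dest: permutes_in_image intro!: sum.cong prod.cong)

text \<open>With exponents of the form row minus column, all Leibniz terms have the same degree, so
  the leading coefficients form a determinant of their own. It may vanish, which only makes the
  degree smaller.\<close>

lemma rdeg_det:
  assumes "\<And>l i. l < n \<Longrightarrow> i < n \<Longrightarrow> rdeg (\<rho> l - \<gamma> i) (Lm l i) (W l i)"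
  shows "rdeg ((\<Sum>l<n. \<rho> l) - (\<Sum>i<n. \<gamma> i)) (Determinant.det (mat n n (\<lambda>(l, i). Lm l i))) (\<lambda>x. Determinant.det (mat n n (\<lambda>(l, i). W l i x)))"
proof -
  let ?e = "(\<Sum>l<n. \<rho> l) - (\<Sum>i<n. \<gamma> i)"
  have "rdeg ?e (\<Sum>p | p permutes {0..<n}. of_int (sign p) * (\<Prod>l<n. Lm l (p l)))
     (\<lambda>x. \<Sum>p | p permutes {0..<n}. of_int (sign p) * (\<Prod>l<n. W l (p l) x))"
  proof (intro rdeg_sum rdeg_cmult)
    fix p assume "p \<in> {p. p permutes {0..<n}}"
    hence p: "p permutes {..<n}" by (simp add: lessThan_atLeast0)
    have "rdeg (\<Sum>l<n. \<rho> l - \<gamma> (p l)) (\<Prod>l<n. Lm l (p l)) (\<lambda>x. \<Prod>l<n. W l (p l) x)"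
      using assms permutes_in_image[OF p] by (intro rdeg_prod) auto
    also have "(\<Sum>l<n. \<rho> l - \<gamma> (p l)) = (\<Sum>l<n. \<rho> l) - (\<Sum>i<n. \<gamma> i)"
      using sum.permute[OF p, of \<gamma>] by (simp add: sum_subtractf comp_def)
    finally show "rdeg ?e (\<Prod>l<n. Lm l (p l)) (\<lambda>x. \<Prod>l<n. W l (p l) x)" .
  qed
  thus ?thesis by (simp only: det_mat_permutes)
qed

text \<open>A combination of degree below \<open>k\<close> with \<open>k\<close> distinct zeros is
  0, and nonzero polynomials of different degrees are independent. Hence Vandermonde-like blocks
  have trivial kernel.\<close>

lemma graded_independent:
  fixes p :: "nat \<Rightarrow> real poly"
  assumes p: "\<And>i. i < k \<Longrightarrow> degree (p i) = i \<and> p i \<noteq> 0" and x: "inj_on x A" "finite A" "card A = k"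
    and z: "\<And>l. l \<in> A \<Longrightarrow> (\<Sum>i<k. v i * poly (p i) (x l)) = 0"
  shows "\<forall>i<k. v i = 0"
proof -
  have dep: "(\<Sum>i<k'. smult (v i) (p i)) = 0 \<Longrightarrow> k' \<le> k \<Longrightarrow> \<forall>i<k'. v i = 0" for k'
  proof (induction k')
    case (Suc k')
    have "degree (\<Sum>i<k'. smult (v i) (p i)) < k' \<or> k' = 0"
    proof (cases k')
      case (Suc j)
      have "degree (\<Sum>i<k'. smult (v i) (p i)) \<le> j"
        using p Suc.prems Suc by (intro degree_sum_le) (auto intro!: order.trans[OF degree_smult_le])
      thus ?thesis using Suc by simp
    qed simp
    hence "coeff (\<Sum>i<k'. smult (v i) (p i)) k' = 0" by (auto simp: coeff_eq_0)
    hence "v k' * coeff (p k') k' = 0" using arg_cong[OF Suc.prems(1), of "\<lambda>q. coeff q k'"] by simp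
    moreover have "coeff (p k') k' \<noteq> 0" using p[of k'] Suc.prems(2) by (metis Suc_le_eq leading_coeff_0_iff)
    ultimately have v: "v k' = 0" by simp
    hence "\<forall>i<k'. v i = 0" using Suc by simp
    thus ?case using v less_Suc_eq by auto
  qed simp
  let ?q = "\<Sum>i<k. smult (v i) (p i)"
  have "?q = 0"
  proof (rule ccontr)
    assume q: "?q \<noteq> 0"
    have k0: "k > 0" using q by (cases k) auto
    have "degree ?q \<le> k - 1" using p k0 by (intro degree_sum_le) (auto intro!: order.trans[OF degree_smult_le])
    moreover have "x ` A \<subseteq> {y. poly ?q y = 0}" using z by (auto simp: poly_sum)
    hence "card (x ` A) \<le> card {y. poly ?q y = 0}" using q by (intro card_mono poly_roots_finite)
    ultimately show False using card_poly_roots_bound[OF q] card_image[OF x(1)] x(3) k0 by linarith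
  qed
  thus ?thesis using dep[of k] by simp
qed

lemma rdeg_linear_ratio:
  "rdeg 0 1 (\<lambda>x. (x + p) / (x + q))" "rdeg (- 1) (p - q) (\<lambda>x. (x + p) / (x + q) - 1)"
proof -
  show "rdeg 0 1 (\<lambda>x. (x + p) / (x + q))"
    by (rule rdegI[where P = "[:p, 1:]" and Q = "[:q, 1:]" and n = 1]) (auto simp: add.commute)
  have "MOST x. poly [:q, 1:] x \<noteq> (0 :: real)" by (rule cofinite_nonzero) simp
  hence "MOST x. (x + p) / (x + q) - 1 = poly [:p - q:] x / poly [:q, 1:] x"
    by eventually_elim (simp add: field_simps)
  thus "rdeg (- 1) (p - q) (\<lambda>x. (x + p) / (x + q) - 1)"
    by (rule rdegI[where n = 0, rotated]) auto
qed

definition row_sign :: "nat \<Rightarrow> real" where "row_sign t = (if t \<in> {2, 3} then 1 else - 1)"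

text \<open>At infinity \<open>\<xi> a b N t (x + 1) 1\<close> is
  \<open>row_sign t * (1 + row_exp / x + ...)\<close>. Products of such factors grow like x^row_exp,
  so a row of degree \<open>e\<close> behaves as if its degree were
  \<open>e + row_exp\<close>.\<close>

definition row_exp :: "real \<Rightarrow> real \<Rightarrow> real \<Rightarrow> nat \<Rightarrow> real" where
  "row_exp a b N t = (if t \<in> {1, 2} then - (a + b + 2 * N + 2) else 0) + (if t \<in> {2, 4} then b - a else 0)"

lemma rdeg_\<xi>:
  assumes "t \<in> {1, 2, 3, 4}"
  shows "rdeg 0 1 (\<lambda>x. row_sign t * \<xi> a b N t (x + 1) 1)"
    and "rdeg (- 1) (row_exp a b N t) (\<lambda>x. row_sign t * \<xi> a b N t (x + 1) 1 - 1)"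
proof -
  define f where "f = (\<lambda>x. (x + - N) / (x + (a + b + N + 2)))"
  define g where "g = (\<lambda>x. (x + (b + 1)) / (x + (a + 1)))"
  have f: "rdeg 0 1 f" "rdeg (- 1) (- (a + b + 2 * N + 2)) (\<lambda>x. f x - 1)"
    using rdeg_linear_ratio[of "- N" "a + b + N + 2"] by (simp_all add: f_def algebra_simps)
  have g: "rdeg 0 1 g" "rdeg (- 1) (b - a) (\<lambda>x. g x - 1)"
    using rdeg_linear_ratio[of "b + 1" "a + 1"] by (simp_all add: g_def)
  have fg: "rdeg 0 1 (\<lambda>x. f x * g x)" using rdeg_mult[OF f(1) g(1)] by simp
  have fg': "rdeg (- 1) (- (a + b + 2 * N + 2) + (b - a)) (\<lambda>x. f x * g x - 1)"
    using rdeg_add[OF rdeg_mult[OF f(2) g(1), unfolded add_0_right] g(2)] by (simp add: algebra_simps)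
  have one: "rdeg 0 1 (\<lambda>x. 1 :: real)" "rdeg (- 1) 0 (\<lambda>x. 1 - 1 :: real)"
    using rdeg_const[of 1] rdeg_zero[of "-1"] by simp_all
  have "(\<lambda>x. row_sign t * \<xi> a b N t (x + 1) 1) = (\<lambda>x. (if t \<in> {1, 2} then f x else 1) * (if t \<in> {2, 4} then g x else 1))"
    using assms by (auto simp: row_sign_def \<xi>_def \<xi>_num_def \<xi>_den_def f_def g_def add_ac divide_simps fun_eq_iff)
  note e = this fun_cong[OF this]
  show "rdeg 0 1 (\<lambda>x. row_sign t * \<xi> a b N t (x + 1) 1)" unfolding e using assms f g fg one by (auto simp: eta_contract_eq)
  show "rdeg (- 1) (row_exp a b N t) (\<lambda>x. row_sign t * \<xi> a b N t (x + 1) 1 - 1)"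
    unfolding e row_exp_def using assms f g fg' one by auto
qed

section \<open>Shift operators acting on rows\<close>

definition row_step :: "real \<Rightarrow> real \<Rightarrow> real \<Rightarrow> nat \<Rightarrow> real \<Rightarrow> (real \<Rightarrow> real) \<Rightarrow> real \<Rightarrow> real" where
  "row_step a b N t s f x = \<xi> a b N t (x + 1) 1 * f (x + 1) - s * f x"

text \<open>The operator \<open>R(E)\<close> for the weighted shift that sends \<open>f\<close> to
  \<open>\<xi> a b N t (x + 1) 1 * f (x + 1)\<close>; the cocycle rule gives its powers in this
  closed form.\<close>

definition row_poly :: "real \<Rightarrow> real \<Rightarrow> real \<Rightarrow> nat \<Rightarrow> real poly \<Rightarrow> (real \<Rightarrow> real) \<Rightarrow> real \<Rightarrow> real" where
  "row_poly a b N t R f x = (\<Sum>k\<le>degree R. coeff R k * (\<xi> a b N t (x + real k) k * f (x + real k)))"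

lemma row_poly_bound: "degree R < n \<Longrightarrow> row_poly a b N t R f x = (\<Sum>k<n. coeff R k * (\<xi> a b N t (x + real k) k * f (x + real k)))"
  unfolding row_poly_def by (rule sum.mono_neutral_left) (auto simp: coeff_eq_0)

lemma row_poly_1: "row_poly a b N t 1 f = f"
  by (rule ext) (simp add: row_poly_def)

lemma row_step_poly: "row_step a b N t s (row_poly a b N t R f) = row_poly a b N t ([:- s, 1:] * R) f"
proof
  fix x
  define g where "g = (\<lambda>k. \<xi> a b N t (x + real k) k * f (x + real k))"
  define n where "n = Suc (degree R)"
  have g: "\<xi> a b N t (x + 1) 1 * (\<xi> a b N t (x + 1 + real k) k * f (x + 1 + real k)) = g (Suc k)" for k
    using \<xi>_add[of a b N t "x + 1 + real k" k 1] by (simp add: g_def algebra_simps)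
  have "degree ([:- s, 1:] * R) < Suc n" using degree_mult_le[of "[:- s, 1:]" R] by (simp add: n_def del: mult_pCons_left)
  hence "row_poly a b N t ([:- s, 1:] * R) f x = (\<Sum>k<Suc n. coeff ([:- s, 1:] * R) k * g k)"
    by (simp only: row_poly_bound g_def)
  also have "\<dots> = (\<Sum>k<Suc n. (case k of 0 \<Rightarrow> 0 | Suc j \<Rightarrow> coeff R j) * g k) - s * (\<Sum>k<Suc n. coeff R k * g k)"
    by (simp only: sum_distrib_left flip: sum_subtractf)
       (intro sum.cong refl, simp add: coeff_pCons algebra_simps split: nat.splits)
  also have "(\<Sum>k<Suc n. (case k of 0 \<Rightarrow> 0 | Suc j \<Rightarrow> coeff R j) * g k) = (\<Sum>k<n. coeff R k * g (Suc k))"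
    by (subst sum.lessThan_Suc_shift) simp
  also have "(\<Sum>k<Suc n. coeff R k * g k) = row_poly a b N t R f x"
    by (subst row_poly_bound[of R "Suc n"]) (auto simp: n_def g_def)
  also have "(\<Sum>k<n. coeff R k * g (Suc k)) = \<xi> a b N t (x + 1) 1 * row_poly a b N t R f (x + 1)"
    by (subst row_poly_bound[of R n]) (simp add: n_def, simp only: sum_distrib_left g[symmetric] mult_ac)
  finally show "row_step a b N t s (row_poly a b N t R f) x = row_poly a b N t ([:- s, 1:] * R) f x"
    by (simp add: row_step_def)
qed

lemma rdeg_row_step:
  assumes t: "t \<in> {1, 2, 3, 4}" and f: "rdeg e L f"
  shows "rdeg (e - 1) (row_sign t * (of_int e + row_exp a b N t) * L) (row_step a b N t (row_sign t) f)"
    and "rdeg e (2 * row_sign t * L) (row_step a b N t (- row_sign t) f)"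
proof -
  let ?h = "\<lambda>x. row_sign t * \<xi> a b N t (x + 1) 1"
  note h = rdeg_\<xi>[OF t, of a b N]
  have "rdeg (- 1 + e) (row_exp a b N t * L) (\<lambda>x. (?h x - 1) * f (x + 1))"
    by (intro rdeg_mult h rdeg_shift f)
  hence "rdeg (e - 1) (row_exp a b N t * L) (\<lambda>x. (?h x - 1) * f (x + 1))" by (simp add: algebra_simps)
  from rdeg_cmult[OF rdeg_add[OF this rdeg_difference[OF f, of 1]], of "row_sign t"]
  have "rdeg (e - 1) (row_sign t * (row_exp a b N t * L + of_int e * 1 * L))
    (\<lambda>x. row_sign t * ((?h x - 1) * f (x + 1) + (f (x + 1) - f x)))" .
  moreover have "(\<lambda>x. row_sign t * ((?h x - 1) * f (x + 1) + (f (x + 1) - f x))) = row_step a b N t (row_sign t) f"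
    by (rule ext) (simp add: row_step_def row_sign_def algebra_simps)
  ultimately show "rdeg (e - 1) (row_sign t * (of_int e + row_exp a b N t) * L) (row_step a b N t (row_sign t) f)"
    by (simp add: algebra_simps)
  have "rdeg (0 + e) (1 * L) (\<lambda>x. ?h x * f (x + 1))" by (intro rdeg_mult h rdeg_shift f)
  hence "rdeg e L (\<lambda>x. ?h x * f (x + 1))" by simp
  from rdeg_cmult[OF rdeg_add[OF this f], of "row_sign t"]
  have "rdeg e (row_sign t * (L + L)) (\<lambda>x. row_sign t * (?h x * f (x + 1) + f x))" .
  moreover have "(\<lambda>x. row_sign t * (?h x * f (x + 1) + f x)) = row_step a b N t (- row_sign t) f"
    by (rule ext) (simp add: row_step_def row_sign_def algebra_simps)
  ultimately show "rdeg e (2 * row_sign t * L) (row_step a b N t (- row_sign t) f)"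
    by (simp add: algebra_simps)
qed

lemma sum_lessThan_add: "sum F {..<k + l} = sum F {..<k} + (\<Sum>i<l. F (k + i :: nat))"
  by (induction l) (auto simp: add_ac)

definition falling_poly :: "nat \<Rightarrow> real poly" where "falling_poly i = (\<Prod>j<i. [:- real j, 1:])"

lemma falling_poly: "degree (falling_poly i) = i" "falling_poly i \<noteq> 0"
proof -
  show "degree (falling_poly i) = i" unfolding falling_poly_def
    by (subst degree_prod_eq_sum_degree) auto
  show "falling_poly i \<noteq> 0" by (simp add: falling_poly_def)
qed

text \<open>Every factor with the zero \<open>row_sign t\<close> lowers the degree by one and
  contributes the current degree plus \<open>row_exp\<close>, which builds the falling factorial.
  Every factor with the opposite zero keeps the degree and contributes 2 up to sign.\<close>

lemma rdeg_row_poly: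
  assumes t: "t \<in> {1, 2, 3, 4}" and f: "rdeg e L f"
  shows "rdeg (e - int i) ((2 * row_sign t) ^ k * (row_sign t ^ i * poly (falling_poly i) (of_int e + row_exp a b N t) * L))
     (row_poly a b N t ([:row_sign t, 1:] ^ k * [:- row_sign t, 1:] ^ i) f)"
proof (induction k)
  case 0
  show ?case
  proof (induction i)
    case 0
    thus ?case using f by (simp add: row_poly_1 falling_poly_def)
  next
    case (Suc i)
    let ?f = "row_poly a b N t ([:- row_sign t, 1:] ^ i) f"
    from rdeg_row_step(1)[OF t Suc, of a b N] show ?case
      unfolding row_step_poly power_0 mult_1 power_Suc
      by (rule back_subst[where P = "\<lambda>x. x", OF _ arg_cong2[where f = "\<lambda>p q. rdeg p q _"]])
         (simp_all add: falling_poly_def algebra_simps)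
  qed
next
  case (Suc k)
  from rdeg_row_step(2)[OF t Suc, of a b N] show ?case
    unfolding row_step_poly minus_minus power_Suc mult.assoc .
qed

text \<open>With \<open>E f x = \<xi>\<^sub>x\<^sub>+\<^sub>1\<^sub>,\<^sub>1 f (x + 1)\<close>, the operator \<open>E - s\<close> lowers the degree of a row with \<open>\<xi> \<sim> s = \<plusminus>1\<close> by one and keeps that of
  the other rows. Mixing the columns by the polynomials below therefore makes the matrix of leading terms block diagonal, with
  Vandermonde-like blocks.\<close>

definition mix_poly :: "nat \<Rightarrow> nat \<Rightarrow> nat \<Rightarrow> real poly" where
  "mix_poly kp km i = (if i < kp then [:1, 1:] ^ km * [:- 1, 1:] ^ i else [:- 1, 1:] ^ kp * [:1, 1:] ^ (i - kp))"

lemma degree_mix_poly: "i < kp + km \<Longrightarrow> degree (mix_poly kp km i) < kp + km"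
proof -
  assume "i < kp + km"
  moreover have "degree ([:p, 1:] ^ k * [:q, 1:] ^ l) \<le> k + l" for p q :: real and k l
    using degree_mult_le[of "[:p, 1:] ^ k" "[:q, 1:] ^ l"] degree_power_le[of "[:p, 1:]" k] degree_power_le[of "[:q, 1:]" l] by simp
  from this[of 1 km "-1" i] this[of "-1" kp 1 "i - kp"]
  show ?thesis using \<open>i < kp + km\<close> by (auto simp: mix_poly_def)
qed

context casorati_rows
begin

definition "plus_row l \<longleftrightarrow> rtyp l \<in> {2, 3}"
definition "kp = card {l. l < m \<and> plus_row l}"
definition "km = card {l. l < m \<and> \<not> plus_row l}"
abbreviation "rexp l \<equiv> row_exp a b N (rtyp l)"

lemma kp_km: "kp + km = m"
proof -
  have "kp + km = card ({l. l < m \<and> plus_row l} \<union> {l. l < m \<and> \<not> plus_row l})"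
    unfolding kp_def km_def by (rule card_Un_disjoint[symmetric]) auto
  also have "{l. l < m \<and> plus_row l} \<union> {l. l < m \<and> \<not> plus_row l} = {..<m}" by auto
  finally show ?thesis by simp
qed

definition mix_mat :: "real mat" where
  "mix_mat = mat m m (\<lambda>(r, i). coeff (mix_poly kp km i) (m - Suc r))"

definition lead_entry :: "(nat \<Rightarrow> int) \<Rightarrow> (nat \<Rightarrow> real) \<Rightarrow> nat \<Rightarrow> nat \<Rightarrow> real" where
  "lead_entry e L l i = (if plus_row l then if i < kp then 2 ^ km * (poly (falling_poly i) (of_int (e l) + rexp l) * L l) else 0
     else if i < kp then 0 else (- 2) ^ kp * ((- 1) ^ (i - kp) * poly (falling_poly (i - kp)) (of_int (e l) + rexp l) * L l))"

definition "lead_mat e L = mat m m (\<lambda>(l, i). lead_entry e L l i)"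

definition exp_distinct :: "(nat \<Rightarrow> int) \<Rightarrow> bool" where
  "exp_distinct e \<longleftrightarrow> inj_on (\<lambda>l. of_int (e l) + rexp l) {l. l < m \<and> plus_row l} \<and>
     inj_on (\<lambda>l. of_int (e l) + rexp l) {l. l < m \<and> \<not> plus_row l}"

text \<open>A kernel vector splits along the two blocks. Each part gives a combination of falling
  factorials whose degree is below the block size and which vanishes at as many distinct
  points.\<close>

lemma det_lead_mat:
  assumes e: "exp_distinct e" and L: "\<And>l. l < m \<Longrightarrow> L l \<noteq> 0"
  shows "Determinant.det (lead_mat e L) \<noteq> 0"
proof
  have C: "lead_mat e L \<in> carrier_mat m m" by (simp add: lead_mat_def)
  assume "Determinant.det (lead_mat e L) = 0"
  then obtain v where v: "v \<in> carrier_vec m" "v \<noteq> 0\<^sub>v m" "lead_mat e L *\<^sub>v v = 0\<^sub>v m"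
    using det_0_iff_vec_prod_zero[OF C] by blast
  define w where "w = vec_index v"
  have row: "(\<Sum>i<m. lead_entry e L l i * w i) = 0" if "l < m" for l
  proof -
    have "(\<Sum>i<m. lead_entry e L l i * w i) = vec_index (lead_mat e L *\<^sub>v v) l"
      using that v(1) unfolding w_def lead_mat_def by (simp add: scalar_prod_def lessThan_atLeast0)
    thus ?thesis using that v(3) by simp
  qed
  have split: "sum F {..<m} = sum F {..<kp} + (\<Sum>i<km. F (kp + i))" for F :: "nat \<Rightarrow> real"
    using sum_lessThan_add[of F kp km] unfolding kp_km .
  let ?x = "\<lambda>l. of_int (e l) + rexp l" and ?P = "{l. l < m \<and> plus_row l}" and ?M = "{l. l < m \<and> \<not> plus_row l}"
  have p: "\<forall>i<kp. w i = 0"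
  proof (rule graded_independent[where p = falling_poly and x = ?x and A = ?P])
    show "inj_on ?x ?P" using e by (simp add: exp_distinct_def)
    fix l assume l: "l \<in> ?P"
    have "0 = (2 ^ km * L l) * (\<Sum>i<kp. w i * poly (falling_poly i) (?x l))"
      using row[of l] l unfolding split by (simp add: lead_entry_def sum_distrib_left mult_ac)
    thus "(\<Sum>i<kp. w i * poly (falling_poly i) (?x l)) = 0" using L[of l] l by simp
  qed (auto simp: falling_poly kp_def)
  have "\<forall>i<km. (- 1) ^ i * w (kp + i) = 0"
  proof (rule graded_independent[where p = falling_poly and x = ?x and A = ?M])
    show "inj_on ?x ?M" using e by (simp add: exp_distinct_def)
    fix l assume l: "l \<in> ?M"
    have "0 = ((- 2) ^ kp * L l) * (\<Sum>i<km. (- 1) ^ i * w (kp + i) * poly (falling_poly i) (?x l))"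
      using row[of l] l unfolding split by (simp add: lead_entry_def sum_distrib_left mult_ac)
    thus "(\<Sum>i<km. (- 1) ^ i * w (kp + i) * poly (falling_poly i) (?x l)) = 0" using L[of l] l by simp
  qed (auto simp: falling_poly km_def)
  hence q: "\<forall>i<km. w (kp + i) = 0" by simp
  have "w i = 0" if "i < m" for i
    using p q[rule_format, of "i - kp"] kp_km that by (cases "i < kp") auto
  hence "v = 0\<^sub>v m" using v(1) unfolding w_def by (intro eq_vecI) auto
  thus False using v(2) by simp
qed

text \<open>The columns at y - 1, ..., y - m are powers of the weighted shift taken at the last
  point \<open>y - m\<close>; multiplying by \<open>mix_mat\<close> combines them to the operators
  \<open>mix_poly\<close>.\<close>

lemma cdet_mix:
  "cdet y (\<lambda>l r. f l (y - real (Suc r))) * Determinant.det mix_mat =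
     Determinant.det (mat m m (\<lambda>(l, i). row_poly a b N (rtyp l) (mix_poly kp km i) (f l) (y - real m)))"
proof -
  let ?A = "mat m m (\<lambda>(l, r). \<xi> a b N (rtyp l) (y - real (Suc r)) (m - Suc r) * f l (y - real (Suc r)))"
  have "?A * mix_mat = mat m m (\<lambda>(l, i). row_poly a b N (rtyp l) (mix_poly kp km i) (f l) (y - real m))"
  proof (rule eq_matI, goal_cases)
    case (1 l i)
    hence l: "l < m" and i: "i < m" by auto
    have "(?A * mix_mat) $$ (l, i) = (\<Sum>r<m. \<xi> a b N (rtyp l) (y - real (Suc r)) (m - Suc r) * f l (y - real (Suc r)) * coeff (mix_poly kp km i) (m - Suc r))"
      using l i by (simp add: mix_mat_def scalar_prod_def lessThan_atLeast0)
    also have "\<dots> = (\<Sum>k<m. coeff (mix_poly kp km i) k * (\<xi> a b N (rtyp l) (y - real m + real k) k * f l (y - real m + real k)))"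
      by (rule sum.reindex_bij_witness[of _ "\<lambda>k. m - Suc k" "\<lambda>k. m - Suc k"]) (auto simp: of_nat_diff algebra_simps)
    also have "\<dots> = row_poly a b N (rtyp l) (mix_poly kp km i) (f l) (y - real m)"
      using degree_mix_poly[of i kp km] i kp_km by (subst row_poly_bound[of _ m]) auto
    finally show ?case using l i by simp
  qed (auto simp: mix_mat_def)
  thus ?thesis unfolding cdet_def by (subst det_mult[symmetric, of _ m]) (auto simp: mix_mat_def)
qed

definition cas_deg :: "(nat \<Rightarrow> int) \<Rightarrow> int" where
  "cas_deg e = (\<Sum>l<m. e l) - int (kp choose 2) - int (km choose 2)"

lemma sum_int_lessThan: "(\<Sum>i<n. int i) = int (n choose 2)"
  by (induction n) (auto simp: choose_two numeral_2_eq_2)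

lemma rdeg_cdet_mix:
  assumes f: "\<And>l. l < m \<Longrightarrow> rdeg (e l) (L l) (f l)"
  shows "rdeg (cas_deg e) (Determinant.det (lead_mat e L))
     (\<lambda>y. cdet y (\<lambda>l r. f l (y - real (Suc r))) * Determinant.det mix_mat)"
proof -
  \<comment> \<open>The offsets give the entries of the two diagonal blocks exactly the degree
    \<open>\<rho> l - \<gamma> i\<close>, while entries off the blocks have strictly smaller degree
    and count as 0 in \<open>lead_mat\<close>.\<close>
  define \<rho> where "\<rho> l = (if plus_row l then e l else e l - (int km - int kp))" for l
  define \<gamma> where "\<gamma> i = (if i < kp then int i else int i - int km)" for i
  have s1: "(\<Sum>l<m. \<rho> l) = (\<Sum>l<m. e l) - int km * (int km - int kp)"
  proof -
    have "(\<Sum>l<m. \<rho> l) = (\<Sum>l<m. e l) - (\<Sum>l<m. if plus_row l then 0 else int km - int kp)"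
      unfolding sum_subtractf[symmetric] by (intro sum.cong) (auto simp: \<rho>_def)
    also have "(\<Sum>l<m. if plus_row l then 0 else int km - int kp) = (\<Sum>l\<in>{l. l < m \<and> \<not> plus_row l}. int km - int kp)"
      by (rule sum.mono_neutral_cong_right) auto
    finally show ?thesis by (simp add: km_def)
  qed
  have s2: "(\<Sum>i<m. \<gamma> i) = int (kp choose 2) + (int (km choose 2) + int km * (int kp - int km))"
  proof -
    have "(\<Sum>i<m. \<gamma> i) = (\<Sum>i<kp. \<gamma> i) + (\<Sum>i<km. \<gamma> (kp + i))"
      using sum_lessThan_add[of \<gamma> kp km] unfolding kp_km .
    also have "(\<Sum>i<km. \<gamma> (kp + i)) = (\<Sum>i<km. int i + (int kp - int km))" by (intro sum.cong) (auto simp: \<gamma>_def)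
    also have "\<dots> = int (km choose 2) + int km * (int kp - int km)" unfolding sum.distrib sum_int_lessThan by simp
    also have "(\<Sum>i<kp. \<gamma> i) = int (kp choose 2)" unfolding sum_int_lessThan[symmetric] by (intro sum.cong) (auto simp: \<gamma>_def)
    finally show ?thesis .
  qed
  have "rdeg ((\<Sum>l<m. \<rho> l) - (\<Sum>i<m. \<gamma> i)) (Determinant.det (lead_mat e L))
     (\<lambda>y. Determinant.det (mat m m (\<lambda>(l, i). row_poly a b N (rtyp l) (mix_poly kp km i) (f l) (y - real m))))"
    unfolding lead_mat_def
  proof (rule rdeg_det)
    fix l i assume l: "l < m" and i: "i < m"
    note t = rtyp_range[OF l]
    let ?F = "row_poly a b N (rtyp l) (mix_poly kp km i) (f l)"
    note R = rdeg_row_poly[OF t f[OF l], of _ _ a b N]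
    have "rdeg (\<rho> l - \<gamma> i) (lead_entry e L l i) ?F"
    proof (cases "plus_row l")
      case True
      hence s: "row_sign (rtyp l) = 1" by (simp add: plus_row_def row_sign_def)
      show ?thesis
      proof (cases "i < kp")
        case True
        thus ?thesis using R[of i km] \<open>plus_row l\<close> unfolding s by (simp add: \<rho>_def \<gamma>_def lead_entry_def mix_poly_def)
      next
        case False
        hence "e l - int kp < \<rho> l - \<gamma> i" using \<open>plus_row l\<close> i kp_km by (simp add: \<rho>_def \<gamma>_def)
        from rdeg_weaken[OF R[of kp "i - kp"] this] show ?thesis using False \<open>plus_row l\<close> unfolding s
          by (simp add: lead_entry_def mix_poly_def mult.commute)
      qed
    next
      case False
      hence s: "row_sign (rtyp l) = - 1" by (simp add: plus_row_def row_sign_def)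
      show ?thesis
      proof (cases "i < kp")
        case False
        thus ?thesis using R[of "i - kp" kp] \<open>\<not> plus_row l\<close> unfolding s
          by (simp add: \<rho>_def \<gamma>_def lead_entry_def mix_poly_def of_nat_diff algebra_simps)
      next
        case True
        hence "e l - int km < \<rho> l - \<gamma> i" using \<open>\<not> plus_row l\<close> i kp_km by (simp add: \<rho>_def \<gamma>_def)
        from rdeg_weaken[OF R[of km i] this] show ?thesis using True \<open>\<not> plus_row l\<close> unfolding s
          by (simp add: lead_entry_def mix_poly_def mult.commute)
      qed
    qed
    from rdeg_shift[OF this, of "- real m"]
    show "rdeg (\<rho> l - \<gamma> i) (lead_entry e L l i) (\<lambda>y. row_poly a b N (rtyp l) (mix_poly kp km i) (f l) (y - real m))" by simp
  qed
  moreover have "(\<Sum>l<m. \<rho> l) - (\<Sum>i<m. \<gamma> i) = cas_deg e"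
    unfolding s1 s2 cas_deg_def by (simp add: algebra_simps)
  ultimately show ?thesis unfolding cdet_mix by simp
qed

text \<open>Instead of evaluating it, the asymptotics are applied to monomial rows: the leading
  coefficient of the mixed determinant is nonzero, so the mixing matrix cannot be singular.\<close>

lemma det_mix_mat:
  assumes "exp_distinct (\<lambda>l. int (e l))"
  shows "Determinant.det mix_mat \<noteq> 0"
proof
  assume z: "Determinant.det mix_mat = 0"
  have "rdeg (int (e l)) 1 (poly (monom 1 (e l)))" for l
    using rdeg_poly[of "monom 1 (e l) :: real poly" "e l"] by (simp add: degree_monom_eq)
  from rdeg_cdet_mix[of "\<lambda>l. int (e l)" "\<lambda>l. 1", OF this]
  have "rdeg (cas_deg (\<lambda>l. int (e l))) (Determinant.det (lead_mat (\<lambda>l. int (e l)) (\<lambda>l. 1))) (poly 0)"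
    by (simp add: z poly_0[abs_def])
  thus False using poly_rdegD(2)[of _ _ 0] det_lead_mat[OF assms, of "\<lambda>l. 1"] by fastforce
qed

lemma rdeg_cdet:
  assumes d: "Determinant.det mix_mat \<noteq> 0" and f: "\<And>l. l < m \<Longrightarrow> rdeg (e l) (L l) (f l)"
  shows "rdeg (cas_deg e) (Determinant.det (lead_mat e L) / Determinant.det mix_mat)
     (\<lambda>y. cdet y (\<lambda>l r. f l (y - real (Suc r))))"
  using rdeg_cmult[OF rdeg_cdet_mix[of e L f, OF f], of "1 / Determinant.det mix_mat"] d by simp

end

section \<open>Degrees of \<open>S\<close>, \<open>S * \<Omega>\<close> and
  \<open>M_fun\<close>\<close>

lemma sum_nat_lessThan: "(\<Sum>i<n. i) = n choose 2"
  by (induction n) (auto simp: choose_two numeral_2_eq_2)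

lemma sum_minus_Suc: "k \<le> m \<Longrightarrow> (\<Sum>i<m. k - Suc i) = k choose 2"
proof -
  assume k: "k \<le> m"
  have "(\<Sum>i<m. k - Suc i) = (\<Sum>i<k. k - Suc i)" by (rule sum.mono_neutral_right) (use k in auto)
  also have "\<dots> = (\<Sum>i<k. i)" by (rule sum.nat_diff_reindex)
  finally show ?thesis unfolding sum_nat_lessThan .
qed

lemma degree_common_weight:
  assumes k: "k \<le> m"
  shows "degree (common_weight c m [:p, 1:] k) = 2 * (k choose 2)"
proof -
  have d: "degree (pcompose [:p, 1:] (col_pt i)) = 1" "pcompose [:p, 1:] (col_pt i) \<noteq> 0"
    "degree (pcompose [:p, 1:] (ref_pt c i)) = 1" "pcompose [:p, 1:] (ref_pt c i) \<noteq> 0" for i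
    by (simp_all add: col_pt_def ref_pt_def pcompose_pCons)
  have "degree (common_weight c m [:p, 1:] k) = (\<Sum>i<m. (k - (m - i)) + (k - Suc i))"
    unfolding common_weight_def using d
    by (subst degree_prod_eq_sum_degree) (auto simp: degree_mult_eq degree_power_eq intro!: sum.cong)
  also have "\<dots> = (\<Sum>i<m. k - (m - i)) + (\<Sum>i<m. k - Suc i)" by (rule sum.distrib)
  also have "(\<Sum>i<m. k - (m - i)) = (\<Sum>i<m. k - Suc i)"
    by (rule sum.reindex_bij_witness[of _ "\<lambda>i. m - Suc i" "\<lambda>i. m - Suc i"]) auto
  finally show ?thesis using sum_minus_Suc[OF k] by simp
qed

lemma degree_mirror_prod: "degree (mirror_prod c m) = m choose 2"
proof -
  have "degree (mirror_prod c m) = card {(i, j). i < j \<and> j < m}"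
    unfolding mirror_prod_def by (subst degree_prod_eq_sum_degree) (simp_all add: mirror_lin_def case_prod_beta)
  also have "\<dots> = card (SIGMA j:{..<m}. {..<j})"
    by (rule bij_betw_same_card[of prod.swap]) (auto simp: bij_betw_def inj_on_def image_iff)
  also have "\<dots> = m choose 2" by (simp add: sum_nat_lessThan)
  finally show ?thesis .
qed

lemma degree_pochhammer_linear: "degree (pochhammer [:p, 1:] n :: real poly) = n"
proof -
  have "degree ([:p, 1:] + of_nat k :: real poly) = 1" "[:p, 1:] + of_nat k \<noteq> (0 :: real poly)" for k
    by (simp_all add: of_nat_poly)
  thus ?thesis unfolding pochhammer_prod by (subst degree_prod_eq_sum_degree) auto
qed

lemma sum_1_to_4: "(\<Sum>t=1..4. f t) = f 1 + f 2 + f 3 + f (4 :: nat)"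
  by (simp add: eval_nat_numeral add_ac)

lemma int_choose_two: "2 * int (n choose 2) = int n * (int n - 1)"
  by (induction n) (auto simp: choose_two numeral_2_eq_2 algebra_simps)

definition rdeg_le :: "int \<Rightarrow> (real \<Rightarrow> real) \<Rightarrow> bool" where "rdeg_le e f \<longleftrightarrow> (\<exists>L. rdeg e L f)"

lemma rdeg_le_mult: "rdeg_le e f \<Longrightarrow> rdeg_le e' g \<Longrightarrow> rdeg_le (e + e') (\<lambda>x. f x * g x)"
  unfolding rdeg_le_def using rdeg_mult by blast

lemma rdeg_le_sum: "(\<And>i. i \<in> A \<Longrightarrow> rdeg_le e (f i)) \<Longrightarrow> rdeg_le e (\<lambda>x. \<Sum>i\<in>A. f i x)"
  unfolding rdeg_le_def by (metis rdeg_sum)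

lemma rdeg_le_poly: "degree p \<le> n \<Longrightarrow> rdeg_le (int n) (poly p)"
  unfolding rdeg_le_def using rdeg_poly by blast

lemma rdeg_le_cong: "MOST x. f x = g x \<Longrightarrow> rdeg_le e f \<Longrightarrow> rdeg_le e g"
  unfolding rdeg_le_def using rdeg_cong by blast

definition diff1 :: "(real \<Rightarrow> real) \<Rightarrow> real \<Rightarrow> real" where "diff1 f x = f (x + 1) - f x"

lemma rdeg_le_diff1: "rdeg_le e f \<Longrightarrow> rdeg_le (e - int i) ((diff1 ^^ i) f)"
proof (induction i)
  case (Suc i)
  then obtain L where "rdeg (e - int i) L ((diff1 ^^ i) f)" by (auto simp: rdeg_le_def)
  from rdeg_difference[OF this, of 1] show ?case
    by (auto simp: rdeg_le_def diff1_def[abs_def] algebra_simps)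
qed simp

lemma diff1_sum: "(diff1 ^^ i) (\<lambda>x. \<Sum>j\<in>A. k j * f j x) = (\<lambda>x. \<Sum>j\<in>A. k j * (diff1 ^^ i) (f j) x)"
  by (induction i) (auto simp: diff1_def fun_eq_iff algebra_simps sum_subtractf)

text \<open>Newton's formula moves values at different shifts to one common point. It pays off
  because every difference lowers the degree by one.\<close>

lemma newton_forward: "s \<le> n \<Longrightarrow> f (x + real s) = (\<Sum>i\<le>n. real (s choose i) * (diff1 ^^ i) f x)"
proof (induction s arbitrary: n x)
  case 0
  have "(\<Sum>i\<le>n. real (0 choose i) * (diff1 ^^ i) f x) = (\<Sum>i\<in>{0}. real (0 choose i) * (diff1 ^^ i) f x)"
    by (rule sum.mono_neutral_right) auto
  thus ?case by simp
next
  case (Suc s)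
  then obtain n' where n: "n = Suc n'" "s \<le> n'" by (cases n) auto
  have "f (x + real (Suc s)) = f (x + 1 + real s)" by (simp add: add_ac)
  also have "\<dots> = (\<Sum>i\<le>n. real (s choose i) * ((diff1 ^^ i) f x + (diff1 ^^ Suc i) f x))"
  proof -
    have "(diff1 ^^ i) f x + (diff1 ^^ Suc i) f x = (diff1 ^^ i) f (x + 1)" for i
      unfolding funpow.simps comp_apply diff1_def[of "(diff1 ^^ i) f" x] by simp
    thus ?thesis using Suc.IH[of n "x + 1"] Suc.prems by simp
  qed
  also have "\<dots> = (\<Sum>i\<le>n. real (s choose i) * (diff1 ^^ i) f x) + (\<Sum>i\<le>n'. real (s choose i) * (diff1 ^^ Suc i) f x)"
    using n by (simp add: distrib_left sum.distrib binomial_eq_0)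
  also have "\<dots> = (\<Sum>i\<le>n. real (Suc s choose i) * (diff1 ^^ i) f x)"
    unfolding n(1) by (simp only: sum.atMost_Suc_shift) (simp add: distrib_right sum.distrib add_ac)
  finally show ?case .
qed

lemma poly_falling_poly: "poly (falling_poly i) (real s) = fact i * real (s choose i)"
proof -
  have "poly (falling_poly i) (real s) = (\<Prod>j = 0..<i. real s - real j)"
    by (simp add: falling_poly_def poly_prod lessThan_atLeast0)
  thus ?thesis by (simp add: binomial_gbinomial gbinomial_mult_fact)
qed

context casorati_rows
begin

definition "cnt t = card {l. l < m \<and> rtyp l = t}"

lemma card_union_types:
  "t \<noteq> t' \<Longrightarrow> card {l. l < m \<and> (rtyp l = t \<or> rtyp l = t')} = cnt t + cnt t'"
  unfolding cnt_def by (subst card_Un_disjoint[symmetric]) (auto intro!: arg_cong[where f = card])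

lemma card_types: "k12 = cnt 1 + cnt 2" "k24 = cnt 2 + cnt 4" "kp = cnt 2 + cnt 3" "km = cnt 1 + cnt 4"
proof -
  have "{l. l < m \<and> \<not> plus_row l} = {l. l < m \<and> (rtyp l = 1 \<or> rtyp l = 4)}"
    using rtyp_range by (auto simp: plus_row_def)
  thus "k12 = cnt 1 + cnt 2" "k24 = cnt 2 + cnt 4" "kp = cnt 2 + cnt 3" "km = cnt 1 + cnt 4"
    unfolding kp_def km_def ty12_def ty24_def plus_row_def
    by (simp_all add: card_union_types[symmetric])
qed

lemma card_le_m: "card {l. l < m \<and> P l} \<le> m"
  using card_mono[of "{..<m}" "{l. l < m \<and> P l}"] by auto

definition S_deg :: int where
  "S_deg = 1 + (int m - 1) * (int k12 + int k24) - 2 * int (k12 choose 2) - 2 * int (k24 choose 2) - int (m choose 2)"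

lemma rdeg_S: "\<exists>L. L \<noteq> 0 \<and> rdeg S_deg L S"
proof -
  have mid: "mid \<noteq> 0" "degree mid = 1" by (simp_all add: mid_def)
  hence n0: "S_num \<noteq> 0" using den_nonzero sgn_all_sq unfolding S_num_def by auto
  have "int (degree S_num) = 1 + (int m - 1) * (int k12 + int k24)"
  proof -
    have "degree S_num = 1 + (m - 1) * k12 + (m - 1) * k24"
      unfolding S_num_def using mid den_nonzero sgn_all_sq
      by (auto simp: degree_mult_eq degree_power_eq den12_def den24_def degree_pochhammer_linear mult.commute)
    moreover have "m = 0 \<Longrightarrow> k12 = 0 \<and> k24 = 0" using card_le_m[of ty12] card_le_m[of ty24] by linarith
    ultimately show ?thesis by (cases m) (auto simp: algebra_simps)
  qed
  moreover have "degree S_den = 2 * (k12 choose 2) + 2 * (k24 choose 2) + (m choose 2)"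
    unfolding S_den_def using com_nonzero mirror_prod_nonzero[of c m]
    by (simp add: degree_mult_eq degree_common_weight degree_mirror_prod card_le_m)
  ultimately have "int (degree S_num) = int (degree S_den) + S_deg" unfolding S_deg_def by simp
  hence "rdeg S_deg (lead_coeff S_num / lead_coeff S_den) S"
    using S_den_nonzero by (intro rdegI[where P = S_num and Q = S_den and n = "degree S_num"]) (auto simp: S_def)
  thus ?thesis using n0 S_den_nonzero by (intro exI[of _ "lead_coeff S_num / lead_coeff S_den"]) simp
qed

text \<open>Both degrees are quadratic in the numbers of rows of the four types. All mixed products
  cancel, and one binomial coefficient per type is left.\<close>

lemma S_cas_deg: "S_deg + cas_deg e = 1 + (\<Sum>l<m. e l) - 2 * (\<Sum>t=1..4. int (cnt t choose 2))"
proof -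
  have "2 * (S_deg + cas_deg e) = 2 + 2 * (int m - 1) * (int k12 + int k24) - 2 * (2 * int (k12 choose 2)) - 2 * (2 * int (k24 choose 2))
      - 2 * int (m choose 2) - 2 * int (kp choose 2) - 2 * int (km choose 2) + 2 * (\<Sum>l<m. e l)"
    unfolding S_deg_def cas_deg_def by (simp add: algebra_simps)
  also have "\<dots> = 2 + 2 * (\<Sum>l<m. e l) - 2 * (\<Sum>t=1..4. 2 * int (cnt t choose 2))"
    unfolding int_choose_two card_types unfolding kp_km[symmetric] sum_1_to_4 card_types(3,4) by (simp add: algebra_simps)
  finally have "2 * (S_deg + cas_deg e) = 2 * (1 + (\<Sum>l<m. e l) - 2 * (\<Sum>t=1..4. int (cnt t choose 2)))"
    unfolding sum_distrib_left[symmetric] right_diff_distrib distrib_left by simp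
  thus ?thesis unfolding mult_left_cancel[OF zero_neq_numeral[symmetric]] .
qed

context
  assumes nz: "\<And>l. l < m \<Longrightarrow> Yl l \<noteq> 0"
    and distinct: "exp_distinct (\<lambda>l. int (2 * degree (Yl l)))"
begin

lemma rdeg_theta_row: "rdeg (int (2 * degree (Yl l))) (lead_coeff (Yl l)) (\<lambda>x. poly (Yl l) (x * (x + c)))"
proof -
  let ?p = "pcompose (Yl l) [:0, c, 1:]"
  have "degree ?p = 2 * degree (Yl l)" by (simp add: degree_pcompose)
  moreover have "lead_coeff ?p = lead_coeff (Yl l)" by (subst lead_coeff_comp) auto
  moreover have "poly ?p = (\<lambda>x. poly (Yl l) (x * (x + c)))" by (rule ext) (simp add: poly_pcompose algebra_simps)
  ultimately show ?thesis using rdeg_poly[of ?p "degree ?p"] by simp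
qed

lemma degree_upoly:
  "upoly Yl \<noteq> 0" "int (degree (upoly Yl)) = 1 + 2 * (\<Sum>l<m. int (degree (Yl l))) - 2 * (\<Sum>t=1..4. int (cnt t choose 2))"
proof -
  obtain L where L: "L \<noteq> 0" "rdeg S_deg L S" using rdeg_S by blast
  note d = det_mix_mat[OF distinct]
  let ?e = "\<lambda>l. int (2 * degree (Yl l))" and ?D = "\<lambda>y. cdet y (\<lambda>l r. poly (Yl l) ((y - real (Suc r)) * (y - real (Suc r) + c)))"
  let ?L = "L * (Determinant.det (lead_mat ?e (\<lambda>l. lead_coeff (Yl l))) / Determinant.det mix_mat)"
  have "rdeg (cas_deg ?e) (Determinant.det (lead_mat ?e (\<lambda>l. lead_coeff (Yl l))) / Determinant.det mix_mat) ?D"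
    by (rule rdeg_cdet[OF d, where f = "\<lambda>l x. poly (Yl l) (x * (x + c))"]) (rule rdeg_theta_row)
  from rdeg_mult[OF L(2) this] have 1: "rdeg (S_deg + cas_deg ?e) ?L (\<lambda>y. S y * ?D y)" .
  have 2: "MOST y. S y * ?D y = poly (upoly Yl) y"
    using S_\<Omega> unfolding \<Omega>_cdet theta_rows_def poly_pcompose poly_theta_pt .
  have "?L \<noteq> 0" using L(1) d det_lead_mat[OF distinct, of "\<lambda>l. lead_coeff (Yl l)"] nz by simp
  with poly_rdegD(2)[OF rdeg_cong[OF 2 1]] have *: "int (degree (upoly Yl)) = S_deg + cas_deg ?e" "lead_coeff (upoly Yl) = ?L"
    by blast+
  show "upoly Yl \<noteq> 0" using *(2) \<open>?L \<noteq> 0\<close> by (metis leading_coeff_0_iff)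
  show "int (degree (upoly Yl)) = 1 + 2 * (\<Sum>l<m. int (degree (Yl l))) - 2 * (\<Sum>t=1..4. int (cnt t choose 2))"
    unfolding *(1) S_cas_deg by (simp add: sum_distrib_left)
qed

text \<open>The polynomial \<open>upoly Yl\<close> has odd degree, so reflection changes the sign of
  its leading coefficient. The value -1 would make it invariant.\<close>

lemma mirror_sign_1: "mirror_sign = 1"
proof (rule ccontr)
  assume "mirror_sign \<noteq> 1"
  hence "mirror_sign = -1" using mirror_sign by blast
  hence "poly (pcompose (upoly Yl) [:real m + 1 - c, -1:]) y = poly (upoly Yl) y" for y
    using upoly_reflect[of Yl y] by (simp add: poly_pcompose)
  hence e: "pcompose (upoly Yl) [:real m + 1 - c, -1:] = upoly Yl" by (intro poly_eq_poly_eq_iff[THEN iffD1] ext)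
  have "int (degree (upoly Yl)) = 2 * ((\<Sum>l<m. int (degree (Yl l))) - (\<Sum>t=1..4. int (cnt t choose 2))) + 1"
    unfolding degree_upoly(2) by simp
  hence "odd (int (degree (upoly Yl)))" by presburger
  hence "odd (degree (upoly Yl))" by simp
  hence "lead_coeff (pcompose (upoly Yl) [:real m + 1 - c, -1:]) = - lead_coeff (upoly Yl)"
    by (subst lead_coeff_comp) auto
  thus False unfolding e using degree_upoly(1) by simp
qed

text \<open>A window before shifting: \<open>Tj h (Suc j) x\<close> is
  \<open>Gcol h j (x + Suc j)\<close>.\<close>

definition Gcol :: "nat \<Rightarrow> nat \<Rightarrow> real \<Rightarrow> real" where
  "Gcol h j y = poly mid y * poly (red (unit_row h j)) y / poly V y"

text \<open>A combination with powers of the column points is again \<open>S * cdet\<close>, with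
  the power as row \<open>h\<close>, so its degree is known. Only a bound holds, as the exponent of
  the new row may coincide with another one.\<close>

lemma Gcol_moment:
  assumes h: "h < m"
  shows "rdeg_le (int (degree (upoly Yl)) - int (2 * degree (Yl h)) + int k)
     (\<lambda>y. \<Sum>j<m. (y - real (Suc j)) ^ k * Gcol h j y)"
proof -
  obtain L where L: "rdeg S_deg L S" using rdeg_S by blast
  note d = det_mix_mat[OF distinct]
  let ?f = "\<lambda>l x. if l = h then x ^ k else poly (Yl l) (x * (x + c))"
  let ?e = "\<lambda>l. if l = h then int k else int (2 * degree (Yl l))"
  let ?L = "\<lambda>l. if l = h then 1 else lead_coeff (Yl l)"
  have f: "rdeg (?e l) (?L l) (?f l)" for l
  proof (cases "l = h")
    case True
    have "rdeg (int k) 1 (poly (monom 1 k))" using rdeg_poly[of "monom 1 k" k] by (simp add: degree_monom_eq)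
    moreover have "poly (monom 1 k) = (\<lambda>x :: real. x ^ k)" by (rule ext) (simp add: poly_monom)
    ultimately show ?thesis using True by simp
  qed (use rdeg_theta_row in simp)
  from rdeg_mult[OF L rdeg_cdet[where f = ?f and e = ?e and L = ?L, OF d f]]
  have 1: "rdeg_le (S_deg + cas_deg ?e) (\<lambda>y. S y * cdet y (\<lambda>l r. ?f l (y - real (Suc r))))"
    unfolding rdeg_le_def by blast
  have e: "S_deg + cas_deg ?e = int (degree (upoly Yl)) - int (2 * degree (Yl h)) + int k"
  proof -
    have "(\<Sum>l<m. ?e l) = (\<Sum>l<m. int (2 * degree (Yl l))) - int (2 * degree (Yl h)) + int k"
      using h by (subst (1 2) sum.remove[of _ h]) (auto intro!: sum.cong)
    thus ?thesis unfolding S_cas_deg degree_upoly(2) by (simp add: sum_distrib_left)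
  qed
  let ?Q = "\<lambda>l r. if l = h then col_pt r ^ k else theta_rows Yl l r"
  have Q: "poly (?Q l r) y = ?f l (y - real (Suc r))" for l r y
    by (simp add: poly_col_pt theta_rows_def poly_pcompose poly_theta_pt)
  have "MOST y. S y * cdet y (\<lambda>l r. ?f l (y - real (Suc r))) = (\<Sum>j<m. (y - real (Suc j)) ^ k * Gcol h j y)"
    using S_cdet
  proof eventually_elim
    case (elim y)
    have "S y * cdet y (\<lambda>l r. ?f l (y - real (Suc r))) = poly mid y * poly (red ?Q) y / poly V y"
      using elim[rule_format, of ?Q] unfolding Q .
    also have "\<dots> = (\<Sum>j<m. (y - real (Suc j)) ^ k * Gcol h j y)"
      unfolding red_row_expand[OF h, of "\<lambda>r. col_pt r ^ k"] Gcol_def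
      by (simp add: poly_sum poly_col_pt sum_distrib_left sum_divide_distrib mult_ac del: of_nat_Suc)
    finally show ?case .
  qed
  from rdeg_le_cong[OF this 1] show ?thesis unfolding e .
qed

text \<open>Single windows are not bounded by this degree, but their moments are. From moments in
  the column points one passes to moments in \<open>j\<close> and to binomial moments, of degree at
  most \<open>c0 + i\<close>. Newton's formula writes the sum of the windows as the sum of the
  \<open>i\<close>-th differences of these, and the differences take away the surplus
  \<open>i\<close>.\<close>

lemma M_fun_degree:
  assumes h: "h < m" and M: "MOST x. M_fun a b N U S (Suc h) x = poly M x" "M \<noteq> 0"
  shows "degree M + 2 * degree (Yl h) \<le> degree (upoly Yl)"
proof -
  define c0 where "c0 = int (degree (upoly Yl)) - int (2 * degree (Yl h))"
  have pw: "rdeg_le (c0 + int n) (\<lambda>y. \<Sum>j<m. real (Suc j) ^ n * Gcol h j y)" for n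
  proof -
    have "rdeg_le (c0 + int n) (\<lambda>y. \<Sum>k\<le>n. poly (monom (real (n choose k) * (-1) ^ k) (n - k)) y * (\<Sum>j<m. (y - real (Suc j)) ^ k * Gcol h j y))"
      (is "rdeg_le _ (\<lambda>y. \<Sum>k\<le>n. ?t k y)")
    proof (rule rdeg_le_sum)
      fix k assume k: "k \<in> {..n}"
      have "rdeg_le (int (n - k) + (c0 + int k)) (?t k)"
        unfolding c0_def by (intro rdeg_le_mult rdeg_le_poly degree_monom_le Gcol_moment[OF h])
      moreover have "int (n - k) + (c0 + int k) = c0 + int n" using k by simp
      ultimately show "rdeg_le (c0 + int n) (?t k)" by (simp only:)
    qed
    moreover have "(\<Sum>k\<le>n. ?t k y) = (\<Sum>j<m. real (Suc j) ^ n * Gcol h j y)" for y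
    proof -
      have "real (Suc j) ^ n = (\<Sum>k\<le>n. real (n choose k) * (- (y - real (Suc j))) ^ k * y ^ (n - k))" for j
        using binomial_ring[of "- (y - real (Suc j))" y n] by simp
      also have "\<dots> j = (\<Sum>k\<le>n. real (n choose k) * (-1) ^ k * y ^ (n - k) * (y - real (Suc j)) ^ k)" for j
        by (intro sum.cong refl) (subst power_minus, simp only: mult_ac)
      finally have e: "real (Suc j) ^ n = (\<Sum>k\<le>n. real (n choose k) * (-1) ^ k * y ^ (n - k) * (y - real (Suc j)) ^ k)" for j .
      show ?thesis unfolding poly_monom sum_distrib_left
        by (subst sum.swap, simp only: e sum_distrib_right) (simp only: mult_ac)
    qed
    ultimately show ?thesis by simp
  qed
  have bin: "rdeg_le (c0 + int i) (\<lambda>y. \<Sum>j<m. real (Suc j choose i) * Gcol h j y)" for i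
  proof -
    have "rdeg_le (c0 + int i) (\<lambda>y. \<Sum>n\<le>i. poly [:coeff (falling_poly i) n / fact i:] y * (\<Sum>j<m. real (Suc j) ^ n * Gcol h j y))"
      (is "rdeg_le _ (\<lambda>y. \<Sum>n\<le>i. ?t n y)")
    proof (rule rdeg_le_sum)
      fix n assume n: "n \<in> {..i}"
      have "rdeg_le (int (i - n) + (c0 + int n)) (?t n)"
        by (intro rdeg_le_mult rdeg_le_poly pw) simp
      moreover have "int (i - n) + (c0 + int n) = c0 + int i" using n by simp
      ultimately show "rdeg_le (c0 + int i) (?t n)" by (simp only:)
    qed
    moreover have "(\<Sum>n\<le>i. ?t n y) = (\<Sum>j<m. real (Suc j choose i) * Gcol h j y)" for y
    proof -
      have "real (Suc j choose i) = (\<Sum>n\<le>i. coeff (falling_poly i) n / fact i * real (Suc j) ^ n)" for j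
        using poly_falling_poly[of i "Suc j"] by (simp add: poly_altdef falling_poly sum_divide_distrib[symmetric] field_simps del: of_nat_Suc)
      thus ?thesis
        unfolding sum_distrib_left by (subst sum.swap, simp only: sum_distrib_right) (simp add: mult_ac del: of_nat_Suc)
    qed
    ultimately show ?thesis by simp
  qed
  have "rdeg_le c0 (\<lambda>x. \<Sum>i\<le>m. (diff1 ^^ i) (\<lambda>y. \<Sum>j<m. real (Suc j choose i) * Gcol h j y) x)"
  proof (rule rdeg_le_sum)
    fix i
    from rdeg_le_diff1[OF bin[of i], of i]
    show "rdeg_le c0 ((diff1 ^^ i) (\<lambda>y. \<Sum>j<m. real (Suc j choose i) * Gcol h j y))" by simp
  qed
  moreover have "(\<Sum>i\<le>m. (diff1 ^^ i) (\<lambda>y. \<Sum>j<m. real (Suc j choose i) * Gcol h j y) x) = (\<Sum>j=1..m. Tj h j x)" for x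
  proof -
    have "(\<Sum>i\<le>m. (diff1 ^^ i) (\<lambda>y. \<Sum>j<m. real (Suc j choose i) * Gcol h j y) x) = (\<Sum>j<m. \<Sum>i\<le>m. real (Suc j choose i) * (diff1 ^^ i) (Gcol h j) x)"
      unfolding diff1_sum by (rule sum.swap)
    also have "\<dots> = (\<Sum>j<m. Gcol h j (x + real (Suc j)))"
      by (intro sum.cong refl newton_forward[symmetric]) simp
    also have "\<dots> = (\<Sum>j=1..m. Tj h j x)"
      by (rule sum.reindex_bij_witness[of _ "\<lambda>j. j - 1" Suc]) (auto simp: Gcol_def Tj_def)
    finally show ?thesis .
  qed
  ultimately have 1: "rdeg_le c0 (\<lambda>x. \<Sum>j=1..m. Tj h j x)" by simp
  have 2: "MOST x. (\<Sum>j=1..m. Tj h j x) = poly M x"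
    using M(1) M_fun_windows[OF h] by eventually_elim simp
  have "int (degree M) \<le> c0" using M(2) poly_rdegD(1) rdeg_le_cong[OF 2 1] unfolding rdeg_le_def by blast
  thus ?thesis unfolding c0_def by linarith
qed

end

end

section \<open>Existence of the difference operator\<close>

lemma polynomial_antidifference:
  fixes u :: "real poly"
  shows "degree u \<le> n \<Longrightarrow> \<exists>p. degree p \<le> Suc n \<and> (\<forall>x. poly p x - poly p (x - 1) = poly u x)"
proof (induction n arbitrary: u)
  case 0
  then obtain k where "u = [:k:]" by (auto elim: degree_eq_zeroE)
  thus ?case by (intro exI[of _ "[:0, k:]"]) (auto simp: algebra_simps)
next
  case (Suc n)
  define p0 where "p0 = monom (coeff u (Suc n) / real (Suc (Suc n))) (Suc (Suc n))"
  define v where "v = shift (-1) p0 - p0"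
  have p0: "degree p0 \<le> Suc (Suc n)" "coeff p0 (Suc (Suc n)) = coeff u (Suc n) / real (Suc (Suc n))"
    by (simp_all add: p0_def degree_monom_le)
  have v: "degree v \<le> Suc n" "coeff v (Suc n) = - coeff u (Suc n)"
    using coeff_shift_diff[OF p0(1), of "-1"] unfolding p0(2) by (simp_all add: v_def del: of_nat_Suc)
  have "degree (u + v) \<le> Suc n" "coeff (u + v) (Suc n) = 0" using Suc.prems v by (auto intro: degree_add_le)
  hence "degree (u + v) \<le> n" using eq_zero_or_degree_less[of "u + v" "Suc n"] by auto
  then obtain p where p: "degree p \<le> Suc n" "\<And>x. poly p x - poly p (x - 1) = poly (u + v) x" using Suc.IH by blast
  have "poly (p + p0) x - poly (p + p0) (x - 1) = poly u x" for x
    using p(2)[of x] by (simp add: v_def poly_shift)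
  moreover have "degree (p + p0) \<le> Suc (Suc n)" using p(1) p0(1) by (intro degree_add_le) auto
  ultimately show ?case by blast
qed

lemma periodic_poly_const:
  fixes p :: "real poly"
  assumes "\<And>x. poly p x = poly p (x - 1)"
  shows "poly p x = poly p y"
proof -
  have "poly p (real n) = poly p 0" for n by (induction n) (use assms[of "real (Suc _)"] in auto)
  hence "range real \<subseteq> {x. poly (p - [:poly p 0:]) x = 0}" by auto
  moreover have "infinite (range real)" by (rule range_inj_infinite) (simp add: inj_on_def)
  ultimately have "p - [:poly p 0:] = 0" using poly_roots_finite finite_subset by blast
  hence "poly (p - [:poly p 0:]) x = poly (p - [:poly p 0:]) y" by simp
  thus ?thesis by simp
qed

text \<open>Division by the invariant \<open>x * (x + c)\<close> commutes with the reflection, so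
  the quotient has the same symmetry. The linear remainder is a constant for \<open>s = 1\<close>
  and a multiple of \<open>2 * x + c\<close> for \<open>s = -1\<close>.\<close>

lemma reflection_symmetric_poly:
  fixes p :: "real poly"
  shows "pcompose p [:- c, -1:] = smult s p \<Longrightarrow> s = 1 \<or> s = -1 \<Longrightarrow>
    \<exists>Q. p = (if s = 1 then 1 else [:c, 2:]) * pcompose Q [:0, c, 1:]"
proof (induction "degree p" arbitrary: p rule: less_induct)
  case less
  let ?T = "[:0, c, 1:]" and ?R = "[:- c, -1:]" and ?w = "if s = 1 then 1 else [:c, 2:]"
  define q where "q = p div ?T"
  define r where "r = p mod ?T"
  have p: "p = q * ?T + r" unfolding q_def r_def by (rule div_mult_mod_eq[symmetric])
  have r1: "degree r \<le> 1" unfolding r_def using degree_mod_less[of ?T p] by auto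
  have T: "pcompose ?T ?R = ?T" by (simp add: pcompose_pCons algebra_simps)
  have "pcompose q ?R * ?T + pcompose r ?R = smult s q * ?T + smult s r"
    using less.prems(1) unfolding p pcompose_add pcompose_mult T by (simp add: smult_add_right del: mult_pCons_right)
  hence e: "(pcompose q ?R - smult s q) * ?T = smult s r - pcompose r ?R"
    by (simp add: left_diff_distrib algebra_simps del: mult_pCons_right)
  have "degree (smult s r - pcompose r ?R) \<le> 1"
    using r1 by (intro degree_diff_le) (auto simp: degree_pcompose intro: order.trans[OF degree_smult_le])
  hence q0: "pcompose q ?R - smult s q = 0"
    unfolding e[symmetric] using degree_mult_eq[of "pcompose q ?R - smult s q" ?T] by (cases "pcompose q ?R - smult s q = 0") auto
  hence q: "pcompose q ?R = smult s q" and r: "pcompose r ?R = smult s r" using e by auto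
  obtain k l where kl: "r = [:k, l:]"
    using r1 by (intro that[of "coeff r 0" "coeff r 1"] poly_eqI) (auto simp: coeff_pCons coeff_eq_0 split: nat.splits)
  have rf: "\<exists>k. r = ?w * [:k:]"
  proof (cases "s = 1")
    case True
    hence "- l = l" using r unfolding kl by (simp add: pcompose_pCons)
    thus ?thesis using True kl by auto
  next
    case False
    hence "k - c * l = - k" using r less.prems(2) unfolding kl by (simp add: pcompose_pCons)
    thus ?thesis using False kl by (intro exI[of _ "l / 2"]) (simp add: mult.commute)
  qed
  then obtain k where k: "r = ?w * [:k:]" by blast
  show ?case
  proof (cases "q = 0")
    case True
    thus ?thesis using p k by (intro exI[of _ "[:k:]"]) (simp add: pcompose_pCons)
  next
    case False
    have "degree (q * ?T) = degree q + 2" using False by (subst degree_mult_eq) auto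
    hence "degree q < degree p" unfolding p using r1 by (subst degree_add_eq_left) auto
    then obtain Q where Q: "q = ?w * pcompose Q ?T" using less.hyps q less.prems(2) by blast
    have "p = ?w * pcompose (pCons k Q) ?T"
      unfolding p k Q by (simp add: pcompose_pCons[of k Q] algebra_simps del: mult_pCons_right mult_pCons_left)
    thus ?thesis by blast
  qed
qed

section \<open>Assembling the operator\<close>

context casorati_rows
begin

lemma red_col_expand:
  assumes j: "j < m"
  shows "(\<Sum>h<m. theta_rows Yl h j * red (unit_row h j)) = red (theta_rows Yl)"
proof -
  have "(\<Sum>h<m. theta_rows Yl h j * (\<Prod>l<m. unit_row h j l (\<pi> l))) = (\<Prod>l<m. theta_rows Yl l (\<pi> l))"
    if p: "\<pi> permutes {0..<m}" for \<pi>
  proof -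
    obtain h where h: "h < m" "\<pi> h = j" using permutes_surj[OF p] permutes_in_image[OF p] j
      by (metis atLeastLessThan_iff surj_def zero_le)
    have inj: "\<pi> h' = j \<Longrightarrow> h' = h" for h' using permutes_inj[OF p] h(2) by (auto dest: injD)
    have 1: "(\<Prod>l<m. unit_row h' j l (\<pi> l)) = (if \<pi> h' = j then 1 else 0) * (\<Prod>l\<in>{..<m} - {h'}. theta_rows Yl l (\<pi> l))" if "h' < m" for h'
      using that by (subst prod.remove[of _ h']) (auto simp: unit_row_def intro!: prod.cong)
    have "(\<Sum>h'<m. theta_rows Yl h' j * (\<Prod>l<m. unit_row h' j l (\<pi> l))) =
      (\<Sum>h'\<in>{h}. theta_rows Yl h' j * (\<Prod>l<m. unit_row h' j l (\<pi> l)))"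
    proof (rule sum.mono_neutral_right)
      show "\<forall>h'\<in>{..<m} - {h}. theta_rows Yl h' j * (\<Prod>l<m. unit_row h' j l (\<pi> l)) = 0"
      proof
        fix h' assume h': "h' \<in> {..<m} - {h}"
        hence "\<pi> h' \<noteq> j" using inj by blast
        thus "theta_rows Yl h' j * (\<Prod>l<m. unit_row h' j l (\<pi> l)) = 0" using 1[of h'] h' by simp
      qed
    qed (use h in auto)
    also have "\<dots> = (\<Prod>l<m. theta_rows Yl l (\<pi> l))"
      using h(1) by (simp add: prod.remove[of "{..<m}" h "\<lambda>l. theta_rows Yl l (\<pi> l)"] 1[OF h(1)] h(2))
    finally show ?thesis .
  qed
  hence "red (theta_rows Yl) = (\<Sum>\<pi> | \<pi> permutes {0..<m}. of_int (sign \<pi>) *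
     (left_weight c m al ty12 \<pi> * left_weight c m be ty24 \<pi> * (\<Sum>h<m. theta_rows Yl h j * (\<Prod>l<m. unit_row h j l (\<pi> l)))))"
    unfolding reduced_det_def by (intro sum.cong refl) simp
  also have "\<dots> = (\<Sum>h<m. theta_rows Yl h j * red (unit_row h j))"
    unfolding reduced_det_def sum_distrib_left by (subst sum.swap) (intro sum.cong refl, simp only: mult_ac)
  finally show ?thesis ..
qed

text \<open>For fixed \<open>j\<close> the sum over the rows is the expansion along one column,
  which restores the full determinant at \<open>x + j\<close>.\<close>

lemma sum_M_fun: "MOST x. (\<Sum>h=1..m. poly (Y_row a b N U h) (\<theta> a b x) * M_fun a b N U S h x) = (\<Sum>j=1..m. poly (upoly Yl) (x + real j))"
proof -
  have 1: "MOST x. \<forall>h\<in>{..<m}. M_fun a b N U S (Suc h) x = (\<Sum>j=1..m. Tj h j x)"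
    using M_fun_windows by (simp add: eventually_ball_finite_distrib)
  have 2: "MOST x. \<forall>j\<in>{1..m}. poly V (x + real j) \<noteq> 0"
    using cofinite_shift[OF cofinite_nonzero[OF mirror_prod_nonzero[of c m]]] by (simp add: eventually_ball_finite_distrib)
  show ?thesis using 1 2
  proof eventually_elim
    case (elim x)
    have "(\<Sum>h=1..m. poly (Y_row a b N U h) (\<theta> a b x) * M_fun a b N U S h x) = (\<Sum>h<m. poly (Yl h) (\<theta> a b x) * M_fun a b N U S (Suc h) x)"
      by (rule sum.reindex_bij_witness[of _ Suc "\<lambda>h. h - 1"]) (auto simp: Yl_def)
    also have "\<dots> = (\<Sum>h<m. \<Sum>j=1..m. poly (Yl h) (\<theta> a b x) * Tj h j x)"
      using elim(1) by (intro sum.cong refl) (simp add: sum_distrib_left)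
    also have "\<dots> = (\<Sum>j=1..m. \<Sum>h<m. poly (Yl h) (\<theta> a b x) * Tj h j x)" by (rule sum.swap)
    also have "\<dots> = (\<Sum>j=1..m. poly (upoly Yl) (x + real j))"
    proof (rule sum.cong[OF refl], goal_cases)
      case j: (1 j)
      let ?y = "x + real j"
      have t: "poly (theta_rows Yl h (j - 1)) ?y = poly (Yl h) (\<theta> a b x)" for h
        using j by (simp add: theta_rows_def poly_pcompose poly_theta_pt \<theta>_def algebra_simps)
      have "(\<Sum>h<m. poly (Yl h) (\<theta> a b x) * Tj h j x) = poly mid ?y * poly (\<Sum>h<m. theta_rows Yl h (j - 1) * red (unit_row h (j - 1))) ?y / poly V ?y"
        unfolding poly_sum poly_mult t sum_distrib_left sum_divide_distrib Tj_def by (intro sum.cong refl) simp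
      also have "\<dots> = poly mid ?y * poly (red (theta_rows Yl)) ?y / poly V ?y"
      proof -
        have "j - 1 < m" using j by auto
        thus ?thesis by (simp only: red_col_expand)
      qed
      also have "\<dots> = poly (upoly Yl) ?y" using elim(2) j by (intro poly_upoly) simp
      finally show ?case .
    qed
    finally show ?case .
  qed
qed

lemma S_rational: "is_rational S"
  unfolding is_rational_def using S_den_nonzero S_def by (intro exI[of _ S_num] exI[of _ S_den]) auto

theorem difference_operator:
  assumes nz: "\<And>l. l < m \<Longrightarrow> Yl l \<noteq> 0" and distinct: "exp_distinct (\<lambda>l. int (2 * degree (Yl l)))"
  shows "\<exists>lam D. constructed_op a b N U S lam D \<and>
     is_difference_op (1 + (\<Sum>l<m. int (degree (Yl l))) - (\<Sum>t=1..4. int (cnt t choose 2))) D"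
proof -
  let ?u = "upoly Yl"
  note u = degree_upoly[OF nz distinct] and sg = mirror_sign_1[OF nz distinct]
  obtain lam where "degree lam \<le> Suc (degree ?u) \<and> (\<forall>x. poly lam x - poly lam (x - 1) = poly ?u x)"
    by (rule exE[OF polynomial_antidifference[of ?u "degree ?u", OF order_refl]])
  hence lam: "degree lam \<le> Suc (degree ?u)" "\<And>x. poly lam x - poly lam (x - 1) = poly ?u x" by simp_all
  have dlam: "degree lam = Suc (degree ?u)"
  proof -
    have "poly (shift (-1) lam - lam) x = poly (- ?u) x" for x
      using lam(2)[of x] by (simp add: poly_shift)
    hence e: "shift (-1) lam - lam = - ?u" by (intro poly_eq_poly_eq_iff[THEN iffD1] ext)
    have "coeff (- ?u) (degree ?u) = real (Suc (degree ?u)) * (-1) * coeff lam (Suc (degree ?u))"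
      using coeff_shift_diff[OF lam(1), of "-1"] unfolding e by blast
    hence "coeff lam (Suc (degree ?u)) \<noteq> 0" using u(1) by (intro notI) simp
    thus ?thesis using lam(1) le_degree by (metis le_antisym)
  qed
  \<comment> \<open>The difference of the two sides has period one by \<open>upoly_reflect\<close>,
    so it is constant; at the fixed point of the reflection it is 0.\<close>
  have sym: "poly lam (real m - c - x) = poly lam x" for x
  proof -
    define \<mu> where "\<mu> = pcompose lam [:real m - c, -1:] - lam"
    have \<mu>: "poly \<mu> x = poly lam (real m - c - x) - poly lam x" for x by (simp add: \<mu>_def poly_pcompose)
    have "poly \<mu> x = poly \<mu> (x - 1)" for x
      using lam(2)[of x] lam(2)[of "real m + 1 - c - x"] upoly_reflect[of Yl x] sg
      unfolding \<mu> by (simp add: algebra_simps)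
    hence "poly \<mu> x = poly \<mu> ((real m - c) / 2)" by (rule periodic_poly_const)
    also have "\<dots> = 0" unfolding \<mu> by (simp add: field_simps)
    finally show ?thesis unfolding \<mu> by simp
  qed
  \<comment> \<open>By \<open>sum_M_fun\<close> and telescoping, the required P at theta_x is 2
    lam(x) + lam(x + m) - lam(x). This is \<open>p\<close>, and the symmetry of \<open>lam\<close>
    makes it a polynomial in \<open>\<theta>\<close>.\<close>
  define p where "p = lam + shift (real m) lam"
  have lcs: "coeff (shift (real m) lam) (degree lam) = lead_coeff lam" by (rule coeff_shift_top) simp
  have dp: "degree p = degree lam"
  proof (rule antisym)
    show "degree p \<le> degree lam" unfolding p_def by (rule degree_add_le) auto
    have "coeff p (degree lam) = 2 * lead_coeff lam" unfolding p_def coeff_add lcs by simp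
    moreover have "lam \<noteq> 0" using dlam by (intro notI) simp
    ultimately show "degree lam \<le> degree p" by (intro le_degree) simp
  qed
  have "poly (pcompose p [:- c, -1:]) x = poly p x" for x
    using sym[of x] sym[of "x + real m"] by (simp add: p_def poly_pcompose poly_shift algebra_simps)
  hence "pcompose p [:- c, -1:] = smult 1 p" unfolding smult_1_left by (intro poly_eq_poly_eq_iff[THEN iffD1] ext)
  from reflection_symmetric_poly[OF this] obtain P where P: "p = pcompose P [:0, c, 1:]" by auto
  have dP: "2 * degree P = Suc (degree ?u)" using dp dlam unfolding P by (simp add: degree_pcompose)
  have theta: "poly [:0, c, 1:] x = \<theta> a b x" for x by (simp add: \<theta>_def algebra_simps)
  have M: "\<exists>Mt. (MOST x. M_fun a b N U S h x = \<sigma> a b (x + 1) * poly Mt (\<theta> a b x)) \<and>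
     (Mt \<noteq> 0 \<longrightarrow> degree Mt + degree (Y_row a b N U h) + 1 \<le> degree P)" if h: "h \<in> {1..m}" for h
  proof -
    have h': "h - 1 < m" "Suc (h - 1) = h" using h by auto
    obtain M where M: "MOST x. M_fun a b N U S h x = poly M x" using M_fun_polynomial(1)[OF h'(1) sg] unfolding h'(2) by blast
    have "poly (pcompose M [:- c, -1:]) x = poly (smult (-1) M) x" for x
    proof -
      have "poly (pcompose M [:- c, -1:]) x = poly M (- x - c)"
        unfolding poly_pcompose by (rule arg_cong[where f = "poly M"]) simp
      thus ?thesis using M_fun_polynomial(2)[OF h'(1) sg, of M x] M unfolding h'(2) by simp
    qed
    hence "pcompose M [:- c, -1:] = smult (-1) M" by (intro poly_eq_poly_eq_iff[THEN iffD1] ext)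
    \<comment> \<open>The factor \<open>[:c, 2:]\<close> is \<open>- \<sigma>\<close> at
      \<open>x + 1\<close>, hence the witness \<open>- Q\<close>.\<close>
    from reflection_symmetric_poly[OF this] obtain Q where Q: "M = [:c, 2:] * pcompose Q [:0, c, 1:]" by auto
    have "MOST x. M_fun a b N U S h x = \<sigma> a b (x + 1) * poly (- Q) (\<theta> a b x)"
      using M unfolding Q poly_mult poly_pcompose theta by (simp add: \<sigma>_def algebra_simps)
    moreover have "degree (- Q) + degree (Y_row a b N U h) + 1 \<le> degree P" if "- Q \<noteq> 0"
    proof -
      have pQ: "pcompose Q [:0, c, 1:] \<noteq> 0" using that by (simp add: pcompose_eq_0_iff)
      hence M0: "M \<noteq> 0" unfolding Q by (simp del: mult_pCons_left)
      have "degree M = 1 + 2 * degree Q" using pQ unfolding Q by (subst degree_mult_eq) (auto simp: degree_pcompose)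
      moreover have "degree M + 2 * degree (Y_row a b N U h) \<le> degree ?u"
        using M_fun_degree[OF nz distinct h'(1) _ M0] M unfolding Yl_def h'(2) by simp
      ultimately show ?thesis using dP by simp
    qed
    ultimately show ?thesis by blast
  qed
  hence "\<forall>h\<in>{1..m}. \<exists>Mt. (MOST x. M_fun a b N U S h x = \<sigma> a b (x + 1) * poly Mt (\<theta> a b x)) \<and>
     (Mt \<noteq> 0 \<longrightarrow> degree Mt + degree (Y_row a b N U h) + 1 \<le> degree P)" by blast
  then obtain Mt where Mt: "\<And>h. h \<in> {1..m} \<Longrightarrow> MOST x. M_fun a b N U S h x = \<sigma> a b (x + 1) * poly (Mt h) (\<theta> a b x)"
    "\<And>h. h \<in> {1..m} \<Longrightarrow> Mt h \<noteq> 0 \<Longrightarrow> degree (Mt h) + degree (Y_row a b N U h) + 1 \<le> degree P" by metis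
  define D where "D = (\<lambda>p. smult (1 / 2) (poly_op P (hahn_op a b N) p) +
           (\<Sum>h = 1..m. poly_op (Mt h) (hahn_op a b N)
                (cal_D a b N (row_t U h) (poly_op (Y_row a b N U h) (hahn_op a b N) p))))"
  have tel: "(\<Sum>j=1..k. poly ?u (x + real j)) = poly lam (x + real k) - poly lam x" for k x
  proof (induction k)
    case (Suc k)
    thus ?case using lam(2)[of "x + real (Suc k)"] by (simp add: algebra_simps)
  qed simp
  have "constructed_op a b N U S lam D"
    unfolding constructed_op_def
  proof (intro conjI exI)
    show "MOST x. poly lam x - poly lam (x - 1) = S x * \<Omega> a b N U x"
      using S_\<Omega> unfolding lam(2) by (simp add: eq_commute)
    show "MOST x. poly P (\<theta> a b x) = 2 * poly lam x + (\<Sum>h = 1..m. poly (Y_row a b N U h) (\<theta> a b x) * M_fun a b N U S h x)"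
      using sum_M_fun
    proof eventually_elim
      case (elim x)
      have "poly P (\<theta> a b x) = poly p x" unfolding P poly_pcompose theta ..
      also have "\<dots> = 2 * poly lam x + (poly lam (x + real m) - poly lam x)" by (simp add: p_def poly_shift)
      finally show ?case unfolding elim tel .
    qed
  qed (use Mt D_def S_rational in auto)
  moreover have "P \<noteq> 0" using dP by auto
  hence "is_difference_op (int (degree P)) D" using constructed_is_difference_op[OF D_def] Mt(2) by blast
  moreover have "2 * int (degree P) = 2 * (1 + (\<Sum>l<m. int (degree (Yl l))) - (\<Sum>t=1..4. int (cnt t choose 2)))"
    using arg_cong[OF dP, of int] u(2) by simp
  hence "int (degree P) = 1 + (\<Sum>l<m. int (degree (Yl l))) - (\<Sum>t=1..4. int (cnt t choose 2))"
    unfolding mult_left_cancel[OF zero_neq_numeral[symmetric]] .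
  ultimately show ?thesis by metis
qed

end

section \<open>Hahn functions of the second kind\<close>

lemma nonpos_Ints_add_nat: "z + real n \<notin> \<int>\<^sub>\<le>\<^sub>0" if "z \<notin> \<int>\<^sub>\<le>\<^sub>0"
proof
  assume "z + real n \<in> \<int>\<^sub>\<le>\<^sub>0"
  then obtain k where "z + real n = - real k" by (elim nonpos_Ints_cases')
  hence "z = - real (n + k)" by simp
  thus False using that by (metis minus_of_nat_in_nonpos_Ints)
qed

lemma Gamma_add_nat: "z \<notin> \<int>\<^sub>\<le>\<^sub>0 \<Longrightarrow> Gamma (z + real n) = Gamma z * pochhammer z n"
  by (simp add: pochhammer_Gamma Gamma_eq_zero_iff)

text \<open>Integration against the Hahn weight with parameters \<open>\<alpha> - 1\<close> and
  \<open>\<beta> - 1\<close> on 0, ..., M, without the factor M!. Parameters and range vary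
  independently, as the shifted weights require.\<close>

definition gsum :: "real \<Rightarrow> real \<Rightarrow> nat \<Rightarrow> (nat \<Rightarrow> real) \<Rightarrow> real" where
  "gsum \<alpha> \<beta> M f = (\<Sum>x\<le>M. Gamma (\<alpha> + real x) * Gamma (\<beta> + real (M - x)) / (fact x * fact (M - x)) * f x)"

lemma gsum_sum: "gsum \<alpha> \<beta> M (\<lambda>x. \<Sum>j\<in>A. k j * f j x) = (\<Sum>j\<in>A. k j * gsum \<alpha> \<beta> M (f j))"
  unfolding gsum_def sum_distrib_left by (subst sum.swap) (simp add: mult_ac)

lemma gsum_cmult: "gsum \<alpha> \<beta> M (\<lambda>x. k * f x) = k * gsum \<alpha> \<beta> M f"
  unfolding gsum_def sum_distrib_left by (simp add: mult_ac)

lemma gsum_cong: "(\<And>x. x \<le> M \<Longrightarrow> f x = g x) \<Longrightarrow> gsum \<alpha> \<beta> M f = gsum \<alpha> \<beta> M g"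
  unfolding gsum_def by (intro sum.cong) auto

lemma gsum_1:
  assumes "\<alpha> \<notin> \<int>\<^sub>\<le>\<^sub>0" "\<beta> \<notin> \<int>\<^sub>\<le>\<^sub>0"
  shows "gsum \<alpha> \<beta> M (\<lambda>_. 1) = Gamma \<alpha> * Gamma \<beta> * pochhammer (\<alpha> + \<beta>) M / fact M"
  unfolding gsum_def pochhammer_binomial_sum sum_distrib_left sum_divide_distrib
  by (intro sum.cong refl) (simp add: Gamma_add_nat assms binomial_fact field_simps del: of_nat_diff)

text \<open>The factor merges with the first Gamma function into a larger \<open>\<alpha>\<close>,
  which reduces the claim to \<open>gsum_1\<close>.\<close>

lemma gsum_rising:
  assumes "\<alpha> \<notin> \<int>\<^sub>\<le>\<^sub>0" "\<beta> \<notin> \<int>\<^sub>\<le>\<^sub>0"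
  shows "gsum \<alpha> \<beta> M (\<lambda>x. pochhammer (\<alpha> + real x) j) = pochhammer \<alpha> j * (Gamma \<alpha> * Gamma \<beta> * pochhammer (\<alpha> + \<beta> + real j) M / fact M)"
proof -
  have "gsum \<alpha> \<beta> M (\<lambda>x. pochhammer (\<alpha> + real x) j) = gsum (\<alpha> + real j) \<beta> M (\<lambda>_. 1)"
    unfolding gsum_def
  proof (rule sum.cong[OF refl], goal_cases)
    case (1 x)
    have "Gamma (\<alpha> + real j + real x) = Gamma (\<alpha> + real x) * pochhammer (\<alpha> + real x) j"
      using Gamma_add_nat[OF nonpos_Ints_add_nat[OF assms(1), of x], of j] by (simp add: add_ac)
    thus ?case by simp
  qed
  thus ?thesis using gsum_1[OF nonpos_Ints_add_nat[OF assms(1), of j] assms(2)] Gamma_add_nat[OF assms(1), of j]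
    by (simp add: add_ac mult_ac)
qed

text \<open>The factor cancels part of \<open>fact x\<close>: the first \<open>j\<close> points drop
  out, and \<open>\<alpha>\<close> grows by \<open>j\<close>.\<close>

lemma gsum_falling:
  assumes "\<alpha> \<notin> \<int>\<^sub>\<le>\<^sub>0" "\<beta> \<notin> \<int>\<^sub>\<le>\<^sub>0" "j \<le> M"
  shows "gsum \<alpha> \<beta> M (\<lambda>x. pochhammer (- real x) j) =
     pochhammer (- real M) j * pochhammer \<alpha> j * (Gamma \<alpha> * Gamma \<beta> * pochhammer (\<alpha> + \<beta> + real j) (M - j) / fact M)"
proof -
  have ff: "pochhammer (- real x) j = (-1) ^ j * (fact x / fact (x - j))" if "j \<le> x" for x
    using that pochhammer_minus[of "real x" j] pochhammer_split[of 1 "x - j" j]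
    by (simp add: pochhammer_fact[symmetric] of_nat_diff field_simps)
  have "gsum \<alpha> \<beta> M (\<lambda>x. pochhammer (- real x) j) =
     (\<Sum>x\<in>{j..M}. Gamma (\<alpha> + real x) * Gamma (\<beta> + real (M - x)) / (fact x * fact (M - x)) * pochhammer (- real x) j)"
    unfolding gsum_def by (rule sum.mono_neutral_right) (auto simp: pochhammer_of_nat_eq_0_iff)
  also have "\<dots> = (\<Sum>x\<le>M - j. (-1) ^ j * (Gamma (\<alpha> + real j + real x) * Gamma (\<beta> + real (M - j - x)) / (fact x * fact (M - j - x)) * 1))"
    using assms(3) by (intro sum.reindex_bij_witness[of _ "\<lambda>x. x + j" "\<lambda>x. x - j"]) (auto simp: ff of_nat_diff add_ac mult_ac)
  also have "\<dots> = (-1) ^ j * gsum (\<alpha> + real j) \<beta> (M - j) (\<lambda>_. 1)" unfolding gsum_def sum_distrib_left ..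
  finally show ?thesis
    using gsum_1[OF nonpos_Ints_add_nat[OF assms(1), of j] assms(2)] Gamma_add_nat[OF assms(1), of j] ff[OF assms(3)]
    by (simp add: add_ac mult_ac)
qed

text \<open>The dual Hahn polynomial at theta_z + a + b, where each of its factors splits as (z + 1
  + i)(z + a + b - i).\<close>

definition dual_sum :: "real \<Rightarrow> real \<Rightarrow> real \<Rightarrow> nat \<Rightarrow> real \<Rightarrow> real" where
  "dual_sum a b K u z = (\<Sum>k\<le>u. pochhammer (- real u) k * pochhammer (z + 1) k * pochhammer (- z - a - b) k *
     pochhammer (- K + real k) (u - k) / (pochhammer (1 - a) k * fact k))"

lemma poly_dual_hahn_theta: "poly (dual_hahn (- a) (- b) K u) (\<theta> a b z + a + b) = dual_sum a b K u z"
proof -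
  have p: "poly (\<Prod>i<k. [:- (real i * (real i + - a + - b + 1)), 1:]) (\<theta> a b z + a + b) = (-1) ^ k * (pochhammer (z + 1) k * pochhammer (- z - a - b) k)" for k
    by (induction k) (auto simp: pochhammer_Suc \<theta>_def algebra_simps)
  have s: "(-1::real) ^ k * (-1) ^ k = 1" for k by (simp flip: power_mult_distrib)
  have "(-1) ^ k * x * y / d * ((-1) ^ k * z) = ((-1) ^ k * (-1) ^ k) * (x * z * y / d)" for x y z d :: real and k :: nat
    by (simp only: mult_ac divide_inverse inverse_mult_distrib)
  thus ?thesis
    unfolding dual_hahn_def dual_sum_def poly_sum poly_smult p atLeast0AtMost
    by (intro sum.cong refl) (simp only: s mult_1 add.commute[of 1] diff_conv_add_uminus mult.assoc)
qed

lemma poly_dual_hahn_theta': "poly (dual_hahn (- b) (- a) K u) (\<theta> a b z + a + b) = dual_sum b a K u z"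
  using poly_dual_hahn_theta[of b a K u z] by (simp add: \<theta>_def algebra_simps)

text \<open>Division of a weight by one node becomes a combination of weights with smaller
  parameter. The proof splits \<open>(y - K) / (y - u)\<close> as
  \<open>1 + (u - K) / (y - u)\<close> again and again; it ends because
  \<open>pochhammer (- u) (u + 1)\<close> is 0.\<close>

lemma Gamma_partial_fraction:
  assumes "\<And>k. k \<le> u \<Longrightarrow> y - real k \<notin> \<int>\<^sub>\<le>\<^sub>0"
  shows "Gamma (y + 1) / (y - real u) = (\<Sum>k\<le>u. (-1) ^ k * pochhammer (- real u) k * Gamma (y - real k))"
proof -
  have yu: "y - real u \<noteq> 0" using assms[of u] by auto
  have "K \<le> Suc u \<Longrightarrow> Gamma (y + 1) / (y - real u) = (\<Sum>k<K. (-1) ^ k * pochhammer (- real u) k * Gamma (y - real k)) +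
     (-1) ^ K * pochhammer (- real u) K * Gamma (y - real K + 1) / (y - real u)" for K
  proof (induction K)
    case (Suc K)
    let ?c = "(-1) ^ K * pochhammer (- real u) K * Gamma (y - real K)"
    have "Gamma (y - real K + 1) = (y - real K) * Gamma (y - real K)"
      using Suc.prems assms[of K] by (intro Gamma_plus1) auto
    hence e: "(-1) ^ K * pochhammer (- real u) K * Gamma (y - real K + 1) / (y - real u) = ?c * ((y - real K) / (y - real u))" by simp
    have q: "(y - real K) / (y - real u) = 1 + (real u - real K) / (y - real u)" using yu by (simp add: field_simps)
    have "y - real (Suc K) + 1 = y - real K" by simp
    hence e2: "(-1) ^ Suc K * pochhammer (- real u) (Suc K) * Gamma (y - real (Suc K) + 1) / (y - real u) = ?c * ((real u - real K) / (y - real u))"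
      using yu by (simp only: pochhammer_Suc power_Suc) (simp add: field_simps)
    have "Gamma (y + 1) / (y - real u) = (\<Sum>k<K. (-1) ^ k * pochhammer (- real u) k * Gamma (y - real k)) + (?c + ?c * ((real u - real K) / (y - real u)))"
      using Suc unfolding e q by (simp add: distrib_left)
    thus ?case unfolding e2 by simp
  qed simp
  from this[of "Suc u"] show ?thesis by (simp add: pochhammer_of_nat_eq_0_iff lessThan_Suc_atMost del: of_nat_Suc)
qed

text \<open>The counterpart for reciprocal Gamma functions, by similar telescoping. The factor stays
  on the left, so the identity includes its zero.\<close>

lemma rGamma_partial_fraction:
  "(x + 1 + real u) * (\<Sum>k\<le>u. pochhammer (- real u) k * rGamma (x + real k + 2)) = rGamma (x + 1 :: real)"
proof -
  have "(x + 1 + real u) * (\<Sum>k<K. pochhammer (- real u) k * rGamma (x + real k + 2)) = rGamma (x + 1) - pochhammer (- real u) K * rGamma (x + real K + 1)" for K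
  proof (induction K)
    case (Suc K)
    have "rGamma (x + real K + 1) = (x + real K + 1) * rGamma (x + real K + 2)"
      using rGamma_plus1[of "x + real K + 1"] by (simp add: add_ac)
    thus ?case using Suc by (simp add: pochhammer_Suc algebra_simps)
  qed simp
  from this[of "Suc u"] show ?thesis by (simp add: pochhammer_of_nat_eq_0_iff lessThan_Suc_atMost del: of_nat_Suc)
qed

lemma pochhammer_fact_swap: "pochhammer (real k + 1) n * fact k = pochhammer (real n + 1) k * fact n"
proof -
  have "pochhammer (1 :: real) (k + n) = pochhammer 1 (n + k)" by (simp add: add.commute)
  thus ?thesis unfolding pochhammer_split pochhammer_fact[symmetric] by (simp add: add_ac mult_ac)
qed

lemma Gamma_minus_nat:
  assumes "a - real k \<notin> \<int>\<^sub>\<le>\<^sub>0"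
  shows "Gamma a = Gamma (a - real k) * ((-1) ^ k * pochhammer (1 - a) k)" "pochhammer (1 - a) k \<noteq> 0"
proof -
  have "pochhammer (a - real k) k = (-1) ^ k * pochhammer (1 - a) k"
    using pochhammer_reflect[of "1 - a" k] by simp
  moreover have "pochhammer (a - real k) k \<noteq> 0"
    using assms by (auto simp: pochhammer_eq_0_iff)
  ultimately show "Gamma a = Gamma (a - real k) * ((-1) ^ k * pochhammer (1 - a) k)" "pochhammer (1 - a) k \<noteq> 0"
    using Gamma_add_nat[OF assms, of k] by auto
qed

text \<open>Only regroups the factors of one summand, with Gamma values and split pochhammer symbols
  kept abstract, so that it serves both \<open>second_kind_2\<close> and
  \<open>second_kind_4\<close>.\<close>

lemma second_kind_term:
  fixes A B C D F G G0 K Kk P Q R S T s fk :: real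
  assumes "C * fk = P * F" "G0 = G * (s * S)" "K = Kk * R" "A * B * Kk = D * Q * T" "s * s = 1"
    "F \<noteq> 0" "K \<noteq> 0" "S \<noteq> 0" "fk \<noteq> 0" "T \<noteq> 0"
  shows "s * (A / (T * F)) * G * B * C = G0 * D / K * (P * Q * R / (S * fk))"
proof -
  have "C / F = P / fk" using assms by (simp add: field_simps)
  have "Kk \<noteq> 0" "R \<noteq> 0" using assms by auto
  have "G0 * D / K * (P * Q * R / (S * fk)) = s * G * (D * Q) / Kk * (P / fk)"
    unfolding assms(2,3) using assms \<open>Kk \<noteq> 0\<close> \<open>R \<noteq> 0\<close> by (simp add: field_simps)
  also have "D * Q = A * B * Kk / T" using assms by (simp add: field_simps)
  also have "P / fk = C / F" using \<open>C / F = P / fk\<close> ..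
  finally show ?thesis using \<open>Kk \<noteq> 0\<close> by simp
qed

locale hahn_nat = hahn_params a b "real N" for a b :: real and N :: nat
begin

lemma nonpos_a: "a + 1 + real k \<notin> \<int>\<^sub>\<le>\<^sub>0" and nonpos_b: "b + 1 + real k \<notin> \<int>\<^sub>\<le>\<^sub>0"
proof -
  have "a + 1 \<notin> \<int>\<^sub>\<le>\<^sub>0"
  proof
    assume "a + 1 \<in> \<int>\<^sub>\<le>\<^sub>0"
    then obtain j where "a + 1 = - real j" by (elim nonpos_Ints_cases')
    thus False using nz_a[of j] by simp
  qed
  thus "a + 1 + real k \<notin> \<int>\<^sub>\<le>\<^sub>0" by (rule nonpos_Ints_add_nat)
  have "b + 1 \<notin> \<int>\<^sub>\<le>\<^sub>0"
  proof
    assume "b + 1 \<in> \<int>\<^sub>\<le>\<^sub>0"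
    then obtain j where "b + 1 = - real j" by (elim nonpos_Ints_cases')
    thus False using nz_b[of j] by simp
  qed
  thus "b + 1 + real k \<notin> \<int>\<^sub>\<le>\<^sub>0" by (rule nonpos_Ints_add_nat)
qed

lemma hahn_nat_swap: "hahn_nat b a N"
  by unfold_locales (use pos_a pos_b pos_ab pos_abN in \<open>simp_all add: add.commute add.left_commute\<close>)

text \<open>Each term contains (-x)_j (-N + j)_(n-j): the first factor is 0 for
  \<open>j > x\<close>, the second for \<open>j \<le> N < n\<close>.\<close>

lemma H_vanish:
  assumes "N < n" "x \<le> N"
  shows "H n (real x) = 0"
proof -
  have "pochhammer (- real x) j * pochhammer (- real N + real j) (n - j) = 0" for j
  proof (cases "j \<le> N")
    case True
    hence e: "- real N + real j = - real (N - j)" by (simp add: of_nat_diff)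
    have "pochhammer (- real N + real j) (n - j) = 0"
      unfolding e using assms(1) True by (subst pochhammer_of_nat_eq_0_iff) auto
    thus ?thesis by simp
  next
    case False
    thus ?thesis using assms by (simp add: pochhammer_of_nat_eq_0_iff)
  qed
  hence "hsum n (real n + (a + b + 1)) (- real x) (a + 1) (- real N) = 0"
    unfolding hsum_def by (intro sum.neutral) (metis (no_types, lifting) mult.commute mult.left_commute mult_zero_left)
  thus ?thesis by (simp add: hahn_hsum1)
qed

text \<open>Expansion in falling factorials and \<open>gsum_falling\<close> lead to an
  \<open>hsum\<close> that Saalschuetz's formula sums for every admissible \<open>\<alpha>\<close>.
  The choice \<open>a - k\<close> gives functions of the second kind, the choice
  \<open>a + 1 + s\<close> orthogonality.\<close>

lemma gsum_hahn:
  assumes \<alpha>: "\<alpha> \<notin> \<int>\<^sub>\<le>\<^sub>0" and n: "n \<le> N"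
  shows "gsum \<alpha> (b + 1) N (\<lambda>x. H n (real x)) = hconst n * pochhammer (- real N) n *
     (Gamma \<alpha> * Gamma (b + 1) * pochhammer (\<alpha> + b + 1 + real n) (N - n) / fact N) * (pochhammer (b + 1) n * pochhammer (a + 1 - \<alpha>) n)"
proof -
  let ?s = "real n + (a + b + 1)"
  let ?C = "hconst n * pochhammer (- real N) n * (Gamma \<alpha> * Gamma (b + 1) * pochhammer (\<alpha> + b + 1 + real n) (N - n) / fact N)"
  let ?k = "\<lambda>j. hconst n * ((-1) ^ j * real (n choose j) * pochhammer ?s j * pochhammer (a + 1 + real j) (n - j) * pochhammer (- real N + real j) (n - j))"
  have "gsum \<alpha> (b + 1) N (\<lambda>x. H n (real x)) = gsum \<alpha> (b + 1) N (\<lambda>x. \<Sum>j\<le>n. ?k j * pochhammer (- real x) j)"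
    by (rule gsum_cong) (simp add: hahn_hsum1 hsum_def sum_distrib_left mult_ac)
  also have "\<dots> = (\<Sum>j\<le>n. ?k j * gsum \<alpha> (b + 1) N (\<lambda>x. pochhammer (- real x) j))" by (rule gsum_sum)
  also have "\<dots> = (\<Sum>j\<le>n. ?C *
     ((-1) ^ j * real (n choose j) * pochhammer ?s j * pochhammer \<alpha> j * pochhammer (a + 1 + real j) (n - j) * pochhammer (\<alpha> + b + 1 + real j) (n - j)))"
  proof (rule sum.cong[OF refl], goal_cases)
    case (1 j)
    hence j: "j \<le> n" "j \<le> N" using n by auto
    have e1: "pochhammer (- real N) n = pochhammer (- real N) j * pochhammer (- real N + real j) (n - j)"
      using pochhammer_split[of "- real N" j "n - j"] j by simp
    have e2: "pochhammer (\<alpha> + (b + 1) + real j) (N - j) = pochhammer (\<alpha> + b + 1 + real j) (n - j) * pochhammer (\<alpha> + b + 1 + real n) (N - n)"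
      using pochhammer_split[of "\<alpha> + b + 1 + real j" "n - j" "N - n"] j n by (simp add: of_nat_diff add_ac)
    have "b + 1 \<notin> \<int>\<^sub>\<le>\<^sub>0" using nonpos_b[of 0] by simp
    note g = gsum_falling[OF \<alpha> this j(2)]
    show ?case
      unfolding g e1 e2 by (simp only: mult_ac divide_inverse inverse_mult_distrib)
  qed
  also have "\<dots> = ?C *
     hsum n ?s \<alpha> (a + 1) (\<alpha> + b + 1)"
    unfolding hsum_def sum_distrib_left ..
  finally show ?thesis using hsum_saalschuetz[of n a b \<alpha>] by (simp add: add_ac)
qed

text \<open>The range extends \<open>Suc k\<close> points to the left of 0. Here the expansion in
  rising factorials of \<open>x + a + 1\<close> fits, since after the shift they merge with the
  Gamma function of \<open>a - k + x\<close>.\<close>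

lemma gsum_hahn_shifted:
  assumes \<alpha>: "a - real k \<notin> \<int>\<^sub>\<le>\<^sub>0"
  shows "gsum (a - real k) (b + 1) (N + Suc k) (\<lambda>x. H n (real x - real (Suc k))) = (-1) ^ n * hconst n *
     (Gamma (a - real k) * Gamma (b + 1) * pochhammer (a - real k + b + 1 + real n) (N + Suc k) / fact (N + Suc k)) *
     (pochhammer (b + 1) n * pochhammer (real k + 1) n)"
proof -
  let ?s = "real n + (a + b + 1)" and ?\<alpha> = "a - real k"
  let ?g = "gsum ?\<alpha> (b + 1) (N + Suc k)"
  let ?C = "(-1) ^ n * hconst n * (Gamma ?\<alpha> * Gamma (b + 1) * pochhammer (?\<alpha> + b + 1 + real n) (N + Suc k) / fact (N + Suc k))"
  let ?k = "\<lambda>j. (-1) ^ n * hconst n * ((-1) ^ j * real (n choose j) * pochhammer ?s j * pochhammer (a + 1 + real j) (n - j) * pochhammer (a + b + real N + 2 + real j) (n - j))"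
  have "?g (\<lambda>x. H n (real x - real (Suc k))) = ?g (\<lambda>x. \<Sum>j\<le>n. ?k j * pochhammer (?\<alpha> + real x) j)"
  proof (rule gsum_cong)
    fix x
    have "real x - real (Suc k) + a + 1 = ?\<alpha> + real x" by simp
    thus "H n (real x - real (Suc k)) = (\<Sum>j\<le>n. ?k j * pochhammer (?\<alpha> + real x) j)"
      unfolding hahn_hsum3 hsum_def by (simp only: sum_distrib_left mult_ac)
  qed
  also have "\<dots> = (\<Sum>j\<le>n. ?k j * ?g (\<lambda>x. pochhammer (?\<alpha> + real x) j))" by (rule gsum_sum)
  also have "\<dots> = (\<Sum>j\<le>n. ?C *
     ((-1) ^ j * real (n choose j) * pochhammer ?s j * pochhammer ?\<alpha> j * pochhammer (a + 1 + real j) (n - j) * pochhammer (?\<alpha> + b + 1 + real j) (n - j)))"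
  proof (rule sum.cong[OF refl], goal_cases)
    case (1 j)
    hence j: "j \<le> n" by auto
    have e: "pochhammer (?\<alpha> + (b + 1) + real j) (N + Suc k) * pochhammer (a + b + real N + 2 + real j) (n - j) =
       pochhammer (?\<alpha> + b + 1 + real j) (n - j) * pochhammer (?\<alpha> + b + 1 + real n) (N + Suc k)"
    proof -
      have "pochhammer (?\<alpha> + b + 1 + real j) ((N + Suc k) + (n - j)) = pochhammer (?\<alpha> + b + 1 + real j) ((n - j) + (N + Suc k))"
        by (simp add: add.commute)
      thus ?thesis unfolding pochhammer_split using j by (simp add: of_nat_diff add_ac algebra_simps)
    qed
    have "b + 1 \<notin> \<int>\<^sub>\<le>\<^sub>0" using nonpos_b[of 0] by simp
    note g = gsum_rising[OF \<alpha> this, of "N + Suc k" j]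
    have "?k j * ?g (\<lambda>x. pochhammer (?\<alpha> + real x) j) =
      (-1) ^ n * hconst n * ((-1) ^ j * real (n choose j) * pochhammer ?s j * pochhammer (a + 1 + real j) (n - j)) * pochhammer ?\<alpha> j *
       (Gamma ?\<alpha> * Gamma (b + 1) * (pochhammer (?\<alpha> + (b + 1) + real j) (N + Suc k) * pochhammer (a + b + real N + 2 + real j) (n - j)) / fact (N + Suc k))"
      unfolding g by (simp only: mult_ac divide_inverse inverse_mult_distrib)
    thus ?case
      unfolding e by (simp only: mult_ac divide_inverse inverse_mult_distrib)
  qed
  also have "\<dots> = ?C *
     hsum n ?s ?\<alpha> (a + 1) (?\<alpha> + b + 1)"
    unfolding hsum_def sum_distrib_left ..
  also have "hsum n ?s ?\<alpha> (a + 1) (?\<alpha> + b + 1) = pochhammer (b + 1) n * pochhammer (real k + 1) n"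
    using hsum_saalschuetz[of n a b ?\<alpha>] by (simp add: add_ac)
  finally show ?thesis .
qed

text \<open>The Hahn functions of the second kind, evaluated at the additional zeros of the transformed weight, are dual Hahn polynomials
  in \<open>\<theta>\<^sub>n\<close>. For types 3 and 4 these zeros lie outside \<open>[0, N]\<close> and the function is a combination of sums over longer ranges.\<close>

lemma second_kind_2:
  assumes u': "\<forall>k\<le>u. a - real k \<notin> \<int>\<^sub>\<le>\<^sub>0" and K: "pochhammer (- (a + b + real N)) u \<noteq> 0"
  shows "gsum (a + 1) (b + 1) N (\<lambda>x. H n (real x) / (real x + a - real u)) =
    Gamma a * Gamma (b + 1) * pochhammer (a + b + 1) N / (fact N * pochhammer (- (a + b + real N)) u) *
    ((-1) ^ n * \<xi> a b (real N) 2 (real n) n * dual_sum a b (a + b + real N) u (real n))" (is "?l = _")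
\<comment> \<open>For \<open>n > N\<close> both sides vanish: the Hahn polynomial on the range of
  summation, and \<open>\<xi>\<close> through its factor (-N)_n.\<close>
proof (cases "n \<le> N")
  case False
  hence "?l = 0"
    unfolding gsum_def by (intro sum.neutral) (simp add: H_vanish)
  moreover have "\<xi> a b (real N) 2 (real n) n = 0" using False by (simp add: \<xi>_def \<xi>_num_def pochhammer_of_nat_eq_0_iff)
  ultimately show ?thesis by simp
next
  case True
  note u = u'[rule_format]
  let ?p = "\<lambda>k. (-1) ^ k * pochhammer (- real u) k" and ?K = "a + b + real N"
  let ?c = "(-1) ^ n * Gamma (b + 1) * pochhammer (- real N) n * pochhammer (b + 1) n / (fact N * pochhammer (a + b + real N + 2) n * pochhammer (a + 1) n)"
  have \<xi>: "\<xi> a b (real N) 2 (real n) n = pochhammer (b + 1) n * pochhammer (- real N) n / (pochhammer (a + 1) n * pochhammer (a + b + real N + 2) n)"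
    by (simp add: \<xi>_def \<xi>_num_def \<xi>_den_def)
  have "?l = (\<Sum>k\<le>u. ?p k * gsum (a - real k) (b + 1) N (\<lambda>x. H n (real x)))"
  proof -
    have pf: "Gamma (a + 1 + real x) / (real x + a - real u) = (\<Sum>k\<le>u. ?p k * Gamma (a - real k + real x))" for x
    proof -
      have "real x + a - real k \<notin> \<int>\<^sub>\<le>\<^sub>0" if "k \<le> u" for k
        using nonpos_Ints_add_nat[OF u[OF that], of x] by (simp add: algebra_simps)
      from Gamma_partial_fraction[of u "real x + a", OF this] show ?thesis by (simp add: algebra_simps)
    qed
    hence "Gamma (a + 1 + real x) * g / f * (h / (real x + a - real u)) = (\<Sum>k\<le>u. ?p k * (Gamma (a - real k + real x) * g / f * h))" for x g f h
    proof -
      have "Gamma (a + 1 + real x) * g / f * (h / (real x + a - real u)) = (Gamma (a + 1 + real x) / (real x + a - real u)) * (g / f * h)" by (simp add: mult_ac)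
      also have "\<dots> = (\<Sum>k\<le>u. ?p k * (Gamma (a - real k + real x) * g / f * h))"
        unfolding pf sum_distrib_right by (intro sum.cong refl) simp
      finally show ?thesis .
    qed
    thus ?thesis unfolding gsum_def sum_distrib_left by (subst sum.swap) simp
  qed
  also have "\<dots> = (\<Sum>k\<le>u. ?c * pochhammer (- real u) k * ((-1) ^ k * (pochhammer (a + b + 1) n / (1 * fact n)) * Gamma (a - real k) *
      pochhammer (a - real k + b + 1 + real n) (N - n) * pochhammer (real k + 1) n))"
  proof (rule sum.cong[OF refl], goal_cases)
    case (1 k)
    hence "a - real k \<notin> \<int>\<^sub>\<le>\<^sub>0" using u by simp
    from gsum_hahn[OF this True]
    show ?case
      by (simp add: hconst_def mult_ac add_ac)
  qed
  also have "\<dots> = (\<Sum>k\<le>u. ?c * pochhammer (- real u) k * (Gamma a * pochhammer (a + b + 1) N / pochhammer (- ?K) u *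
      (pochhammer (real n + 1) k * pochhammer (- real n - a - b) k * pochhammer (- ?K + real k) (u - k) / (pochhammer (1 - a) k * fact k))))"
  proof (rule sum.cong[OF refl], rule arg_cong[where f = "\<lambda>x. ?c * _ * x"], rule second_kind_term)
    fix k assume "k \<in> {..u}"
    hence k: "k \<le> u" by simp
    show "pochhammer (real k + 1) n * fact k = pochhammer (real n + 1) k * fact n" by (rule pochhammer_fact_swap)
    show "Gamma a = Gamma (a - real k) * ((-1) ^ k * pochhammer (1 - a) k)" "pochhammer (1 - a) k \<noteq> 0"
      using Gamma_minus_nat[OF u[OF k]] by auto
    show "pochhammer (- ?K) u = pochhammer (- ?K) k * pochhammer (- ?K + real k) (u - k)"
      using pochhammer_split[of "- ?K" k "u - k"] k by simp
    show "pochhammer (a + b + 1) n * pochhammer (a - real k + b + 1 + real n) (N - n) * pochhammer (- ?K) k = pochhammer (a + b + 1) N * pochhammer (- real n - a - b) k * 1"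
    proof -
      let ?z = "a - real k + b + 1 + real n"
      have r1: "(-1) ^ k * pochhammer (- ?K) k = pochhammer (?z + real (N - n)) k"
        using pochhammer_reflect[of "- ?K" k] True by (simp add: of_nat_diff algebra_simps)
      have r2: "(-1) ^ k * pochhammer (- real n - a - b) k = pochhammer ?z k"
        using pochhammer_reflect[of "- real n - a - b" k] by (simp add: algebra_simps)
      have "pochhammer ?z ((N - n) + k) = pochhammer ?z (k + (N - n))" by (simp add: add.commute)
      hence "pochhammer ?z (N - n) * pochhammer (?z + real (N - n)) k = pochhammer ?z k * pochhammer (a + b + 1 + real n) (N - n)"
        unfolding pochhammer_split by (simp add: algebra_simps)
      hence "(-1) ^ k * (pochhammer ?z (N - n) * pochhammer (- ?K) k) = (-1) ^ k * (pochhammer (- real n - a - b) k * pochhammer (a + b + 1 + real n) (N - n))"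
        unfolding r1[symmetric] r2[symmetric] by (simp only: mult_ac)
      hence "pochhammer ?z (N - n) * pochhammer (- ?K) k = pochhammer (- real n - a - b) k * pochhammer (a + b + 1 + real n) (N - n)" by simp
      moreover have "pochhammer (a + b + 1) N = pochhammer (a + b + 1) n * pochhammer (a + b + 1 + real n) (N - n)"
        using pochhammer_split[of "a + b + 1" n "N - n"] True by simp
      ultimately show ?thesis by (simp add: mult_ac)
    qed
    show "(-1::real) ^ k * (-1) ^ k = 1" by (simp flip: power_mult_distrib)
  qed (use K in auto)
  also have "\<dots> = ?c * (Gamma a * pochhammer (a + b + 1) N / pochhammer (- ?K) u) * dual_sum a b ?K u (real n)"
    unfolding dual_sum_def sum_distrib_left by (intro sum.cong refl) (simp only: mult_ac divide_inverse inverse_mult_distrib)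
  finally show ?thesis unfolding \<xi> by (simp only: mult_ac divide_inverse inverse_mult_distrib)
qed

lemma second_kind_4:
  assumes u': "\<forall>k\<le>u. a - real k \<notin> \<int>\<^sub>\<le>\<^sub>0"
  shows "(\<Sum>k\<le>u. pochhammer (- real u) k * gsum (a - real k) (b + 1) (N + Suc k) (\<lambda>x. H n (real x - real (Suc k)))) =
    Gamma a * Gamma (b + 1) * pochhammer (a + b + 1) (N + 1) / fact (N + 1 + u) *
    ((-1) ^ n * \<xi> a b (real N) 4 (real n) n * dual_sum a b (- 2 - real N) u (real n))"
proof -
  note u = u'[rule_format]
  let ?g = "\<lambda>k. gsum (a - real k) (b + 1) (N + Suc k) (\<lambda>x. H n (real x - real (Suc k)))"
  let ?c = "Gamma (b + 1) * pochhammer (b + 1) n / pochhammer (a + 1) n"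
  have sq: "(-1::real) ^ n * (-1) ^ n = 1" for n by (simp flip: power_mult_distrib)
  have "(\<Sum>k\<le>u. pochhammer (- real u) k * ?g k) =
     (\<Sum>k\<le>u. ?c * pochhammer (- real u) k * (1 * (pochhammer (a + b + 1) n / (pochhammer (a + b + real N + 2) n * fact n)) * ((-1) ^ k * Gamma (a - real k)) *
      ((-1) ^ k * pochhammer (a - real k + b + 1 + real n) (N + Suc k) / fact (N + Suc k)) * pochhammer (real k + 1) n))"
  proof (rule sum.cong[OF refl], goal_cases)
    case (1 k)
    hence "a - real k \<notin> \<int>\<^sub>\<le>\<^sub>0" using u by simp
    have "pochhammer (- real u) k * ?g k =
      ((-1) ^ n * (-1) ^ n) * ((-1) ^ k * (-1) ^ k) * (?c * pochhammer (- real u) k * (pochhammer (a + b + 1) n / (pochhammer (a + b + real N + 2) n * fact n)) * Gamma (a - real k) *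
      (pochhammer (a - real k + b + 1 + real n) (N + Suc k) / fact (N + Suc k)) * pochhammer (real k + 1) n)"
      unfolding gsum_hahn_shifted[OF \<open>a - real k \<notin> \<int>\<^sub>\<le>\<^sub>0\<close>] hconst_def sq[of k] by (simp add: mult_ac)
    thus ?case
      unfolding sq[of n] by (simp add: mult_ac divide_inverse del: of_nat_Suc)
  qed
  also have "\<dots> = (\<Sum>k\<le>u. ?c * pochhammer (- real u) k * (Gamma a * pochhammer (a + b + 1) (N + 1) / fact (N + 1 + u) *
      (pochhammer (real n + 1) k * pochhammer (- real n - a - b) k * pochhammer (- (- 2 - real N) + real k) (u - k) / (pochhammer (1 - a) k * fact k))))"
  proof (rule sum.cong[OF refl], rule arg_cong[where f = "\<lambda>x. ?c * _ * x"], rule second_kind_term)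
    fix k assume "k \<in> {..u}"
    hence k: "k \<le> u" by simp
    show "pochhammer (real k + 1) n * fact k = pochhammer (real n + 1) k * fact n" by (rule pochhammer_fact_swap)
    show "Gamma a = (-1) ^ k * Gamma (a - real k) * (1 * pochhammer (1 - a) k)" "pochhammer (1 - a) k \<noteq> 0"
      using Gamma_minus_nat[OF u[OF k]] by (auto simp: mult_ac)
    show "fact (N + 1 + u) = fact (N + Suc k) * pochhammer (- (- 2 - real N) + real k) (u - k)"
    proof -
      have "pochhammer (1 :: real) (N + 1 + u) = pochhammer 1 (N + Suc k) * pochhammer (1 + real (N + Suc k)) (u - k)"
        using pochhammer_split[of 1 "N + Suc k" "u - k"] k by simp
      thus ?thesis by (simp add: pochhammer_fact add_ac)
    qed
    show "pochhammer (a + b + 1) n * ((-1) ^ k * pochhammer (a - real k + b + 1 + real n) (N + Suc k) / fact (N + Suc k)) * fact (N + Suc k) =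
      pochhammer (a + b + 1) (N + 1) * pochhammer (- real n - a - b) k * pochhammer (a + b + real N + 2) n"
    proof -
      let ?z = "a - real k + b + 1 + real n"
      have r2: "pochhammer ?z k = (-1) ^ k * pochhammer (- real n - a - b) k"
        using pochhammer_reflect[of "- real n - a - b" k] by (simp add: algebra_simps)
      have "pochhammer ?z (N + Suc k) = pochhammer ?z k * pochhammer (a + b + 1 + real n) (N + 1)"
        using pochhammer_split[of ?z k "N + 1"] by (simp add: algebra_simps)
      moreover have "pochhammer (a + b + 1) n * pochhammer (a + b + 1 + real n) (N + 1) = pochhammer (a + b + 1) (N + 1) * pochhammer (a + b + real N + 2) n"
        using pochhammer_split[of "a + b + 1" n "N + 1"] pochhammer_split[of "a + b + 1" "N + 1" n] by (simp add: add_ac)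
      moreover have "P * (s * (s * Q * R) / f) * f = (s * s) * ((P * R) * Q)" if "f \<noteq> 0" for P Q R s f :: real using that by simp
      ultimately show ?thesis unfolding r2 using sq[of k] by (simp add: mult_ac)
    qed
  qed (use pos_abN in auto)
  also have "\<dots> = ?c * (Gamma a * pochhammer (a + b + 1) (N + 1) / fact (N + 1 + u)) * dual_sum a b (- 2 - real N) u (real n)"
    unfolding dual_sum_def sum_distrib_left by (intro sum.cong refl) (simp only: mult_ac divide_inverse inverse_mult_distrib)
  also have "?c = Gamma (b + 1) * ((-1) ^ n * \<xi> a b (real N) 4 (real n) n)"
    by (simp add: \<xi>_def \<xi>_num_def \<xi>_den_def add_ac sq mult.assoc[symmetric])
  finally show ?thesis by (simp only: mult_ac divide_inverse inverse_mult_distrib)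
qed

end

lemma gsum_reflect: "gsum \<alpha> \<beta> M f = gsum \<beta> \<alpha> M (\<lambda>x. f (M - x))"
  unfolding gsum_def
  by (rule sum.reindex_bij_witness[of _ "\<lambda>x. M - x" "\<lambda>x. M - x"]) (auto simp: mult_ac)

text \<open>At z = - n - 1 the factor (z + 1)_k is (-n)_k. The sum stops at \<open>min n u\<close>
  and can be read as an \<open>hsum\<close> of order \<open>n\<close> in the variable
  \<open>- u\<close>: index and variable exchange their roles.\<close>

lemma dual_sum_negative:
  assumes "pochhammer (1 - a) n \<noteq> 0" "pochhammer (- K) n \<noteq> 0"
  shows "dual_sum a b K u (- real (Suc n)) * (pochhammer (1 - a) n * pochhammer (- K) n) =
    pochhammer (- K) u * hsum n (real (Suc n) - a - b) (- real u) (1 - a) (- K)"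
proof -
  let ?t = "\<lambda>k. pochhammer (- real u) k * pochhammer (- real (Suc n) + 1) k * pochhammer (real (Suc n) - a - b) k *
     pochhammer (- K + real k) (u - k) / (pochhammer (1 - a) k * fact k)"
  have z: "- real (Suc n) + 1 = - real n" by simp
  have "dual_sum a b K u (- real (Suc n)) = (\<Sum>k\<le>u. ?t k)" by (simp only: dual_sum_def minus_minus)
  also have "\<dots> = (\<Sum>k\<le>min n u. ?t k)"
    unfolding z by (rule sum.mono_neutral_right) (auto simp: pochhammer_of_nat_eq_0_iff)
  finally have e: "dual_sum a b K u (- real (Suc n)) = (\<Sum>k\<le>min n u. ?t k)" .
  have "dual_sum a b K u (- real (Suc n)) * (pochhammer (1 - a) n * pochhammer (- K) n) = (\<Sum>k\<le>min n u. pochhammer (- K) u *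
     ((-1) ^ k * real (n choose k) * pochhammer (real (Suc n) - a - b) k * pochhammer (- real u) k * pochhammer (1 - a + real k) (n - k) * pochhammer (- K + real k) (n - k)))"
    (is "_ = sum ?h _")
    unfolding e sum_distrib_right
  proof (rule sum.cong[OF refl], goal_cases)
    case (1 k)
    hence k: "k \<le> n" "k \<le> u" by auto
    have 1: "pochhammer (- real n) k / fact k = (-1) ^ k * real (n choose k)"
      using pochhammer_minus[of "real n" k] pochhammer_split[of 1 "n - k" k] k
      by (simp add: pochhammer_fact[symmetric] binomial_fact of_nat_diff field_simps)
    have 2: "pochhammer (1 - a) n = pochhammer (1 - a) k * pochhammer (1 - a + real k) (n - k)"
      "pochhammer (- K) n = pochhammer (- K) k * pochhammer (- K + real k) (n - k)"
      "pochhammer (- K) u = pochhammer (- K) k * pochhammer (- K + real k) (u - k)"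
      using pochhammer_split[of "1 - a" k "n - k"] pochhammer_split[of "- K" k "n - k"] pochhammer_split[of "- K" k "u - k"] k by simp_all
    have nz: "pochhammer (1 - a) k \<noteq> 0" using assms(1) unfolding 2 by auto
    have "?t k * (pochhammer (1 - a) n * pochhammer (- K) n) =
      (pochhammer (- real n) k / fact k) * (pochhammer (- real u) k * pochhammer (real (Suc n) - a - b) k *
       (pochhammer (- K) k * pochhammer (- K + real k) (u - k)) * pochhammer (1 - a + real k) (n - k) * pochhammer (- K + real k) (n - k))"
      unfolding z 2(1,2) using nz by simp
    thus ?case
      unfolding 1 2(3)[symmetric] by (simp only: mult_ac)
  qed
  also have "\<dots> = pochhammer (- K) u * hsum n (real (Suc n) - a - b) (- real u) (1 - a) (- K)"
    unfolding hsum_def sum_distrib_left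
  proof (rule sum.mono_neutral_left)
    show "\<forall>k\<in>{..n} - {..min n u}. ?h k = 0" by (auto simp: pochhammer_of_nat_eq_0_iff)
  qed auto
  finally show ?thesis .
qed

lemma hsum_polynomial: "\<exists>p. degree p \<le> n \<and> (\<forall>x. poly p x = hsum n s (y - x) c d)"
proof -
  let ?p = "\<Sum>j\<le>n. smult ((-1) ^ j * real (n choose j) * pochhammer s j * pochhammer (c + real j) (n - j) * pochhammer (d + real j) (n - j))
     (pochhammer [:y, -1:] j)"
  have "degree (pochhammer [:y, -1:] j) \<le> j" for j
  proof (induction j)
    case (Suc j)
    have "degree (pochhammer [:y, -1:] j * ([:y, -1:] + of_nat j)) \<le> degree (pochhammer [:y, -1:] j) + degree ([:y, -1:] + of_nat j)"
      by (rule degree_mult_le)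
    thus ?case using Suc by (simp add: pochhammer_Suc of_nat_poly)
  qed simp
  hence "degree ?p \<le> n" by (intro degree_sum_le) (auto intro!: order.trans[OF degree_smult_le] intro: order.trans)
  moreover have "poly ?p x = hsum n s (y - x) c d" for x
    by (simp add: poly_sum poly_pochhammer hsum_def mult_ac)
  ultimately show ?thesis by blast
qed

section \<open>Reflection, orthogonality of Hahn polynomials, negative indices\<close>

context hahn_nat
begin

text \<open>Compares the expansions in \<open>x - N\<close> and in \<open>- x\<close>. Exchanging
  \<open>a\<close> and \<open>b\<close> in this way reduces types 1 and 3 to types 2 and 4.\<close>

lemma hahn_reflect: "H n x = (-1) ^ n * pochhammer (b + 1) n / pochhammer (a + 1) n * poly (hahn b a (real N) (int n)) (real N - x)"
proof -
  interpret S: hahn_nat b a N by (rule hahn_nat_swap)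
  have e: "b + a + 1 = a + b + 1" "b + a + real N + 2 = a + b + real N + 2" by simp_all
  hence "(-1) ^ n * hconst n = (-1) ^ n * pochhammer (b + 1) n / pochhammer (a + 1) n * S.hconst n"
    unfolding hconst_def S.hconst_def e using pos_b[of n] by (simp add: mult_ac)
  thus ?thesis unfolding hahn_hsum2 S.hahn_hsum1 e by simp
qed

lemma second_kind_1:
  assumes u: "\<forall>k\<le>u. b - real k \<notin> \<int>\<^sub>\<le>\<^sub>0" and K: "pochhammer (- (a + b + real N)) u \<noteq> 0"
  shows "gsum (a + 1) (b + 1) N (\<lambda>x. H n (real x) / (b + real N - real u - real x)) =
    Gamma b * Gamma (a + 1) * pochhammer (a + b + 1) N / (fact N * pochhammer (- (a + b + real N)) u) *
    ((-1) ^ n * \<xi> a b (real N) 1 (real n) n * dual_sum b a (a + b + real N) u (real n))"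
proof -
  interpret S: hahn_nat b a N by (rule hahn_nat_swap)
  have e: "b + a = a + b" by simp
  let ?r = "(-1) ^ n * pochhammer (b + 1) n / pochhammer (a + 1) n"
  have "gsum (a + 1) (b + 1) N (\<lambda>x. H n (real x) / (b + real N - real u - real x)) =
     gsum (b + 1) (a + 1) N (\<lambda>x. ?r * (S.H n (real x) / (real x + b - real u)))"
    unfolding gsum_reflect[of "a + 1"]
    by (rule gsum_cong) (simp add: hahn_reflect[of n] of_nat_diff algebra_simps)
  also have "\<dots> = Gamma b * Gamma (a + 1) * pochhammer (a + b + 1) N / (fact N * pochhammer (- (a + b + real N)) u) *
    (?r * ((-1) ^ n * \<xi> b a (real N) 2 (real n) n) * dual_sum b a (a + b + real N) u (real n))"
    unfolding gsum_cmult S.second_kind_2[OF u K[folded e]] e by (simp only: mult_ac)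
  also have "?r * ((-1) ^ n * \<xi> b a (real N) 2 (real n) n) = (-1) ^ n * \<xi> a b (real N) 1 (real n) n"
    using pos_a[of n] pos_b[of n] by (simp add: \<xi>_def \<xi>_num_def \<xi>_den_def add_ac)
  finally show ?thesis .
qed

lemma second_kind_3:
  assumes u: "\<forall>k\<le>u. b - real k \<notin> \<int>\<^sub>\<le>\<^sub>0"
  shows "(\<Sum>k\<le>u. pochhammer (- real u) k * gsum (b - real k) (a + 1) (N + Suc k) (\<lambda>x. H n (real N - (real x - real (Suc k))))) =
    Gamma b * Gamma (a + 1) * pochhammer (a + b + 1) (N + 1) / fact (N + 1 + u) *
    ((-1) ^ n * \<xi> a b (real N) 3 (real n) n * dual_sum b a (- 2 - real N) u (real n))"
proof -
  interpret S: hahn_nat b a N by (rule hahn_nat_swap)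
  let ?r = "(-1) ^ n * pochhammer (b + 1) n / pochhammer (a + 1) n"
  have e: "H n (real N - y) = ?r * S.H n y" for y using hahn_reflect[of n "real N - y"] by simp
  have "(\<Sum>k\<le>u. pochhammer (- real u) k * gsum (b - real k) (a + 1) (N + Suc k) (\<lambda>x. H n (real N - (real x - real (Suc k))))) =
    ?r * (\<Sum>k\<le>u. pochhammer (- real u) k * gsum (b - real k) (a + 1) (N + Suc k) (\<lambda>x. S.H n (real x - real (Suc k))))"
    unfolding e gsum_cmult sum_distrib_left by (intro sum.cong refl) (simp only: mult_ac)
  also have "\<dots> = Gamma b * Gamma (a + 1) * pochhammer (b + a + 1) (N + 1) / fact (N + 1 + u) *
    (?r * ((-1) ^ n * \<xi> b a (real N) 4 (real n) n) * dual_sum b a (- 2 - real N) u (real n))"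
    unfolding S.second_kind_4[OF u] by (simp only: mult_ac)
  also have "?r * ((-1) ^ n * \<xi> b a (real N) 4 (real n) n) = (-1) ^ n * \<xi> a b (real N) 3 (real n) n"
    using pos_a[of n] pos_b[of n] by (simp add: \<xi>_def \<xi>_num_def \<xi>_den_def add_ac)
  also have "b + a + 1 = a + b + 1" by simp
  finally show ?thesis .
qed

abbreviation "rise \<equiv> pochhammer [:a + 1, 1:]"

definition L :: "real poly \<Rightarrow> real" where "L p = gsum (a + 1) (b + 1) N (\<lambda>x. poly p (real x))"

lemma L_add: "L (p + q) = L p + L q"
  by (simp add: L_def gsum_def sum.distrib distrib_left)

lemma L_smult: "L (smult k p) = k * L p"
  by (simp add: L_def gsum_cmult)

lemma L_hahn_large: "N < n \<Longrightarrow> L (hp n * p) = 0"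
  unfolding L_def gsum_def by (intro sum.neutral) (simp add: H_vanish)

lemma L_hahn_rising:
  assumes "n \<le> N"
  shows "L (hp n * rise s) = hconst n * pochhammer (- real N) n *
     (Gamma (a + 1 + real s) * Gamma (b + 1) * pochhammer (a + 1 + real s + b + 1 + real n) (N - n) / fact N) * (pochhammer (b + 1) n * pochhammer (- real s) n)"
proof -
  have "L (hp n * rise s) = gsum (a + 1 + real s) (b + 1) N (\<lambda>x. H n (real x))"
    unfolding L_def gsum_def
  proof (rule sum.cong[OF refl], goal_cases)
    case (1 x)
    have "Gamma (a + 1 + real s + real x) = Gamma (a + 1 + real x) * pochhammer (a + 1 + real x) s"
      using Gamma_add_nat[OF nonpos_a[of x], of s] by (simp add: add_ac)
    thus ?case by (simp add: poly_pochhammer)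
  qed
  thus ?thesis using gsum_hahn[OF nonpos_a[of s] assms] by simp
qed

text \<open>Rising factorials of \<open>x + a + 1\<close> of order \<open>s\<close> integrate to a
  multiple of (-s)_n, which is 0 for \<open>s < n\<close> and nonzero for \<open>s = n\<close>, and
  they span all polynomials. For \<open>n > N\<close> the Hahn polynomial vanishes on the
  support.\<close>

lemma L_hahn:
  shows "degree p < n \<Longrightarrow> L (hp n * p) = 0"
    and "n \<le> N \<Longrightarrow> degree p \<le> n \<Longrightarrow> L (hp n * p) = coeff p n * L (hp n * rise n)"
    and "n \<le> N \<Longrightarrow> L (hp n * rise n) \<noteq> 0"
proof -
  let ?h = "hp n"
  have main: "degree p \<le> d \<Longrightarrow> d \<le> n \<Longrightarrow> L (?h * p) = coeff p n * L (?h * rise n)" if n: "n \<le> N" for p d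
  proof (induction d arbitrary: p)
    case 0
    then obtain k where p: "p = [:k:]" by (auto elim: degree_eq_zeroE)
    have "L (?h * p) = k * L (?h * rise 0)" by (simp add: p L_smult[symmetric])
    moreover have "L (?h * rise 0) = 0" if "n > 0"
      using that unfolding L_hahn_rising[OF n] by (simp add: pochhammer_0_left)
    ultimately show ?case by (cases n) (auto simp: p)
  next
    case (Suc d)
    define k where "k = coeff p (Suc d)"
    define P where "P = rise (Suc d)"
    have P: "degree P = Suc d" "coeff P (Suc d) = 1"
    proof -
      show d: "degree P = Suc d" unfolding P_def by (rule degree_pochhammer_linear)
      have "lead_coeff (rise i) = 1" for i
        by (induction i) (auto simp: pochhammer_Suc lead_coeff_mult of_nat_poly simp del: mult_pCons_right)
      thus "coeff P (Suc d) = 1" using d unfolding P_def by metis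
    qed
    let ?q = "p - smult k P"
    have "degree ?q \<le> Suc d" using Suc.prems(1) P(1) by (intro degree_diff_le) (auto intro: order.trans[OF degree_smult_le])
    moreover have "coeff ?q (Suc d) = 0" by (simp add: k_def P(2))
    ultimately have "degree ?q \<le> d" using eq_zero_or_degree_less[of ?q "Suc d"] by auto
    hence "L (?h * ?q) = coeff ?q n * L (?h * rise n)" using Suc.IH Suc.prems(2) by simp
    moreover have "L (?h * p) = L (?h * ?q) + k * L (?h * P)"
      by (simp add: L_add[symmetric] L_smult[symmetric] algebra_simps)
    moreover have "k * L (?h * P) = coeff (smult k P) n * L (?h * rise n)"
    proof (cases "n = Suc d")
      case True
      thus ?thesis using P by (simp add: P_def)
    next
      case False
      hence "Suc d < n" using Suc.prems(2) by simp
      hence "L (?h * P) = 0" unfolding P_def L_hahn_rising[OF n] by (simp add: pochhammer_of_nat_eq_0_iff del: of_nat_Suc)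
      thus ?thesis using P(1) \<open>Suc d < n\<close> by (simp add: coeff_eq_0)
    qed
    ultimately show ?case by (simp only: coeff_diff left_diff_distrib diff_add_cancel)
  qed
  show "L (?h * p) = 0" if "degree p < n"
  proof (cases "n \<le> N")
    case True
    thus ?thesis using main[OF True, of p "degree p"] that by (simp add: coeff_eq_0)
  qed (use L_hahn_large in auto)
  show "n \<le> N \<Longrightarrow> degree p \<le> n \<Longrightarrow> L (?h * p) = coeff p n * L (?h * rise n)"
    by (rule main[of _ n]) auto
  show "L (?h * rise n) \<noteq> 0" if n: "n \<le> N"
  proof -
    have "a + 1 + real n + b + 1 + real n + real k \<noteq> 0" for k using nz_ab[of "Suc (n + n + k)"] by (simp add: algebra_simps)
    hence "pochhammer (a + 1 + real n + b + 1 + real n) (N - n) \<noteq> 0" by (auto simp: pochhammer_eq_0_iff eq_neg_iff_add_eq_0)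
    moreover have "Gamma (a + 1 + real n) \<noteq> 0" "Gamma (b + 1) \<noteq> 0" using nonpos_a[of n] nonpos_b[of 0] by (simp_all add: Gamma_eq_zero_iff)
    ultimately show ?thesis unfolding L_hahn_rising[OF n] using hconst_nonzero pos_b n by (simp add: pochhammer_of_nat_eq_0_iff)
  qed
qed

text \<open>The constants of \<open>second_kind_1\<close> to \<open>second_kind_4\<close>. Types 1
  and 3 receive a minus sign because the factor in the weight is \<open>root - x\<close>
  there.\<close>

definition kap :: "nat \<Rightarrow> nat \<Rightarrow> real" where
  "kap t u = (if t = 1 then - (Gamma b * Gamma (a + 1) * pochhammer (a + b + 1) N / (fact N * pochhammer (- (a + b + real N)) u))
     else if t = 2 then Gamma a * Gamma (b + 1) * pochhammer (a + b + 1) N / (fact N * pochhammer (- (a + b + real N)) u)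
     else if t = 3 then - (Gamma b * Gamma (a + 1) * pochhammer (a + b + 1) (N + 1) / fact (N + 1 + u))
     else Gamma a * Gamma (b + 1) * pochhammer (a + b + 1) (N + 1) / fact (N + 1 + u))"

definition root :: "nat \<Rightarrow> nat \<Rightarrow> real" where
  "root t u = (if t = 1 then b + real N - real u else if t = 2 then real u - a else if t = 3 then real N + 1 + real u else - 1 - real u)"

definition dual :: "nat \<Rightarrow> nat \<Rightarrow> real \<Rightarrow> real" where
  "dual t u z = (if t = 1 then dual_sum b a (a + b + real N) u z else if t = 2 then dual_sum a b (a + b + real N) u z
     else if t = 3 then dual_sum b a (- 2 - real N) u z else dual_sum a b (- 2 - real N) u z)"

abbreviation "\<xi>' t n \<equiv> \<xi> a b (real N) t 0 (Suc n)"
abbreviation "\<xi>_den' t n \<equiv> \<xi>_den a b (real N) t 0 (Suc n)"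

text \<open>Converts the constant \<open>B\<close> of \<open>negative_values\<close>, which belongs
  to type 3, into that of type 1. The companion \<open>\<xi>4_negative\<close> does the same with
  \<open>A\<close> for type 4, and type 2 needs both.\<close>

lemma \<xi>1_negative:
  assumes "\<xi>_den' 1 n \<noteq> 0"
  shows "pochhammer (- (a + b + real N)) n \<noteq> 0"
    and "\<xi>' 1 n * (pochhammer (a + b + 1) (N + 1) / (fact (N + 1) * pochhammer (real N + 2) n)) =
      (-1) ^ n * pochhammer (a + b + 1) N / (fact N * pochhammer (- (a + b + real N)) n)"
proof -
  let ?K = "a + b + real N"
  have sq: "(-1::real) ^ n * (-1) ^ n = 1" by (simp flip: power_mult_distrib)
  have den: "\<xi>_den' 1 n = (-1) ^ n * pochhammer (- ?K) n * (?K + 1)"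
    using pochhammer_reflect[of "- ?K" n] pochhammer_split[of "?K + 1 - real n" n 1]
    by (simp add: \<xi>_den_def algebra_simps)
  show nz: "pochhammer (- ?K) n \<noteq> 0" using assms unfolding den by auto
  have K1: "?K + 1 \<noteq> 0" using assms unfolding den by auto
  have num: "\<xi>_num a b (real N) 1 0 (Suc n) = (real N + 1) * pochhammer (real N + 2) n"
  proof -
    have "\<xi>_num a b (real N) 1 0 (Suc n) = (-1) ^ Suc n * pochhammer (1 - (real N + 1) - real (Suc n)) (Suc n)"
    proof -
      have "1 - (real N + 1) - real (Suc n) = 0 - real (Suc n) - real N" by simp
      thus ?thesis by (simp only: \<xi>_num_def) simp
    qed
    also have "\<dots> = ((-1) ^ Suc n * (-1) ^ Suc n) * pochhammer (real N + 1) (Suc n)"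
      unfolding pochhammer_reflect by (simp only: mult.assoc)
    also have "\<dots> = pochhammer (real N + 1) (Suc n)" by (simp flip: power_mult_distrib)
    finally show ?thesis by (simp add: pochhammer_rec add_ac)
  qed
  have p: "pochhammer (real N + 2) n \<noteq> 0" by (auto simp: pochhammer_eq_0_iff)
  have aux: "Y * r / (s * q * k) * (P * k / (Y * f * r)) = s * P / (f * q)" if "s * s = 1" "k \<noteq> 0" "q \<noteq> 0" "f \<noteq> 0" "r \<noteq> 0" "Y \<noteq> 0" for s q k P Y f r :: real
  proof -
    have "s \<noteq> 0" using that(1) by auto
    hence "1 / s = s" using that(1) by (simp add: field_simps)
    have "Y * r / (s * q * k) * (P * k / (Y * f * r)) = 1 / s * P / (f * q)" using that \<open>s \<noteq> 0\<close> by (simp add: field_simps)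
    thus ?thesis unfolding \<open>1 / s = s\<close> .
  qed
  have P1: "pochhammer (a + b + 1) (N + 1) = pochhammer (a + b + 1) N * (?K + 1)" by (simp add: pochhammer_Suc add_ac)
  have f1: "fact (N + 1) = (real N + 1) * fact N" by (simp add: add.commute)
  show "\<xi>' 1 n * (pochhammer (a + b + 1) (N + 1) / (fact (N + 1) * pochhammer (real N + 2) n)) =
      (-1) ^ n * pochhammer (a + b + 1) N / (fact N * pochhammer (- ?K) n)"
    unfolding \<xi>_def den num P1 f1 by (rule aux[OF sq K1 nz _ p]) auto
qed

lemma \<xi>4_negative:
  assumes "\<xi>_den' 4 n \<noteq> 0" "pochhammer (b - real n) (Suc n) \<noteq> 0"
  shows "pochhammer (1 - a) n \<noteq> 0"
    and "\<xi>' 4 n * (- (Gamma b * Gamma (a + 1)) / pochhammer (1 - b) n) = (-1) ^ n * (Gamma a * Gamma (b + 1)) / pochhammer (1 - a) n"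
proof -
  have sq: "(-1::real) ^ n * (-1) ^ n = 1" by (simp flip: power_mult_distrib)
  have r: "pochhammer (z - real n) (Suc n) = (-1) ^ n * pochhammer (1 - z) n * z" for z
    using pochhammer_reflect[of "1 - z" n] pochhammer_split[of "z - real n" n 1] by simp
  have den: "\<xi>_den' 4 n = (-1) ^ n * pochhammer (1 - a) n * a"
    unfolding r[symmetric] by (simp add: \<xi>_den_def algebra_simps)
  have num: "\<xi>_num a b (real N) 4 0 (Suc n) = - ((-1) ^ n * ((-1) ^ n * pochhammer (1 - b) n * b))"
    unfolding r[symmetric] by (simp add: \<xi>_num_def algebra_simps)
  show nz: "pochhammer (1 - a) n \<noteq> 0" using assms unfolding den by auto
  have a0: "a \<noteq> 0" using assms unfolding den by auto
  have b0: "b \<noteq> 0" "pochhammer (1 - b) n \<noteq> 0" using assms unfolding r by auto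
  have "z \<notin> \<int>\<^sub>\<le>\<^sub>0" if "z + 1 \<notin> \<int>\<^sub>\<le>\<^sub>0" "z \<noteq> 0" for z :: real
  proof
    assume "z \<in> \<int>\<^sub>\<le>\<^sub>0"
    then obtain k where k: "z = - real k" by (elim nonpos_Ints_cases')
    with that(2) obtain j where "k = Suc j" by (cases k) auto
    hence "z + 1 = - real j" using k by simp
    thus False using that(1) by (metis minus_of_nat_in_nonpos_Ints)
  qed
  hence G: "Gamma (a + 1) = a * Gamma a" "Gamma (b + 1) = b * Gamma b"
    using nonpos_a[of 0] nonpos_b[of 0] a0 b0 by (auto intro!: Gamma_plus1)
  show "\<xi>' 4 n * (- (Gamma b * Gamma (a + 1)) / pochhammer (1 - b) n) = (-1) ^ n * (Gamma a * Gamma (b + 1)) / pochhammer (1 - a) n"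
    unfolding \<xi>_def den num G using nz a0 b0 by (simp add: field_simps)
qed

text \<open>Continued to the negative index \<open>- n - 1\<close>, the values of second kind become a polynomial of degree at most \<open>n\<close> in the zero;
  this governs the columns of the Casorati determinant to the right of column \<open>n\<close> when \<open>n < m\<close>.\<close>

lemma negative_values:
  assumes b: "pochhammer (b - real n) (Suc n) \<noteq> 0"
  shows "\<exists>p. degree p \<le> n \<and> (\<forall>t\<in>{1, 2, 3, 4}. \<forall>u. \<xi>_den' t n \<noteq> 0 \<longrightarrow>
     pochhammer (- (a + b + real N)) u \<noteq> 0 \<or> t \<in> {3, 4} \<longrightarrow>
     kap t u * dual t u (- real (Suc n)) = \<xi>' t n * poly p (root t u))"
proof -
  let ?s = "real (Suc n) - a - b" and ?K = "a + b + real N"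
  let ?h = "\<lambda>u. hsum n ?s (- real u)"
  define A where "A = - (Gamma b * Gamma (a + 1)) / pochhammer (1 - b) n"
  define B where "B = pochhammer (a + b + 1) (N + 1) / (fact (N + 1) * pochhammer (real N + 2) n)"
  have sq: "(-1::real) ^ n * (-1) ^ n = 1" by (simp flip: power_mult_distrib)
  \<comment> \<open>This is the value for type 3, whose \<open>\<xi>\<close> is 1. One
    transformation of \<open>hsum\<close> connects it with types 1 and 4, two with type 2.\<close>
  obtain p where p: "degree p \<le> n" "\<And>x. poly p x = hsum n ?s (real N + 1 - x) (1 - b) (real N + 2)"
    using hsum_polynomial by metis
  have "pochhammer (b - real n) (Suc n) = (-1) ^ n * pochhammer (1 - b) n * b"
    using pochhammer_reflect[of "1 - b" n] pochhammer_split[of "b - real n" n 1] by simp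
  hence b1: "pochhammer (1 - b) n \<noteq> 0" using b by auto
  have N2: "pochhammer (- (- 2 - real N)) n \<noteq> 0" "pochhammer (real N + 2) n \<noteq> 0" by (auto simp: pochhammer_eq_0_iff)
  have N2': "- (- 2 - real N) = real N + 2" by simp
  have fN: "fact (N + 1 + u) = fact (N + 1) * pochhammer (real N + 2) u" for u
    using pochhammer_split[of 1 "N + 1" u] by (simp add: pochhammer_fact add_ac)
  have fu: "pochhammer (real N + 2) u \<noteq> 0" for u by (auto simp: pochhammer_eq_0_iff)
  have s': "real (Suc n) - b - a = ?s" by simp
  have kap3: "kap 3 u = - (Gamma b * Gamma (a + 1) * pochhammer (a + b + 1) (N + 1) / (fact (N + 1) * pochhammer (real N + 2) u))"
    and kap4: "kap 4 u = Gamma a * Gamma (b + 1) * pochhammer (a + b + 1) (N + 1) / (fact (N + 1) * pochhammer (real N + 2) u)" for u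
    unfolding kap_def fN[symmetric] by simp_all
  have key: "kap t u * dual t u (- real (Suc n)) = \<xi>' t n * poly (smult (A * B) p) (root t u)"
    if t: "t \<in> {1, 2, 3, 4}" and den: "\<xi>_den' t n \<noteq> 0" and Ku: "pochhammer (- ?K) u \<noteq> 0 \<or> t \<in> {3, 4}" for t u
  proof -
    have ds: "dual_sum x y K u (- real (Suc n)) = pochhammer (- K) u * hsum n (real (Suc n) - x - y) (- real u) (1 - x) (- K) / (pochhammer (1 - x) n * pochhammer (- K) n)"
      if "pochhammer (1 - x) n \<noteq> 0" "pochhammer (- K) n \<noteq> 0" for x y K
      using dual_sum_negative[OF that, of y u] that by (simp add: field_simps)
    consider "t = 1" | "t = 2" | "t = 3" | "t = 4" using t by auto
    thus ?thesis
    proof cases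
      case 1
      note X = \<xi>1_negative[OF den[unfolded 1]]
      have "poly p (root 1 u) = (-1) ^ n * ?h u (1 - b) (- ?K)"
        using hsum_transform[of n ?s "1 - b" "- real u" "real N + 2"] unfolding p(2) root_def by (simp add: algebra_simps)
      hence "\<xi>' 1 n * poly (smult (A * B) p) (root 1 u) = (\<xi>' 1 n * B) * A * ((-1) ^ n * ?h u (1 - b) (- ?K))" by simp
      also have "\<dots> = ((-1) ^ n * (-1) ^ n) * (A * (pochhammer (a + b + 1) N / (fact N * pochhammer (- ?K) n)) * ?h u (1 - b) (- ?K))"
        unfolding B_def X(2) by simp
      finally show ?thesis unfolding sq 1 using Ku b1 X(1)
        by (simp add: kap_def dual_def ds[OF b1 X(1)] s' A_def 1 mult_ac del: of_nat_Suc)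
    next
      case 3
      have "real N + 1 - root 3 u = - real u" by (simp add: root_def)
      hence pr: "poly (smult (A * B) p) (root 3 u) = A * B * ?h u (1 - b) (real N + 2)" unfolding poly_smult p(2) by simp
      show ?thesis unfolding 3 pr using b1 N2 fu[of u]
        by (simp add: kap3 dual_def ds[OF b1 N2(1)] s' N2' A_def B_def \<xi>_def \<xi>_num_def \<xi>_den_def mult_ac del: of_nat_Suc fact_Suc)
    next
      case 4
      note X = \<xi>4_negative[OF den[unfolded 4] b]
      have "poly p (root 4 u) = (-1) ^ n * ?h u (1 - a) (real N + 2)"
        using hsum_transform[of n ?s "real N + 2" "- real u" "1 - b"] unfolding p(2) root_def
        by (simp add: hsum_commute[of n _ _ "1 - b"] hsum_commute[of n _ _ "1 - a"] algebra_simps)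
      hence "\<xi>' 4 n * poly (smult (A * B) p) (root 4 u) = (\<xi>' 4 n * A) * B * ((-1) ^ n * ?h u (1 - a) (real N + 2))" by simp
      also have "\<dots> = ((-1) ^ n * (-1) ^ n) * (Gamma a * Gamma (b + 1) / pochhammer (1 - a) n * B * ?h u (1 - a) (real N + 2))"
        unfolding A_def X(2) by simp
      finally show ?thesis unfolding sq 4 using fu[of u] N2
        by (simp add: kap4 dual_def ds[OF X(1) N2(1)] N2' B_def mult_ac del: of_nat_Suc fact_Suc)
    next
      case 2
      have dp: "\<xi>_den' 2 n = \<xi>_den' 4 n * \<xi>_den' 1 n" by (simp add: \<xi>_den_def)
      have d1: "\<xi>_den' 1 n \<noteq> 0" and d4: "\<xi>_den' 4 n \<noteq> 0" using den unfolding 2 dp by auto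
      note X = \<xi>1_negative[OF d1] and X' = \<xi>4_negative[OF d4 b]
      have x2: "\<xi>' 2 n = \<xi>' 1 n * \<xi>' 4 n"
      proof -
        have "((-1) ^ Suc n * x) * ((-1) ^ Suc n * y) = y * x" for x y :: real by (simp flip: power_mult_distrib)
        hence "\<xi>_num a b (real N) 2 0 (Suc n) = \<xi>_num a b (real N) 1 0 (Suc n) * \<xi>_num a b (real N) 4 0 (Suc n)" by (simp add: \<xi>_num_def)
        thus ?thesis unfolding \<xi>_def dp by simp
      qed
      have "poly p (root 2 u) = (-1) ^ n * hsum n ?s (1 - a - (- real u)) (1 - a) (real N + 2)"
        using hsum_transform[of n ?s "real N + 2" "1 - a + real u" "1 - b"] unfolding p(2) root_def
        by (simp add: hsum_commute[of n _ _ "1 - b"] hsum_commute[of n _ _ "1 - a"] algebra_simps)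
      also have "\<dots> = (-1) ^ n * ((-1) ^ n * ?h u (1 - a) (- ?K))"
        unfolding hsum_transform by (simp add: algebra_simps)
      finally have pr: "poly p (root 2 u) = ?h u (1 - a) (- ?K)" unfolding mult.assoc[symmetric] sq by simp
      have "\<xi>' 2 n * poly (smult (A * B) p) (root 2 u) = (\<xi>' 1 n * B) * (\<xi>' 4 n * A) * ?h u (1 - a) (- ?K)"
        unfolding poly_smult pr x2 by simp
      also have "\<dots> = ((-1) ^ n * (-1) ^ n) * (pochhammer (a + b + 1) N / (fact N * pochhammer (- ?K) n) * (Gamma a * Gamma (b + 1) / pochhammer (1 - a) n) * ?h u (1 - a) (- ?K))"
        unfolding A_def B_def X(2) X'(2) by simp
      finally show ?thesis unfolding sq 2 using Ku X(1) X'(1)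
        by (simp add: kap_def dual_def ds[OF X'(1) X(1)] 2 mult_ac del: of_nat_Suc)
    qed
  qed
  show ?thesis
  proof (intro exI[of _ "smult (A * B) p"] conjI ballI allI impI)
    show "degree (smult (A * B) p) \<le> n" using p(1) degree_smult_le order.trans by blast
  qed (rule key)
qed

end

section \<open>Orthogonality\<close>

lemma det_zero_iff_comb:
  fixes A :: "real mat"
  assumes A: "A \<in> carrier_mat n n"
  shows "Determinant.det A = 0 \<longleftrightarrow> (\<exists>v. (\<exists>j<n. v j \<noteq> 0) \<and> (\<forall>i<n. (\<Sum>j<n. A $$ (i, j) * v j) = 0))"
proof
  assume "Determinant.det A = 0"
  then obtain v where v: "v \<in> carrier_vec n" "v \<noteq> 0\<^sub>v n" "A *\<^sub>v v = 0\<^sub>v n"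
    using det_0_iff_vec_prod_zero[OF A] by blast
  have "(\<Sum>j<n. A $$ (i, j) * vec_index v j) = 0" if "i < n" for i
  proof -
    have "(\<Sum>j<n. A $$ (i, j) * vec_index v j) = vec_index (A *\<^sub>v v) i"
      using that v(1) A by (simp add: scalar_prod_def lessThan_atLeast0)
    thus ?thesis using that v(3) by simp
  qed
  moreover have "\<exists>j<n. vec_index v j \<noteq> 0"
  proof (rule ccontr)
    assume "\<not> (\<exists>j<n. vec_index v j \<noteq> 0)"
    hence "v = 0\<^sub>v n" using v(1) by (intro eq_vecI) auto
    thus False using v(2) by simp
  qed
  ultimately show "\<exists>v. (\<exists>j<n. v j \<noteq> 0) \<and> (\<forall>i<n. (\<Sum>j<n. A $$ (i, j) * v j) = 0)" by blast
next
  assume "\<exists>v. (\<exists>j<n. v j \<noteq> 0) \<and> (\<forall>i<n. (\<Sum>j<n. A $$ (i, j) * v j) = 0)"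
  then obtain v j where v: "j < n" "v j \<noteq> 0" "\<And>i. i < n \<Longrightarrow> (\<Sum>j<n. A $$ (i, j) * v j) = 0" by blast
  have "A *\<^sub>v vec n v = 0\<^sub>v n"
    using v(3) A by (intro eq_vecI) (auto simp: scalar_prod_def lessThan_atLeast0)
  moreover have "vec n v \<noteq> 0\<^sub>v n" using v(1,2) by (metis index_vec index_zero_vec(1))
  ultimately show "Determinant.det A = 0" using det_0_iff_vec_prod_zero[OF A] vec_carrier by blast
qed

lemma det_zero_row_comb:
  fixes A :: "real mat"
  assumes A: "A \<in> carrier_mat n n" and v: "j < n" "v j \<noteq> 0" "\<And>k. k < n \<Longrightarrow> (\<Sum>i<n. v i * A $$ (i, k)) = 0"
  shows "Determinant.det A = 0"
proof -
  have "Determinant.det (transpose_mat A) = 0"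
    using v A by (subst det_zero_iff_comb[of _ n]) (auto intro!: exI[of _ v] simp: mult.commute)
  thus ?thesis using det_transpose[OF A] by simp
qed

text \<open>As \<open>C\<close> is smaller than \<open>R\<close>, every permutation sends some index
  of \<open>R\<close> outside \<open>C\<close>, and its Leibniz term has a zero factor.\<close>

lemma det_zero_block:
  fixes A :: "real mat"
  assumes A: "A \<in> carrier_mat n n" and R: "R \<subseteq> {..<n}" and C: "C \<subseteq> {..<n}" "card C < card R"
    and z: "\<And>i j. i \<in> R \<Longrightarrow> j < n \<Longrightarrow> j \<notin> C \<Longrightarrow> A $$ (i, j) = 0"
  shows "Determinant.det A = 0"
  unfolding Determinant.det_def'[OF A]
proof (rule sum.neutral, rule ballI)
  fix p assume "p \<in> {p. p permutes {0..<n}}"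
  hence p: "p permutes {0..<n}" by simp
  have "\<not> p ` R \<subseteq> C"
  proof
    assume "p ` R \<subseteq> C"
    moreover have "card (p ` R) = card R" using permutes_inj[OF p] by (intro card_image) (auto intro: inj_on_subset)
    ultimately show False using C card_mono[of C "p ` R"] finite_subset by fastforce
  qed
  then obtain i where i: "i \<in> R" "p i \<notin> C" by blast
  have "i < n" using i R by auto
  hence "p i < n" using permutes_in_image[OF p, of i] by simp
  hence "A $$ (i, p i) = 0" using z i by simp
  thus "signof p * (\<Prod>i = 0..<n. A $$ (i, p i)) = 0" using \<open>i < n\<close> by auto
qed

lemma det_row_scale:
  "Determinant.det (mat n n (\<lambda>(i, j). d i * A i j)) = (\<Prod>i<n. d i) * Determinant.det (mat n n (\<lambda>(i, j). A i j :: real))"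
  unfolding det_mat_permutes by (simp only: prod.distrib sum_distrib_left) (simp only: mult_ac)

definition node_poly :: "nat \<Rightarrow> (nat \<Rightarrow> real) \<Rightarrow> real poly" where
  "node_poly m x = (\<Prod>l<m. [:- x l, 1:])"

definition node_del :: "nat \<Rightarrow> (nat \<Rightarrow> real) \<Rightarrow> nat \<Rightarrow> real poly" where
  "node_del m x i = (\<Prod>l\<in>{..<m} - {i}. [:- x l, 1:])"

lemma degree_prod_linear:
  fixes x :: "nat \<Rightarrow> real"
  shows "finite A \<Longrightarrow> degree (\<Prod>l\<in>A. [:- x l, 1:]) = card A \<and> coeff (\<Prod>l\<in>A. [:- x l, 1:]) (card A) = 1"
proof (induction A rule: finite_induct)
  case (insert l A)
  let ?p = "\<Prod>l\<in>A. [:- x l, 1:]"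
  have "degree ([:- x l, 1:] * ?p) = Suc (card A)" using insert by (subst degree_mult_eq) auto
  moreover have "coeff ([:- x l, 1:] * ?p) (1 + card A) = coeff [:- x l, 1:] 1 * coeff ?p (card A)"
    using insert by (intro coeff_mult_top) auto
  ultimately show ?case using insert by (simp del: mult_pCons_left)
qed simp

lemma node_poly: "degree (node_poly m x) = m" "lead_coeff (node_poly m x) = 1"
  using degree_prod_linear[of "{..<m}" x] by (auto simp: node_poly_def)

lemma node_del: "i < m \<Longrightarrow> degree (node_del m x i) = m - 1" "i < m \<Longrightarrow> coeff (node_del m x i) (m - 1) = 1"
proof -
  assume i: "i < m"
  show d: "degree (node_del m x i) = m - 1" using degree_prod_linear[of "{..<m} - {i}" x] i by (simp add: node_del_def)
  show "coeff (node_del m x i) (m - 1) = 1" using degree_prod_linear[of "{..<m} - {i}" x] i by (simp add: node_del_def)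
qed

lemma poly_node_del:
  assumes "inj_on x {..<m}" "i < m" "k < m"
  shows "poly (node_del m x i) (x k) = 0 \<longleftrightarrow> k \<noteq> i"
  using assms by (auto simp: node_del_def poly_prod prod_zero_iff inj_on_eq_iff)

lemma lagrange:
  assumes x: "inj_on x {..<m}" and f: "degree f < m"
  shows "f = (\<Sum>i<m. smult (poly f (x i) / poly (node_del m x i) (x i)) (node_del m x i))"
proof -
  let ?g = "\<Sum>i<m. smult (poly f (x i) / poly (node_del m x i) (x i)) (node_del m x i)"
  have e: "poly ?g (x k) = poly f (x k)" if k: "k < m" for k
  proof -
    have "poly ?g (x k) = (\<Sum>i\<in>{k}. poly f (x i) / poly (node_del m x i) (x i) * poly (node_del m x i) (x k))"
      unfolding poly_sum poly_smult using k poly_node_del[OF x] by (intro sum.mono_neutral_right) auto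
    thus ?thesis using poly_node_del[OF x k k] by simp
  qed
  show ?thesis
  proof (rule ccontr)
    assume "f \<noteq> ?g"
    hence nz: "f - ?g \<noteq> 0" by simp
    have "degree ?g \<le> m - 1" using node_del(1) by (intro degree_sum_le) (auto intro!: order.trans[OF degree_smult_le])
    hence "degree (f - ?g) \<le> m - 1" using f by (intro degree_diff_le) auto
    moreover have "x ` {..<m} \<subseteq> {y. poly (f - ?g) y = 0}" using e by auto
    hence "card (x ` {..<m}) \<le> card {y. poly (f - ?g) y = 0}" using nz by (intro card_mono poly_roots_finite)
    ultimately show False using card_poly_roots_bound[OF nz] f card_image[OF x] by simp
  qed
qed

text \<open>Compares the coefficients of x^(m-1) in the Lagrange formula. In particular the sum
  vanishes for degree below m - 1.\<close>

lemma lagrange_coeff: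
  assumes x: "inj_on x {..<m}" and f: "degree f < m"
  shows "(\<Sum>i<m. poly f (x i) / poly (node_del m x i) (x i)) = coeff f (m - 1)"
proof -
  have "coeff f (m - 1) = (\<Sum>i<m. poly f (x i) / poly (node_del m x i) (x i) * coeff (node_del m x i) (m - 1))"
    by (subst lagrange[OF assms]) (simp add: coeff_sum)
  thus ?thesis using node_del(2) by simp
qed

text \<open>\<open>I\<close> is integration against the transformed weight: multiplied by all nodes it is the Hahn functional \<open>L\<close>, and multiplied by
  all nodes but one it is a function of the second kind at the omitted node.\<close>

locale hahn_functional = hahn_nat a b N + casorati_rows a b "real N" U
  for a b :: real and N :: nat and U :: "nat \<Rightarrow> nat set" +
  fixes I :: "real poly \<Rightarrow> real" and C0 C1 :: real
  assumes I_add: "I (p + q) = I p + I q" and I_smult: "I (smult s p) = s * I p"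
    and C: "C0 \<noteq> 0" "C1 \<noteq> 0"
    and I_node_poly: "I (node_poly (size_U U) (\<lambda>l. root (row_t U (Suc l)) (row_u U (Suc l))) * p) = C0 * L p"
    and I_node_del: "l < size_U U \<Longrightarrow> I (node_del (size_U U) (\<lambda>l. root (row_t U (Suc l)) (row_u U (Suc l))) l * hahn a b (real N) (int n)) =
       C1 * (kap (row_t U (Suc l)) (row_u U (Suc l)) * ((-1) ^ n * \<xi> a b (real N) (row_t U (Suc l)) (real n) n * dual (row_t U (Suc l)) (row_u U (Suc l)) (real n)))"
    and root_inj: "inj_on (\<lambda>l. root (row_t U (Suc l)) (row_u U (Suc l))) {..<size_U U}"
    and kap_nonzero: "l < size_U U \<Longrightarrow> kap (row_t U (Suc l)) (row_u U (Suc l)) \<noteq> 0"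
    and K_nonzero: "l < size_U U \<Longrightarrow> row_t U (Suc l) \<in> {1, 2} \<Longrightarrow> pochhammer (- (a + b + real N)) (row_u U (Suc l)) \<noteq> 0"
    and b_int: "b = real k \<Longrightarrow> card {l. l < size_U U \<and> row_t U (Suc l) \<in> {1, 3}} \<le> k"
begin

abbreviation "uu l \<equiv> row_u U (Suc l)"
abbreviation "xr l \<equiv> root (rtyp l) (uu l)"
abbreviation "kp_row l \<equiv> kap (rtyp l) (uu l)"
abbreviation "\<xi>r l \<equiv> \<xi> a b (real N) (rtyp l)"
abbreviation "B n j \<equiv> bminor a b (real N) U (real n) j"
abbreviation "ent \<equiv> entry a b (real N) U"
abbreviation "en n i j \<equiv> ent (Suc i) (real n - real j) (m - j)"
abbreviation "\<Omega>n n \<equiv> \<Omega> a b (real N) U (real n)"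
abbreviation "q n \<equiv> q_poly a b (real N) U n"
definition "nice n \<longleftrightarrow> \<Omega>_defined a b (real N) U (real n) \<and> \<Omega> a b (real N) U (real n) \<noteq> 0"

lemma xr_eta: "(\<lambda>l. root (row_t U (Suc l)) (row_u U (Suc l))) = (\<lambda>l. xr l)"
  by (simp add: rtyp_def)

lemmas x_inj = root_inj[unfolded xr_eta]

lemma I_sum: "I (\<Sum>i\<in>A. smult (k i) (f i)) = (\<Sum>i\<in>A. k i * I (f i))"
proof -
  have "I 0 = 0" using I_smult[of 0 0] by simp
  thus ?thesis by (induction A rule: infinite_finite_induct) (auto simp: I_add I_smult)
qed

lemma poly_Yl: "l < m \<Longrightarrow> poly (Yl l) (\<theta> a b z) = dual (rtyp l) (uu l) z"
  using rtyp_range[of l] poly_dual_hahn_theta[of a b _ "uu l" z] poly_dual_hahn_theta'[of b a _ "uu l" z]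
  by (auto simp: Yl_def Y_row_def dual_def rtyp_def[symmetric] poly_pcompose add_ac)

lemma en: "l < m \<Longrightarrow> en n l j = \<xi>r l (real n - real j) (m - j) * dual (rtyp l) (uu l) (real n - real j)"
  using poly_Yl[of l "real n - real j"] by (simp add: entry_def rtyp_def Yl_def)

definition vv :: "nat \<Rightarrow> nat \<Rightarrow> real" where
  "vv l n = kp_row l * ((-1) ^ n * \<xi>r l (real n) n * dual (rtyp l) (uu l) (real n))"

lemma I_del_q:
  assumes l: "l < m"
  shows "I (q n * node_del m xr l) = C1 * (\<Sum>j\<le>min n m. B n j * vv l (n - j))"
proof -
  have "q n * node_del m xr l = (\<Sum>j\<le>m. smult (B n j) (node_del m xr l * hahn a b (real N) (int n - int j)))"
    unfolding q_poly_sum sum_distrib_right by (intro sum.cong) (simp_all add: mult.commute)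
  also have "\<dots> = (\<Sum>j\<le>min n m. smult (B n j) (node_del m xr l * hahn a b (real N) (int n - int j)))"
    by (rule sum.mono_neutral_right) (auto simp: hahn_def)
  also have "\<dots> = (\<Sum>j\<le>min n m. smult (B n j) (node_del m xr l * hp (n - j)))"
    by (intro sum.cong) (auto simp: of_nat_diff)
  finally have e: "q n * node_del m xr l = (\<Sum>j\<le>min n m. smult (B n j) (node_del m xr l * hp (n - j)))" .
  have "I (q n * node_del m xr l) = (\<Sum>j\<le>min n m. B n j * (C1 * vv l (n - j)))"
    unfolding e I_sum by (intro sum.cong refl arg_cong2[where f = "(*)"]) (simp only: I_node_del[OF l] vv_def rtyp_def)
  thus ?thesis by (simp add: sum_distrib_left mult_ac)
qed

lemma relation: "l < m \<Longrightarrow> (\<Sum>j\<le>m. (-1) ^ j * B n j * en n l j) = 0"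
  by (rule bminor_relation) simp

lemma I_q_small:
  assumes f: "degree f < m"
  shows "I (q n * f) = (\<Sum>i<m. poly f (xr i) / poly (node_del m xr i) (xr i) * I (q n * node_del m xr i))"
proof -
  have "q n * f = (\<Sum>i<m. smult (poly f (xr i) / poly (node_del m xr i) (xr i)) (q n * node_del m xr i))"
    by (subst lagrange[OF x_inj f]) (simp add: sum_distrib_left)
  thus ?thesis by (simp only: I_sum)
qed

lemma counts: "m = cnt 1 + cnt 2 + cnt 3 + cnt 4"
  using kp_km card_types(3,4) by simp

text \<open>The minor keeps the points n, ..., n - m + 1, which are the columns of
  \<open>\<Omega>\<close> at \<open>n + 1\<close>. Their windows are longer by one, and the surplus
  factor depends on the row only.\<close>

lemma bminor_last: "B n m = (\<Prod>l<m. \<xi>r l (real n - real m + 1) 1) * \<Omega>n (Suc n)"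
proof -
  have "B n m = Determinant.det (mat m m (\<lambda>(i, k). \<xi> a b (real N) (rtyp i) (real n - real m + 1) 1 * ent (Suc i) (real (Suc n) - real (Suc k)) (m - Suc k)))"
    unfolding bminor_mat Let_def
  proof (rule arg_cong[where f = Determinant.det], rule eq_matI, goal_cases)
    case (1 i k)
    hence k: "i < m" "k < m" by auto
    have e: "(m - Suc k) + 1 = m - k" "real n - real k - real (m - Suc k) = real n - real m + 1" using k by (simp_all add: of_nat_diff)
    have "ent (Suc i) (real n - real k) (m - k) = ent (Suc i) (real n - real k) (m - Suc k) * \<xi> a b (real N) (row_t U (Suc i)) (real n - real m + 1) 1"
      using entry_add[of a b "real N" U "Suc i" "real n - real k" "m - Suc k" 1] unfolding e .
    thus ?case using k by (simp add: rtyp_def)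
  qed auto
  also note det_row_scale
  also have "Determinant.det (mat m m (\<lambda>(i, k). ent (Suc i) (real (Suc n) - real (Suc k)) (m - Suc k))) = \<Omega>n (Suc n)"
    unfolding \<Omega>_casorati by (rule arg_cong[where f = Determinant.det], rule eq_matI) (auto simp: casorati_index casorati_def mat1_def)
  finally show ?thesis .
qed

lemma degree_q:
  assumes "nice n"
  shows "degree (q n) = n" "coeff (q n) n \<noteq> 0"
proof -
  have le: "degree (hahn a b (real N) (int n - int j)) \<le> n" "j > 0 \<Longrightarrow> coeff (hahn a b (real N) (int n - int j)) n = 0" for j
  proof -
    have "degree (hahn a b (real N) (int n - int j)) \<le> n - j"
    proof (cases "j \<le> n")
      case True
      hence "int n - int j = int (n - j)" by (simp add: of_nat_diff)
      thus ?thesis by (simp only: degree_hahn)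
    qed (simp add: hahn_def)
    moreover have "int n - int j < 0" if "n < j" using that by simp
    ultimately show "degree (hahn a b (real N) (int n - int j)) \<le> n" "j > 0 \<Longrightarrow> coeff (hahn a b (real N) (int n - int j)) n = 0"
      by (cases "n < j"; auto simp: hahn_def intro!: coeff_eq_0)+
  qed
  have d: "degree (q n) \<le> n"
    unfolding q_poly_sum using le(1) by (intro degree_sum_le) (auto intro: order.trans[OF degree_smult_le])
  have "coeff (q n) n = (\<Sum>j\<in>{0}. B n j * coeff (hahn a b (real N) (int n - int j)) n)"
    unfolding q_poly_sum coeff_sum coeff_smult by (rule sum.mono_neutral_right) (auto simp: le(2))
  also have "\<dots> = \<Omega> a b (real N) U (real n) * coeff (hp n) n" by (simp add: bminor_0)
  finally show "coeff (q n) n \<noteq> 0"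
    using assms pos_ab pos_a pos_abN[of n] unfolding nice_def by (simp add: coeff_hahn(2) add_ac)
  thus "degree (q n) = n" using d le_degree by (metis le_antisym)
qed

end

section \<open>Integrals of \<open>q_poly\<close> against the functional\<close>

context hahn_functional
begin

text \<open>For \<open>n \<ge> m\<close> all columns have nonnegative index, and up to a factor
  independent of the column the integrals \<open>vv\<close> are the Casorati entries; the relation
  between the columns annihilates them.\<close>

lemma I_del_large:
  assumes "m \<le> n" "l < m"
  shows "I (q n * node_del m xr l) = 0"
proof -
  have "B n j * vv l (n - j) = kp_row l * (-1) ^ n * \<xi>r l (real n - real m) (n - m) * ((-1) ^ j * B n j * en n l j)" if j: "j \<le> m" for j
  proof -
    have "\<xi>r l (real (n - j)) ((m - j) + (n - m)) = \<xi>r l (real (n - j)) (m - j) * \<xi>r l (real (n - j) - real (m - j)) (n - m)"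
      by (rule \<xi>_add)
    moreover have "(m - j) + (n - m) = n - j" "real (n - j) - real (m - j) = real n - real m" "real (n - j) = real n - real j"
      using j assms(1) by (simp_all add: of_nat_diff)
    ultimately show ?thesis
      unfolding vv_def en[OF assms(2)] using minus_one_power_diff[of j n] j assms(1) by (simp add: mult_ac)
  qed
  hence "(\<Sum>j\<le>m. B n j * vv l (n - j)) = kp_row l * (-1) ^ n * \<xi>r l (real n - real m) (n - m) * (\<Sum>j\<le>m. (-1) ^ j * B n j * en n l j)"
    unfolding sum_distrib_left by (intro sum.cong) auto
  thus ?thesis unfolding I_del_q[OF assms(2)] relation[OF assms(2)] min.absorb2[OF assms(1)] by simp
qed

lemma L_q:
  "L (q n * g) = (\<Sum>j\<le>min n m. B n j * L (hp (n - j) * g))"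
proof -
  have "q n * g = (\<Sum>j\<le>m. smult (B n j) (hahn a b (real N) (int n - int j) * g))"
    unfolding q_poly_sum sum_distrib_right by simp
  also have "\<dots> = (\<Sum>j\<le>min n m. smult (B n j) (hahn a b (real N) (int n - int j) * g))"
    by (rule sum.mono_neutral_right) (auto simp: hahn_def)
  also have "\<dots> = (\<Sum>j\<le>min n m. smult (B n j) (hp (n - j) * g))"
    by (intro sum.cong) (auto simp: of_nat_diff)
  finally have e: "q n * g = (\<Sum>j\<le>min n m. smult (B n j) (hp (n - j) * g))" .
  have "L 0 = 0" using L_smult[of 0 0] by simp
  hence "L (\<Sum>i\<in>A. smult (k i) (f i)) = (\<Sum>i\<in>A. k i * L (f i))" for A k and f :: "nat \<Rightarrow> real poly"
    by (induction A rule: infinite_finite_induct) (auto simp: L_add L_smult)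
  thus ?thesis unfolding e .
qed

abbreviation "top_functional n \<equiv> \<exists>C. C \<noteq> 0 \<and> (\<forall>f. degree f \<le> n \<longrightarrow> I (q n * f) = C * coeff f n)"

text \<open>Divide \<open>f\<close> by the product of the nodes. The remainder has degree below
  \<open>m\<close> and contributes nothing; the quotient is integrated by the Hahn functional, where
  only the term \<open>j = m\<close>, the Hahn polynomial of index \<open>n - m\<close>, is
  seen.\<close>

lemma functional_large:
  assumes n: "m \<le> n" "n \<le> N + cnt 3 + cnt 4" and nice: "nice (Suc n)"
  shows "top_functional n"
proof -
  define \<Lambda> where "\<Lambda> = L (hp (n - m) * pochhammer [:a + 1, 1:] (n - m))"
  have nN: "n - m \<le> N" using n counts by linarith
  have "\<Lambda> \<noteq> 0" unfolding \<Lambda>_def by (rule L_hahn(3)[OF nN])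
  have "\<xi>r l (real n - real m + 1) 1 \<noteq> 0" if l: "l < m" for l
  proof -
    have e: "real n - real m = real (n - m)" using n by (simp add: of_nat_diff)
    have z: "real (n - m) + a + 1 \<noteq> 0" "real (n - m) + b + 1 \<noteq> 0" "real (n - m) + a + b + real N + 2 \<noteq> 0"
      using nz_a[of "n - m"] nz_b[of "n - m"] nz_abN[of "n - m"] by (simp_all add: add_ac del: of_nat_diff)
    \<comment> \<open>A row of type 1 or 2 makes the bound on \<open>n\<close> strict:
      \<open>n - m < N\<close>.\<close>
    have "real (n - m) - real N \<noteq> 0" if "rtyp l \<in> {1, 2}"
    proof -
      have "rtyp l = 1 \<Longrightarrow> cnt 1 > 0" "rtyp l = 2 \<Longrightarrow> cnt 2 > 0" using l unfolding cnt_def by (auto simp: card_gt_0_iff)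
      hence "cnt 1 + cnt 2 > 0" using that by auto
      hence "n - m < N" using n counts by linarith
      thus ?thesis by (simp del: of_nat_diff)
    qed
    thus ?thesis unfolding e using z rtyp_range[OF l] by (auto simp: \<xi>_def \<xi>_num_def \<xi>_den_def simp del: of_nat_diff)
  qed
  hence Bm: "B n m \<noteq> 0" using nice unfolding bminor_last nice_def by simp
  let ?P = "node_poly m xr"
  note P = node_poly[of m xr]
  have P0: "?P \<noteq> 0" using P(2) by auto
  have "I (q n * f) = C0 * B n m * \<Lambda> * coeff f n" if f: "degree f \<le> n" for f
  proof -
    define g r where "g = f div ?P" and "r = f mod ?P"
    have fe: "f = ?P * g + r" by (simp add: g_def r_def)
    have r: "r = 0 \<or> degree r < m" using degree_mod_less[OF P0, of f] P(1) by (simp add: r_def)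
    have g: "degree g \<le> n - m"
    proof (cases "g = 0")
      case False
      hence d: "degree (?P * g) = m + degree g" using P0 P(1) by (simp add: degree_mult_eq)
      have "degree (?P * g) = degree (f - r)" unfolding fe by simp
      also have "\<dots> \<le> n" using f r n(1) by (intro degree_diff_le) auto
      finally show ?thesis using d by simp
    qed simp
    have "coeff (?P * g) (m + (n - m)) = coeff ?P m * coeff g (n - m)" using g P(1) by (intro coeff_mult_top) auto
    hence cf: "coeff f n = coeff g (n - m)"
      using r n(1) P by (subst fe) (auto simp: coeff_eq_0)
    have "I (q n * r) = 0"
    proof (cases "r = 0")
      case True
      thus ?thesis using I_smult[of 0 0] by simp
    next
      case False
      thus ?thesis using r I_q_small[of r n] I_del_large[OF n(1)] by simp
    qed
    moreover have "q n * f = ?P * (q n * g) + q n * r" by (subst fe) (simp add: algebra_simps)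
    ultimately have "I (q n * f) = C0 * L (q n * g)"
      using I_add I_node_poly[unfolded xr_eta] by simp
    also have "L (q n * g) = (\<Sum>j\<in>{m}. B n j * L (hp (n - j) * g))"
      unfolding L_q
    proof (rule sum.mono_neutral_right)
      show "\<forall>j\<in>{..min n m} - {m}. B n j * L (hp (n - j) * g) = 0"
      proof
        fix j assume "j \<in> {..min n m} - {m}"
        hence "degree g < n - j" using g n(1) by auto
        thus "B n j * L (hp (n - j) * g) = 0" by (simp only: L_hahn(1) mult_zero_right)
      qed
    qed (use n(1) in auto)
    also have "\<dots> = B n m * (coeff g (n - m) * \<Lambda>)" using L_hahn(2)[OF nN g] by (simp add: \<Lambda>_def)
    finally show ?thesis unfolding cf by simp
  qed
  thus ?thesis using C(1) Bm \<open>\<Lambda> \<noteq> 0\<close> by (intro exI[of _ "C0 * B n m * \<Lambda>"]) simp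
qed

abbreviation "cas n \<equiv> mat m m (\<lambda>(i, j). en n i (Suc j))"

lemma casorati_det: "\<Omega>n n = Determinant.det (cas n)"
  unfolding \<Omega>_casorati by (rule arg_cong[where f = Determinant.det], rule eq_matI) (auto simp: casorati_index casorati_def mat1_def)

text \<open>For \<open>b = k\<close> the numerators of \<open>\<xi>\<close> in rows of types 2 and 4
  vanish in all columns left of column \<open>n + k\<close>, counted from 0. By \<open>b_int\<close>
  the remaining columns are fewer than those rows, so \<open>\<Omega>\<close> would be 0 at
  \<open>n\<close>.\<close>

lemma b_condition:
  assumes nice: "nice n" and n: "1 \<le> n" "n \<le> m" and k: "k < m - n"
  shows "b \<noteq> real k"
proof
  assume b: "b = real k"
  let ?R = "{l. l < m \<and> rtyp l \<in> {2, 4}}" and ?C = "{j. n + k \<le> j \<and> j < m}"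
  have "{l. l < m \<and> row_t U (Suc l) \<in> {1, 3}} = {l. l < m \<and> (rtyp l = 1 \<or> rtyp l = 3)}" by (auto simp: rtyp_def)
  hence "cnt 1 + cnt 3 \<le> k" using b_int[OF b] card_union_types[of 1 3] by simp
  moreover have "card ?R = cnt 2 + cnt 4" using card_union_types[of 2 4] by (simp add: disj_commute)
  moreover have "?C = {n + k..<m}" by auto
  hence "card ?C = m - (n + k)" by simp
  ultimately have "card ?C < card ?R" using counts n k by linarith
  hence "Determinant.det (cas n) = 0"
  proof (rule det_zero_block[rotated 3])
    fix i j assume i: "i \<in> ?R" and j: "j < m" "j \<notin> ?C"
    have "real n - real (Suc j) - real (m - Suc j) + b + 1 = - real (m - n - Suc k)"
      using j k b by (simp add: of_nat_diff)
    moreover have "pochhammer (- real (m - n - Suc k)) (m - Suc j) = 0" using j k n by (subst pochhammer_of_nat_eq_0_iff) auto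
    ultimately have "\<xi> a b (real N) (rtyp i) (real n - real (Suc j)) (m - Suc j) = 0"
      using i by (auto simp: \<xi>_def \<xi>_num_def)
    thus "cas n $$ (i, j) = 0" using i j(1) by (simp add: entry_def rtyp_def)
  qed auto
  thus False using nice by (simp add: nice_def casorati_det)
qed

text \<open>The part of the window below index 0; it is common to the columns
  \<open>j \<le> n\<close> of row \<open>l\<close>.\<close>

definition \<xi>0 :: "nat \<Rightarrow> nat \<Rightarrow> real" where "\<xi>0 n l = \<xi>r l 0 (m - n)"

text \<open>Up to \<open>\<xi>0\<close> and the constants \<open>kap\<close>, the columns with
  nonnegative index hold the integrals \<open>vv\<close>, and the \<open>k\<close>-th column beyond
  holds a polynomial of degree at most \<open>k\<close> in the node, by
  \<open>negative_values\<close>.\<close>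

lemma columns:
  assumes nice: "nice n" and n: "1 \<le> n" "n \<le> m"
  shows "l < m \<Longrightarrow> \<xi>0 n l \<noteq> 0"
    and "l < m \<Longrightarrow> j \<le> n \<Longrightarrow> kp_row l * en n l j = \<xi>0 n l * ((-1) ^ (n - j) * vv l (n - j))"
    and "\<exists>f. \<forall>k<m - n. degree (f k) \<le> k \<and> (\<forall>l<m. kp_row l * en n l (n + Suc k) = \<xi>0 n l * poly (f k) (xr l))"
      (is "\<exists>f. \<forall>k<m - n. ?P f k")
proof -
  have den: "\<xi>_den a b (real N) (rtyp l) 0 k \<noteq> 0" if l: "l < m" and k: "k \<le> m - n" for l k
  proof -
    have "Suc l \<in> {1..m}" "n \<in> {1..m}" using l n by auto
    hence "\<xi>_den a b (real N) (rtyp l) (real n - real n) (m - n) \<noteq> 0"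
      using nice unfolding nice_def \<Omega>_defined_def rtyp_def by blast
    moreover have "k + (m - n - k) = m - n" using k by simp
    ultimately show ?thesis using \<xi>_den_add[of a b "real N" "rtyp l" 0 k "m - n - k"] by (intro notI) simp
  qed
  have bk: "pochhammer (b - real k) (Suc k) \<noteq> 0" if "k < m - n" for k
  proof
    assume "pochhammer (b - real k) (Suc k) = 0"
    then obtain i where "i < Suc k" "b - real k = - real i" by (auto simp: pochhammer_eq_0_iff)
    hence "b = real (k - i)" "k - i < m - n" using that by (auto simp: of_nat_diff)
    thus False using b_condition[OF nice n] by blast
  qed
  show "\<xi>0 n l \<noteq> 0" if l: "l < m"
  proof (cases "m - n")
    case (Suc k)
    have 1: "pochhammer (- real (Suc k) - real N) (Suc k) \<noteq> 0" by (auto simp: pochhammer_eq_0_iff)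
    have 2: "pochhammer (- real (Suc k) + b + 1) (Suc k) \<noteq> 0" using bk[of k] Suc by (simp add: algebra_simps)
    show ?thesis using den[OF l order_refl] 1 2 rtyp_range[OF l] unfolding \<xi>0_def Suc \<xi>_def
      by (auto simp: \<xi>_num_def simp del: of_nat_Suc)
  qed (simp add: \<xi>0_def)
  show "kp_row l * en n l j = \<xi>0 n l * ((-1) ^ (n - j) * vv l (n - j))" if l: "l < m" and j: "j \<le> n" for l j
  proof -
    have "m - j = (n - j) + (m - n)" using j n by simp
    hence "\<xi>r l (real n - real j) (m - j) = \<xi>r l (real (n - j)) (n - j) * \<xi>0 n l"
      using \<xi>_add[of a b "real N" "rtyp l" "real (n - j)" "n - j" "m - n"] j by (simp add: \<xi>0_def of_nat_diff)
    thus ?thesis unfolding en[OF l] vv_def using j by (simp add: left_minus_one_mult_self mult_ac) (simp add: of_nat_diff)?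
  qed
  have "\<exists>p. degree p \<le> k \<and> (\<forall>l<m. kp_row l * en n l (n + Suc k) = \<xi>0 n l * poly p (xr l))" if k: "k < m - n" for k
  proof -
    obtain p where p: "degree p \<le> k" "\<And>t u. t \<in> {1, 2, 3, 4} \<Longrightarrow> \<xi>_den a b (real N) t 0 (Suc k) \<noteq> 0 \<Longrightarrow>
      pochhammer (- (a + b + real N)) u \<noteq> 0 \<or> t \<in> {3, 4} \<Longrightarrow> kap t u * dual t u (- real (Suc k)) = \<xi> a b (real N) t 0 (Suc k) * poly p (root t u)"
      using negative_values[OF bk[OF k]] by blast
    have "kp_row l * en n l (n + Suc k) = \<xi>0 n l * poly p (xr l)" if l: "l < m" for l
    proof -
      have e: "real n - real (n + Suc k) = - real (Suc k)" by simp
      have x: "\<xi>0 n l = \<xi>r l 0 (Suc k) * \<xi>r l (- real (Suc k)) (m - (n + Suc k))"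
      proof -
        have "Suc k + (m - (n + Suc k)) = m - n" "0 - real (Suc k) = - real (Suc k)" using k by simp_all
        thus ?thesis using \<xi>_add[of a b "real N" "rtyp l" 0 "Suc k" "m - (n + Suc k)"] by (simp only: \<xi>0_def)
      qed
      have "kp_row l * dual (rtyp l) (uu l) (- real (Suc k)) = \<xi>r l 0 (Suc k) * poly p (xr l)"
        using p(2)[OF rtyp_range[OF l] den[OF l], of "uu l"] k K_nonzero[OF l] rtyp_range[OF l] by (auto simp: rtyp_def)
      from arg_cong[OF this, of "\<lambda>z. z * \<xi>r l (- real (Suc k)) (m - (n + Suc k))"]
      show ?thesis unfolding en[OF l] unfolding e x by (simp only: mult_ac)
    qed
    thus ?thesis using p(1) by blast
  qed
  hence "\<forall>k. \<exists>p. k < m - n \<longrightarrow> degree p \<le> k \<and> (\<forall>l<m. kp_row l * en n l (n + Suc k) = \<xi>0 n l * poly p (xr l))" by blast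
  thus "\<exists>f. \<forall>k<m - n. ?P f k" by (rule choice[THEN exE]) blast
qed

text \<open>Otherwise the m - n polynomials of the negative columns would all have degree below m -
  n - 1. They would be linearly dependent, and so would be columns of \<open>\<Omega>\<close> at
  \<open>n\<close>.\<close>

lemma top_coeff_nonzero:
  assumes nice: "nice n" and n: "1 \<le> n" "n < m"
    and f: "\<And>k. k < m - n \<Longrightarrow> degree (f k) \<le> k"
      "\<And>k l. k < m - n \<Longrightarrow> l < m \<Longrightarrow> kp_row l * en n l (n + Suc k) = \<xi>0 n l * poly (f k) (xr l)"
  shows "coeff (f (m - n - 1)) (m - n - 1) \<noteq> 0"
proof
  let ?d = "m - n"
  assume z: "coeff (f (?d - 1)) (?d - 1) = 0"
  let ?A = "mat ?d ?d (\<lambda>(s, k). coeff (f k) s)"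
  have "Determinant.det ?A = 0"
  proof (rule det_zero_row_comb[where v = "\<lambda>s. if s = ?d - 1 then 1 else 0" and j = "?d - 1" and n = ?d])
    fix k assume k: "k < ?d"
    have "coeff (f k) (?d - 1) = 0"
      using z f(1)[OF k] k by (cases "k = ?d - 1") (auto intro!: coeff_eq_0)
    moreover have "(\<Sum>i<?d. (if i = ?d - 1 then 1 else 0) * ?A $$ (i, k)) = ?A $$ (?d - 1, k)"
      using n by (simp add: if_distrib[of "\<lambda>x. x * _"] cong: if_cong)
    ultimately show "(\<Sum>i<?d. (if i = ?d - 1 then 1 else 0) * ?A $$ (i, k)) = 0" using k n by simp
  qed (use n in auto)
  then obtain y j where y: "j < ?d" "y j \<noteq> 0" "\<And>s. s < ?d \<Longrightarrow> (\<Sum>k<?d. ?A $$ (s, k) * y k) = 0"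
    using det_zero_iff_comb[of ?A ?d] by auto
  have "(\<Sum>k<?d. smult (y k) (f k)) = 0"
  proof (rule poly_eqI)
    fix s
    show "coeff (\<Sum>k<?d. smult (y k) (f k)) s = coeff 0 s"
    proof (cases "s < ?d")
      case True
      thus ?thesis using y(3)[OF True] by (simp add: coeff_sum mult.commute)
    next
      case False
      hence "coeff (f k) s = 0" if "k < ?d" for k using f(1)[OF that] that by (intro coeff_eq_0) simp
      thus ?thesis by (simp add: coeff_sum)
    qed
  qed
  hence "poly (\<Sum>k<?d. smult (y k) (f k)) x = 0" for x by simp
  hence comb: "(\<Sum>k<?d. y k * poly (f k) x) = 0" for x by (simp add: poly_sum)
  have "Determinant.det (cas n) = 0"
  proof (subst det_zero_iff_comb[of _ m], simp, intro exI[of _ "\<lambda>j. if j < n then 0 else y (j - n)"] conjI allI impI)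
    show "\<exists>j<m. (if j < n then 0 else y (j - n)) \<noteq> 0"
      using y(1,2) by (intro exI[of _ "n + j"]) auto
    fix i assume i: "i < m"
    let ?S = "\<Sum>j<m. cas n $$ (i, j) * (if j < n then 0 else y (j - n))"
    have "?S = (\<Sum>j\<in>{n..<m}. en n i (Suc j) * y (j - n))"
      using i by (intro sum.mono_neutral_cong_right) auto
    also have "\<dots> = (\<Sum>k<?d. en n i (n + Suc k) * y k)"
      by (rule sum.reindex_bij_witness[of _ "\<lambda>k. n + k" "\<lambda>j. j - n"]) auto
    finally have e: "?S = (\<Sum>k<?d. en n i (n + Suc k) * y k)" .
    have "kp_row i * (\<Sum>k<?d. en n i (n + Suc k) * y k) = (\<Sum>k<?d. (kp_row i * en n i (n + Suc k)) * y k)"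
      by (simp only: sum_distrib_left mult.assoc)
    also have "\<dots> = (\<Sum>k<?d. \<xi>0 n i * (y k * poly (f k) (xr i)))"
      by (rule sum.cong[OF refl]) (simp only: f(2)[OF _ i] lessThan_iff, simp only: mult_ac)
    also have "\<dots> = 0" unfolding sum_distrib_left[symmetric] comb by simp
    finally show "?S = 0"
      unfolding e using kap_nonzero[OF i] by (simp add: rtyp_def)
  qed
  thus False using nice by (simp add: nice_def casorati_det)
qed

text \<open>The relation between the columns trades the integrals with index
  \<open>j \<le> n\<close> for the polynomials \<open>F k\<close> at the nodes. By
  \<open>lagrange_coeff\<close> the integral against \<open>f\<close> then consists of coefficients
  of x^(m-1) in \<open>f * F k\<close>; for degree at most \<open>n\<close> only k = m - n - 1
  reaches it, and only through the coefficient of x^n in \<open>f\<close>.\<close>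

lemma functional_small:
  assumes n: "1 \<le> n" "n < m" and nice: "nice n" "nice (Suc n)"
  shows "top_functional n"
proof -
  let ?d = "m - n"
  have nm: "n \<le> m" using n by simp
  note col = columns[OF nice(1) n(1) nm]
  obtain F where F: "\<And>k. k < ?d \<Longrightarrow> degree (F k) \<le> k"
    "\<And>k l. k < ?d \<Longrightarrow> l < m \<Longrightarrow> kp_row l * en n l (n + Suc k) = \<xi>0 n l * poly (F k) (xr l)"
    using col(3) by blast
  have top: "coeff (F (?d - 1)) (?d - 1) \<noteq> 0" by (rule top_coeff_nonzero[OF nice(1) n F])
  have Idel: "I (q n * node_del m xr l) = C1 * (\<Sum>k<?d. (-1) ^ k * B n (n + Suc k) * poly (F k) (xr l))" if l: "l < m" for l
  proof -
    let ?t = "\<lambda>j. (-1) ^ j * B n j * (kp_row l * en n l j)"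
    have "0 = kp_row l * (\<Sum>j\<le>m. (-1) ^ j * B n j * en n l j)" unfolding relation[OF l] by simp
    also have "\<dots> = (\<Sum>j\<le>m. ?t j)"
      by (simp only: sum_distrib_left mult_ac)
    also have "{..m} = {..n} \<union> {Suc n..m}" using nm by auto
    also have "(\<Sum>j\<in>{..n} \<union> {Suc n..m}. ?t j) =
       (\<Sum>j\<le>n. ?t j) + (\<Sum>j\<in>{Suc n..m}. ?t j)"
      by (rule sum.union_disjoint) auto
    also have "(\<Sum>j\<le>n. ?t j) = (\<Sum>j\<le>n. \<xi>0 n l * (-1) ^ n * (B n j * vv l (n - j)))"
    proof (rule sum.cong[OF refl], goal_cases)
      case (1 j)
      hence j: "j \<le> n" by simp
      show ?case
        unfolding col(2)[OF l j] minus_one_power_diff[OF j] using left_minus_one_mult_self[of j "\<xi>0 n l * (-1) ^ n * (B n j * vv l (n - j))"] by (simp add: mult_ac)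
    qed
    also have "(\<Sum>j\<in>{Suc n..m}. ?t j) = (\<Sum>k<?d. (-1) ^ (n + Suc k) * B n (n + Suc k) * (kp_row l * en n l (n + Suc k)))"
      by (rule sum.reindex_bij_witness[of _ "\<lambda>k. n + Suc k" "\<lambda>j. j - Suc n"]) auto
    also have "\<dots> = (\<Sum>k<?d. - (\<xi>0 n l * (-1) ^ n * ((-1) ^ k * B n (n + Suc k) * poly (F k) (xr l))))"
    proof (rule sum.cong[OF refl], goal_cases)
      case (1 k)
      hence k: "k < ?d" by simp
      show ?case
        unfolding F(2)[OF k l] by (simp add: power_add mult_ac)
    qed
    finally have "\<xi>0 n l * (-1) ^ n * ((\<Sum>j\<le>n. B n j * vv l (n - j)) - (\<Sum>k<?d. (-1) ^ k * B n (n + Suc k) * poly (F k) (xr l))) = 0"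
      unfolding sum_negf sum_distrib_left[symmetric] diff_conv_add_uminus distrib_left mult_minus_right by (rule sym)
    hence "(\<Sum>j\<le>n. B n j * vv l (n - j)) = (\<Sum>k<?d. (-1) ^ k * B n (n + Suc k) * poly (F k) (xr l))"
      using col(1)[OF l] by simp
    thus ?thesis unfolding I_del_q[OF l] using nm by (simp add: min_def)
  qed
  have Bm: "B n m \<noteq> 0"
  proof -
    have "\<xi>r l (real n - real m + 1) 1 \<noteq> 0" if l: "l < m" for l
    proof
      assume z: "\<xi>r l (real n - real m + 1) 1 = 0"
      have "\<xi>0 n l = \<xi>r l 0 (?d - 1) * \<xi>r l (0 - real (?d - 1)) 1"
      proof -
        have "(?d - 1) + 1 = ?d" using n by simp
        thus ?thesis using \<xi>_add[of a b "real N" "rtyp l" 0 "?d - 1" 1] by (simp only: \<xi>0_def)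
      qed
      moreover have e: "0 - real (?d - 1) = real n - real m + 1" using n by (simp add: of_nat_diff)
      ultimately have "\<xi>0 n l = 0" unfolding e z by simp
      thus False using col(1)[OF l] by simp
    qed
    thus ?thesis using nice(2) unfolding bminor_last nice_def by simp
  qed
  define C' where "C' = C1 * ((-1) ^ (?d - 1) * B n m * coeff (F (?d - 1)) (?d - 1))"
  have "I (q n * f) = C' * coeff f n" if f: "degree f \<le> n" for f
  proof -
    let ?w = "\<lambda>i. poly (node_del m xr i) (xr i)"
    have "I (q n * f) = (\<Sum>i<m. poly f (xr i) / ?w i * I (q n * node_del m xr i))" using f n by (intro I_q_small) simp
    also have "\<dots> = (\<Sum>i<m. \<Sum>k<?d. C1 * ((-1) ^ k * B n (n + Suc k)) * (poly (f * F k) (xr i) / ?w i))"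
      by (rule sum.cong[OF refl]) (simp add: Idel sum_distrib_left sum_divide_distrib mult_ac)
    also have "\<dots> = (\<Sum>k<?d. C1 * ((-1) ^ k * B n (n + Suc k)) * (\<Sum>i<m. poly (f * F k) (xr i) / ?w i))"
      unfolding sum_distrib_left by (rule sum.swap)
    also have "\<dots> = (\<Sum>k<?d. C1 * ((-1) ^ k * B n (n + Suc k)) * coeff (f * F k) (m - 1))"
    proof (rule sum.cong[OF refl], goal_cases)
      case (1 k)
      hence k: "k < ?d" by simp
      have "degree (f * F k) < m" using degree_mult_le[of f "F k"] F(1)[OF k] f k by linarith
      thus ?case
        using lagrange_coeff[OF x_inj, of "f * F k"] by simp
    qed
    also have "\<dots> = (\<Sum>k\<in>{?d - 1}. C1 * ((-1) ^ k * B n (n + Suc k)) * coeff (f * F k) (m - 1))"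
    proof (rule sum.mono_neutral_right)
      show "\<forall>k\<in>{..<?d} - {?d - 1}. C1 * ((-1) ^ k * B n (n + Suc k)) * coeff (f * F k) (m - 1) = 0"
      proof
        fix k assume k: "k \<in> {..<?d} - {?d - 1}"
        have "degree (f * F k) < m - 1" using degree_mult_le[of f "F k"] F(1)[of k] f k n by auto
        thus "C1 * ((-1) ^ k * B n (n + Suc k)) * coeff (f * F k) (m - 1) = 0" by (simp add: coeff_eq_0)
      qed
    qed (use n in auto)
    also have "\<dots> = C' * coeff f n"
    proof -
      have "coeff (f * F (?d - 1)) (n + (?d - 1)) = coeff f n * coeff (F (?d - 1)) (?d - 1)"
        using f F(1)[of "?d - 1"] n by (intro coeff_mult_top) auto
      moreover have "n + (?d - 1) = m - 1" "n + Suc (?d - 1) = m" using n by auto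
      ultimately show ?thesis by (simp add: C'_def)
    qed
    finally show ?thesis .
  qed
  moreover have "C' \<noteq> 0" using C(2) Bm top by (simp add: C'_def)
  ultimately show ?thesis by blast
qed

lemma functional_zero:
  assumes m: "0 < m" and nice: "nice 0" "nice 1"
  shows "top_functional 0"
proof -
  have m1: "1 \<le> m" using m by simp
  note col = columns[OF nice(2) order_refl m1]
  obtain F where F: "\<And>k. k < m - 1 \<Longrightarrow> degree (F k) \<le> k"
    "\<And>k l. k < m - 1 \<Longrightarrow> l < m \<Longrightarrow> kp_row l * en 1 l (1 + Suc k) = \<xi>0 1 l * poly (F k) (xr l)"
    using col(3) by blast
  let ?w = "\<lambda>i. poly (node_del m xr i) (xr i)"
  have w: "?w i \<noteq> 0" if "i < m" for i using poly_node_del[OF x_inj that that] by simp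
  have h0: "hahn a b (real N) (int 0) = 1" by (simp add: hahn_def)
  have I1: "I 1 = (\<Sum>i<m. 1 / ?w i * (C1 * vv i 0))"
  proof -
    have "1 = (\<Sum>i<m. smult (1 / ?w i) (node_del m xr i))" using lagrange[OF x_inj, of 1] m by simp
    hence "I 1 = I (\<Sum>i<m. smult (1 / ?w i) (node_del m xr i))" by (rule arg_cong)
    also have "\<dots> = (\<Sum>i<m. 1 / ?w i * I (node_del m xr i))" by (rule I_sum)
    also have "\<dots> = (\<Sum>i<m. 1 / ?w i * (C1 * vv i 0))"
      using I_node_del[of _ 0, unfolded xr_eta h0] by (intro sum.cong refl) (simp add: vv_def rtyp_def)
    finally show ?thesis .
  qed
  have "I 1 \<noteq> 0"
  proof
    assume z: "I 1 = 0"
    \<comment> \<open>Lagrange weights, corrected by the row factors: with them the column of index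
      0 sums to a multiple of the total mass, and the others to coefficients of x^(m-1) of
      polynomials of lower degree.\<close>
    let ?v = "\<lambda>i. kp_row i / (\<xi>0 1 i * ?w i)"
    have "Determinant.det (cas 1) = 0"
    proof (rule det_zero_row_comb[where v = ?v and j = 0])
      show "?v 0 \<noteq> 0" using col(1)[OF m] w[OF m] kap_nonzero[OF m] by (simp add: rtyp_def)
      fix k assume k: "k < m"
      have "(\<Sum>i<m. ?v i * cas 1 $$ (i, k)) = (\<Sum>i<m. (kp_row i * en 1 i (Suc k)) / (\<xi>0 1 i * ?w i))"
        using k by (intro sum.cong) auto
      also have "\<dots> = 0"
      proof (cases k)
        case 0
        have "(\<Sum>i<m. (kp_row i * en 1 i (Suc k)) / (\<xi>0 1 i * ?w i)) = (\<Sum>i<m. vv i 0 / ?w i)"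
          using col(2)[of _ 1] col(1) 0 by (intro sum.cong refl) simp
        also have "C1 * \<dots> = 0" using z unfolding I1 by (simp add: sum_distrib_left)
        finally show ?thesis using C(2) by simp
      next
        case (Suc s)
        hence s: "s < m - 1" using k by simp
        have "(\<Sum>i<m. (kp_row i * en 1 i (Suc k)) / (\<xi>0 1 i * ?w i)) = (\<Sum>i<m. poly (F s) (xr i) / ?w i)"
        proof (rule sum.cong[OF refl], goal_cases)
          case (1 i)
          hence i: "i < m" by simp
          have "kp_row i * en 1 i (Suc k) = \<xi>0 1 i * poly (F s) (xr i)" using F(2)[OF s i] Suc by simp
          thus ?case using col(1)[OF i] by simp
        qed
        also have "\<dots> = coeff (F s) (m - 1)" using F(1)[OF s] s by (intro lagrange_coeff[OF x_inj]) simp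
        also have "\<dots> = 0" using F(1)[OF s] s by (intro coeff_eq_0) simp
        finally show ?thesis .
      qed
      finally show "(\<Sum>i<m. ?v i * cas 1 $$ (i, k)) = 0" .
    qed (use m in auto)
    thus False using nice(2) unfolding nice_def casorati_det by simp
  qed
  have q0: "q 0 = [:coeff (q 0) 0:]" "coeff (q 0) 0 \<noteq> 0"
    using degree_q[OF nice(1)] by (auto elim: degree_eq_zeroE)
  have "I (q 0 * f) = coeff (q 0) 0 * I 1 * coeff f 0" if "degree f \<le> 0" for f
  proof -
    obtain k where f: "f = [:k:]" using \<open>degree f \<le> 0\<close> by (auto elim: degree_eq_zeroE)
    have "q 0 * f = smult (coeff (q 0) 0 * k) 1" by (subst q0(1)) (simp add: f)
    thus ?thesis unfolding f by (simp only: I_smult) simp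
  qed
  thus ?thesis using q0(2) \<open>I 1 \<noteq> 0\<close> by (intro exI[of _ "coeff (q 0) 0 * I 1"]) simp
qed

theorem orthogonality:
  assumes nice: "\<And>n. n \<le> N + cnt 3 + cnt 4 + 1 \<Longrightarrow> nice n"
    and n: "n \<le> N + cnt 3 + cnt 4"
  shows "degree (q n) = n" "degree f < n \<Longrightarrow> I (q n * f) = 0" "I (q n * q n) \<noteq> 0"
proof -
  have nn: "nice n" "nice (Suc n)" using nice n by auto
  show d: "degree (q n) = n" by (rule degree_q(1)[OF nn(1)])
  have "top_functional n"
  proof (cases "m \<le> n")
    case True
    thus ?thesis using functional_large[OF _ n nn(2)] by blast
  next
    case False
    thus ?thesis using functional_small[of n] functional_zero nn by (cases n) auto
  qed
  then obtain C where "C \<noteq> 0" "\<And>f. degree f \<le> n \<Longrightarrow> I (q n * f) = C * coeff f n" by blast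
  thus "degree f < n \<Longrightarrow> I (q n * f) = 0" "I (q n * q n) \<noteq> 0"
    using degree_q(2)[OF nn(1)] d by (auto simp: coeff_eq_0)
qed

end

section \<open>The transformed Hahn weight\<close>

lemma rows_facts:
  assumes "\<forall>t\<in>{1, 2, 3, 4}. finite (U t)"
  shows "length (rows U) = size_U U" "distinct (rows U)" "set (rows U) = (SIGMA t:{1, 2, 3, 4}. U t)"
proof -
  show "length (rows U) = size_U U" using assms
    unfolding size_U_def sum_1_to_4 by (simp add: rows_def length_concat)
  show "set (rows U) = (SIGMA t:{1, 2, 3, 4}. U t)" using assms by (auto simp: rows_def)
  show "distinct (rows U)" using assms by (auto simp: rows_def distinct_map inj_on_def)
qed

lemma row_nth: "rows U ! l = (row_t U (Suc l), row_u U (Suc l))"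
  by (simp add: row_t_def row_u_def)

lemma rows_bij:
  assumes "\<forall>t\<in>{1, 2, 3, 4}. finite (U t)"
  shows "bij_betw (\<lambda>l. (row_t U (Suc l), row_u U (Suc l))) {..<size_U U} (SIGMA t:{1, 2, 3, 4}. U t)"
  unfolding row_nth[symmetric] rows_facts(3)[OF assms, symmetric]
  by (rule bij_betw_nth) (simp_all add: rows_facts[OF assms])

lemma fmax_ge: "- 1 \<le> fmax F" by (simp add: fmax_def)

lemma le_fmax: "finite F \<Longrightarrow> f \<in> F \<Longrightarrow> int f \<le> fmax F"
  by (auto simp: fmax_def)

text \<open>The removed numbers index the factors that \<open>F\<close> puts into the weight, the
  remaining ones the rows. Together they fill an initial segment, so their factors multiply to a
  pochhammer symbol.\<close>

lemma J_set_complement: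
  assumes "finite F" "0 \<notin> F" "1 \<le> h"
  shows "J_set h F = {..<nat (fmax F + int h)} - (\<lambda>f. f - 1) ` F" "(\<lambda>f. f - 1) ` F \<subseteq> {..<nat (fmax F + int h)}"
    "inj_on (\<lambda>f. f - 1) F"
proof -
  have pos: "f \<in> F \<Longrightarrow> f \<ge> 1" for f using assms(2) by (cases f) auto
  show "inj_on (\<lambda>f. f - 1) F"
  proof (rule inj_onI)
    fix x y assume "x \<in> F" "y \<in> F" "x - 1 = y - 1"
    thus "x = y" using pos[of x] pos[of y] by linarith
  qed
  show "(\<lambda>f. f - 1) ` F \<subseteq> {..<nat (fmax F + int h)}"
  proof
    fix u assume "u \<in> (\<lambda>f. f - 1) ` F"
    then obtain f where f: "f \<in> F" "u = f - 1" by blast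
    thus "u \<in> {..<nat (fmax F + int h)}" using le_fmax[OF assms(1) f(1)] pos[OF f(1)] assms(3) by auto
  qed
  have "(\<exists>f. int u = int f - 1 \<and> f \<in> F) \<longleftrightarrow> u \<in> (\<lambda>f. f - 1) ` F" for u
  proof
    assume "\<exists>f. int u = int f - 1 \<and> f \<in> F"
    then obtain f where "int u = int f - 1" "f \<in> F" by blast
    thus "u \<in> (\<lambda>f. f - 1) ` F" by (intro image_eqI[of _ _ f]) auto
  next
    assume "u \<in> (\<lambda>f. f - 1) ` F"
    then obtain f where "f \<in> F" "u = f - 1" by blast
    thus "\<exists>f. int u = int f - 1 \<and> f \<in> F" using pos by (intro exI[of _ f]) (auto simp: of_nat_diff)
  qed
  moreover have "int u \<in> {0..fmax F + int h - 1} \<longleftrightarrow> u < nat (fmax F + int h)" for u by auto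
  ultimately show "J_set h F = {..<nat (fmax F + int h)} - (\<lambda>f. f - 1) ` F"
    unfolding J_set_def by (auto simp del: atLeastAtMost_iff)
qed

lemma I_set_complement:
  assumes "finite F" "0 \<notin> F"
  shows "I_set F = {..<nat (fmax F + 1)} - (\<lambda>f. nat (fmax F) - f) ` F" "(\<lambda>f. nat (fmax F) - f) ` F \<subseteq> {..<nat (fmax F + 1)}"
    "inj_on (\<lambda>f. nat (fmax F) - f) F"
proof -
  let ?r = "\<lambda>f. nat (fmax F) - f"
  have le: "f \<in> F \<Longrightarrow> f \<le> nat (fmax F) \<and> int (nat (fmax F)) = fmax F" for f using le_fmax[OF assms(1), of f] by simp
  show "inj_on (\<lambda>f. nat (fmax F) - f) F"
  proof (rule inj_onI)
    fix x y assume "x \<in> F" "y \<in> F" "nat (fmax F) - x = nat (fmax F) - y"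
    thus "x = y" using le[of x] le[of y] by linarith
  qed
  show "?r ` F \<subseteq> {..<nat (fmax F + 1)}"
  proof
    fix u assume "u \<in> ?r ` F"
    then obtain f where f: "f \<in> F" "u = nat (fmax F) - f" by blast
    have "nat (fmax F + 1) = Suc (nat (fmax F))" using le_fmax[OF assms(1) f(1)] by (simp add: nat_add_distrib)
    thus "u \<in> {..<nat (fmax F + 1)}" using f by simp
  qed
  have "(int u \<in> {1..fmax F} \<and> \<not> (\<exists>f. int u = fmax F - int f \<and> f \<in> F)) \<longleftrightarrow> u < nat (fmax F + 1) \<and> u \<notin> ?r ` F" for u
  proof (cases "F = {}")
    case True
    thus ?thesis by (simp add: fmax_def)
  next
    case False
    have M: "nat (fmax F) \<in> F" using False assms(1) by (simp add: fmax_def)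
    have "(\<exists>f. int u = fmax F - int f \<and> f \<in> F) \<longleftrightarrow> u \<in> ?r ` F"
    proof
      assume "\<exists>f. int u = fmax F - int f \<and> f \<in> F"
      then obtain f where f: "int u = fmax F - int f" "f \<in> F" by blast
      thus "u \<in> ?r ` F" using le[OF f(2)] by (intro image_eqI[of _ _ f]) auto
    next
      assume "u \<in> ?r ` F"
      then obtain f where f: "f \<in> F" "u = nat (fmax F) - f" by blast
      thus "\<exists>f. int u = fmax F - int f \<and> f \<in> F" using le[OF f(1)] by (intro exI[of _ f]) (simp add: of_nat_diff)
    qed
    \<comment> \<open>The number 0, missing from the segment that starts at 1, is also removed here,
      as the difference of the maximum with itself.\<close>
    moreover have "u = 0 \<Longrightarrow> u \<in> ?r ` F" using M by (intro image_eqI[of _ _ "nat (fmax F)"]) auto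
    ultimately show ?thesis by (cases "u = 0") auto
  qed
  thus "I_set F = {..<nat (fmax F + 1)} - ?r ` F"
    unfolding I_set_def by (auto simp del: atLeastAtMost_iff)
qed

lemma choose_two_diff: "n \<le> k \<Longrightarrow> int (k choose 2) - int ((k - n) choose 2) = int k * int n - int (n choose 2) - int n"
proof -
  assume n: "n \<le> k"
  have "2 * (int (k choose 2) - int ((k - n) choose 2)) = 2 * (int k * int n - int (n choose 2) - int n)"
    using int_choose_two[of k] int_choose_two[of "k - n"] int_choose_two[of n] n by (simp add: of_nat_diff algebra_simps)
  thus ?thesis by simp
qed

lemma sum_complement:
  assumes "A \<subseteq> {..<k}"
  shows "(\<Sum>u\<in>{..<k} - A. int u) - int (card ({..<k} - A) choose 2) = int k * int (card A) - int (card A choose 2) - int (card A) - (\<Sum>u\<in>A. int u)"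
proof -
  have f: "finite A" using assms finite_subset by blast
  have "card A \<le> k" using card_mono[OF _ assms] by simp
  have "(\<Sum>u<k. int u) = int (k choose 2)" using arg_cong[OF sum_nat_lessThan[of k], of int] by simp
  thus ?thesis using choose_two_diff[OF \<open>card A \<le> k\<close>] assms f
    by (simp add: sum_diff card_Diff_subset)
qed

section \<open>Rows, nodes and order belonging to a quartet\<close>

locale quartet =
  fixes N :: nat and F :: "nat \<Rightarrow> nat set" and h :: "nat \<Rightarrow> nat" and a b :: real
  assumes N1: "N \<ge> 1"
    and F: "\<forall>i\<in>{1..4}. finite (F i) \<and> 0 \<notin> F i"
    and h: "\<forall>i\<in>{1..3}. h i \<ge> 1"
    and a_ints: "a \<notin> ints_upto (fmax (F 2) + fmax (F 4) + int (h 2))"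
    and b_ints: "b \<notin> ints_upto (fmax (F 1) + fmax (F 3) + int (h 1) + int (h 3) - 1)"
    and ab_ints: "a + b \<notin> ints_upto ((\<Sum>i = 1..4. fmax (F i)) + (\<Sum>i = 1..3. int (h i)))"
    and a_pos: "F 2 \<noteq> {} \<or> F 4 \<noteq> {} \<longrightarrow> (\<forall>k::nat. k \<ge> 1 \<longrightarrow> a \<noteq> real k)"
    and b_pos: "F 1 \<noteq> {} \<or> F 3 \<noteq> {} \<longrightarrow> (\<forall>k::nat. k \<ge> 1 \<longrightarrow> b \<noteq> real k)"
begin

abbreviation "U \<equiv> U_sets F h"
abbreviation "fm t \<equiv> fmax (F t)"

text \<open>The length of the segment of type \<open>t\<close>. In these terms the parameters of the
  transformed weight are \<open>a - kk 2 - kk 4\<close>, \<open>b - kk 1 - kk 3\<close> and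
  \<open>N + kk 3 + kk 4\<close>.\<close>

definition kk :: "nat \<Rightarrow> nat" where "kk t = (if t = 4 then nat (fm 4 + 1) else nat (fm t + int (h t)))"

definition co :: "nat \<Rightarrow> nat set" where "co t = (if t = 4 then (\<lambda>f. nat (fm 4) - f) ` F 4 else (\<lambda>f. f - 1) ` F t)"

lemma types: "t \<in> {1, 2, 3, 4} \<Longrightarrow> t \<noteq> 4 \<Longrightarrow> t \<in> {1..3}" "t \<in> {1, 2, 3, 4} \<Longrightarrow> t \<in> {1..4 :: nat}" by auto

lemma U_co:
  assumes "t \<in> {1, 2, 3, 4}"
  shows "U t = {..<kk t} - co t" "co t \<subseteq> {..<kk t}" "card (co t) = card (F t)" "finite (U t)"
proof -
  have "finite (F t)" "0 \<notin> F t" using F types(2)[OF assms] by auto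
  note J = J_set_complement[OF this] and I = I_set_complement[OF this]
  have h1: "t \<noteq> 4 \<Longrightarrow> 1 \<le> h t" using h types(1)[OF assms] by auto
  show 1: "U t = {..<kk t} - co t" and "co t \<subseteq> {..<kk t}" "card (co t) = card (F t)"
    using J[OF h1] I by (cases "t = 4"; simp add: U_sets_def kk_def co_def card_image)+
  show "finite (U t)" unfolding 1 by simp
qed

lemma U_finite: "\<forall>t\<in>{1, 2, 3, 4}. finite (U t)"
  using U_co(4) by blast

lemma kk_int: "int (kk 4) = fm 4 + 1" "t \<in> {1..3} \<Longrightarrow> int (kk t) = fm t + int (h t)"
proof -
  show "int (kk 4) = fm 4 + 1" using fmax_ge[of "F 4"] by (simp add: kk_def)
  assume t: "t \<in> {1..3}"
  hence "1 \<le> h t" using h by blast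
  thus "int (kk t) = fm t + int (h t)" using fmax_ge[of "F t"] t by (auto simp: kk_def)
qed

lemma fm_bounds: "fm t \<ge> - 1" by (rule fmax_ge)

lemma ints_upto_D: "x \<notin> ints_upto k \<Longrightarrow> x = of_int j \<Longrightarrow> k < j"
  by (auto simp: ints_upto_def not_le[symmetric])

lemma a_int: "a = of_int j \<Longrightarrow> int (kk 2) + fm 4 < j"
  using ints_upto_D[OF a_ints] kk_int(2)[of 2] by fastforce

lemma b_int: "b = of_int j \<Longrightarrow> int (kk 1) + int (kk 3) - 1 < j"
  using ints_upto_D[OF b_ints] kk_int(2)[of 1] kk_int(2)[of 3] by fastforce

lemma ab_int: "a + b = of_int j \<Longrightarrow> int (kk 1) + int (kk 2) + int (kk 3) + fm 4 < j"
  using ints_upto_D[OF ab_ints, of j] kk_int(2)[of 1] kk_int(2)[of 2] kk_int(2)[of 3]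
  by (simp add: sum_1_to_4 numeral_3_eq_3 eval_nat_numeral)

lemma hahn_nat: "hahn_nat a b N"
proof -
  have 1: "a \<noteq> - 1 - real n" for n using a_int[of "- 1 - int n"] fm_bounds[of 4] by (intro notI) simp
  have 2: "b \<noteq> - 1 - real n" for n using b_int[of "- 1 - int n"] by (intro notI) simp
  have 3: "a + b \<noteq> - 1 - real n" for n using ab_int[of "- 1 - int n"] fm_bounds[of 4] by (intro notI) simp
  show ?thesis
  proof unfold_locales
    fix n
    show "pochhammer (a + 1) n \<noteq> 0" using 1 by (auto simp: pochhammer_eq_0_iff algebra_simps eq_neg_iff_add_eq_0)
    show "pochhammer (b + 1) n \<noteq> 0" using 2 by (auto simp: pochhammer_eq_0_iff algebra_simps eq_neg_iff_add_eq_0)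
    show "pochhammer (a + b + 1) n \<noteq> 0"
    proof
      assume "pochhammer (a + b + 1) n = 0"
      then obtain k where "a + b + 1 = - real k" by (auto simp: pochhammer_eq_0_iff)
      thus False using 3[of k] by simp
    qed
    show "pochhammer (a + b + real N + 2) n \<noteq> 0"
    proof
      assume "pochhammer (a + b + real N + 2) n = 0"
      then obtain k where "a + b + real N + 2 = - real k" by (auto simp: pochhammer_eq_0_iff)
      thus False using 3[of "k + N + 1"] by simp
    qed
  qed
qed

lemma casorati_rows: "casorati_rows U"
proof
  fix l assume l: "l < size_U U"
  have "(row_t U (Suc l), row_u U (Suc l)) \<in> (SIGMA t:{1, 2, 3, 4}. U t)"
    using bij_betwE[OF rows_bij[OF U_finite]] l by blast
  thus "row_t U (Suc l) \<in> {1, 2, 3, 4}" by blast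
qed

sublocale hahn_nat a b N by (rule hahn_nat)
sublocale casorati_rows a b "real N" U by (rule casorati_rows)

abbreviation "uw l \<equiv> row_u U (Suc l)"

lemma row_bij: "bij_betw (\<lambda>l. (rtyp l, uw l)) {..<m} (SIGMA t:{1, 2, 3, 4}. U t)"
  using rows_bij[OF U_finite] by (simp add: rtyp_def)

lemma uw_U: "l < m \<Longrightarrow> uw l \<in> U (rtyp l)"
  using bij_betwE[OF row_bij] by blast

lemma uw_less: "l < m \<Longrightarrow> uw l < kk (rtyp l)"
  using uw_U[of l] U_co(1)[OF rtyp_range] by auto

lemma row_eq: "l < m \<Longrightarrow> l' < m \<Longrightarrow> rtyp l = rtyp l' \<Longrightarrow> uw l = uw l' \<Longrightarrow> l = l'"
  using bij_betw_imp_inj_on[OF row_bij] by (auto simp: inj_on_def)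

lemma cnt_card: "t \<in> {1, 2, 3, 4} \<Longrightarrow> cnt t = card (U t)"
proof -
  assume t: "t \<in> {1, 2, 3, 4}"
  have "bij_betw uw {l. l < m \<and> rtyp l = t} (U t)"
  proof (rule bij_betwI')
    fix l l' assume "l \<in> {l. l < m \<and> rtyp l = t}" "l' \<in> {l. l < m \<and> rtyp l = t}"
    thus "uw l = uw l' \<longleftrightarrow> l = l'" using row_eq[of l l'] by auto
  next
    fix l assume "l \<in> {l. l < m \<and> rtyp l = t}"
    thus "uw l \<in> U t" using uw_U[of l] by auto
  next
    fix u assume "u \<in> U t"
    hence "(t, u) \<in> (\<lambda>l. (rtyp l, uw l)) ` {..<m}" using t bij_betw_imp_surj_on[OF row_bij] by auto
    thus "\<exists>l\<in>{l. l < m \<and> rtyp l = t}. u = uw l" by auto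
  qed
  from bij_betw_same_card[OF this] show ?thesis by (simp add: cnt_def)
qed

lemma nonpos_ab:
  "t \<in> {1, 3} \<Longrightarrow> k < kk t \<Longrightarrow> b - real k \<notin> \<int>\<^sub>\<le>\<^sub>0"
  "t \<in> {2, 4} \<Longrightarrow> k < kk t \<Longrightarrow> a - real k \<notin> \<int>\<^sub>\<le>\<^sub>0"
proof -
  show "b - real k \<notin> \<int>\<^sub>\<le>\<^sub>0" if "t \<in> {1, 3}" "k < kk t"
  proof
    assume "b - real k \<in> \<int>\<^sub>\<le>\<^sub>0"
    then obtain j where "b - real k = - real j" by (elim nonpos_Ints_cases')
    hence "b = of_int (int k - int j)" by simp
    thus False using b_int[of "int k - int j"] that by auto
  qed
  show "a - real k \<notin> \<int>\<^sub>\<le>\<^sub>0" if "t \<in> {2, 4}" "k < kk t"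
  proof
    assume "a - real k \<in> \<int>\<^sub>\<le>\<^sub>0"
    then obtain j where "a - real k = - real j" by (elim nonpos_Ints_cases')
    hence "a = of_int (int k - int j)" by simp
    thus False using a_int[of "int k - int j"] that kk_int(1) fm_bounds[of 4] by auto
  qed
qed

lemma degree_dual_hahn:
  assumes "pochhammer (\<alpha> + 1) n \<noteq> 0"
  shows "degree (dual_hahn \<alpha> \<beta> K n) = n \<and> dual_hahn \<alpha> \<beta> K n \<noteq> 0"
proof -
  let ?P = "\<lambda>j. \<Prod>i<j. [:- (real i * (real i + \<alpha> + \<beta> + 1)), 1:]"
  let ?c = "\<lambda>j. (- 1) ^ j * pochhammer (- real n) j * pochhammer (- K + real j) (n - j) / (pochhammer (\<alpha> + 1) j * fact j)"
  have P: "degree (?P j) = j \<and> coeff (?P j) j = 1" for j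
    using degree_prod_linear[of "{..<j}" "\<lambda>i. real i * (real i + \<alpha> + \<beta> + 1)"] by simp
  have "coeff (dual_hahn \<alpha> \<beta> K n) n = (\<Sum>j\<in>{n}. ?c j * coeff (?P j) n)"
    unfolding dual_hahn_def coeff_sum coeff_smult using P by (intro sum.mono_neutral_right) (auto simp: coeff_eq_0)
  also have "\<dots> \<noteq> 0" using assms P[of n] by (simp add: pochhammer_of_nat_eq_0_iff)
  finally have c: "coeff (dual_hahn \<alpha> \<beta> K n) n \<noteq> 0" .
  have "degree (dual_hahn \<alpha> \<beta> K n) \<le> n"
    unfolding dual_hahn_def using P by (intro degree_sum_le) (auto intro!: order.trans[OF degree_smult_le])
  thus ?thesis using c le_degree[OF c] by auto
qed

lemma Yl_degree:
  assumes l: "l < m"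
  shows "degree (Yl l) = uw l" "Yl l \<noteq> 0"
proof -
  have b: "pochhammer (- b + 1) (uw l) \<noteq> 0" if "rtyp l \<in> {1, 3}"
    using Gamma_minus_nat(2)[OF nonpos_ab(1)[OF that uw_less[OF l]]] by (simp add: add.commute)
  have a: "pochhammer (- a + 1) (uw l) \<noteq> 0" if "rtyp l \<in> {2, 4}"
    using Gamma_minus_nat(2)[OF nonpos_ab(2)[OF that uw_less[OF l]]] by (simp add: add.commute)
  consider "rtyp l = 1" | "rtyp l = 2" | "rtyp l = 3" | "rtyp l = 4" using rtyp_range[OF l] by auto
  hence "degree (Yl l) = uw l \<and> Yl l \<noteq> 0"
    by cases (use degree_dual_hahn[OF b] degree_dual_hahn[OF a] in
      \<open>auto simp: Yl_def Y_row_def rtyp_def degree_pcompose pcompose_eq_0_iff Let_def\<close>)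
  thus "degree (Yl l) = uw l" "Yl l \<noteq> 0" by auto
qed

text \<open>Equal exponents in rows of the same sign but different type would force
  \<open>a\<close>, for types 2 and 3, or \<open>b\<close>, for types 1 and 4, to be the integer u -
  u' - N - 1, which lies in the excluded range. Within a type the exponents differ because the
  degrees do.\<close>

lemma distinct_exponents: "exp_distinct (\<lambda>l. int (2 * degree (Yl l)))"
proof -
  have eq: "l = l'" if l: "l < m" "l' < m" and p: "plus_row l = plus_row l'" and e: "of_int (int (2 * degree (Yl l))) + rexp l = of_int (int (2 * degree (Yl l'))) + rexp l'" for l l'
  proof -
    have e': "2 * real (uw l) + rexp l = 2 * real (uw l') + rexp l'" using e Yl_degree[OF l(1)] Yl_degree[OF l(2)] by simp
    have A: False if "i < m" "i' < m" "rtyp i = 2" "rtyp i' = 3" "2 * real (uw i) + rexp i = 2 * real (uw i') + rexp i'" for i i'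
    proof -
      have "a = of_int (int (uw i) - int (uw i') - int N - 1)" using that by (simp add: row_exp_def)
      from a_int[OF this] show False using uw_less[OF that(1)] that(3) fm_bounds[of 4] by simp
    qed
    have B: False if "i < m" "i' < m" "rtyp i = 1" "rtyp i' = 4" "2 * real (uw i) + rexp i = 2 * real (uw i') + rexp i'" for i i'
    proof -
      have "b = of_int (int (uw i) - int (uw i') - int N - 1)" using that by (simp add: row_exp_def)
      from b_int[OF this] show False using uw_less[OF that(1)] that(3) by simp
    qed
    have "rtyp l = rtyp l'"
      using rtyp_range[OF l(1)] rtyp_range[OF l(2)] p A[OF l _ _ e'] A[OF l(2,1) _ _ e'[symmetric]] B[OF l _ _ e'] B[OF l(2,1) _ _ e'[symmetric]]
      by (auto simp: plus_row_def)
    thus "l = l'" using e' by (intro row_eq[OF l]) auto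
  qed
  show ?thesis unfolding exp_distinct_def by (intro conjI inj_onI) (auto intro!: eq)
qed

text \<open>For each type \<open>sum_complement\<close> trades the rows for the removed numbers. In
  type 4 these are \<open>fmax - f\<close>, the products with \<open>fmax\<close> cancel, and the
  sum over \<open>F 4\<close> is left with a positive sign.\<close>

lemma order: "1 + (\<Sum>l<m. int (degree (Yl l))) - (\<Sum>t=1..4. int (cnt t choose 2)) = order_r F h"
proof -
  have "(\<Sum>l<m. int (degree (Yl l))) = (\<Sum>l<m. int (snd (rtyp l, uw l)))" using Yl_degree by (intro sum.cong) auto
  also have "\<dots> = (\<Sum>x\<in>(SIGMA t:{1, 2, 3, 4}. U t). int (snd x))" by (rule sum.reindex_bij_betw[OF row_bij])
  also have "\<dots> = (\<Sum>t\<in>{1, 2, 3, 4}. \<Sum>u\<in>U t. int u)" using U_co(4) by (subst sum.Sigma) (auto simp: case_prod_beta)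
  finally have s: "(\<Sum>l<m. int (degree (Yl l))) = (\<Sum>t=1..4. \<Sum>u\<in>U t. int u)" unfolding sum_1_to_4 by simp
  have J: "(\<Sum>u\<in>U t. int u) - int (cnt t choose 2) = int (card (F t)) * (fm t + int (h t)) - int (card (F t) choose 2) - (\<Sum>f\<in>F t. int f)"
    if t: "t \<in> {1..3}" for t
  proof -
    have t4: "t \<in> {1, 2, 3, 4}" "t \<noteq> 4" using t by auto
    have ff: "finite (F t)" "0 \<notin> F t" "1 \<le> h t" using F h t by auto
    have "(\<Sum>u\<in>co t. int u) = (\<Sum>f\<in>F t. int (f - 1))"
      using t4(2) J_set_complement(3)[OF ff] by (simp add: co_def sum.reindex)
    also have "\<dots> = (\<Sum>f\<in>F t. int f - 1)" using ff(2) by (intro sum.cong refl) (metis One_nat_def Suc_leI neq0_conv of_nat_1 of_nat_diff)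
    finally have "(\<Sum>u\<in>co t. int u) = (\<Sum>f\<in>F t. int f) - int (card (F t))" by (simp add: sum_subtractf)
    thus ?thesis using sum_complement[OF U_co(2)[OF t4(1)]] U_co(1,3)[OF t4(1)] cnt_card[OF t4(1)] kk_int(2)[OF t]
      by (simp add: mult.commute)
  qed
  have I: "(\<Sum>u\<in>U 4. int u) - int (cnt 4 choose 2) = (\<Sum>f\<in>F 4. int f) - int (card (F 4) choose 2)"
  proof -
    have ff: "finite (F 4)" "0 \<notin> F 4" using F by auto
    have "(\<Sum>u\<in>co 4. int u) = (\<Sum>f\<in>F 4. int (nat (fm 4) - f))"
      using I_set_complement(3)[OF ff] by (simp add: co_def sum.reindex)
    also have "\<dots> = (\<Sum>f\<in>F 4. fm 4 - int f)" using le_fmax[OF ff(1)] by (intro sum.cong refl) (fastforce simp: of_nat_diff)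
    finally have "(\<Sum>u\<in>co 4. int u) = int (card (F 4)) * fm 4 - (\<Sum>f\<in>F 4. int f)" by (simp add: sum_subtractf)
    thus ?thesis using sum_complement[OF U_co(2)[of 4]] U_co(1,3)[of 4] cnt_card[of 4] kk_int(1)
      by (simp add: algebra_simps)
  qed
  have three: "(\<Sum>i=1..3. g i) = g 1 + g 2 + g (3::nat)" for g :: "nat \<Rightarrow> int" by (simp add: eval_nat_numeral)
  show ?thesis unfolding s order_r_def sum_1_to_4 three using J[of 1] J[of 2] J[of 3] I by simp
qed

text \<open>A coincidence of nodes of different types makes \<open>a\<close>, \<open>b\<close> or
  \<open>a + b\<close> an excluded integer. For types 2 and 4 it makes \<open>a\<close> a positive
  integer, while a row of type 4 exists only if \<open>F 4\<close> is nonempty. Nodes of types 3 and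
  4 lie on different sides of 0, ..., N.\<close>

lemma root_distinct: "inj_on (\<lambda>l. root (rtyp l) (uw l)) {..<m}"
proof (rule inj_onI)
  fix l l' assume l: "l \<in> {..<m}" "l' \<in> {..<m}" and e: "root (rtyp l) (uw l) = root (rtyp l') (uw l')"
  have *: False if i: "i < m" "i' < m" "rtyp i < rtyp i'" and e: "root (rtyp i) (uw i) = root (rtyp i') (uw i')" for i i'
  proof -
    let ?u = "uw i" and ?v = "uw i'"
    note less = uw_less[OF i(1)] uw_less[OF i(2)]
    have F4: "F 4 \<noteq> {}" if "rtyp i' = 4" using less(2) that by (auto simp: kk_def fmax_def)
    consider "rtyp i = 1" "rtyp i' = 2" | "rtyp i = 1" "rtyp i' = 3" | "rtyp i = 1" "rtyp i' = 4" | "rtyp i = 2" "rtyp i' = 3"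
      | "rtyp i = 2" "rtyp i' = 4" | "rtyp i = 3" "rtyp i' = 4"
      using i(3) rtyp_range[OF i(1)] rtyp_range[OF i(2)] by auto
    thus False
    proof cases
      case 1
      hence "a + b = of_int (int ?u + int ?v - int N)" using e by (simp add: root_def)
      from ab_int[OF this] show False using less 1 fm_bounds[of 4] by simp
    next
      case 2
      hence "b = of_int (int ?u + int ?v + 1)" using e by (simp add: root_def)
      from b_int[OF this] show False using less 2 by simp
    next
      case 3
      hence "b = of_int (int ?u - int ?v - int N - 1)" using e by (simp add: root_def)
      from b_int[OF this] show False using less 3 by simp
    next
      case 4
      hence "a = of_int (int ?u - int ?v - int N - 1)" using e by (simp add: root_def)
      from a_int[OF this] show False using less 4 fm_bounds[of 4] by simp
    next
      case 5
      hence "a = real (?u + ?v + 1)" using e by (simp add: root_def)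
      moreover have "1 \<le> ?u + ?v + 1" by simp
      ultimately show False using a_pos F4[OF 5(2)] by blast
    next
      case 6
      thus False using e by (simp add: root_def)
    qed
  qed
  have "rtyp l = rtyp l'" using *[of l l'] *[of l' l] l e by (metis lessThan_iff linorder_neqE_nat)
  moreover have "uw l = uw l'" using e unfolding \<open>rtyp l = rtyp l'\<close> by (auto simp: root_def split: if_splits)
  ultimately show "l = l'" using row_eq l by auto
qed

lemma K_nonzero:
  assumes "l < m" "rtyp l \<in> {1, 2}"
  shows "pochhammer (- (a + b + real N)) (uw l) \<noteq> 0"
proof
  assume "pochhammer (- (a + b + real N)) (uw l) = 0"
  then obtain i where i: "i < uw l" "- (a + b + real N) = - real i" by (auto simp: pochhammer_eq_0_iff)
  hence "a + b = of_int (int i - int N)" by simp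
  from ab_int[OF this] show False using uw_less[OF assms(1)] assms(2) i fm_bounds[of 4] by auto
qed

lemma kap_nonzero:
  assumes l: "l < m"
  shows "kap (rtyp l) (uw l) \<noteq> 0"
proof -
  have G1: "Gamma (a + 1) \<noteq> 0" "Gamma (b + 1) \<noteq> 0" using nonpos_a[of 0] nonpos_b[of 0] by (simp_all add: Gamma_eq_zero_iff)
  have k: "0 < kk (rtyp l)" using uw_less[OF l] by simp
  have "Gamma b \<noteq> 0" if "rtyp l \<in> {1, 3}" using nonpos_ab(1)[OF that k] by (simp add: Gamma_eq_zero_iff)
  moreover have "Gamma a \<noteq> 0" if "rtyp l \<in> {2, 4}" using nonpos_ab(2)[OF that k] by (simp add: Gamma_eq_zero_iff)
  ultimately show ?thesis using rtyp_range[OF l] G1 K_nonzero[OF l] pos_ab by (auto simp: kap_def)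
qed

lemma b_nat:
  assumes b: "b = real k"
  shows "card {l. l < m \<and> rtyp l \<in> {1, 3}} \<le> k"
proof -
  have "{l. l < m \<and> rtyp l \<in> {1, 3}} = {l. l < m \<and> (rtyp l = 1 \<or> rtyp l = 3)}" by auto
  hence c: "card {l. l < m \<and> rtyp l \<in> {1, 3}} = cnt 1 + cnt 3" using card_union_types[of 1 3] by simp
  have "cnt t \<le> kk t" if "t \<in> {1, 2, 3, 4}" for t
    using card_mono[of "{..<kk t}" "U t"] U_co(1)[OF that] unfolding cnt_card[OF that] by auto
  hence "cnt 1 + cnt 3 \<le> kk 1 + kk 3" by (simp add: add_mono)
  moreover have "int (kk 1) + int (kk 3) - 1 < int k" using b_int[of "int k"] b by simp
  ultimately show ?thesis unfolding c by linarith
qed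

end

text \<open>Nodes of types 3 and 4 are points of the range of the weight, so the omitted factor
  cannot be divided out there. Away from its zero the identity follows by multiplying with it; at
  the zero by continuity of \<open>rGamma\<close>.\<close>

lemma rGamma_omit_factor:
  assumes u: "u < k"
  shows "(\<Prod>v\<in>{..<k} - {u}. x + 1 + real v) * rGamma (x + real k + 1) = (\<Sum>i\<le>u. pochhammer (- real u) i * rGamma (x + real i + 2))"
proof -
  let ?f = "\<lambda>x. (\<Prod>v\<in>{..<k} - {u}. x + 1 + real v) * rGamma (x + real k + 1)"
  let ?g = "\<lambda>x. \<Sum>i\<le>u. pochhammer (- real u) i * rGamma (x + real i + 2)"
  have e: "(x + 1 + real u) * ?f x = (x + 1 + real u) * ?g x" for x
  proof -
    have "(x + 1 + real u) * ?f x = (\<Prod>v<k. x + 1 + real v) * rGamma (x + 1 + real k)"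
      using u by (subst (2) prod.remove[of _ u]) (simp_all add: add_ac)
    also have "\<dots> = rGamma (x + 1)" using pochhammer_rGamma[of "x + 1" k] by (simp add: pochhammer_prod lessThan_atLeast0)
    finally show ?thesis unfolding rGamma_partial_fraction .
  qed
  have "{x. ?f x \<noteq> ?g x} \<subseteq> {- 1 - real u}"
  proof
    fix x assume "x \<in> {x. ?f x \<noteq> ?g x}"
    hence "x + 1 + real u = 0" using e[of x] by (simp only: mem_Collect_eq mult_left_cancel mult_cancel_left) simp
    thus "x \<in> {- 1 - real u}" by simp
  qed
  hence "MOST x. ?f x = ?g x" unfolding eventually_cofinite by (rule finite_subset) simp
  moreover have "isCont ?f x" "isCont ?g x" by (intro continuous_intros)+
  ultimately show ?thesis by (intro isCont_cofinite_eq[where f = ?f and g = ?g])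
qed

lemma rGamma_nat: "rGamma (real n + 1) = 1 / fact n"
  using Gamma_fact[of n, where 'a = real] by (simp add: rGamma_inverse_Gamma field_simps add.commute)

section \<open>Integration against the transformed weight\<close>

context quartet
begin

definition fac :: "nat \<Rightarrow> nat \<Rightarrow> real \<Rightarrow> real" where
  "fac t u x = (if t = 1 then b + real N - real u - x else if t = 2 then x + a - real u
     else if t = 3 then real N + 1 + real u - x else x + 1 + real u)"

definition sg :: "nat \<Rightarrow> real" where "sg t = (if t \<in> {1, 3} then - 1 else 1)"

lemma fac_root: "x - root t u = sg t * fac t u x"
  by (simp add: fac_def sg_def root_def)

text \<open>The transformed Hahn weight as a product over the types; \<open>gfull\<close> is the
  same for the original weight, reached by multiplying with \<open>kk t\<close> linear factors.
  Inverse factorials are written with \<open>rGamma\<close>, which is 0 at the points outside the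
  range.\<close>

definition grest :: "nat \<Rightarrow> real \<Rightarrow> real" where
  "grest t x = (if t = 1 then Gamma (real N - x + b + 1 - real (kk 1)) else if t = 2 then Gamma (x + a + 1 - real (kk 2))
     else if t = 3 then rGamma (real N - x + real (kk 3) + 1) else rGamma (x + real (kk 4) + 1))"

definition gfull :: "nat \<Rightarrow> real \<Rightarrow> real" where
  "gfull t x = (if t = 1 then Gamma (real N - x + b + 1) else if t = 2 then Gamma (x + a + 1)
     else if t = 3 then rGamma (real N - x + 1) else rGamma (x + 1))"

definition "A = {- int (kk 4)..int (N + kk 3)}"
definition "NN = N + kk 3 + kk 4"

abbreviation "\<mu> \<equiv> transformed_weight a b N F h"

lemma kk_real: "real (kk 4) = of_int (fm 4) + 1" "t \<in> {1..3} \<Longrightarrow> real (kk t) = of_int (fm t) + real (h t)"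
proof -
  have e: "real n = of_int (int n)" for n by simp
  show "real (kk 4) = of_int (fm 4) + 1" unfolding e kk_int(1) by simp
  show "t \<in> {1..3} \<Longrightarrow> real (kk t) = of_int (fm t) + real (h t)" unfolding e[of "kk t"] kk_int(2) by simp
qed

lemma NN: "nat (int N + fm 3 + fm 4 + int (h 3) + 1) = NN"
  using kk_int(1) kk_int(2)[of 3] by (simp add: NN_def)

lemma hahn_weight_nat: "X \<le> n \<Longrightarrow> hahn_weight \<alpha> \<beta> n (real X) = fact n * (Gamma (\<alpha> + real X + 1) * Gamma (real n - real X + \<beta> + 1) / (fact X * fact (n - X)))"
proof -
  assume X: "X \<le> n"
  have "(\<Sum>x = 0..n. Gamma (\<alpha> + real x + 1) * Gamma (real n - real x + \<beta> + 1) / (fact x * fact (n - x)) * of_bool (real X = real x)) =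
    (\<Sum>x\<in>{X}. Gamma (\<alpha> + real x + 1) * Gamma (real n - real x + \<beta> + 1) / (fact x * fact (n - x)) * of_bool (real X = real x))"
    using X by (intro sum.mono_neutral_right) auto
  thus ?thesis by (simp add: hahn_weight_def)
qed

lemma hahn_weight_support: "hahn_weight \<alpha> \<beta> n y \<noteq> 0 \<Longrightarrow> \<exists>X\<le>n. y = real X"
proof (rule ccontr)
  assume "hahn_weight \<alpha> \<beta> n y \<noteq> 0" "\<not> (\<exists>X\<le>n. y = real X)"
  moreover from this(2) have "hahn_weight \<alpha> \<beta> n y = 0"
    unfolding hahn_weight_def by (simp add: sum.neutral)
  ultimately show False by simp
qed

lemma weight_support: "\<mu> x \<noteq> 0 \<Longrightarrow> x \<in> of_int ` A"
proof -
  assume "\<mu> x \<noteq> 0"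
  hence "\<exists>\<alpha> \<beta>. hahn_weight \<alpha> \<beta> NN (x + of_int (fm 4) + 1) \<noteq> 0"
    unfolding transformed_weight_def Let_def NN by (metis mult_zero_right)
  then obtain X where X: "X \<le> NN" "x + of_int (fm 4) + 1 = real X"
    using hahn_weight_support by blast
  hence "x = of_int (int X - int (kk 4))" using kk_real(1) by simp
  moreover have "int X - int (kk 4) \<in> A" using X(1) by (auto simp: A_def NN_def)
  ultimately show ?thesis by blast
qed

lemma weight_eq:
  assumes "z \<in> A"
  shows "\<mu> (of_int z) = fact NN * (\<Prod>t\<in>{1, 2, 3, 4}. (\<Prod>u\<in>co t. fac t u (of_int z)) * grest t (of_int z))"
proof -
  let ?x = "of_int z :: real"
  define X where "X = nat (z + int (kk 4))"
  have X: "X \<le> NN" "real X = ?x + real (kk 4)" using assms by (auto simp: X_def A_def NN_def)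
  have X': "real (NN - X) = real N - ?x + real (kk 3)" using X by (simp add: of_nat_diff NN_def)
  have p: "(\<Prod>f\<in>F t. g f) = (\<Prod>u\<in>co t. fac t u ?x)" if t: "t \<in> {1..3}" and g: "\<And>f. f \<ge> 1 \<Longrightarrow> g f = fac t (f - 1) ?x" for t g
  proof -
    have ff: "finite (F t)" "0 \<notin> F t" "1 \<le> h t" and t4: "t \<noteq> 4" using F h t by auto
    have "(\<Prod>u\<in>co t. fac t u ?x) = (\<Prod>f\<in>F t. fac t (f - 1) ?x)"
      using t4 J_set_complement(3)[OF ff] by (simp add: co_def prod.reindex)
    also have "\<dots> = (\<Prod>f\<in>F t. g f)" using ff(2) g by (intro prod.cong refl) (metis One_nat_def Suc_leI neq0_conv)
    finally show ?thesis ..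
  qed
  have p4: "(\<Prod>f\<in>F 4. ?x + of_int (fm 4) + 1 - real f) = (\<Prod>u\<in>co 4. fac 4 u ?x)"
  proof -
    have ff: "finite (F 4)" "0 \<notin> F 4" using F by auto
    have "(\<Prod>u\<in>co 4. fac 4 u ?x) = (\<Prod>f\<in>F 4. fac 4 (nat (fm 4) - f) ?x)"
      using I_set_complement(3)[OF ff] by (simp add: co_def prod.reindex)
    also have "\<dots> = (\<Prod>f\<in>F 4. ?x + of_int (fm 4) + 1 - real f)"
    proof (rule prod.cong[OF refl], goal_cases)
      case (1 f)
      hence "int f \<le> fm 4" by (rule le_fmax[OF ff(1)])
      hence "int (nat (fm 4) - f) = fm 4 - int f" by simp
      hence "real (nat (fm 4) - f) = of_int (fm 4) - real f" by (metis of_int_diff of_int_of_nat_eq)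
      thus ?case by (simp add: fac_def)
    qed
    finally show ?thesis ..
  qed
  have e: "?x + of_int (fm 4) + 1 = real X" using X kk_real(1) by simp
  have g1: "Gamma (a - of_int (fm 2) - of_int (fm 4) - real (h 2) - 1 + real X + 1) = grest 2 ?x"
    unfolding X(2) grest_def using kk_real(1) kk_real(2)[of 2] by (simp add: algebra_simps)
  have g2: "Gamma (real NN - real X + (b - of_int (fm 1) - of_int (fm 3) - real (h 1) - real (h 3)) + 1) = grest 1 ?x"
  proof -
    have "real NN - real X = real N - ?x + real (kk 3)" using X' X(1) by (simp add: of_nat_diff)
    hence "real NN - real X + (b - of_int (fm 1) - of_int (fm 3) - real (h 1) - real (h 3)) + 1 = real N - ?x + b + 1 - real (kk 1)"
      using kk_real(2)[of 1] kk_real(2)[of 3] by simp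
    thus ?thesis by (simp only: grest_def) simp
  qed
  have g3: "1 / fact X = grest 4 ?x" "1 / fact (NN - X) = grest 3 ?x"
    unfolding rGamma_nat[symmetric] X(2) X' grest_def by simp_all
  have q1: "(\<Prod>f\<in>F 1. b + real N + 1 - real f - ?x) = (\<Prod>u\<in>co 1. fac 1 u ?x)" by (rule p) (simp_all add: fac_def of_nat_diff)
  have q2: "(\<Prod>f\<in>F 2. ?x + a + 1 - real f) = (\<Prod>u\<in>co 2. fac 2 u ?x)" by (rule p) (simp_all add: fac_def of_nat_diff)
  have q3: "(\<Prod>f\<in>F 3. real N + real f - ?x) = (\<Prod>u\<in>co 3. fac 3 u ?x)" by (rule p) (simp_all add: fac_def of_nat_diff)
  have "\<mu> ?x = (\<Prod>u\<in>co 1. fac 1 u ?x) * (\<Prod>u\<in>co 2. fac 2 u ?x) * (\<Prod>u\<in>co 3. fac 3 u ?x) * (\<Prod>u\<in>co 4. fac 4 u ?x) *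
     (fact NN * (grest 2 ?x * grest 1 ?x / (fact X * fact (NN - X))))"
    unfolding transformed_weight_def Let_def NN e[symmetric] p4[symmetric] q1[symmetric] q2[symmetric] q3[symmetric]
    unfolding e hahn_weight_nat[OF X(1)] g1 g2 ..
  also have "grest 2 ?x * grest 1 ?x / (fact X * fact (NN - X)) = grest 2 ?x * grest 1 ?x * (grest 4 ?x * grest 3 ?x)"
    unfolding g3[symmetric] by simp
  finally show ?thesis by (simp add: mult_ac)
qed

lemma nonpos_A:
  assumes "z \<in> A"
  shows "of_int z + a + 1 - real (kk 2) \<notin> \<int>\<^sub>\<le>\<^sub>0" "real N - of_int z + b + 1 - real (kk 1) \<notin> \<int>\<^sub>\<le>\<^sub>0"
proof -
  show "of_int z + a + 1 - real (kk 2) \<notin> \<int>\<^sub>\<le>\<^sub>0"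
  proof
    assume "of_int z + a + 1 - real (kk 2) \<in> \<int>\<^sub>\<le>\<^sub>0"
    then obtain j where "of_int z + a + 1 - real (kk 2) = - real j" by (elim nonpos_Ints_cases')
    hence "a = of_int (int (kk 2) - int j - 1 - z)" by simp
    from a_int[OF this] show False using assms kk_int(1) by (auto simp: A_def)
  qed
  show "real N - of_int z + b + 1 - real (kk 1) \<notin> \<int>\<^sub>\<le>\<^sub>0"
  proof
    assume "real N - of_int z + b + 1 - real (kk 1) \<in> \<int>\<^sub>\<le>\<^sub>0"
    then obtain j where "real N - of_int z + b + 1 - real (kk 1) = - real j" by (elim nonpos_Ints_cases')
    hence "b = of_int (int (kk 1) - int j - 1 - int N + z)" by simp
    from b_int[OF this] show False using assms by (auto simp: A_def)
  qed
qed

lemma falling_prod: "(\<Prod>u<k. y + real k - 1 - real u) = pochhammer y k"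
proof (induction k)
  case (Suc k)
  have "(\<Prod>u<k. y + real (Suc k) - 1 - real (Suc u)) = (\<Prod>u<k. y + real k - 1 - real u)" by (intro prod.cong) auto
  thus ?case unfolding prod.lessThan_Suc_shift using Suc by (simp add: pochhammer_rec' del: of_nat_Suc)
qed simp

lemma gfull_eq:
  assumes z: "z \<in> A" and t: "t \<in> {1, 2, 3, 4}"
  shows "(\<Prod>u<kk t. fac t u (of_int z)) * grest t (of_int z) = gfull t (of_int z)"
proof -
  let ?x = "of_int z :: real"
  note np = nonpos_A[OF z]
  consider "t = 1" | "t = 2" | "t = 3" | "t = 4" using t by auto
  thus ?thesis
  proof cases
    case 1
    have "(\<Prod>u<kk 1. fac 1 u ?x) = pochhammer (real N - ?x + b + 1 - real (kk 1)) (kk 1)"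
      unfolding falling_prod[symmetric] by (intro prod.cong) (simp_all add: fac_def)
    thus ?thesis using Gamma_add_nat[OF np(2), of "kk 1"] unfolding 1 by (simp add: grest_def gfull_def)
  next
    case 2
    have "(\<Prod>u<kk 2. fac 2 u ?x) = pochhammer (?x + a + 1 - real (kk 2)) (kk 2)"
      unfolding falling_prod[symmetric] by (intro prod.cong) (simp_all add: fac_def)
    thus ?thesis using Gamma_add_nat[OF np(1), of "kk 2"] unfolding 2 by (simp add: grest_def gfull_def)
  next
    case 3
    have "(\<Prod>u<kk 3. fac 3 u ?x) = pochhammer (real N - ?x + 1) (kk 3)"
      unfolding pochhammer_prod lessThan_atLeast0 by (intro prod.cong) (simp_all add: fac_def)
    thus ?thesis using pochhammer_rGamma[of "real N - ?x + 1" "kk 3"] unfolding 3 by (simp add: grest_def gfull_def add_ac)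
  next
    case 4
    have "(\<Prod>u<kk 4. fac 4 u ?x) = pochhammer (?x + 1) (kk 4)"
      unfolding pochhammer_prod lessThan_atLeast0 by (intro prod.cong) (simp_all add: fac_def)
    thus ?thesis using pochhammer_rGamma[of "?x + 1" "kk 4"] unfolding 4 by (simp add: grest_def gfull_def add_ac)
  qed
qed

lemma weight_prod:
  assumes z: "z \<in> A" and L: "Lr \<subseteq> {..<m}"
  shows "\<mu> (of_int z) * (\<Prod>l\<in>Lr. fac (rtyp l) (uw l) (of_int z)) =
    fact NN * (\<Prod>t\<in>{1, 2, 3, 4}. (\<Prod>u\<in>co t \<union> uw ` {l \<in> Lr. rtyp l = t}. fac t u (of_int z)) * grest t (of_int z))"
proof -
  let ?L = "\<lambda>t. {l \<in> Lr. rtyp l = t}" and ?R = "\<lambda>t. uw ` {l \<in> Lr. rtyp l = t}"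
  let ?x = "of_int z :: real"
  have fin: "finite Lr" using L finite_subset by blast
  have "(\<Prod>l\<in>Lr. fac (rtyp l) (uw l) ?x) = (\<Prod>t\<in>{1, 2, 3, 4}. \<Prod>l\<in>?L t. fac (rtyp l) (uw l) ?x)"
    using rtyp_range L by (intro prod.group[symmetric] fin) auto
  also have "\<dots> = (\<Prod>t\<in>{1, 2, 3, 4}. \<Prod>u\<in>?R t. fac t u ?x)"
  proof (rule prod.cong[OF refl], goal_cases)
    case (1 t)
    have "inj_on uw (?L t)"
    proof (rule inj_onI)
      fix l l' assume "l \<in> ?L t" "l' \<in> ?L t" "uw l = uw l'"
      thus "l = l'" using L row_eq[of l l'] by auto
    qed
    thus ?case by (simp add: prod.reindex)
  qed
  finally have 1: "(\<Prod>l\<in>Lr. fac (rtyp l) (uw l) ?x) = (\<Prod>t\<in>{1, 2, 3, 4}. \<Prod>u\<in>?R t. fac t u ?x)" .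
  have 2: "(\<Prod>u\<in>co t \<union> ?R t. fac t u ?x) = (\<Prod>u\<in>co t. fac t u ?x) * (\<Prod>u\<in>?R t. fac t u ?x)"
    if t: "t \<in> {1, 2, 3, 4}" for t
  proof (rule prod.union_disjoint)
    show "finite (co t)" using U_co(2)[OF t] finite_subset by blast
    show "co t \<inter> ?R t = {}" using uw_U U_co(1)[OF t] L by fastforce
  qed (use fin in auto)
  have "(\<Prod>t\<in>{1, 2, 3, 4}. (\<Prod>u\<in>co t \<union> ?R t. fac t u ?x) * grest t ?x) =
     (\<Prod>t\<in>{1, 2, 3, 4}. ((\<Prod>u\<in>co t. fac t u ?x) * grest t ?x) * (\<Prod>u\<in>?R t. fac t u ?x))"
    using 2 by (intro prod.cong refl) (simp add: mult_ac)
  thus ?thesis unfolding weight_eq[OF z] 1 by (simp only: prod.distrib mult.assoc)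
qed

lemma co_rows: "t \<in> {1, 2, 3, 4} \<Longrightarrow> co t \<union> uw ` {l \<in> {..<m}. rtyp l = t} = {..<kk t}"
proof -
  assume t: "t \<in> {1, 2, 3, 4}"
  have "uw ` {l \<in> {..<m}. rtyp l = t} = U t"
  proof (intro equalityI subsetI)
    fix u assume "u \<in> U t"
    hence "(t, u) \<in> (\<lambda>l. (rtyp l, uw l)) ` {..<m}" using t bij_betw_imp_surj_on[OF row_bij] by auto
    thus "u \<in> uw ` {l \<in> {..<m}. rtyp l = t}" by auto
  qed (use uw_U in auto)
  thus ?thesis using U_co(1,2)[OF t] by auto
qed

lemma co_rows_del:
  assumes t: "t \<in> {1, 2, 3, 4}" and l0: "l0 < m"
  shows "co t \<union> uw ` {l \<in> {..<m} - {l0}. rtyp l = t} = (if t = rtyp l0 then {..<kk t} - {uw l0} else {..<kk t})"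
proof (cases "t = rtyp l0")
  case False
  hence "{l \<in> {..<m} - {l0}. rtyp l = t} = {l \<in> {..<m}. rtyp l = t}" by auto
  thus ?thesis using co_rows[OF t] False by simp
next
  case True
  have "uw l0 \<notin> co t" using uw_U[OF l0] U_co(1)[OF t] True by auto
  moreover have "uw l0 \<notin> uw ` {l \<in> {..<m} - {l0}. rtyp l = t}" using row_eq[OF l0] True by fastforce
  moreover have "uw ` {l \<in> {..<m}. rtyp l = t} = insert (uw l0) (uw ` {l \<in> {..<m} - {l0}. rtyp l = t})" using True l0 by blast
  ultimately show ?thesis using co_rows[OF t] True by auto
qed

abbreviation "nodes \<equiv> \<lambda>l. root (rtyp l) (uw l)"

lemma weight_full:
  assumes z: "z \<in> A"
  shows "\<mu> (of_int z) * (\<Prod>l<m. fac (rtyp l) (uw l) (of_int z)) =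
     fact NN * (gfull 2 (of_int z) * gfull 1 (of_int z) * gfull 4 (of_int z) * gfull 3 (of_int z))"
proof -
  have "(\<Prod>t\<in>{1, 2, 3, 4}. (\<Prod>u\<in>co t \<union> uw ` {l \<in> {..<m}. rtyp l = t}. fac t u (of_int z)) * grest t (of_int z)) = (\<Prod>t\<in>{1, 2, 3, 4}. gfull t (of_int z))"
    by (intro prod.cong refl) (simp only: co_rows gfull_eq[OF z])
  thus ?thesis unfolding weight_prod[OF z order_refl] by (simp add: mult_ac)
qed

lemma weight_del:
  assumes z: "z \<in> A" and l: "l < m"
  shows "\<mu> (of_int z) * (\<Prod>l\<in>{..<m} - {l}. fac (rtyp l) (uw l) (of_int z)) =
     fact NN * ((\<Prod>t\<in>{1, 2, 3, 4} - {rtyp l}. gfull t (of_int z)) * ((\<Prod>u\<in>{..<kk (rtyp l)} - {uw l}. fac (rtyp l) u (of_int z)) * grest (rtyp l) (of_int z)))"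
proof -
  let ?x = "of_int z :: real"
  have "(\<Prod>t\<in>{1, 2, 3, 4}. (\<Prod>u\<in>co t \<union> uw ` {l' \<in> {..<m} - {l}. rtyp l' = t}. fac t u ?x) * grest t ?x) =
    (\<Prod>t\<in>{1, 2, 3, 4}. if t = rtyp l then (\<Prod>u\<in>{..<kk (rtyp l)} - {uw l}. fac (rtyp l) u ?x) * grest (rtyp l) ?x else gfull t ?x)"
    using co_rows_del[OF _ l] gfull_eq[OF z] by (intro prod.cong refl) (simp split: if_splits)
  also have "\<dots> = ((\<Prod>u\<in>{..<kk (rtyp l)} - {uw l}. fac (rtyp l) u ?x) * grest (rtyp l) ?x) * (\<Prod>t\<in>{1, 2, 3, 4} - {rtyp l}. gfull t ?x)"
    using rtyp_range[OF l] by (subst prod.remove[of _ "rtyp l"]) (auto intro!: arg_cong2[where f = "(*)"] prod.cong)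
  finally show ?thesis using weight_prod[OF z, of "{..<m} - {l}"] by (simp add: mult_ac)
qed

abbreviation "wt s r z \<equiv> gfull 2 z * gfull 1 z * rGamma (z + real s + 1) * rGamma (real N - z + real r + 1)"

text \<open>The zeros of \<open>rGamma\<close> cut the range down to - s, ..., N + r, and there the
  product is the summand of a Hahn weight with \<open>a\<close> lowered by \<open>s\<close> and
  \<open>b\<close> by \<open>r\<close>.\<close>

lemma window:
  assumes "s \<le> kk 4" "r \<le> kk 3"
  shows "(\<Sum>z\<in>A. wt s r (of_int z) * g (of_int z)) =
    gsum (a + 1 - real s) (b + 1 - real r) (N + s + r) (\<lambda>X. g (real X - real s))"
proof -
  let ?t = "\<lambda>z. wt s r (of_int z) * g (of_int z)"
  have "sum ?t A = sum ?t {- int s..int (N + r)}"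
  proof (rule sum.mono_neutral_right)
    show "\<forall>z\<in>A - {- int s..int (N + r)}. ?t z = 0"
    proof
      fix z assume "z \<in> A - {- int s..int (N + r)}"
      hence "z + int s + 1 \<le> 0 \<or> int N - z + int r + 1 \<le> 0" by auto
      hence "(of_int (z + int s + 1) :: real) \<in> \<int>\<^sub>\<le>\<^sub>0 \<or> (of_int (int N - z + int r + 1) :: real) \<in> \<int>\<^sub>\<le>\<^sub>0"
        unfolding of_int_in_nonpos_Ints_iff .
      thus "?t z = 0" by (auto simp: rGamma_eq_zero_iff)
    qed
  qed (use assms in \<open>auto simp: A_def\<close>)
  also have "\<dots> = gsum (a + 1 - real s) (b + 1 - real r) (N + s + r) (\<lambda>X. g (real X - real s))"
    unfolding gsum_def
  proof (rule sum.reindex_bij_witness[of _ "\<lambda>X. int X - int s" "\<lambda>z. nat (z + int s)"])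
    let ?h = "\<lambda>x. Gamma (a + 1 - real s + real x) * Gamma (b + 1 - real r + real (N + s + r - x)) / (fact x * fact (N + s + r - x)) * g (real x - real s)"
    fix z assume z: "z \<in> {- int s..int (N + r)}"
    define X where "X = nat (z + int s)"
    have X: "X \<le> N + s + r" and zX: "of_int z = real X - real s" using z by (auto simp: X_def)
    have d: "real (N + s + r - X) = real N - of_int z + real r" using X zX by (simp add: of_nat_diff)
    have "gfull 2 (of_int z) = Gamma (a + 1 - real s + real X)" "gfull 1 (of_int z) = Gamma (b + 1 - real r + real (N + s + r - X))"
      unfolding gfull_def d by (simp_all add: zX algebra_simps)
    moreover have "rGamma (of_int z + real s + 1) = 1 / fact X" using rGamma_nat[of X] by (simp add: zX)
    moreover have "rGamma (real N - of_int z + real r + 1) = 1 / fact (N + s + r - X)" unfolding rGamma_nat[symmetric] d ..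
    ultimately show "?h (nat (z + int s)) = ?t z"
      unfolding X_def[symmetric] zX by simp
  qed auto
  finally show ?thesis .
qed

definition I :: "real poly \<Rightarrow> real" where "I p = (\<Sum>z\<in>A. \<mu> (of_int z) * poly p (of_int z))"

lemma mass_integral_I: "mass_integral \<mu> (\<lambda>x. poly p x) = I p"
proof -
  have inj: "inj_on (of_int :: int \<Rightarrow> real) A" by (auto simp: inj_on_def)
  have "mass_integral \<mu> (\<lambda>x. poly p x) = (\<Sum>x\<in>of_int ` A. poly p x * \<mu> x)"
    unfolding mass_integral_def using weight_support by (intro sum.mono_neutral_left) (auto simp: A_def)
  also have "\<dots> = I p" unfolding I_def by (subst sum.reindex[OF inj]) (simp add: mult.commute)
  finally show ?thesis .
qed

definition "sgt = (\<Prod>l<m. sg (rtyp l))"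

lemma sgt: "sgt \<noteq> 0" by (simp add: sgt_def sg_def)

lemma I_node: "I (node_poly m nodes * p) = sgt * fact NN * L p"
proof -
  have "\<mu> (of_int z) * poly (node_poly m nodes * p) (of_int z) = sgt * fact NN *
      (wt 0 0 (of_int z) * poly p (of_int z))"
    if z: "z \<in> A" for z
  proof -
    have "poly (node_poly m nodes) (of_int z) = (\<Prod>l<m. sg (rtyp l) * fac (rtyp l) (uw l) (of_int z))"
      unfolding node_poly_def poly_prod fac_root[symmetric] by (intro prod.cong) auto
    hence "poly (node_poly m nodes) (of_int z) = sgt * (\<Prod>l<m. fac (rtyp l) (uw l) (of_int z))"
      by (simp add: prod.distrib sgt_def)
    thus ?thesis using weight_full[OF z] by (simp add: gfull_def mult_ac)
  qed
  hence "I (node_poly m nodes * p) = sgt * fact NN * (\<Sum>z\<in>A. wt 0 0 (of_int z) * poly p (of_int z))"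
    unfolding I_def sum_distrib_left by (intro sum.cong) auto
  thus ?thesis unfolding window[of 0 0 "poly p", OF le0 le0] by (simp add: L_def)
qed

lemma I_del:
  assumes l: "l < m"
  shows "I (node_del m nodes l * hp n) = sgt * fact NN *
     (kap (rtyp l) (uw l) * ((-1) ^ n * \<xi> a b (real N) (rtyp l) (real n) n * dual (rtyp l) (uw l) (real n)))"
proof -
  let ?t = "rtyp l" and ?u = "uw l"
  let ?f = "\<lambda>z. fac ?t ?u (of_int z)"
  define G where "G = (\<lambda>z. (\<Prod>t\<in>{1, 2, 3, 4} - {?t}. gfull t (of_int z)) * ((\<Prod>u\<in>{..<kk ?t} - {?u}. fac ?t u (of_int z)) * grest ?t (of_int z)))"
  note less = uw_less[OF l]
  have "\<mu> (of_int z) * poly (node_del m nodes l * hp n) (of_int z) = sgt * fact NN * sg ?t * (G z * H n (of_int z))"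
    if z: "z \<in> A" for z
  proof -
    have "poly (node_del m nodes l) (of_int z) = (\<Prod>l\<in>{..<m} - {l}. sg (rtyp l) * fac (rtyp l) (uw l) (of_int z))"
      unfolding node_del_def poly_prod fac_root[symmetric] by (intro prod.cong) auto
    moreover have "sgt * sg ?t = (\<Prod>l\<in>{..<m} - {l}. sg (rtyp l))"
      using l unfolding sgt_def by (subst prod.remove[of _ l]) (auto simp: sg_def)
    ultimately have "poly (node_del m nodes l) (of_int z) = sgt * sg ?t * (\<Prod>l\<in>{..<m} - {l}. fac (rtyp l) (uw l) (of_int z))"
      by (simp add: prod.distrib)
    thus ?thesis using weight_del[OF z l] by (simp add: G_def mult_ac)
  qed
  hence e: "I (node_del m nodes l * hp n) = sgt * fact NN * (sg ?t * (\<Sum>z\<in>A. G z * H n (of_int z)))"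
    unfolding I_def sum_distrib_left by (intro sum.cong) auto
  have T: "{1, 2, 3, 4} - {1} = {2, 3, 4::nat}" "{1, 2, 3, 4} - {2} = {1, 3, 4::nat}" "{1, 2, 3, 4} - {3} = {1, 2, 4::nat}" "{1, 2, 3, 4} - {4} = {1, 2, 3::nat}"
    by auto
  \<comment> \<open>Nodes of types 1 and 2 avoid the range of summation, so the omitted factor may
    be divided out of the full weight.\<close>
  have div: "G z = wt 0 0 (of_int z) * (1 / ?f z)"
    if z: "z \<in> A" and t: "?t \<in> {1, 2}" for z
  proof -
    have nz: "?f z \<noteq> 0"
    proof
      assume f0: "?f z = 0"
      note np = nonpos_A[OF z]
      have less1: "real ?u + 1 = real (Suc ?u)" by simp
      have le: "Suc ?u \<le> kk ?t" using less by simp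
      consider "?t = 1" | "?t = 2" using t by auto
      thus False
      proof cases
        case 1
        hence "real N - of_int z + b + 1 - real (kk 1) = - real (kk 1 - Suc ?u)" using f0 le by (simp add: fac_def of_nat_diff)
        thus False using np(2) minus_of_nat_in_nonpos_Ints by metis
      next
        case 2
        hence "of_int z + a + 1 - real (kk 2) = - real (kk 2 - Suc ?u)" using f0 le by (simp add: fac_def of_nat_diff)
        thus False using np(1) minus_of_nat_in_nonpos_Ints by metis
      qed
    qed
    have "(\<Prod>u<kk ?t. fac ?t u (of_int z)) = ?f z * (\<Prod>u\<in>{..<kk ?t} - {?u}. fac ?t u (of_int z))"
      using less by (intro prod.remove) auto
    hence q: "(\<Prod>u\<in>{..<kk ?t} - {?u}. fac ?t u (of_int z)) * grest ?t (of_int z) = gfull ?t (of_int z) / ?f z"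
      using gfull_eq[OF z rtyp_range[OF l]] nz by (simp add: field_simps)
    have r: "(\<Prod>t\<in>{1, 2, 3, 4} - {?t}. gfull t (of_int z)) * gfull ?t (of_int z) = gfull 2 (of_int z) * gfull 1 (of_int z) * gfull 4 (of_int z) * gfull 3 (of_int z)"
    proof -
      consider "?t = 1" | "?t = 2" using t by auto
      thus ?thesis
      proof cases
        case 1
        show ?thesis unfolding 1 T by (simp add: mult_ac)
      next
        case 2
        show ?thesis unfolding 2 T by (simp add: mult_ac)
      qed
    qed
    have "G z = ((\<Prod>t\<in>{1, 2, 3, 4} - {?t}. gfull t (of_int z)) * gfull ?t (of_int z)) * (1 / ?f z)"
      unfolding G_def q by simp
    thus ?thesis unfolding r by (simp add: gfull_def)
  qed
  have "sg ?t * (\<Sum>z\<in>A. G z * H n (of_int z)) = kap ?t ?u * ((-1) ^ n * \<xi> a b (real N) ?t (real n) n * dual ?t ?u (real n))"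
  proof -
    consider "?t = 1" | "?t = 2" | "?t = 3" | "?t = 4" using rtyp_range[OF l] by auto
    thus ?thesis
    proof cases
      case 1
      have b: "\<forall>k\<le>?u. b - real k \<notin> \<int>\<^sub>\<le>\<^sub>0" using nonpos_ab(1)[of 1] less 1 by auto
      have "(\<Sum>z\<in>A. G z * H n (of_int z)) = (\<Sum>z\<in>A. wt 0 0 (of_int z) * (H n (of_int z) / fac 1 ?u (of_int z)))"
        using div 1 by (intro sum.cong) auto
      also have "\<dots> = gsum (a + 1) (b + 1) N (\<lambda>x. H n (real x) / (b + real N - real ?u - real x))"
        unfolding window[of 0 0 "\<lambda>x. H n x / fac 1 ?u x", OF le0 le0] by (simp add: fac_def)
      finally show ?thesis using second_kind_1[OF b, of n] K_nonzero[OF l] 1 by (simp add: sg_def kap_def dual_def)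
    next
      case 2
      have a: "\<forall>k\<le>?u. a - real k \<notin> \<int>\<^sub>\<le>\<^sub>0" using nonpos_ab(2)[of 2] less 2 by auto
      have "(\<Sum>z\<in>A. G z * H n (of_int z)) = (\<Sum>z\<in>A. wt 0 0 (of_int z) * (H n (of_int z) / fac 2 ?u (of_int z)))"
        using div 2 by (intro sum.cong) auto
      also have "\<dots> = gsum (a + 1) (b + 1) N (\<lambda>x. H n (real x) / (real x + a - real ?u))"
        unfolding window[of 0 0 "\<lambda>x. H n x / fac 2 ?u x", OF le0 le0] by (simp add: fac_def)
      finally show ?thesis using second_kind_2[OF a, of n] K_nonzero[OF l] 2 by (simp add: sg_def kap_def dual_def)
    next
      case 3
      have b: "\<forall>k\<le>?u. b - real k \<notin> \<int>\<^sub>\<le>\<^sub>0" using nonpos_ab(1)[of 3] less 3 by auto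
      \<comment> \<open>Omitting a node beyond \<open>N\<close> leaves a sum of weights on 0, ..., N
        + k + 1, the form that \<open>second_kind_3\<close> evaluates.\<close>
      have "G z = (\<Sum>k\<le>?u. pochhammer (- real ?u) k * (wt 0 (Suc k) (of_int z)))" for z
        unfolding G_def 3 T using rGamma_omit_factor[of ?u "kk 3" "real N - of_int z"] less 3
        by (simp add: fac_def grest_def gfull_def sum_distrib_left algebra_simps)
      hence "(\<Sum>z\<in>A. G z * H n (of_int z)) = (\<Sum>k\<le>?u. pochhammer (- real ?u) k * (\<Sum>z\<in>A. wt 0 (Suc k) (of_int z) * H n (of_int z)))"
        by (simp only: sum_distrib_right sum_distrib_left, subst sum.swap) (simp only: mult.assoc)
      also have "\<dots> = (\<Sum>k\<le>?u. pochhammer (- real ?u) k * gsum (b - real k) (a + 1) (N + Suc k) (\<lambda>x. H n (real N - (real x - real (Suc k)))))"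
      proof (intro sum.cong refl arg_cong2[where f = "(*)"], goal_cases)
        case (1 k)
        hence "Suc k \<le> kk 3" using less 3 by simp
        from window[OF le0 this, of "H n"]
        have "(\<Sum>z\<in>A. wt 0 (Suc k) (of_int z) * H n (of_int z)) = gsum (a + 1) (b - real k) (N + Suc k) (\<lambda>X. H n (real X))"
          by simp
        also have "\<dots> = gsum (b - real k) (a + 1) (N + Suc k) (\<lambda>x. H n (real N - (real x - real (Suc k))))"
          unfolding gsum_reflect[of "a + 1"] by (rule gsum_cong) (simp add: of_nat_diff algebra_simps)
        finally show ?case .
      qed
      finally show ?thesis unfolding second_kind_3[OF b] by (simp add: 3 sg_def kap_def dual_def)
    next
      case 4
      have a: "\<forall>k\<le>?u. a - real k \<notin> \<int>\<^sub>\<le>\<^sub>0" using nonpos_ab(2)[of 4] less 4 by auto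
      have "G z = (\<Sum>k\<le>?u. pochhammer (- real ?u) k * (wt (Suc k) 0 (of_int z)))" for z
        unfolding G_def 4 T using rGamma_omit_factor[of ?u "kk 4" "of_int z"] less 4
        by (simp add: fac_def grest_def gfull_def sum_distrib_left algebra_simps)
      hence "(\<Sum>z\<in>A. G z * H n (of_int z)) = (\<Sum>k\<le>?u. pochhammer (- real ?u) k * (\<Sum>z\<in>A. wt (Suc k) 0 (of_int z) * H n (of_int z)))"
        by (simp only: sum_distrib_right sum_distrib_left, subst sum.swap) (simp only: mult.assoc)
      also have "\<dots> = (\<Sum>k\<le>?u. pochhammer (- real ?u) k * gsum (a - real k) (b + 1) (N + Suc k) (\<lambda>x. H n (real x - real (Suc k))))"
      proof (intro sum.cong refl arg_cong2[where f = "(*)"], goal_cases)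
        case (1 k)
        hence "Suc k \<le> kk 4" using less 4 by simp
        from window[OF this le0, of "H n"]
        show ?case by simp
      qed
      finally show ?thesis unfolding second_kind_4[OF a] by (simp add: 4 sg_def kap_def dual_def)
    qed
  qed
  thus ?thesis unfolding e by simp
qed

sublocale hahn_functional a b N U I "sgt * fact NN" "sgt * fact NN"
proof unfold_locales
  show "I (p + q) = I p + I q" for p q by (simp add: I_def sum.distrib distrib_left)
  show "I (smult s p) = s * I p" for s p by (simp add: I_def sum_distrib_left mult_ac)
  show "sgt * fact NN \<noteq> 0" using sgt by simp
  show "I (node_poly m (\<lambda>l. root (row_t U (Suc l)) (uw l)) * p) = sgt * fact NN * L p" for p
    using I_node[of p] by (simp only: rtyp_def)
  show "l < m \<Longrightarrow> I (node_del m (\<lambda>l. root (row_t U (Suc l)) (uw l)) l * hp n) = sgt * fact NN *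
     (kap (row_t U (Suc l)) (uw l) * ((-1) ^ n * \<xi> a b (real N) (row_t U (Suc l)) (real n) n * dual (row_t U (Suc l)) (uw l) (real n)))" for l n
    using I_del[of l n] unfolding rtyp_def by blast
  show "inj_on (\<lambda>l. root (row_t U (Suc l)) (uw l)) {..<m}" using root_distinct by (simp only: rtyp_def)
  show "l < m \<Longrightarrow> kap (row_t U (Suc l)) (uw l) \<noteq> 0" for l using kap_nonzero[of l] unfolding rtyp_def by blast
  show "l < m \<Longrightarrow> row_t U (Suc l) \<in> {1, 2} \<Longrightarrow> pochhammer (- (a + b + real N)) (uw l) \<noteq> 0" for l using K_nonzero[of l] unfolding rtyp_def by blast
  show "b = real k \<Longrightarrow> card {l. l < m \<and> row_t U (Suc l) \<in> {1, 3}} \<le> k" for k using b_nat[of k] unfolding rtyp_def by blast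
qed

text \<open>The column \<open>j = 0\<close> is part of \<open>q_poly\<close> but not of
  \<open>\<Omega>\<close>, so \<open>\<Omega>_defined\<close> says nothing about its denominator. It
  differs by one factor from that of the next column, and the excluded values of \<open>a\<close>
  and \<open>a + b\<close> keep this factor from vanishing.\<close>

lemma \<xi>_den_columns:
  assumes def: "\<Omega>_defined a b (real N) U (real n)" and l: "l < m" and j: "j \<le> m"
  shows "\<xi>_den a b (real N) (rtyp l) (real n - real j) (m - j) \<noteq> 0"
proof (cases j)
  case (Suc i)
  hence "Suc l \<in> {1..m}" "j \<in> {1..m}" using l j by auto
  thus ?thesis using def unfolding \<Omega>_defined_def rtyp_def by blast
next
  case 0
  have k: "0 < kk (rtyp l)" using uw_less[OF l] by simp
  have a: "real n + a \<noteq> 0" if "rtyp l \<in> {2, 4}"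
  proof
    assume "real n + a = 0"
    hence "a - real 0 = - real n" by simp
    thus False using nonpos_ab(2)[OF that k] minus_of_nat_in_nonpos_Ints by metis
  qed
  have ab: "real n + a + b + real N + 1 \<noteq> 0" using nz_ab[of "N + n"] by (simp add: add_ac)
  have "\<xi>_den a b (real N) (rtyp l) (real n) 1 \<noteq> 0"
  proof -
    have e: "real n - real 1 + a + 1 = real n + a" "real n - real 1 + a + b + real N + 2 = real n + a + b + real N + 1" by simp_all
    show ?thesis unfolding \<xi>_den_def e using a ab rtyp_range[OF l] by auto
  qed
  moreover have "\<xi>_den a b (real N) (rtyp l) (real n - real 1) (m - 1) \<noteq> 0"
  proof -
    have "Suc l \<in> {1..m}" "1 \<in> {1..m}" using l by auto
    thus ?thesis using def unfolding \<Omega>_defined_def rtyp_def by blast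
  qed
  moreover have "1 + (m - 1) = m" using l by simp
  ultimately have "\<xi>_den a b (real N) (rtyp l) (real n) m \<noteq> 0"
    using \<xi>_den_add[of a b "real N" "rtyp l" "real n" 1 "m - 1"] by simp
  thus ?thesis using 0 by simp
qed

theorem orthogonal_eigenfunctions:
  assumes \<Omega>: "\<forall>n \<le> N + card (U 3) + card (U 4) + 1. \<Omega>_defined a b (real N) U (real n) \<and> \<Omega> a b (real N) U (real n) \<noteq> 0"
  shows "orthogonal_polys \<mu> q {0..N + card (U 3) + card (U 4)}"
    and "\<exists>S lam D. constructed_op a b (real N) U S lam D \<and> is_difference_op (order_r F h) D \<and>
        (\<forall>n \<le> N + card (U 3) + card (U 4). D (q n) = smult (poly lam (real n)) (q n))"
proof -
  have c: "card (U 3) = cnt 3" "card (U 4) = cnt 4" using cnt_card by simp_all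
  have nice: "nice n" if "n \<le> N + cnt 3 + cnt 4 + 1" for n using \<Omega> that unfolding c nice_def by blast
  note O = orthogonality[OF nice]
  show "orthogonal_polys \<mu> q {0..N + card (U 3) + card (U 4)}"
    unfolding orthogonal_polys_def c
  proof (intro conjI ballI impI)
    fix n k assume nk: "n \<in> {0..N + cnt 3 + cnt 4}" "k \<in> {0..N + cnt 3 + cnt 4}" "n \<noteq> k"
    have "I (q n * q k) = 0"
    proof (cases "k < n")
      case True
      thus ?thesis using O(2)[of n "q k"] O(1)[of k] nk by simp
    next
      case False
      thus ?thesis using O(2)[of k "q n"] O(1)[of n] nk by (simp add: mult.commute)
    qed
    thus "mass_integral \<mu> (\<lambda>x. poly (q n) x * poly (q k) x) = 0"
      using mass_integral_I[of "q n * q k"] by simp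
  next
    fix n assume "n \<in> {0..N + cnt 3 + cnt 4}"
    hence n: "n \<le> N + cnt 3 + cnt 4" by simp
    show "degree (q n) = n" using O(1)[OF _ n] by simp
    show "mass_integral \<mu> (\<lambda>x. (poly (q n) x)\<^sup>2) \<noteq> 0"
      using mass_integral_I[of "q n * q n"] O(3)[OF _ n] by (simp add: power2_eq_square)
  qed
  obtain lam D where D: "constructed_op a b (real N) U S lam D" "is_difference_op (order_r F h) D"
    using difference_operator[OF Yl_degree(2) distinct_exponents] unfolding order by blast
  then obtain Mt P where MP: "MOST x. poly lam x - poly lam (x - 1) = S x * \<Omega> a b (real N) U x"
    "\<forall>h\<in>{1..m}. MOST x. M_fun a b (real N) U S h x = \<sigma> a b (x + 1) * poly (Mt h) (\<theta> a b x)"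
    "MOST x. poly P (\<theta> a b x) = 2 * poly lam x + (\<Sum>h = 1..m. poly (Y_row a b (real N) U h) (\<theta> a b x) * M_fun a b (real N) U S h x)"
    "D = (\<lambda>p. smult (1 / 2) (poly_op P (hahn_op a b (real N)) p) +
           (\<Sum>h = 1..m. poly_op (Mt h) (hahn_op a b (real N))
                (cal_D a b (real N) (row_t U h) (poly_op (Y_row a b (real N) U h) (hahn_op a b (real N)) p))))"
    unfolding constructed_op_def by blast
  have "D (q n) = smult (poly lam (real n)) (q n)" if n: "n \<le> N + card (U 3) + card (U 4)" for n
  proof (rule constructed_op_eigen[OF MP])
    fix l assume l: "l \<in> {1..m}"
    hence l': "l - 1 < m" "Suc (l - 1) = l" by auto
    show "row_t U l \<in> {1, 2, 3, 4}" using rtyp_range[OF l'(1)] l'(2) by (simp add: rtyp_def)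
    have "\<Omega>_defined a b (real N) U (real n)" using \<Omega> n by simp
    from \<xi>_den_columns[OF this l'(1)]
    show "\<xi>_den a b (real N) (row_t U l) (real n - real j) (m - j) \<noteq> 0" if "j \<le> m" for j
      using that l'(2) by (simp add: rtyp_def)
  qed
  thus "\<exists>S lam D. constructed_op a b (real N) U S lam D \<and> is_difference_op (order_r F h) D \<and>
        (\<forall>n \<le> N + card (U 3) + card (U 4). D (q n) = smult (poly lam (real n)) (q n))"
    using D by blast
qed

end

theorem theorem6p2:
  fixes N :: nat and F :: "nat \<Rightarrow> nat set" and h :: "nat \<Rightarrow> nat" and a b :: real
  assumes "N \<ge> 1"
    and "\<forall>i\<in>{1..4}. finite (F i) \<and> 0 \<notin> F i"
    and "\<forall>i\<in>{1..3}. h i \<ge> 1"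
    and "a \<notin> ints_upto (fmax (F 2) + fmax (F 4) + int (h 2))"
    and "b \<notin> ints_upto (fmax (F 1) + fmax (F 3) + int (h 1) + int (h 3) - 1)"
    and "a + b \<notin> ints_upto ((\<Sum>i = 1..4. fmax (F i)) + (\<Sum>i = 1..3. int (h i)))"
    and "F 2 \<noteq> {} \<or> F 4 \<noteq> {} \<longrightarrow> (\<forall>k::nat. k \<ge> 1 \<longrightarrow> a \<noteq> real k)"
    and "F 1 \<noteq> {} \<or> F 3 \<noteq> {} \<longrightarrow> (\<forall>k::nat. k \<ge> 1 \<longrightarrow> b \<noteq> real k)"
    and "\<forall>n \<le> N + card (U_sets F h 3) + card (U_sets F h 4) + 1.
           \<Omega>_defined a b (real N) (U_sets F h) (real n) \<and>
           \<Omega> a b (real N) (U_sets F h) (real n) \<noteq> 0"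
  shows
    "orthogonal_polys (transformed_weight a b N F h) (q_poly a b (real N) (U_sets F h))
       {0..N + card (U_sets F h 3) + card (U_sets F h 4)} \<and>
     (\<exists>S lam D. constructed_op a b (real N) (U_sets F h) S lam D \<and>
        is_difference_op (order_r F h) D \<and>
        (\<forall>n \<le> N + card (U_sets F h 3) + card (U_sets F h 4).
           D (q_poly a b (real N) (U_sets F h) n) =
             smult (poly lam (real n)) (q_poly a b (real N) (U_sets F h) n)))"
proof -
  interpret quartet N F h a b by (rule quartet.intro) (rule assms)+
  show ?thesis using orthogonal_eigenfunctions[OF assms(9)] by blast
qed

end
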